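(* Under the standing assumptions on $n,\Omega,T,w,d,\mathbb C,\mathbb B,K$ listed in the context, let $(\alpha,u,e,p)\colon[0,T]\to H^1(\Omega;[0,1])\times\mathcal A$ be a global quasistatic evolution with datum $w$. Then there exists a countable set $N\subset[0,T]$ such that $(\alpha,u,e,p)$ is strongly continuous from $[0,T]\setminus N$ into $H^1(\Omega)\times\mathcal A$ (i.e. the restriction to $[0,T]\setminus N$ is continuous for the norm topology of $H^1(\Omega)\times H^1(\Omega;\mathbb R^n)\times L^2(\Omega;\mathbb M)\times H^1(\Omega;\mathbb M)$).
   Context: Setting. $n\in\{2,3\}$; $\Omega\subset\mathbb R^n$ is a bounded domain with Lipschitz boundary; $T>0$. $\mathbb M$ denotes the space of real symmetric $n\times n$ matrices with scalar product $A:B$ and norm $|\cdot|$; $\mathrm Eu=\frac12(\nabla u+\nabla u^T)$. $\|\cdot\|_p$ is the norm of $L^p(\Omega)$, $(\cdot,\cdot)_2$ the $L^2(\Omega)$ scalar product. $H^1(\Omega;[0,1])$ is the set of $H^1(\Omega)$ functions with values in $[0,1]$ a.e. Boundary values are traces. $\mathcal A:=H^1(\Omega;\mathbb R^n)\times L^2(\Omega;\mathbb M)\times H^1(\Omega;\mathbb M)$. For $\hat w\in H^1(\Omega;\mathbb R^n)$, $\mathcal A(\hat w):=\{(u,e,p)\in\mathcal A:\ \mathrm Eu=e+p\text{ in }\Omega,\ u=\hat w\text{ on }\partial\Omega\}$. For $\hat\alpha\in H^1(\Omega;[0,1])$, $\mathcal D(\hat\alpha):=\{\beta\in H^1(\Omega;[0,1]):\beta\le\hat\alpha\}$.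 Standing assumptions on the data. $w\in H^1((0,T);H^1(\Omega;\mathbb R^n))$ (identified with its continuous representative). $d\in C^{1,1}([0,1];[0,\infty))$ with $\dot d(0)\le0$. $\mathbb C$ is a linear map $\mathbb M\to\mathbb M$ with $\mathbb C_{ijkl}=\mathbb C_{klij}=\mathbb C_{jikl}$ and $\gamma_1|\xi|^2\le\mathbb C\xi:\xi\le\gamma_2|\xi|^2$ for all $\xi\in\mathbb M$, with constants $\gamma_1,\gamma_2>0$. $\mathbb B\in C^{1,1}([0,1];\mathrm{Lin}(\mathbb M;\mathbb M))$ with $\dot{\mathbb B}(0)\xi:\xi\le0$ and $\mathbb B(a)\xi:\xi\ge0$ for all $\xi\in\mathbb M$, $a\in[0,1]$, and $\mathbb B_{ijkl}(a)=\mathbb B_{klij}(a)=\mathbb B_{jikl}(a)$. $K\subset\mathbb M$ is closed and convex (possibly unbounded) and contains $\{|\sigma|\le r_H\}$ for some $r_H>0$. Functionals. $\mathcal E(\alpha,e,p):=\frac12\int_\Omega\mathbb Ce:e\,\mathrm dx+\int_\Omega d(\alpha)\,\mathrm dx+\|\nabla\alpha\|_2^2+\int_\Omega\mathbb B(\alpha)p:p\,\mathrm dx+\|\nabla p\|_2^2$ for $\alpha\in H^1(\Omega;[0,1])$, $e\in L^2(\Omega;\mathbb M)$, $p\in H^1(\Omega;\mathbb M)$. $H(\xi):=\sup_{\sigma\in K}\sigma:\xi\in[0,\infty]$ and $\mathcal H(p):=\int_\Omega H(p(x))\,\mathrm dx$ for $p\in L^1(\Omega;\mathbb M)$. $\mathcal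 V_{\mathcal H}(p;t_1,t_2):=\sup\sum_{j=1}^N\mathcal H(p(s_j)-p(s_{j-1}))$, the supremum being over all $N\in\mathbb N$ and partitions $t_1=s_0<\dots<s_N=t_2$. Definition. $(\alpha,u,e,p)\colon[0,T]\to H^1(\Omega;[0,1])\times\mathcal A$ is a global quasistatic evolution with datum $w$ if: (qs0) for a.e. $x\in\Omega$ the map $t\mapsto\alpha(t,x)$ is nonincreasing on $[0,T]$ (i.e. $\alpha(t_2)\le\alpha(t_1)$ a.e. in $\Omega$ whenever $t_1\le t_2$); (qs1) for all $t\in[0,T]$: $(u(t),e(t),p(t))\in\mathcal A(w(t))$ and $\mathcal E(\alpha(t),e(t),p(t))\le\mathcal E(\beta,\eta,q)+\mathcal H(q-p(t))$ for all $(\beta,v,\eta,q)\in\mathcal D(\alpha(t))\times\mathcal A(w(t))$; (qs2) $\mathcal V_{\mathcal H}(p;0,T)<\infty$ and for all $t\in[0,T]$: $\mathcal E(\alpha(t),e(t),p(t))+\mathcal V_{\mathcal H}(p;0,t)=\mathcal E(\alpha(0),e(0),p(0))+\int_0^t(\mathbb Ce(s),\mathrm E\dot w(s))_2\,\mathrm ds$. *)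

theory Defs
  imports "HOL-Analysis.Analysis"
begin

text \<open>
  Elements of Lebesgue and Sobolev spaces are represented by functions on the whole space of which
  only the values almost everywhere in \<open>\<Omega>\<close> matter; accordingly the norms below are
  seminorms on representatives.
\<close>

section \<open>Lebesgue and Sobolev spaces\<close>

definition L2 :: "'a::euclidean_space set \<Rightarrow> ('a \<Rightarrow> 'b::euclidean_space) set" where
  "L2 \<Omega> = {f. f \<in> borel_measurable (lebesgue_on \<Omega>) \<and>
               integrable (lebesgue_on \<Omega>) (\<lambda>x. (norm (f x))\<^sup>2)}"

definition L2_norm :: "'a::euclidean_space set \<Rightarrow> ('a \<Rightarrow> 'b::euclidean_space) \<Rightarrow> real" where
  "L2_norm \<Omega> f = sqrt (LINT x|lebesgue_on \<Omega>. (norm (f x))\<^sup>2)"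

primrec Ck :: "nat \<Rightarrow> ('a::euclidean_space \<Rightarrow> 'b::real_normed_vector) \<Rightarrow> bool" where
  "Ck 0 f \<longleftrightarrow> continuous_on UNIV f"
| "Ck (Suc k) f \<longleftrightarrow> (\<forall>x. f differentiable (at x)) \<and>
     (\<forall>b\<in>Basis. Ck k (\<lambda>x. frechet_derivative f (at x) b))"

definition smooth :: "('a::euclidean_space \<Rightarrow> 'b::real_normed_vector) \<Rightarrow> bool" where
  "smooth f \<longleftrightarrow> (\<forall>k. Ck k f)"

definition test_function :: "'a::euclidean_space set \<Rightarrow> ('a \<Rightarrow> real) \<Rightarrow> bool" where
  "test_function \<Omega> \<phi> \<longleftrightarrow> smooth \<phi> \<and>
     compact (closure {x. \<phi> x \<noteq> 0}) \<and> closure {x. \<phi> x \<noteq> 0} \<subseteq> \<Omega>"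

text \<open>The \<open>i\<close>-th component of the gradient is the \<open>i\<close>-th partial derivative, so the norm of
  the gradient is the Euclidean (Frobenius) one also for vector- and matrix-valued functions.\<close>

definition weak_gradient ::
  "(real^'n) set \<Rightarrow> (real^'n \<Rightarrow> 'b::euclidean_space) \<Rightarrow> (real^'n \<Rightarrow> 'b^'n) \<Rightarrow> bool" where
  "weak_gradient \<Omega> f G \<longleftrightarrow>
     (\<forall>\<phi> i. test_function \<Omega> \<phi> \<longrightarrow>
        (LINT x|lebesgue_on \<Omega>. frechet_derivative \<phi> (at x) (axis i 1) *\<^sub>R f x)
          = - (LINT x|lebesgue_on \<Omega>. \<phi> x *\<^sub>R (G x $ i)))"

definition H1 :: "(real^'n) set \<Rightarrow> (real^'n \<Rightarrow> 'b::euclidean_space) set" where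
  "H1 \<Omega> = {f \<in> L2 \<Omega>. \<exists>G\<in>L2 \<Omega>. weak_gradient \<Omega> f G}"

definition wgrad :: "(real^'n) set \<Rightarrow> (real^'n \<Rightarrow> 'b::euclidean_space) \<Rightarrow> real^'n \<Rightarrow> 'b^'n" where
  "wgrad \<Omega> f = (SOME G. G \<in> L2 \<Omega> \<and> weak_gradient \<Omega> f G)"

definition H1_norm :: "(real^'n) set \<Rightarrow> (real^'n \<Rightarrow> 'b::euclidean_space) \<Rightarrow> real" where
  "H1_norm \<Omega> f = sqrt ((L2_norm \<Omega> f)\<^sup>2 + (L2_norm \<Omega> (wgrad \<Omega> f))\<^sup>2)"

definition sym_mat :: "(real^'n^'n) set" where
  "sym_mat = {A. transpose A = A}"

definition L2_sym :: "(real^'n) set \<Rightarrow> (real^'n \<Rightarrow> real^'n^'n) set" where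
  "L2_sym \<Omega> = {f \<in> L2 \<Omega>. AE x in lebesgue_on \<Omega>. f x \<in> sym_mat}"

definition H1_sym :: "(real^'n) set \<Rightarrow> (real^'n \<Rightarrow> real^'n^'n) set" where
  "H1_sym \<Omega> = {f \<in> H1 \<Omega>. AE x in lebesgue_on \<Omega>. f x \<in> sym_mat}"

definition H1_unit :: "(real^'n) set \<Rightarrow> (real^'n \<Rightarrow> real) set" where
  "H1_unit \<Omega> = {f \<in> H1 \<Omega>. AE x in lebesgue_on \<Omega>. 0 \<le> f x \<and> f x \<le> 1}"

definition sym_grad :: "(real^'n) set \<Rightarrow> (real^'n \<Rightarrow> real^'n) \<Rightarrow> real^'n \<Rightarrow> real^'n^'n" where
  "sym_grad \<Omega> u x = (1/2) *\<^sub>R (wgrad \<Omega> u x + transpose (wgrad \<Omega> u x))"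

text \<open>Continuity of a curve of (representatives of) functions for the topology of a seminorm.\<close>

definition seminorm_continuous_on ::
  "real set \<Rightarrow> (('a \<Rightarrow> 'b::real_normed_vector) \<Rightarrow> real) \<Rightarrow> (real \<Rightarrow> 'a \<Rightarrow> 'b) \<Rightarrow> bool" where
  "seminorm_continuous_on S nrm f \<longleftrightarrow>
     (\<forall>t\<in>S. ((\<lambda>s. nrm (\<lambda>x. f s x - f t x)) \<longlongrightarrow> 0) (at t within S))"


section \<open>Lipschitz domains and traces\<close>

text \<open>Near each boundary point \<open>\<Omega>\<close> is the strict epigraph, in a direction \<open>\<nu>\<close>, of a Lipschitz
  function \<open>h\<close> on the hyperplane orthogonal to \<open>\<nu>\<close>.\<close>

definition lipschitz_boundary :: "'a::euclidean_space set \<Rightarrow> bool" where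
  "lipschitz_boundary \<Omega> \<longleftrightarrow>
     (\<forall>x\<in>frontier \<Omega>. \<exists>r>0. \<exists>\<nu> h L. norm \<nu> = 1 \<and> L-lipschitz_on {y. y \<bullet> \<nu> = 0} (h :: 'a \<Rightarrow> real) \<and>
        \<Omega> \<inter> ball x r = {y \<in> ball x r. h (y - (y \<bullet> \<nu>) *\<^sub>R \<nu>) < y \<bullet> \<nu>})"

definition hausdorff_pre :: "real \<Rightarrow> real \<Rightarrow> 'a::euclidean_space set \<Rightarrow> ennreal" where
  "hausdorff_pre s \<delta> A =
     (INF C \<in> {C :: nat \<Rightarrow> 'a set. A \<subseteq> (\<Union>i. C i) \<and> (\<forall>i. bounded (C i) \<and> diameter (C i) \<le> \<delta>)}.
        \<Sum>i. ennreal (unit_ball_vol s * (diameter (C i) / 2) powr s))"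

definition hausdorff_outer :: "real \<Rightarrow> 'a::euclidean_space set \<Rightarrow> ennreal" where
  "hausdorff_outer s A = (SUP \<delta>\<in>{0<..}. hausdorff_pre s \<delta> A)"

text \<open>Being a metric outer measure, \<open>hausdorff_outer s\<close> (for \<open>s > 0\<close>) is countably additive on
  the Borel sets, so that it is the \<^const>\<open>emeasure\<close> of the following measure.\<close>

definition hausdorff_measure :: "real \<Rightarrow> 'a::euclidean_space measure" where
  "hausdorff_measure s = measure_of UNIV (sets borel) (hausdorff_outer s)"

text \<open>The trace operator is the continuous extension to \<open>H1\<close> of the restriction of smooth functions
  to the boundary, with values in the \<open>L2\<close> space of the \<open>(n-1)\<close>-dimensional Hausdorff measure.\<close>

definition has_trace ::
  "(real^'n) set \<Rightarrow> (real^'n \<Rightarrow> 'b::euclidean_space) \<Rightarrow> (real^'n \<Rightarrow> 'b) \<Rightarrow> bool" where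
  "has_trace \<Omega> u g \<longleftrightarrow> u \<in> H1 \<Omega> \<and> g \<in> borel_measurable borel \<and>
     (\<exists>\<phi> :: nat \<Rightarrow> real^'n \<Rightarrow> 'b. (\<forall>k. smooth (\<phi> k)) \<and>
        (\<lambda>k. H1_norm \<Omega> (\<lambda>x. \<phi> k x - u x)) \<longlonglongrightarrow> 0 \<and>
        (\<lambda>k. \<integral>\<^sup>+x. ennreal ((norm (\<phi> k x - g x))\<^sup>2) * indicator (frontier \<Omega>) x
               \<partial>hausdorff_measure (real CARD('n) - 1)) \<longlonglongrightarrow> 0)"

definition same_trace ::
  "(real^'n) set \<Rightarrow> (real^'n \<Rightarrow> 'b::euclidean_space) \<Rightarrow> (real^'n \<Rightarrow> 'b) \<Rightarrow> bool" where
  "same_trace \<Omega> u v \<longleftrightarrow> (\<exists>g. has_trace \<Omega> u g \<and> has_trace \<Omega> v g)"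


section \<open>Bochner--Sobolev spaces\<close>

text \<open>
  The target \<open>X\<close> is a set of representatives with seminorm \<open>nrm\<close>, hence not a type of class
  \<^class>\<open>banach\<close>, so the Bochner integral of the library does not apply to it.
  In \<open>step_integral X I s J\<close>, \<open>s\<close> is an \<open>X\<close>-valued simple function on \<open>I\<close> with integral \<open>J\<close>.
\<close>

definition step_integral ::
  "('a \<Rightarrow> 'b::euclidean_space) set \<Rightarrow> real set \<Rightarrow> (real \<Rightarrow> 'a \<Rightarrow> 'b) \<Rightarrow> ('a \<Rightarrow> 'b) \<Rightarrow> bool" where
  "step_integral X I s J \<longleftrightarrow>
     (\<exists>(m::nat) A c. (\<forall>i<m. A i \<in> sets (lebesgue_on I) \<and> emeasure (lebesgue_on I) (A i) < \<infinity> \<and> c i \<in> X) \<and>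
        s = (\<lambda>t x. \<Sum>i<m. indicator (A i) t *\<^sub>R c i x) \<and>
        J = (\<lambda>x. \<Sum>i<m. measure (lebesgue_on I) (A i) *\<^sub>R c i x))"

definition strongly_measurable ::
  "('a \<Rightarrow> 'b::euclidean_space) set \<Rightarrow> (('a \<Rightarrow> 'b) \<Rightarrow> real) \<Rightarrow> real set \<Rightarrow> (real \<Rightarrow> 'a \<Rightarrow> 'b) \<Rightarrow> bool" where
  "strongly_measurable X nrm I f \<longleftrightarrow>
     (\<exists>s. (\<forall>k::nat. \<exists>J. step_integral X I (s k) J) \<and>
        (AE t in lebesgue_on I. (\<lambda>k. nrm (\<lambda>x. s k t x - f t x)) \<longlonglongrightarrow> 0))"

definition curve_Bochner_integral ::
  "('a \<Rightarrow> 'b::euclidean_space) set \<Rightarrow> (('a \<Rightarrow> 'b) \<Rightarrow> real) \<Rightarrow> real set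
     \<Rightarrow> (real \<Rightarrow> 'a \<Rightarrow> 'b) \<Rightarrow> ('a \<Rightarrow> 'b) \<Rightarrow> bool" where
  "curve_Bochner_integral X nrm I f J \<longleftrightarrow> (\<forall>t\<in>I. f t \<in> X) \<and> J \<in> X \<and>
     (\<exists>s Js. (\<forall>k::nat. step_integral X I (s k) (Js k)) \<and>
        (AE t in lebesgue_on I. (\<lambda>k. nrm (\<lambda>x. s k t x - f t x)) \<longlonglongrightarrow> 0) \<and>
        (\<lambda>k. \<integral>\<^sup>+t. ennreal (nrm (\<lambda>x. s k t x - f t x)) \<partial>lebesgue_on I) \<longlonglongrightarrow> 0 \<and>
        (\<lambda>k. nrm (\<lambda>x. Js k x - J x)) \<longlonglongrightarrow> 0)"

definition Bochner_L2 ::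
  "('a \<Rightarrow> 'b::euclidean_space) set \<Rightarrow> (('a \<Rightarrow> 'b) \<Rightarrow> real) \<Rightarrow> real set \<Rightarrow> (real \<Rightarrow> 'a \<Rightarrow> 'b) set" where
  "Bochner_L2 X nrm I = {f. (\<forall>t\<in>I. f t \<in> X) \<and> strongly_measurable X nrm I f \<and>
     (\<integral>\<^sup>+t. ennreal ((nrm (f t))\<^sup>2) \<partial>lebesgue_on I) < \<infinity>}"

definition weak_time_derivative ::
  "('a \<Rightarrow> 'b::euclidean_space) set \<Rightarrow> (('a \<Rightarrow> 'b) \<Rightarrow> real) \<Rightarrow> real set
     \<Rightarrow> (real \<Rightarrow> 'a \<Rightarrow> 'b) \<Rightarrow> (real \<Rightarrow> 'a \<Rightarrow> 'b) \<Rightarrow> bool" where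
  "weak_time_derivative X nrm I f g \<longleftrightarrow>
     (\<forall>\<phi>. test_function I \<phi> \<longrightarrow>
        (\<exists>J. curve_Bochner_integral X nrm I (\<lambda>t x. deriv \<phi> t *\<^sub>R f t x) J \<and>
             curve_Bochner_integral X nrm I (\<lambda>t x. - (\<phi> t *\<^sub>R g t x)) J))"

definition Bochner_H1 ::
  "('a \<Rightarrow> 'b::euclidean_space) set \<Rightarrow> (('a \<Rightarrow> 'b) \<Rightarrow> real) \<Rightarrow> real set \<Rightarrow> (real \<Rightarrow> 'a \<Rightarrow> 'b) set" where
  "Bochner_H1 X nrm I = {f \<in> Bochner_L2 X nrm I.
     \<exists>g\<in>Bochner_L2 X nrm I. weak_time_derivative X nrm I f g}"

definition time_deriv ::
  "('a \<Rightarrow> 'b::euclidean_space) set \<Rightarrow> (('a \<Rightarrow> 'b) \<Rightarrow> real) \<Rightarrow> real set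
     \<Rightarrow> (real \<Rightarrow> 'a \<Rightarrow> 'b) \<Rightarrow> real \<Rightarrow> 'a \<Rightarrow> 'b" where
  "time_deriv X nrm I f = (SOME g. g \<in> Bochner_L2 X nrm I \<and> weak_time_derivative X nrm I f g)"


section \<open>Material data\<close>

text \<open>Linear maps on symmetric matrices are given by their coefficients
  \<open>C $ i $ j $ k $ l\<close>; under the symmetries below this determines them uniquely.\<close>

type_synonym 'n tensor4 = "real^'n^'n^'n^'n"

definition tapp :: "'n::finite tensor4 \<Rightarrow> real^'n^'n \<Rightarrow> real^'n^'n" where
  "tapp C \<xi> = (\<chi> i j. \<Sum>k\<in>UNIV. \<Sum>l\<in>UNIV. C $ i $ j $ k $ l * \<xi> $ k $ l)"

definition tensor_symmetric :: "'n::finite tensor4 \<Rightarrow> bool" where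
  "tensor_symmetric C \<longleftrightarrow>
     (\<forall>i j k l. C $ i $ j $ k $ l = C $ k $ l $ i $ j \<and> C $ i $ j $ k $ l = C $ j $ i $ k $ l)"

definition C11_unit :: "(real \<Rightarrow> 'b::real_normed_vector) \<Rightarrow> bool" where
  "C11_unit f \<longleftrightarrow>
     (\<exists>f' L. (\<forall>a\<in>{0..1}. (f has_vector_derivative f' a) (at a within {0..1})) \<and>
             L-lipschitz_on {0..1} f')"


section \<open>Functionals and evolutions\<close>

definition energy ::
  "(real^'n) set \<Rightarrow> 'n tensor4 \<Rightarrow> (real \<Rightarrow> 'n tensor4) \<Rightarrow> (real \<Rightarrow> real)
     \<Rightarrow> (real^'n \<Rightarrow> real) \<Rightarrow> (real^'n \<Rightarrow> real^'n^'n) \<Rightarrow> (real^'n \<Rightarrow> real^'n^'n) \<Rightarrow> real" where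
  "energy \<Omega> C B d \<alpha> e p =
     (1/2) * (LINT x|lebesgue_on \<Omega>. tapp C (e x) \<bullet> e x)
     + (LINT x|lebesgue_on \<Omega>. d (\<alpha> x))
     + (L2_norm \<Omega> (wgrad \<Omega> \<alpha>))\<^sup>2
     + (LINT x|lebesgue_on \<Omega>. tapp (B (\<alpha> x)) (p x) \<bullet> p x)
     + (L2_norm \<Omega> (wgrad \<Omega> p))\<^sup>2"

text \<open>The truncation at \<open>0\<close> built into \<^const>\<open>ennreal\<close> is harmless as \<open>K\<close> contains \<open>0\<close>.\<close>

definition support_fun :: "(real^'n^'n) set \<Rightarrow> real^'n^'n \<Rightarrow> ennreal" where
  "support_fun K \<xi> = (SUP \<sigma>\<in>K. ennreal (\<sigma> \<bullet> \<xi>))"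

definition dissipation ::
  "(real^'n) set \<Rightarrow> (real^'n^'n) set \<Rightarrow> (real^'n \<Rightarrow> real^'n^'n) \<Rightarrow> ennreal" where
  "dissipation \<Omega> K p = (\<integral>\<^sup>+x. support_fun K (p x) \<partial>lebesgue_on \<Omega>)"

definition total_dissipation ::
  "(real^'n) set \<Rightarrow> (real^'n^'n) set \<Rightarrow> (real \<Rightarrow> real^'n \<Rightarrow> real^'n^'n) \<Rightarrow> real \<Rightarrow> real \<Rightarrow> ennreal" where
  "total_dissipation \<Omega> K p t1 t2 =
     (SUP (m, s) \<in> {(m::nat, s::nat \<Rightarrow> real). s 0 = t1 \<and> s m = t2 \<and> (\<forall>j<m. s j < s (Suc j))}.
        \<Sum>j<m. dissipation \<Omega> K (\<lambda>x. p (s (Suc j)) x - p (s j) x))"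

definition admissible ::
  "(real^'n) set \<Rightarrow> (real^'n \<Rightarrow> real^'n)
     \<Rightarrow> ((real^'n \<Rightarrow> real^'n) \<times> (real^'n \<Rightarrow> real^'n^'n) \<times> (real^'n \<Rightarrow> real^'n^'n)) set" where
  "admissible \<Omega> w = {(u, e, p). u \<in> H1 \<Omega> \<and> e \<in> L2_sym \<Omega> \<and> p \<in> H1_sym \<Omega> \<and>
     (AE x in lebesgue_on \<Omega>. sym_grad \<Omega> u x = e x + p x) \<and> same_trace \<Omega> u w}"

definition damage_below :: "(real^'n) set \<Rightarrow> (real^'n \<Rightarrow> real) \<Rightarrow> (real^'n \<Rightarrow> real) set" where
  "damage_below \<Omega> \<alpha> = {\<beta> \<in> H1_unit \<Omega>. AE x in lebesgue_on \<Omega>. \<beta> x \<le> \<alpha> x}"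

definition power_loading ::
  "(real^'n) set \<Rightarrow> real \<Rightarrow> 'n tensor4 \<Rightarrow> (real \<Rightarrow> real^'n \<Rightarrow> real^'n)
     \<Rightarrow> (real \<Rightarrow> real^'n \<Rightarrow> real^'n^'n) \<Rightarrow> real \<Rightarrow> real" where
  "power_loading \<Omega> T C w e s =
     (LINT x|lebesgue_on \<Omega>.
        tapp C (e s x) \<bullet> sym_grad \<Omega> (time_deriv (H1 \<Omega>) (H1_norm \<Omega>) {0<..<T} w s) x)"

text \<open>Integrability of the power of the loading, without which the right-hand side of the energy
  balance would have no meaning, is spelled out because the library integral of a non-integrable
  function is \<open>0\<close>.\<close>

definition global_quasistatic_evolution ::
  "(real^'n) set \<Rightarrow> real \<Rightarrow> 'n tensor4 \<Rightarrow> (real \<Rightarrow> 'n tensor4) \<Rightarrow> (real \<Rightarrow> real) \<Rightarrow> (real^'n^'n) set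
     \<Rightarrow> (real \<Rightarrow> real^'n \<Rightarrow> real^'n)
     \<Rightarrow> (real \<Rightarrow> real^'n \<Rightarrow> real) \<Rightarrow> (real \<Rightarrow> real^'n \<Rightarrow> real^'n)
     \<Rightarrow> (real \<Rightarrow> real^'n \<Rightarrow> real^'n^'n) \<Rightarrow> (real \<Rightarrow> real^'n \<Rightarrow> real^'n^'n) \<Rightarrow> bool" where
  "global_quasistatic_evolution \<Omega> T C B d K w \<alpha> u e p \<longleftrightarrow>
     (\<forall>t\<in>{0..T}. \<alpha> t \<in> H1_unit \<Omega>) \<and>
     (\<forall>t1\<in>{0..T}. \<forall>t2\<in>{0..T}. t1 \<le> t2 \<longrightarrow> (AE x in lebesgue_on \<Omega>. \<alpha> t2 x \<le> \<alpha> t1 x)) \<and>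
     (\<forall>t\<in>{0..T}. (u t, e t, p t) \<in> admissible \<Omega> (w t) \<and>
        (\<forall>\<beta>\<in>damage_below \<Omega> (\<alpha> t). \<forall>(v, \<eta>, q)\<in>admissible \<Omega> (w t).
           ereal (energy \<Omega> C B d (\<alpha> t) (e t) (p t))
             \<le> ereal (energy \<Omega> C B d \<beta> \<eta> q) + enn2ereal (dissipation \<Omega> K (\<lambda>x. q x - p t x)))) \<and>
     total_dissipation \<Omega> K p 0 T < \<infinity> \<and>
     integrable (lebesgue_on {0<..<T}) (power_loading \<Omega> T C w e) \<and>
     (\<forall>t\<in>{0..T}.
        ereal (energy \<Omega> C B d (\<alpha> t) (e t) (p t)) + enn2ereal (total_dissipation \<Omega> K p 0 t)
          = ereal (energy \<Omega> C B d (\<alpha> 0) (e 0) (p 0)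
                   + (LINT s|lebesgue_on {0<..<t}. power_loading \<Omega> T C w e s)))"

end

theory Submission
  imports Defs
begin

text \<open>The total dissipation and the spatial mean of the damage variable are monotone in time, hence
  continuous off a countable set \<open>N\<close>; by the energy balance so is the energy. For two times \<open>a < b\<close> test the
  stability at \<open>a\<close> with the midpoint between the state at \<open>a\<close> and the state at \<open>b\<close>, corrected by the increment
  of \<open>w\<close>. Uniform convexity of the quadratic terms then bounds the squared distance of the two states in
  terms of the increments of energy, dissipation, mean damage and \<open>w\<close>, up to two errors: the damage times the
  squared plastic strain, which is handled by truncating the fixed function \<open>p t\<close>, and a multiple of the
  squared \<open>L2\<close> distance of the plastic strains, which is absorbed by interpolation between \<open>H1\<close> and \<open>L1\<close>
  since the \<open>L1\<close> distance is controlled by the dissipation. Convergence of the displacements follows from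
  the inequalities of Korn and Poincare for functions with vanishing trace; these are obtained by
  extending by zero, where the Gauss theorem on the Lipschitz domain is replaced by cutting off along a cover
  of the boundary by small balls, whose total \<open>(n-1)\<close>-dimensional size is bounded by the Hausdorff measure.\<close>

section \<open>Smooth functions and test functions\<close>

text \<open>Testing with the later state itself would only compare two energies; the midpoint gains
  a quarter of the quadratic terms of the difference. Minimality holds only against smaller damage,
  so the test starts from the earlier of the two times, whichever of them is the time at which
  continuity is claimed. The estimate is therefore stated for an ordered pair and carries a strain
  that may be either endpoint; one inequality then gives left and right limits. The obstacle to
  plain convexity is the term B(\<alpha>)p:p, which need not be jointly convex. With \<alpha> frozen
  it is convex in p, and freezing costs |\<alpha>0 - \<alpha>1| (|p0|^2 + |p1|^2). Only one strain
  is fixed, so the other is replaced by the fixed one plus the increment; since |\<alpha>0 -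
  \<alpha>1| \<le> 1, the increment leaves a squared L2 norm, and interpolation hides it in the
  gradient gained by convexity. For u only the symmetric gradient and the boundary datum are
  controlled. Since traces are limits of smooth functions, a zero trace first has to be turned into
  integration by parts against test functions on the whole space.\<close>

lemma Ck_differentiable: "Ck (Suc k) f \<Longrightarrow> f differentiable (at x)"
  by simp

lemma Ck_imp_continuous: "Ck k f \<Longrightarrow> continuous_on UNIV f"
  by (cases k) (auto intro!: differentiable_imp_continuous_on simp: differentiable_on_def)

lemma Ck_SucD: "Ck (Suc k) f \<Longrightarrow> Ck k f"
proof (induction k arbitrary: f)
  case 0
  then show ?case using Ck_imp_continuous[OF 0] by simp
next
  case (Suc k)
  then show ?case by auto
qed

lemma Ck_const: "Ck k (\<lambda>x. c)"
  by (induction k arbitrary: c) (auto simp: frechet_derivative_const)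

lemma Ck_add:
  assumes "Ck k f" "Ck k g" shows "Ck k (\<lambda>x. f x + g x)"
  using assms
proof (induction k arbitrary: f g)
  case 0
  then show ?case by (auto intro!: continuous_intros)
next
  case (Suc k)
  have "frechet_derivative (\<lambda>x. f x + g x) (at x) = (\<lambda>h. frechet_derivative f (at x) h + frechet_derivative g (at x) h)" for x
    using Suc.prems by (intro frechet_derivative_at[symmetric] has_derivative_add) (auto simp: frechet_derivative_works)
  then show ?case using Suc by (auto intro!: differentiable_add)
qed

lemma Ck_mult:
  fixes f g :: "'a::euclidean_space \<Rightarrow> real"
  assumes "Ck k f" "Ck k g" shows "Ck k (\<lambda>x. f x * g x)"
  using assms
proof (induction k arbitrary: f g)
  case 0
  then show ?case by (auto intro!: continuous_intros)
next
  case (Suc k)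
  have "frechet_derivative (\<lambda>x. f x * g x) (at x) = (\<lambda>h. f x * frechet_derivative g (at x) h + frechet_derivative f (at x) h * g x)" for x
    using Suc.prems by (intro frechet_derivative_at[symmetric] has_derivative_mult) (auto simp: frechet_derivative_works)
  then show ?case using Suc Ck_SucD[of k f] Ck_SucD[of k g] by (auto intro!: differentiable_mult Ck_add)
qed

lemma Ck_scaleR:
  assumes "Ck k f" shows "Ck k (\<lambda>x. c *\<^sub>R f x)"
  using assms
proof (induction k arbitrary: f)
  case 0
  then show ?case by (auto intro!: continuous_intros)
next
  case (Suc k)
  have "frechet_derivative (\<lambda>x. c *\<^sub>R f x) (at x) = (\<lambda>h. c *\<^sub>R frechet_derivative f (at x) h)" for x
    using Suc.prems by (intro frechet_derivative_at[symmetric] has_derivative_scaleR_right) (auto simp: frechet_derivative_works)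
  then show ?case using Suc by auto
qed

lemma Ck_prod:
  fixes f :: "'i \<Rightarrow> 'a::euclidean_space \<Rightarrow> real"
  assumes "\<And>i. i \<in> I \<Longrightarrow> Ck k (f i)" shows "Ck k (\<lambda>x. \<Prod>i\<in>I. f i x)"
  using assms
  by (induction I rule: infinite_finite_induct) (auto intro!: Ck_mult Ck_const)

lemma frechet_derivative_affine:
  assumes "f differentiable at (c *\<^sub>R x + z)"
  shows "(\<lambda>x. f (c *\<^sub>R x + z)) differentiable at x"
    and "frechet_derivative (\<lambda>x. f (c *\<^sub>R x + z)) (at x) = (\<lambda>h. c *\<^sub>R frechet_derivative f (at (c *\<^sub>R x + z)) h)"
proof -
  have d: "(f has_derivative frechet_derivative f (at (c *\<^sub>R x + z))) (at (c *\<^sub>R x + z))"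
    using assms by (simp add: frechet_derivative_works)
  have "((\<lambda>x. f (c *\<^sub>R x + z)) has_derivative (\<lambda>h. frechet_derivative f (at (c *\<^sub>R x + z)) (c *\<^sub>R h))) (at x)"
    by (rule has_derivative_compose[where f="\<lambda>x. c *\<^sub>R x + z" and f'="\<lambda>h. c *\<^sub>R h", OF _ d]) (auto intro!: derivative_eq_intros)
  moreover have "frechet_derivative f (at (c *\<^sub>R x + z)) (c *\<^sub>R h) = c *\<^sub>R frechet_derivative f (at (c *\<^sub>R x + z)) h" for h
    using has_derivative_linear[OF d] by (simp add: linear_cmul)
  ultimately have *: "((\<lambda>x. f (c *\<^sub>R x + z)) has_derivative (\<lambda>h. c *\<^sub>R frechet_derivative f (at (c *\<^sub>R x + z)) h)) (at x)"
    by simp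
  then show "(\<lambda>x. f (c *\<^sub>R x + z)) differentiable at x" by (rule differentiableI)
  show "frechet_derivative (\<lambda>x. f (c *\<^sub>R x + z)) (at x) = (\<lambda>h. c *\<^sub>R frechet_derivative f (at (c *\<^sub>R x + z)) h)"
    using frechet_derivative_at[OF *] by simp
qed

lemma Ck_affine:
  assumes "Ck k f" shows "Ck k (\<lambda>x. f (c *\<^sub>R x + z))"
  using assms
proof (induction k arbitrary: f)
  case 0
  then show ?case 
    by (auto intro!: continuous_on_compose2[of UNIV f] continuous_intros)
next
  case (Suc k)
  have "Ck k (\<lambda>x. c *\<^sub>R frechet_derivative f (at (c *\<^sub>R x + z)) b)" if "b \<in> Basis" for b
    using Suc that by (intro Ck_scaleR) (auto intro!: Suc.IH)
  then show ?case using Suc.prems by (auto simp: frechet_derivative_affine)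
qed

lemma frechet_derivative_real:
  fixes g :: "real \<Rightarrow> 'b::real_normed_vector"
  assumes "g differentiable (at x)"
  shows "frechet_derivative g (at x) h = h *\<^sub>R frechet_derivative g (at x) 1"
proof -
  have "linear (frechet_derivative g (at x))"
    using assms by (simp add: frechet_derivative_works has_derivative_linear)
  from linear_cmul[OF this, of h 1] show ?thesis by simp
qed

lemma Ck_coordinate:
  fixes g :: "real \<Rightarrow> real"
  assumes "Ck k g" shows "Ck k (\<lambda>x::real^'n. g (x $ i))"
  using assms
proof (induction k arbitrary: g)
  case 0
  then show ?case 
    by (auto intro!: continuous_on_compose2[of UNIV g] continuous_intros)
next
  case (Suc k)
  have *: "((\<lambda>x::real^'n. g (x $ i)) has_derivative (\<lambda>h. (h $ i) *\<^sub>R frechet_derivative g (at (x $ i)) 1)) (at x)" for x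
  proof -
    have "((\<lambda>x::real^'n. g (x $ i)) has_derivative (\<lambda>h. frechet_derivative g (at (x $ i)) (h $ i))) (at x)"
      using Suc.prems
      by (intro has_derivative_compose[OF bounded_linear_imp_has_derivative[OF bounded_linear_vec_nth]])
        (simp add: frechet_derivative_works)
    moreover have "frechet_derivative g (at (x $ i)) (h $ i) = (h $ i) *\<^sub>R frechet_derivative g (at (x $ i)) 1" for h :: "real^'n"
      using Suc.prems by (intro frechet_derivative_real) simp
    ultimately show ?thesis by simp
  qed
  have "frechet_derivative (\<lambda>x::real^'n. g (x $ i)) (at x) = (\<lambda>h. (h $ i) *\<^sub>R frechet_derivative g (at (x $ i)) 1)" for x
    using frechet_derivative_at[OF *] by simp
  moreover have "Ck k (\<lambda>x::real^'n. (b $ i) *\<^sub>R frechet_derivative g (at (x $ i)) 1)" for b :: "real^'n"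
    using Suc by (intro Ck_scaleR) auto
  ultimately show ?case using differentiableI[OF *] by auto
qed

text \<open>Regularity is local, so a function may be glued from smooth pieces on overlapping open
  sets. This is how a test function multiplied by a boundary cutoff and set to zero outside the
  domain is seen to be smooth.\<close>

lemma Ck_local:
  fixes f :: "'a::euclidean_space \<Rightarrow> 'b::real_normed_vector"
  assumes "\<And>x. \<exists>U g. open U \<and> x \<in> U \<and> Ck k g \<and> (\<forall>y\<in>U. f y = g y)"
  shows "Ck k f"
  using assms
proof (induction k arbitrary: f)
  case 0
  have "isCont f x" for x
  proof -
    obtain U g where U: "open U" "x \<in> U" "Ck 0 g" "\<forall>y\<in>U. f y = g y" using 0 by blast
    then have "isCont g x" by (simp add: continuous_on_eq_continuous_at)
    then show ?thesis using U by (subst isCont_cong[of _ g]) (auto simp: eventually_nhds)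
  qed
  then show ?case by (simp add: continuous_on_eq_continuous_at)
next
  case (Suc k)
  have *: "f differentiable (at x) \<and> frechet_derivative f (at x) = frechet_derivative g (at x)" 
    if "open U" "x \<in> U" "Ck (Suc k) g" "\<forall>y\<in>U. f y = g y" for U g x
  proof -
    have "(g has_derivative frechet_derivative g (at x)) (at x)"
      using that(3) by (simp add: frechet_derivative_works)
    then have "(f has_derivative frechet_derivative g (at x)) (at x)"
      using that by (auto intro: has_derivative_transform_within_open)
    then show ?thesis using frechet_derivative_at differentiableI by metis
  qed
  have "Ck k (\<lambda>x. frechet_derivative f (at x) b)" if "b \<in> Basis" for b
  proof (rule Suc.IH)
    fix x
    obtain U g where U: "open U" "x \<in> U" "Ck (Suc k) g" "\<forall>y\<in>U. f y = g y" using Suc.prems by blast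
    then have "\<forall>y\<in>U. frechet_derivative f (at y) b = frechet_derivative g (at y) b"
      using *[OF U(1) _ U(3,4)] by auto
    moreover have "Ck k (\<lambda>y. frechet_derivative g (at y) b)" using U that by auto
    ultimately show "\<exists>U g. open U \<and> x \<in> U \<and> Ck k g \<and> (\<forall>y\<in>U. frechet_derivative f (at y) b = g y)"
      using U by blast
  qed
  moreover have "f differentiable (at x)" for x using * Suc.prems by blast
  ultimately show ?case by simp
qed

lemma Ck_antiderivative:
  fixes f :: "real \<Rightarrow> real"
  assumes "\<And>x. (f has_real_derivative g x) (at x)" "Ck k g"
  shows "Ck (Suc k) f"
proof -
  have "frechet_derivative f (at x) = (*) (g x)" for x
    using assms(1)[of x] frechet_derivative_at unfolding has_field_derivative_def by metis
  then show ?thesis using assms real_differentiable_def[of f] by auto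
qed

lemma smooth_add: "smooth f \<Longrightarrow> smooth g \<Longrightarrow> smooth (\<lambda>x. f x + g x)"
  by (simp add: smooth_def Ck_add)
lemma smooth_scaleR: "smooth f \<Longrightarrow> smooth (\<lambda>x. c *\<^sub>R f x)"
  by (simp add: smooth_def Ck_scaleR)
lemma smooth_const: "smooth (\<lambda>x. c)"
  by (simp add: smooth_def Ck_const)
lemma smooth_diff: 
  assumes "smooth f" "smooth g" shows "smooth (\<lambda>x. f x - g x)"
  using smooth_add[OF assms(1) smooth_scaleR[OF assms(2), of "-1"]] by simp
lemma smooth_mult: "smooth f \<Longrightarrow> smooth g \<Longrightarrow> smooth (\<lambda>x. f x * (g x::real))"
  by (simp add: smooth_def Ck_mult)
lemma smooth_prod: "(\<And>i. i \<in> I \<Longrightarrow> smooth (f i)) \<Longrightarrow> smooth (\<lambda>x. \<Prod>i\<in>I. (f i x::real))"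
  by (simp add: smooth_def Ck_prod)
lemma smooth_affine: "smooth f \<Longrightarrow> smooth (\<lambda>x. f (c *\<^sub>R x + z))"
  by (simp add: smooth_def Ck_affine)
lemma smooth_coordinate: "smooth g \<Longrightarrow> smooth (\<lambda>x::real^'n. (g (x $ i)::real))"
  by (simp add: smooth_def Ck_coordinate)
lemma smooth_antiderivative:
  assumes "\<And>x. (f has_real_derivative g x) (at x)" "smooth g" shows "smooth f"
  unfolding smooth_def
proof
  fix k show "Ck k f" using Ck_antiderivative[OF assms(1), of k] assms(2) Ck_SucD[of k f] by (auto simp: smooth_def)
qed

lemma smooth_differentiable: "smooth f \<Longrightarrow> f differentiable (at x)"
  using Ck_differentiable[of 0 f] unfolding smooth_def by blast
lemma smooth_has_derivative: "smooth f \<Longrightarrow> (f has_derivative frechet_derivative f (at x)) (at x)"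
  using smooth_differentiable frechet_derivative_works by blast
lemma smooth_continuous_on: "smooth f \<Longrightarrow> continuous_on A f"
  using Ck_imp_continuous[of 0 f] unfolding smooth_def by (meson continuous_on_subset subset_UNIV)
lemma smooth_continuous_partial: 
  assumes "smooth f" "b \<in> Basis" shows "continuous_on A (\<lambda>x. frechet_derivative f (at x) b)"
proof -
  have "Ck (Suc 0) f" using assms(1) unfolding smooth_def by blast
  then show ?thesis using assms(2) by (auto intro: continuous_on_subset)
qed

text \<open>When all derivatives are known by formula, smoothness is an induction on the order in
  which every member of the family is treated at once.\<close>

lemma smooth_sequence:
  fixes D :: "nat \<Rightarrow> real \<Rightarrow> real"
  assumes "\<And>m x. (D m has_real_derivative D (Suc m) x) (at x)"
  shows "smooth (D m)"
proof -
  have "Ck k (D m)" for k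
  proof (induction k arbitrary: m)
    case 0
    then show ?case using assms by (auto simp: continuous_on_eq_continuous_at intro: DERIV_isCont)
  next
    case (Suc k)
    show ?case by (rule Ck_antiderivative[OF assms Suc])
  qed
  then show ?thesis by (simp add: smooth_def)
qed

section \<open>Cutoff functions from the flat exponential\<close>

definition flat_exp :: "real \<Rightarrow> real" where
  "flat_exp x = (if x > 0 then exp (- inverse x) else 0)"

text \<open>With y = 1/x this is the decay of a polynomial against the exponential at
  infinity.\<close>

lemma poly_inverse_exp_tendsto: "((\<lambda>x. poly P (inverse x) * exp (- inverse x)) \<longlongrightarrow> 0) (at_right (0::real))"
proof -
  have "((\<lambda>y. poly P y / exp y) \<longlongrightarrow> 0) at_top"
  proof -
    have "((\<lambda>y. \<Sum>i\<le>degree P. coeff P i * (y ^ i / exp y)) \<longlongrightarrow> (\<Sum>i\<le>degree P. coeff P i * 0)) at_top"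
      by (intro tendsto_intros tendsto_power_div_exp_0)
    then show ?thesis by (simp add: poly_altdef sum_divide_distrib)
  qed
  from filterlim_compose[OF this filterlim_inverse_at_top_right]
  show ?thesis by (simp add: exp_minus field_simps)
qed

lemma smooth_flat_exp: "smooth flat_exp"
proof -
  \<comment> \<open>The m-th derivative of exp(-1/x) is a polynomial P in y = 1/x times exp(-y). As
    dy/dx = -y^2, differentiating sends P to y^2 (P - P'), which is the recursion.\<close>
  define P :: "nat \<Rightarrow> real poly" where "P = rec_nat 1 (\<lambda>_ p. [:0,0,1:] * (p - pderiv p))"
  define D where "D m x = (if x > 0 then poly (P m) (inverse x) * exp (- inverse x) else 0)" for m and x :: real
  have P: "P 0 = 1" "P (Suc m) = [:0,0,1:] * (P m - pderiv (P m))" for m by (simp_all add: P_def)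
  have "(D m has_real_derivative D (Suc m) x) (at x)" for m x
  proof (cases x "0::real" rule: linorder_cases)
    case greater
    have "((\<lambda>x. poly (P m) (inverse x) * exp (- inverse x)) has_real_derivative D (Suc m) x) (at x)"
      using greater by (auto intro!: derivative_eq_intros simp: P D_def field_simps power2_eq_square)
    then show ?thesis
      by (rule has_field_derivative_transform_within_open[where S="{0<..}"]) (use greater in \<open>auto simp: D_def\<close>)
  next
    case less
    have "((\<lambda>x. 0) has_real_derivative D (Suc m) x) (at x)"
      using less by (auto simp: D_def)
    then show ?thesis
      by (rule has_field_derivative_transform_within_open[where S="{..<0}"]) (use less in \<open>auto simp: D_def\<close>)
  next
    case equal
    \<comment> \<open>The difference quotient at the origin divides by x, which multiplies the
      polynomial in 1/x by one more factor 1/x. The same decay therefore applies, and every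
      derivative vanishes at 0.\<close>
    have "((\<lambda>y. D m y / y) \<longlongrightarrow> 0) (at_right 0)"
    proof (rule Lim_transform_eventually)
      show "((\<lambda>x. poly ([:0,1:] * P m) (inverse x) * exp (- inverse x)) \<longlongrightarrow> 0) (at_right (0::real))"
        by (rule poly_inverse_exp_tendsto)
      show "\<forall>\<^sub>F x in at_right 0. poly ([:0,1:] * P m) (inverse x) * exp (- inverse x) = D m x / x"
        by (auto simp: D_def eventually_at_filter field_simps)
    qed
    moreover have "((\<lambda>y. D m y / y) \<longlongrightarrow> 0) (at_left 0)"
      by (rule Lim_transform_eventually[OF tendsto_const]) (auto simp: D_def eventually_at_filter)
    ultimately have "((\<lambda>y. D m y / y) \<longlongrightarrow> 0) (at 0)" by (simp add: filterlim_split_at)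
    then show ?thesis using equal by (simp add: D_def has_field_derivative_iff)
  qed
  then have "smooth (D 0)" by (rule smooth_sequence)
  moreover have "D 0 = flat_exp" by (simp add: D_def P flat_exp_def fun_eq_iff)
  ultimately show ?thesis by simp
qed

text \<open>The product \<open>flat_exp x * flat_exp (1 - x)\<close> is smooth and positive exactly
  on the open unit interval; its normalised antiderivative is the step.\<close>

lemma smooth_step_exists:
  obtains \<theta> :: "real \<Rightarrow> real" where "smooth \<theta>" "\<And>x. x \<le> 0 \<Longrightarrow> \<theta> x = 0" "\<And>x. x \<ge> 1 \<Longrightarrow> \<theta> x = 1"
    "\<And>x. 0 \<le> \<theta> x" "\<And>x. \<theta> x \<le> 1"
proof -
  define b where "b x = flat_exp x * flat_exp (1 - x)" for x
  have sb: "smooth b" unfolding b_def using smooth_affine[OF smooth_flat_exp, of "-1" 1]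
    by (intro smooth_mult smooth_flat_exp) simp
  have cb: "continuous_on A b" for A by (rule smooth_continuous_on[OF sb])
  have b0: "b x \<ge> 0" for x by (simp add: b_def flat_exp_def)
  have bz: "b x = 0" if "x \<le> 0 \<or> x \<ge> 1" for x using that by (auto simp: b_def flat_exp_def)
  define H where "H x = (if x \<le> 0 then 0 else integral {0..x} b)" for x
  have H: "(H has_real_derivative b x) (at x)" for x
  proof (cases "x < 0")
    case True
    have "((\<lambda>x. 0) has_real_derivative b x) (at x)" using True bz[of x] by auto
    then show ?thesis
      by (rule has_field_derivative_transform_within_open[where S="{..<0}"]) (use True in \<open>auto simp: H_def\<close>)
  next
    case False
    \<comment> \<open>Starting the integral at -1 keeps the point 0 interior, so the fundamental
      theorem gives a two-sided derivative there as well. The change is harmless because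
      \<open>b\<close> vanishes on the negative axis.\<close>
    define G where "G x = integral {-1..x} b" for x
    have G: "(G has_real_derivative b x) (at x)"
    proof -
      have "(G has_vector_derivative b x) (at x within {-1..x+1})" unfolding G_def
        using False by (intro integral_has_vector_derivative cb) auto
      then have "(G has_vector_derivative b x) (at x)"
        using False by (subst (asm) at_within_Icc_at) auto
      then show ?thesis by (simp add: has_real_derivative_iff_has_vector_derivative)
    qed
    have z: "integral {-1..y} b = 0" if "y \<le> 0" for y
      using that by (subst integral_cong[of _ _ "\<lambda>_. 0"]) (auto simp: bz)
    have "G y = H y" if "y > -1" for y
    proof (cases "y \<le> 0")
      case True then show ?thesis by (simp add: H_def G_def z)
    next
      case False
      have "integral {-1..0} b + integral {0..y} b = integral {-1..y} b"
        using False by (intro Henstock_Kurzweil_Integration.integral_combine integrable_continuous_real cb) auto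
      then show ?thesis using False z[of 0] by (simp add: H_def G_def)
    qed
    then show ?thesis using False
      by (intro has_field_derivative_transform_within_open[OF G, where S="{-1<..}"]) auto
  qed
  have mono: "H x \<le> H y" if "x \<le> y" for x y
    using that H b0 by (intro DERIV_nonneg_imp_nondecreasing[OF that]) blast
  have H1: "H x = H 1" if "x \<ge> 1" for x
  proof (cases "x = 1")
    case False
    then have "1 < x" using that by simp
    moreover have "continuous_on {1..x} H" using H by (meson DERIV_isCont continuous_at_imp_continuous_on)
    moreover have "(H has_real_derivative 0) (at y)" if "1 < y" for y using H[of y] bz[of y] that by simp
    ultimately show ?thesis by (intro DERIV_isconst_end) auto
  qed simp
  \<comment> \<open>If the total mass were 0, monotonicity would make \<open>H\<close> vanish to the
    left of 1, and its derivative at 1/2 would be 0; but \<open>b\<close> is positive there.\<close>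
  have Hpos: "H 1 > 0"
  proof (rule ccontr)
    assume "\<not> H 1 > 0"
    then have z: "H x = 0" if "x < 1" for x
      using mono[of 0 x] mono[of x 1] mono[of x 0] that by (cases "x \<le> 0") (auto simp: H_def)
    have "((\<lambda>x. 0) has_real_derivative b (1/2)) (at (1/2))"
      by (rule has_field_derivative_transform_within_open[OF H, where S="{..<1}"]) (auto simp: z)
    then have "b (1/2) = 0" using DERIV_unique DERIV_const by blast
    then show False by (simp add: b_def flat_exp_def)
  qed
  show ?thesis
  proof (rule that[of "\<lambda>x. inverse (H 1) *\<^sub>R H x"])
    show "smooth (\<lambda>x. inverse (H 1) *\<^sub>R H x)"
      by (intro smooth_scaleR smooth_antiderivative[OF H sb])
    show "inverse (H 1) *\<^sub>R H x = 0" if "x \<le> 0" for x using that by (simp add: H_def)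
    show "inverse (H 1) *\<^sub>R H x = 1" if "x \<ge> 1" for x using H1[OF that] Hpos by simp
    show "0 \<le> inverse (H 1) *\<^sub>R H x" for x 
      using mono[of 0 x] Hpos by (cases "x \<le> 0") (auto simp: H_def)
    show "inverse (H 1) *\<^sub>R H x \<le> 1" for x 
      using mono[of x 1] H1[of x] Hpos by (cases "x \<le> 1") (auto simp: field_simps)
  qed
qed

section \<open>Compactly supported test functions\<close>

lemma test_function_mono: "test_function \<Omega> \<phi> \<Longrightarrow> \<Omega> \<subseteq> \<Omega>' \<Longrightarrow> test_function \<Omega>' \<phi>"
  by (auto simp: test_function_def)

lemma test_functionI:
  assumes "smooth \<phi>" "compact S" "S \<subseteq> \<Omega>" "\<And>x. x \<notin> S \<Longrightarrow> \<phi> x = 0"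
  shows "test_function \<Omega> \<phi>"
proof -
  have "closure {x. \<phi> x \<noteq> 0} \<subseteq> S"
    using assms by (intro closure_minimal compact_imp_closed) auto
  moreover have "compact (closure {x. \<phi> x \<noteq> 0})"
    using calculation compact_Int_closed[OF assms(2) closed_closure, of "{x. \<phi> x \<noteq> 0}"] by (simp add: Int_absorb1)
  ultimately show ?thesis using assms by (auto simp: test_function_def)
qed

lemma test_functionE:
  assumes "test_function \<Omega> \<phi>"
  obtains S where "smooth \<phi>" "compact S" "S \<subseteq> \<Omega>" "\<And>x. x \<notin> S \<Longrightarrow> \<phi> x = 0"
    "\<And>x b. x \<notin> S \<Longrightarrow> frechet_derivative \<phi> (at x) b = 0"
proof -
  let ?S = "closure {x. \<phi> x \<noteq> 0}"
  have S: "smooth \<phi>" "compact ?S" "?S \<subseteq> \<Omega>" using assms by (auto simp: test_function_def)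
  have z: "\<phi> x = 0" if "x \<notin> ?S" for x using that closure_subset[of "{x. \<phi> x \<noteq> 0}"] by blast
  have d: "frechet_derivative \<phi> (at x) b = 0" if "x \<notin> ?S" for x b
  proof -
    have ev: "\<forall>\<^sub>F y in nhds x. \<phi> y = 0"
      using that z open_Compl[OF closed_closure, of "{x. \<phi> x \<noteq> 0}"] unfolding eventually_nhds by blast
    have "(\<phi> has_derivative (\<lambda>_. 0)) (at x)"
    proof (rule has_derivative_transform_eventually[where f="\<lambda>_. 0"])
      show "((\<lambda>_. 0) has_derivative (\<lambda>_. 0)) (at x)" by (rule has_derivative_const)
      show "\<forall>\<^sub>F y in at x. 0 = \<phi> y" using ev by (auto simp: eventually_at_filter elim: eventually_mono)
      show "0 = \<phi> x" using eventually_nhds_x_imp_x[OF ev] by simp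
    qed simp
    from frechet_derivative_at[OF this] show ?thesis by metis
  qed
  show ?thesis by (rule that[OF S z d])
qed

lemma test_function_translate:
  assumes "test_function U \<phi>" "(\<lambda>x. x + z) ` U \<subseteq> \<Omega>"
  shows "test_function \<Omega> (\<lambda>x. \<phi> (x - z))"
proof -
  obtain S where S: "smooth \<phi>" "compact S" "S \<subseteq> U" "\<And>x. x \<notin> S \<Longrightarrow> \<phi> x = 0"
    using test_functionE[OF assms(1)] by metis
  show ?thesis
  proof (rule test_functionI)
    show "smooth (\<lambda>x. \<phi> (x - z))" using smooth_affine[OF S(1), of 1 "-z"] by simp
    show "compact ((\<lambda>x. x + z) ` S)" using S by (intro compact_continuous_image continuous_intros)
    show "(\<lambda>x. x + z) ` S \<subseteq> \<Omega>" using S assms by auto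
    show "\<phi> (x - z) = 0" if "x \<notin> (\<lambda>x. x + z) ` S" for x
    proof -
      have "x - z \<notin> S" using that by (metis add.commute diff_add_cancel image_eqI)
      then show ?thesis by (rule S)
    qed
  qed
qed

lemma continuous_compact_support_bounded:
  fixes \<phi> :: "'a::topological_space \<Rightarrow> 'b::real_normed_vector"
  assumes "continuous_on UNIV \<phi>" "compact S" "\<And>x. x \<notin> S \<Longrightarrow> \<phi> x = 0"
  obtains M where "M > 0" "\<And>x. norm (\<phi> x) \<le> M"
proof -
  have "bounded (\<phi> ` S)"
    using assms by (intro compact_imp_bounded compact_continuous_image) (auto intro: continuous_on_subset)
  then obtain M where M: "M > 0" "\<And>x. x \<in> S \<Longrightarrow> norm (\<phi> x) \<le> M"
    by (auto simp: bounded_pos)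
  show ?thesis by (rule that[OF M(1)]) (metis M assms(3) less_imp_le norm_zero)
qed

abbreviation partial :: "'n \<Rightarrow> (real^'n::finite \<Rightarrow> 'b::real_normed_vector) \<Rightarrow> real^'n \<Rightarrow> 'b" where
  "partial i f x \<equiv> frechet_derivative f (at x) (axis i 1)"

lemma test_function_bounded:
  fixes \<phi> :: "real^'n \<Rightarrow> real"
  assumes "test_function \<Omega> \<phi>"
  obtains M where "M > 0" "\<And>x. \<bar>\<phi> x\<bar> \<le> M" "\<And>x i. \<bar>partial i \<phi> x\<bar> \<le> M"
proof -
  obtain S where S: "smooth \<phi>" "compact S" "S \<subseteq> \<Omega>" "\<And>x. x \<notin> S \<Longrightarrow> \<phi> x = 0"
      "\<And>x b. x \<notin> S \<Longrightarrow> frechet_derivative \<phi> (at x) b = 0"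
    using test_functionE[OF assms(1)] by metis
  obtain M0 where M0: "M0 > 0" "\<And>x. norm (\<phi> x) \<le> M0"
    using continuous_compact_support_bounded[OF smooth_continuous_on[OF S(1)] S(2,4)] by metis
  have "\<exists>M>0. \<forall>x. norm (partial i \<phi> x) \<le> M" for i
    using continuous_compact_support_bounded[OF smooth_continuous_partial[OF S(1), of "axis i 1"] S(2)] S(5)
    by (metis axis_in_Basis_iff Basis_real_def singletonI)
  then obtain M where M: "\<And>i. M i > 0" "\<And>i x. norm (partial i \<phi> x) \<le> M i" by metis
  show ?thesis
  proof (rule that[of "M0 + (\<Sum>i\<in>UNIV. M i)"])
    have le: "M i \<le> (\<Sum>i\<in>UNIV. M i)" for i using M(1) by (intro member_le_sum) (auto simp: less_imp_le)
    have nn: "0 \<le> (\<Sum>i\<in>UNIV. M i)" using M(1) by (intro sum_nonneg) (auto simp: less_imp_le)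
    show "M0 + (\<Sum>i\<in>UNIV. M i) > 0" using M0 nn by simp
    show "\<bar>\<phi> x\<bar> \<le> M0 + (\<Sum>i\<in>UNIV. M i)" for x using M0(2)[of x] nn by simp
    show "\<bar>partial i \<phi> x\<bar> \<le> M0 + (\<Sum>i\<in>UNIV. M i)" for x i
      using M(2)[where i=i and x=x] le[of i] M0(1) unfolding real_norm_def by linarith
  qed
qed

lemma smooth_borel_measurable: "smooth f \<Longrightarrow> f \<in> borel_measurable borel"
  by (intro borel_measurable_continuous_onI smooth_continuous_on)
lemma smooth_partial_borel_measurable:
  fixes f :: "real^'n \<Rightarrow> 'b::real_normed_vector"
  shows "smooth f \<Longrightarrow> (\<lambda>x. partial i f x) \<in> borel_measurable borel"
  by (intro borel_measurable_continuous_onI smooth_continuous_partial) (auto simp: axis_in_Basis_iff)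

section \<open>The fundamental lemma of the calculus of variations\<close>

text \<open>Bounded pointwise convergence to the indicator from inside lets dominated convergence
  pass from test functions to open boxes.\<close>

lemma box_bumps:
  fixes a b :: "real^'n"
  obtains \<phi> :: "nat \<Rightarrow> real^'n \<Rightarrow> real" where "\<And>k. test_function (box a b) (\<phi> k)"
    "\<And>k x. 0 \<le> \<phi> k x" "\<And>k x. \<phi> k x \<le> 1" "\<And>x. (\<lambda>k. \<phi> k x) \<longlonglongrightarrow> indicator (box a b) x"
proof -
  obtain \<theta> :: "real \<Rightarrow> real" where \<theta>: "smooth \<theta>" "\<And>x. x \<le> 0 \<Longrightarrow> \<theta> x = 0" "\<And>x. x \<ge> 1 \<Longrightarrow> \<theta> x = 1"
    "\<And>x. 0 \<le> \<theta> x" "\<And>x. \<theta> x \<le> 1" using smooth_step_exists by metis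
  \<comment> \<open>Each factor rises with slope of order k + 1. The shift by 1 keeps it zero up to
    distance 1/(k+1) from its face, so the support is a compact subset of the open box; from
    distance 2/(k+1) on, the factor equals 1.\<close>
  define \<phi> where "\<phi> k x = (\<Prod>i\<in>UNIV. \<theta> (real (Suc k) *\<^sub>R x $ i + (- real (Suc k) * a $ i - 1)) 
      * \<theta> ((- real (Suc k)) *\<^sub>R x $ i + (real (Suc k) * b $ i - 1)))" for k :: nat and x :: "real^'n"
  have smooth: "smooth (\<phi> k)" for k unfolding \<phi>_def
    by (intro smooth_prod smooth_mult smooth_coordinate smooth_affine \<theta>)
  have eq: "real (Suc k) * y + (- real (Suc k) * c - 1) = real (Suc k) * (y - c) - 1"
    "- real (Suc k) * y + (real (Suc k) * c - 1) = real (Suc k) * (c - y) - 1" for k y c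
    by (simp_all add: algebra_simps)
  show ?thesis
  proof
    fix k
    let ?S = "cbox (\<chi> i. a $ i + 1 / Suc k) (\<chi> i. b $ i - 1 / Suc k)"
    show "test_function (box a b) (\<phi> k)"
    proof (rule test_functionI[OF smooth])
      show "compact ?S" by simp
      show "?S \<subseteq> box a b"
      proof
        fix x assume x: "x \<in> ?S"
        show "x \<in> box a b" unfolding mem_box_cart
        proof
          fix i
          have "a $ i + 1 / Suc k \<le> x $ i" "x $ i \<le> b $ i - 1 / Suc k" using x by (auto simp: mem_box_cart)
          moreover have "0 < 1 / real (Suc k)" by simp
          ultimately show "a $ i < x $ i \<and> x $ i < b $ i" by linarith
        qed
      qed
      show "\<phi> k x = 0" if "x \<notin> ?S" for x
      proof -
        obtain i where i: "x $ i < a $ i + 1 / Suc k \<or> x $ i > b $ i - 1 / Suc k"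
          using \<open>x \<notin> ?S\<close> by (auto simp: mem_box_cart not_le)
        then have "x $ i - a $ i \<le> 1 / real (Suc k) \<or> b $ i - x $ i \<le> 1 / real (Suc k)" by linarith
        then have "real (Suc k) * (x $ i - a $ i) - 1 \<le> 0 \<or> real (Suc k) * (b $ i - x $ i) - 1 \<le> 0"
          by (auto simp: pos_le_divide_eq mult.commute)
        then have "\<theta> (real (Suc k) * (x $ i - a $ i) - 1) * \<theta> (real (Suc k) * (b $ i - x $ i) - 1) = 0"
          using \<theta>(2) by auto
        then show ?thesis unfolding \<phi>_def real_scaleR_def eq by (intro prod_zero) auto
      qed
    qed
    show "0 \<le> \<phi> k x" for x unfolding \<phi>_def by (intro prod_nonneg) (auto simp: \<theta>)
    show "\<phi> k x \<le> 1" for x unfolding \<phi>_def by (intro prod_le_1) (auto simp: \<theta> mult_le_one)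
  next
    fix x
    show "(\<lambda>k. \<phi> k x) \<longlonglongrightarrow> indicator (box a b) x"
    proof (cases "x \<in> box a b")
      case False
      then obtain i where i: "x $ i - a $ i \<le> 0 \<or> b $ i - x $ i \<le> 0" by (auto simp: mem_box_cart not_less)
      have "\<phi> k x = 0" for k
      proof -
        have "real (Suc k) * (x $ i - a $ i) - 1 \<le> 0 \<or> real (Suc k) * (b $ i - x $ i) - 1 \<le> 0"
          using i mult_nonneg_nonpos[of "real (Suc k)"] by fastforce
        then have "\<theta> (real (Suc k) * (x $ i - a $ i) - 1) * \<theta> (real (Suc k) * (b $ i - x $ i) - 1) = 0"
          using \<theta>(2) by auto
        then show ?thesis unfolding \<phi>_def real_scaleR_def eq by (intro prod_zero) auto
      qed
      then show ?thesis using False by simp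
    next
      case True
      have one: "\<forall>\<^sub>F k in sequentially. \<theta> (real (Suc k) * c - 1) = 1" if "c > 0" for c
      proof -
        have "\<forall>\<^sub>F k in sequentially. real k \<ge> 2 / c" using eventually_ge_at_top by (rule eventually_compose_filterlim) (rule filterlim_real_sequentially)
        then show ?thesis
        proof eventually_elim
          case (elim k)
          then have "real k * c \<ge> 2" using that by (simp add: field_simps)
          then have "real (Suc k) * c - 1 \<ge> 1" using that by (simp add: algebra_simps)
          then show ?case by (rule \<theta>)
        qed
      qed
      have "\<forall>\<^sub>F k in sequentially. \<forall>i\<in>UNIV. \<theta> (real (Suc k) * (x $ i - a $ i) - 1) = 1 \<and> \<theta> (real (Suc k) * (b $ i - x $ i) - 1) = 1"
        using True by (intro eventually_ball_finite ballI eventually_conj one) (auto simp: mem_box_cart)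
      then have "\<forall>\<^sub>F k in sequentially. \<phi> k x = 1"
        by eventually_elim (unfold \<phi>_def real_scaleR_def eq, simp del: of_nat_Suc)
      then show ?thesis using True by (simp add: tendsto_eventually)
    qed
  qed
qed

text \<open>Integrals over boxes vanish by approximation with test functions. Boxes form an
  intersection-stable generator, so the integrals over all Borel sets vanish as well, and the
  density is zero almost everywhere.\<close>

lemma fundamental_lemma_real:
  fixes f :: "real^'n \<Rightarrow> real"
  assumes f: "integrable lborel f" and "open \<Omega>"
    and zero: "\<And>\<phi>. test_function \<Omega> \<phi> \<Longrightarrow> (LBINT x. \<phi> x * f x) = 0"
  shows "AE x in lborel. x \<in> \<Omega> \<longrightarrow> f x = 0"
proof -
  have [measurable]: "f \<in> borel_measurable borel" using f by (auto dest: borel_measurable_integrable)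
  have box0: "(LBINT x. indicator (box a b) x * f x) = 0" if "box a b \<subseteq> \<Omega>" for a b
  proof -
    obtain \<phi> :: "nat \<Rightarrow> real^'n \<Rightarrow> real" where \<phi>: "\<And>k. test_function (box a b) (\<phi> k)"
      "\<And>k x. 0 \<le> \<phi> k x" "\<And>k x. \<phi> k x \<le> 1" "\<And>x. (\<lambda>k. \<phi> k x) \<longlonglongrightarrow> indicator (box a b) x"
      using box_bumps by metis
    have [measurable]: "\<phi> k \<in> borel_measurable borel" for k
      using \<phi>(1) by (auto simp: test_function_def intro: smooth_borel_measurable)
    have "(\<lambda>k. LBINT x. \<phi> k x * f x) \<longlonglongrightarrow> (LBINT x. indicator (box a b) x * f x)"
    proof (rule integral_dominated_convergence[where w="\<lambda>x. norm (f x)"])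
      show "AE x in lborel. (\<lambda>i. \<phi> i x * f x) \<longlonglongrightarrow> indicator (box a b) x * f x"
        by (intro AE_I2 tendsto_mult \<phi> tendsto_const)
      show "AE x in lborel. norm (\<phi> i x * f x) \<le> norm (f x)" for i
        using \<phi>(2,3)[of i] by (intro AE_I2) (simp add: abs_mult mult_left_le_one_le)
    qed (use f in auto)
    moreover have "(LBINT x. \<phi> k x * f x) = 0" for k
      using zero test_function_mono[OF \<phi>(1) that] by blast
    ultimately show ?thesis by (simp add: LIMSEQ_const_iff)
  qed
  \<comment> \<open>Multiplying by the indicator of one fixed box inside the domain makes the
    integral over the whole space vanish too; the complement case of the induction rests on
    this.\<close>
  have boxAE: "AE x in lborel. indicator (box c d) x * f x = 0" if cd: "box c d \<subseteq> \<Omega>" for c d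
  proof (rule density_unique_real)
    let ?F = "\<lambda>x. indicator (box c d) x * f x"
    show F: "integrable lborel ?F" using integrable_mult_indicator[OF _ f, of "box c d"] by simp
    show "integrable lborel (\<lambda>x. 0::real)" by simp
    have box_Int: "box a b \<inter> box c d = box (\<chi> i. max (a $ i) (c $ i)) (\<chi> i. min (b $ i) (d $ i))" 
      for a b c d :: "real^'n" by (auto simp: mem_box_cart set_eq_iff)
    have IS: "Int_stable (range (\<lambda> (a, b). box a b :: (real^'n) set))"
      by (auto simp: Int_stable_def box_Int intro: rangeI)
    have subset_Pow: "range (\<lambda> (a, b). box a b :: (real^'n) set) \<subseteq> Pow UNIV" by simp
    fix A :: "(real^'n) set" assume "A \<in> sets lborel"
    then have "A \<in> sigma_sets UNIV (range (\<lambda> (a, b). box a b))"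
      unfolding sets_lborel by (subst (asm) borel_eq_box) simp
    with IS subset_Pow have "(LINT x:A|lborel. ?F x) = 0"
    proof (induction rule: sigma_sets_induct_disjoint)
      case (basic A)
      then obtain a b where A: "A = box a b" by auto
      have "A \<inter> box c d = box (\<chi> i. max (a $ i) (c $ i)) (\<chi> i. min (b $ i) (d $ i))"
        by (simp add: A box_Int)
      then have "(LBINT x. indicator (A \<inter> box c d) x * f x) = 0"
        using box0 cd by (metis Int_lower2 order_trans)
      then show ?case by (simp add: set_lebesgue_integral_def indicator_inter_arith mult.assoc)
    next
      case empty show ?case by (simp add: set_lebesgue_integral_def)
    next
      case (compl A)
      have A[measurable]: "A \<in> sets borel" using compl(1) by (subst borel_eq_box) simp
      have "(LINT x:UNIV|lborel. ?F x) = (LINT x:A|lborel. ?F x) + (LINT x:UNIV - A|lborel. ?F x)"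
        using F by (subst set_integral_Un[symmetric])
         (auto simp: set_integrable_def intro!: integrable_mult_indicator[where f="?F", simplified] Un_absorb2)
      moreover have "(LINT x:UNIV|lborel. ?F x) = 0"
        using box0[OF cd] by (simp add: set_lebesgue_integral_def)
      ultimately show ?case using compl by simp
    next
      case (union A)
      have A[measurable]: "A i \<in> sets borel" for i using union(2) by (subst borel_eq_box) auto
      have "(LINT x:(\<Union>i. A i)|lborel. ?F x) = (\<Sum>i. (LINT x:A i|lborel. ?F x))"
      proof (rule lebesgue_integral_countable_add)
        show "set_integrable lborel (\<Union>i. A i) ?F" unfolding set_integrable_def
          using integrable_mult_indicator[OF _ F, of "\<Union>i. A i"] by simp
        show "A i \<inter> A j = {}" if "i \<noteq> j" for i j using union(1) that by (auto simp: disjoint_family_on_def)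
      qed simp
      then show ?case using union(3) by simp
    qed
    then show "(LINT x:A|lborel. ?F x) = (LINT x:A|lborel. 0)" by simp
  qed
  \<comment> \<open>An open set is a countable union of boxes with rational corners, so countably
    many null sets suffice.\<close>
  obtain D where D: "countable D" "\<And>X. X \<in> D \<Longrightarrow> X \<subseteq> \<Omega> \<and> (\<exists>a b. X = box a b)" "\<Union>D = \<Omega>"
  proof -
    define a' where "a' = (\<lambda>f :: real^'n \<Rightarrow> real \<times> real. (\<Sum>i\<in>Basis. fst (f i) *\<^sub>R i))"
    define b' where "b' = (\<lambda>f :: real^'n \<Rightarrow> real \<times> real. (\<Sum>i\<in>Basis. snd (f i) *\<^sub>R i))"
    define I where "I = {f\<in>Basis \<rightarrow>\<^sub>E \<rat> \<times> \<rat>. box (a' f) (b' f) \<subseteq> \<Omega>}"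
    have "\<Omega> = (\<Union>f\<in>I. box (a' f) (b' f))"
      unfolding I_def a'_def b'_def by (rule open_UNION_box[OF assms(2)])
    moreover have "countable I" unfolding I_def
      by (intro countable_Collect countable_PiE) (auto intro: countable_rat)
    ultimately show ?thesis
      by (intro that[of "(\<lambda>f. box (a' f) (b' f)) ` I"]) (auto simp: I_def)
  qed
  have "AE x in lborel. \<forall>X\<in>D. indicator X x * f x = 0"
    using D boxAE by (subst AE_ball_countable) metis+
  then show ?thesis
    by eventually_elim (use D(3) in \<open>auto simp: indicator_def\<close>)
qed

lemma fundamental_lemma:
  fixes f :: "real^'n \<Rightarrow> 'b::euclidean_space"
  assumes f: "integrable lborel f" and "open \<Omega>"
    and zero: "\<And>\<phi>. test_function \<Omega> \<phi> \<Longrightarrow> (LBINT x. \<phi> x *\<^sub>R f x) = 0"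
  shows "AE x in lborel. x \<in> \<Omega> \<longrightarrow> f x = 0"
proof -
  have "AE x in lborel. x \<in> \<Omega> \<longrightarrow> f x \<bullet> b = 0" if "b \<in> Basis" for b
  proof (rule fundamental_lemma_real[OF _ assms(2)])
    show "integrable lborel (\<lambda>x. f x \<bullet> b)" using f by simp
    fix \<phi> assume \<phi>: "test_function \<Omega> \<phi>"
    obtain M where M: "M > 0" "\<And>x. \<bar>\<phi> x\<bar> \<le> M" using test_function_bounded[OF \<phi>] by metis
    have [measurable]: "\<phi> \<in> borel_measurable borel" using \<phi> by (auto simp: test_function_def intro: smooth_borel_measurable)
    have [measurable]: "f \<in> borel_measurable borel" using f by (auto dest: borel_measurable_integrable)
    have "integrable lborel (\<lambda>x. \<phi> x *\<^sub>R f x)"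
      by (rule Bochner_Integration.integrable_bound[OF integrable_scaleR_right[OF f, of M]])
        (use M in \<open>auto simp: mult_right_mono\<close>)
    then have "(LBINT x. (\<phi> x *\<^sub>R f x) \<bullet> b) = (LBINT x. \<phi> x *\<^sub>R f x) \<bullet> b"
      by (rule integral_inner_left)
    then show "(LBINT x. \<phi> x * (f x \<bullet> b)) = 0" using zero[OF \<phi>] by simp
  qed
  then have "AE x in lborel. \<forall>b\<in>Basis. x \<in> \<Omega> \<longrightarrow> f x \<bullet> b = 0"
    by (subst AE_ball_countable) (auto intro: countable_finite)
  then show ?thesis by eventually_elim (auto intro: euclidean_eqI)
qed

section \<open>Square integrable functions\<close>

lemma L2I: "f \<in> borel_measurable (lebesgue_on \<Omega>) \<Longrightarrow> integrable (lebesgue_on \<Omega>) (\<lambda>x. (norm (f x))\<^sup>2) \<Longrightarrow> f \<in> L2 \<Omega>"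
  by (simp add: L2_def)

lemma L2_measurable: "f \<in> L2 \<Omega> \<Longrightarrow> f \<in> borel_measurable (lebesgue_on \<Omega>)"
  by (simp add: L2_def)

lemma L2_integrable_square: "f \<in> L2 \<Omega> \<Longrightarrow> integrable (lebesgue_on \<Omega>) (\<lambda>x. (norm (f x))\<^sup>2)"
  by (simp add: L2_def)

lemma L2_norm_power2: "(L2_norm \<Omega> f)\<^sup>2 = (LINT x|lebesgue_on \<Omega>. (norm (f x))\<^sup>2)"
  by (simp add: L2_norm_def)

lemma L2_norm_nonneg [simp]: "0 \<le> L2_norm \<Omega> f"
  by (simp add: L2_norm_def)

lemma L2_AE_cong:
  assumes "f \<in> L2 \<Omega>" "g \<in> L2 \<Omega>" "AE x in lebesgue_on \<Omega>. f x = g x"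
  shows "L2_norm \<Omega> f = L2_norm \<Omega> g"
  unfolding L2_norm_def
  by (subst integral_cong_AE[of _ _ "\<lambda>x. (norm (g x))\<^sup>2"])
    (use assms L2_measurable[OF assms(1)] L2_measurable[OF assms(2)] in \<open>auto elim: eventually_mono\<close>)

lemma power2_norm_add_le: "(norm (x + y))\<^sup>2 \<le> 2 * (norm x)\<^sup>2 + 2 * (norm (y::'a::real_normed_vector))\<^sup>2"
proof -
  have "(norm (x + y))\<^sup>2 \<le> (norm x + norm y)\<^sup>2" by (intro power_mono norm_triangle_ineq) auto
  also have "\<dots> \<le> 2 * (norm x)\<^sup>2 + 2 * (norm y)\<^sup>2"
    using sum_squares_bound[of "norm x" "norm y"] by (simp add: power2_sum)
  finally show ?thesis .
qed

lemma L2_add: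
  assumes "f \<in> L2 \<Omega>" "g \<in> L2 \<Omega>" shows "(\<lambda>x. f x + g x) \<in> L2 \<Omega>"
proof (rule L2I)
  have [measurable]: "f \<in> borel_measurable (lebesgue_on \<Omega>)" "g \<in> borel_measurable (lebesgue_on \<Omega>)"
    using assms by (auto simp: L2_def)
  show "(\<lambda>x. f x + g x) \<in> borel_measurable (lebesgue_on \<Omega>)" by measurable
  show "integrable (lebesgue_on \<Omega>) (\<lambda>x. (norm (f x + g x))\<^sup>2)"
    by (rule Bochner_Integration.integrable_bound[where f="\<lambda>x. 2 * (norm (f x))\<^sup>2 + 2 * (norm (g x))\<^sup>2"])
      (use assms power2_norm_add_le in \<open>auto simp: L2_def\<close>)
qed

lemma L2_scaleR:
  assumes "f \<in> L2 \<Omega>" shows "(\<lambda>x. c *\<^sub>R f x) \<in> L2 \<Omega>"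
  using assms by (auto simp: L2_def power_mult_distrib)

lemma L2_diff:
  assumes "f \<in> L2 \<Omega>" "g \<in> L2 \<Omega>" shows "(\<lambda>x. f x - g x) \<in> L2 \<Omega>"
  using L2_add[OF assms(1) L2_scaleR[OF assms(2), of "-1"]] by simp

lemma L2_bound:
  assumes "f \<in> L2 \<Omega>" "g \<in> borel_measurable (lebesgue_on \<Omega>)" "\<And>x. norm (g x) \<le> c * norm (f x)"
  shows "g \<in> L2 \<Omega>"
proof (rule L2I[OF assms(2)])
  note assms(2)[measurable]
  show "integrable (lebesgue_on \<Omega>) (\<lambda>x. (norm (g x))\<^sup>2)"
  proof (rule Bochner_Integration.integrable_bound[where f="\<lambda>x. c\<^sup>2 * (norm (f x))\<^sup>2"])
    show "AE x in lebesgue_on \<Omega>. norm ((norm (g x))\<^sup>2) \<le> norm (c\<^sup>2 * (norm (f x))\<^sup>2)"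
      using power_mono[OF assms(3), where n=2] by (auto simp: power_mult_distrib)
  qed (use assms(1) in \<open>auto simp: L2_def\<close>)
qed

lemma L2_integrable_mult:
  assumes "f \<in> L2 \<Omega>" "g \<in> L2 \<Omega>"
  shows "integrable (lebesgue_on \<Omega>) (\<lambda>x. norm (f x) * norm (g x))"
proof -
  have [measurable]: "f \<in> borel_measurable (lebesgue_on \<Omega>)" "g \<in> borel_measurable (lebesgue_on \<Omega>)"
    using assms by (auto simp: L2_def)
  have "norm (f x) * norm (g x) \<le> (norm (f x))\<^sup>2 + (norm (g x))\<^sup>2" for x
    using sum_squares_bound[of "norm (f x)" "norm (g x)"] zero_le_power2[of "norm (f x)"] zero_le_power2[of "norm (g x)"] by linarith
  then have "AE x in lebesgue_on \<Omega>. norm (norm (f x) * norm (g x)) \<le> norm ((norm (f x))\<^sup>2 + (norm (g x))\<^sup>2)"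
    by (intro AE_I2) simp
  moreover have "integrable (lebesgue_on \<Omega>) (\<lambda>x. (norm (f x))\<^sup>2 + (norm (g x))\<^sup>2)"
    using assms by (simp add: L2_def)
  ultimately show ?thesis by (rule Bochner_Integration.integrable_bound[rotated 2]) measurable
qed

section \<open>The Cauchy-Schwarz and triangle inequalities in L2\<close>

text \<open>Young's inequality with a free parameter, optimised over the parameter, is
  Cauchy-Schwarz. In this form the integral version follows from a pointwise bound, without dividing
  by norms that may vanish.\<close>

lemma le_mult_of_AM_GM:
  fixes a b I :: real
  assumes "0 \<le> a" "0 \<le> b" "\<And>t. t > 0 \<Longrightarrow> 2 * I \<le> t * a\<^sup>2 + b\<^sup>2 / t"
  shows "I \<le> a * b"
proof (rule field_le_epsilon)
  fix e :: real assume e: "e > 0"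
  have "\<exists>h>0. (a + h) * (b + h) \<le> a * b + e"
  proof (intro exI conjI)
    let ?h = "min 1 (e / (a + b + 1))"
    show h: "?h > 0" using e assms by simp
    have "?h * (a + b + ?h) \<le> e / (a + b + 1) * (a + b + 1)"
      using e assms h by (intro mult_mono) (auto simp del: min_less_iff_conj)
    also have "\<dots> = e" using assms by (simp add: field_simps)
    finally show "(a + ?h) * (b + ?h) \<le> a * b + e" by (simp add: algebra_simps)
  qed
  then obtain h where h: "h > 0" "(a + h) * (b + h) \<le> a * b + e" by blast
  \<comment> \<open>The optimal parameter is b/a. Adding h to both numbers keeps it defined and
    positive when one of them is zero, at a cost below the prescribed error.\<close>
  let ?t = "(b + h) / (a + h)"
  have p: "a + h > 0" "b + h > 0" using h assms by auto
  have "2 * I \<le> ?t * a\<^sup>2 + b\<^sup>2 / ?t" using p by (intro assms) simp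
  also have "\<dots> \<le> ?t * (a + h)\<^sup>2 + (b + h)\<^sup>2 / ?t"
    using p h assms by (intro add_mono mult_left_mono divide_right_mono power_mono) auto
  also have "\<dots> = 2 * ((a + h) * (b + h))"
    using p by (simp add: power2_eq_square)
  finally show "I \<le> a * b + e" using h by simp
qed

lemma L2_Cauchy_Schwarz:
  assumes "f \<in> L2 \<Omega>" "g \<in> L2 \<Omega>"
  shows "(LINT x|lebesgue_on \<Omega>. norm (f x) * norm (g x)) \<le> L2_norm \<Omega> f * L2_norm \<Omega> g"
proof (rule le_mult_of_AM_GM)
  fix t :: real assume t: "t > 0"
  have "2 * (LINT x|lebesgue_on \<Omega>. norm (f x) * norm (g x)) = (LINT x|lebesgue_on \<Omega>. 2 * (norm (f x) * norm (g x)))"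
    by simp
  also have "\<dots> \<le> (LINT x|lebesgue_on \<Omega>. t * (norm (f x))\<^sup>2 + (norm (g x))\<^sup>2 / t)"
  proof (rule integral_mono)
    show "integrable (lebesgue_on \<Omega>) (\<lambda>x. 2 * (norm (f x) * norm (g x)))"
      by (intro integrable_mult_right L2_integrable_mult assms)
    show "integrable (lebesgue_on \<Omega>) (\<lambda>x. t * (norm (f x))\<^sup>2 + (norm (g x))\<^sup>2 / t)"
      using assms by (auto simp: L2_def)
    show "2 * (norm (f x) * norm (g x)) \<le> t * (norm (f x))\<^sup>2 + (norm (g x))\<^sup>2 / t" for x
    proof -
      have "0 \<le> (t * norm (f x) - norm (g x))\<^sup>2 / t" using t by simp
      also have "\<dots> = t * (norm (f x))\<^sup>2 + (norm (g x))\<^sup>2 / t - 2 * (norm (f x) * norm (g x))"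
        using t by (simp add: power2_eq_square field_simps)
      finally show ?thesis by simp
    qed
  qed
  also have "\<dots> = t * (L2_norm \<Omega> f)\<^sup>2 + (L2_norm \<Omega> g)\<^sup>2 / t"
    using assms by (simp add: L2_norm_power2 L2_integrable_square)
  finally show "2 * (LINT x|lebesgue_on \<Omega>. norm (f x) * norm (g x)) \<le> t * (L2_norm \<Omega> f)\<^sup>2 + (L2_norm \<Omega> g)\<^sup>2 / t" .
qed auto

lemma L2_norm_scaleR: "L2_norm \<Omega> (\<lambda>x. c *\<^sub>R f x) = \<bar>c\<bar> * L2_norm \<Omega> f"
  by (simp add: L2_norm_def power_mult_distrib real_sqrt_mult)

lemma L2_norm_triangle:
  assumes "f \<in> L2 \<Omega>" "g \<in> L2 \<Omega>"
  shows "L2_norm \<Omega> (\<lambda>x. f x + g x) \<le> L2_norm \<Omega> f + L2_norm \<Omega> g"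
proof (rule power2_le_imp_le)
  have "(L2_norm \<Omega> (\<lambda>x. f x + g x))\<^sup>2 \<le> (LINT x|lebesgue_on \<Omega>. (norm (f x))\<^sup>2 + 2 * (norm (f x) * norm (g x)) + (norm (g x))\<^sup>2)"
    unfolding L2_norm_power2
  proof (rule integral_mono)
    show "integrable (lebesgue_on \<Omega>) (\<lambda>x. (norm (f x + g x))\<^sup>2)" using L2_add[OF assms] by (simp add: L2_def)
    show "integrable (lebesgue_on \<Omega>) (\<lambda>x. (norm (f x))\<^sup>2 + 2 * (norm (f x) * norm (g x)) + (norm (g x))\<^sup>2)"
      using L2_integrable_mult[OF assms] assms by (simp add: L2_def)
    show "(norm (f x + g x))\<^sup>2 \<le> (norm (f x))\<^sup>2 + 2 * (norm (f x) * norm (g x)) + (norm (g x))\<^sup>2" for x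
      using power_mono[OF norm_triangle_ineq[of "f x" "g x"], of 2] by (simp add: power2_sum)
  qed
  also have "\<dots> = (L2_norm \<Omega> f)\<^sup>2 + 2 * (LINT x|lebesgue_on \<Omega>. norm (f x) * norm (g x)) + (L2_norm \<Omega> g)\<^sup>2"
    using L2_integrable_mult[OF assms] assms by (simp add: L2_def L2_norm_power2)
  also have "\<dots> \<le> (L2_norm \<Omega> f + L2_norm \<Omega> g)\<^sup>2"
    using L2_Cauchy_Schwarz[OF assms] by (simp add: power2_sum)
  finally show "(L2_norm \<Omega> (\<lambda>x. f x + g x))\<^sup>2 \<le> (L2_norm \<Omega> f + L2_norm \<Omega> g)\<^sup>2" .
qed auto

lemma L2_norm_uminus: "L2_norm \<Omega> (\<lambda>x. - f x) = L2_norm \<Omega> f"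
  by (simp add: L2_norm_def)

lemma L2_norm_minus_commute: "L2_norm \<Omega> (\<lambda>x. f x - g x) = L2_norm \<Omega> (\<lambda>x. g x - f x)"
  by (simp add: L2_norm_def norm_minus_commute)

lemma L2_norm_triangle_diff:
  assumes "f \<in> L2 \<Omega>" "g \<in> L2 \<Omega>"
  shows "L2_norm \<Omega> (\<lambda>x. f x - g x) \<le> L2_norm \<Omega> f + L2_norm \<Omega> g"
  using L2_norm_triangle[OF assms(1) L2_scaleR[OF assms(2), of "-1"]] by (simp add: L2_norm_uminus)

text \<open>Translations and Tonelli's theorem are used with respect to \<^const>\<open>lborel\<close>, hence the passage to Borel
  functions vanishing off \<open>\<Omega>\<close>.\<close>

lemma AE_lebesgue_on_iff:
  assumes "\<Omega> \<in> sets borel"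
  shows "(AE x in lebesgue_on \<Omega>. P x) \<longleftrightarrow> (AE x in lborel. x \<in> \<Omega> \<longrightarrow> P x)"
proof -
  have "\<Omega> \<inter> space lebesgue \<in> sets lebesgue" using assms by auto
  then show ?thesis by (simp add: AE_restrict_space_iff AE_completion_iff)
qed

text \<open>A Borel version on the whole space may be translated and used as a Tonelli integrand. It
  is taken coordinate by coordinate and multiplied by the indicator of the domain, so that the
  extension by zero holds everywhere and not only almost everywhere.\<close>

lemma borel_representative:
  fixes f :: "'a::euclidean_space \<Rightarrow> 'b::euclidean_space"
  assumes \<Omega>: "\<Omega> \<in> sets borel" and f: "f \<in> borel_measurable (lebesgue_on \<Omega>)"
  obtains g where "g \<in> borel_measurable borel" "AE x in lebesgue_on \<Omega>. g x = f x" "\<And>x. x \<notin> \<Omega> \<Longrightarrow> g x = 0"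
proof -
  have \<Omega>': "\<Omega> \<inter> space lebesgue \<in> sets lebesgue" using \<Omega> by auto
  have "(\<lambda>x. indicator \<Omega> x *\<^sub>R f x) \<in> borel_measurable lebesgue"
    using f by (subst (asm) borel_measurable_restrict_space_iff[OF \<Omega>'])
  then have "(\<lambda>x. (indicator \<Omega> x *\<^sub>R f x) \<bullet> b) \<in> borel_measurable (completion lborel)" for b
    by (rule borel_measurable_inner) simp
  then have "\<exists>g\<in>borel_measurable lborel. AE x in lborel. (indicator \<Omega> x *\<^sub>R f x) \<bullet> b = g x" for b
    by (rule completion_ex_borel_measurable_real)
  then obtain g where g: "\<And>b. g b \<in> borel_measurable lborel" "\<And>b. AE x in lborel. (indicator \<Omega> x *\<^sub>R f x) \<bullet> b = g b x"
    by metis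
  have [measurable]: "g b \<in> borel_measurable borel" for b using g(1)[of b] by simp
  note \<Omega>[measurable]
  show ?thesis
  proof (rule that[of "\<lambda>x. indicator \<Omega> x *\<^sub>R (\<Sum>b\<in>Basis. g b x *\<^sub>R b)"])
    show "(\<lambda>x. indicator \<Omega> x *\<^sub>R (\<Sum>b\<in>Basis. g b x *\<^sub>R b)) \<in> borel_measurable borel" by measurable
    have "AE x in lborel. \<forall>b\<in>Basis. (indicator \<Omega> x *\<^sub>R f x) \<bullet> b = g b x"
      using g(2) by (subst AE_ball_countable) (blast intro: countable_finite finite_Basis)+
    then show "AE x in lebesgue_on \<Omega>. indicator \<Omega> x *\<^sub>R (\<Sum>b\<in>Basis. g b x *\<^sub>R b) = f x"
      unfolding AE_lebesgue_on_iff[OF \<Omega>]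
    proof eventually_elim
      case (elim x)
      then have "x \<in> \<Omega> \<Longrightarrow> (\<Sum>b\<in>Basis. g b x *\<^sub>R b) = (\<Sum>b\<in>Basis. (f x \<bullet> b) *\<^sub>R b)" by simp
      then show ?case by (simp add: euclidean_representation)
    qed
  qed auto
qed

lemma lebesgue_on_lborel:
  fixes g :: "'a::euclidean_space \<Rightarrow> 'b::euclidean_space"
  assumes \<Omega>: "\<Omega> \<in> sets borel" and g: "g \<in> borel_measurable borel" "\<And>x. x \<notin> \<Omega> \<Longrightarrow> g x = 0"
  shows "integrable (lebesgue_on \<Omega>) g \<longleftrightarrow> integrable lborel g"
    and "(LINT x|lebesgue_on \<Omega>. g x) = (LBINT x. g x)"
proof -
  have \<Omega>': "\<Omega> \<inter> space lebesgue \<in> sets lebesgue" using \<Omega> by auto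
  have eq: "(\<lambda>x. indicator \<Omega> x *\<^sub>R g x) = g" using g(2) by (auto simp: indicator_def)
  show "integrable (lebesgue_on \<Omega>) g \<longleftrightarrow> integrable lborel g"
    unfolding integrable_restrict_space[OF \<Omega>'] eq using g by (intro integrable_completion) simp
  show "(LINT x|lebesgue_on \<Omega>. g x) = (LBINT x. g x)"
    unfolding integral_restrict_space[OF \<Omega>'] eq using g by (intro integral_completion) simp
qed

lemma nn_integral_lebesgue_on_lborel:
  assumes \<Omega>: "\<Omega> \<in> sets borel"
  shows "(\<integral>\<^sup>+x. g x \<partial>lebesgue_on \<Omega>) = (\<integral>\<^sup>+x. g x * indicator \<Omega> x \<partial>lborel)"
  using \<Omega> by (subst nn_integral_restrict_space) (auto simp: nn_integral_completion)

lemma finite_measure_lebesgue_on_bounded: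
  assumes "\<Omega> \<in> sets borel" "bounded \<Omega>"
  shows "finite_measure (lebesgue_on \<Omega>)"
  using assms by (intro finite_measure_lebesgue_on bounded_set_imp_lmeasurable) auto

lemma L2_integrable:
  assumes "\<Omega> \<in> sets borel" "bounded \<Omega>" "f \<in> L2 \<Omega>"
  shows "integrable (lebesgue_on \<Omega>) f"
proof -
  interpret finite_measure "lebesgue_on \<Omega>" using assms(1,2) by (rule finite_measure_lebesgue_on_bounded)
  have "norm y \<le> 1 + (norm y)\<^sup>2" for y :: 'b
  proof -
    have "0 \<le> (norm y - 1)\<^sup>2" by simp
    then have "2 * norm y \<le> 1 + (norm y)\<^sup>2" by (simp add: power2_diff)
    then show ?thesis using norm_ge_zero[of y] by linarith
  qed
  then have "AE x in lebesgue_on \<Omega>. norm (f x) \<le> norm (1 + (norm (f x))\<^sup>2)"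
    by (intro AE_I2) (simp add: abs_of_nonneg)
  moreover have "integrable (lebesgue_on \<Omega>) (\<lambda>x. 1 + (norm (f x))\<^sup>2)"
    using assms(3) by (simp add: L2_def)
  ultimately show ?thesis using L2_measurable[OF assms(3)]
    by (rule Bochner_Integration.integrable_bound[rotated 2])
qed

lemma bounded_measurable_L2:
  fixes f :: "'a::euclidean_space \<Rightarrow> 'b::euclidean_space"
  assumes "\<Omega> \<in> sets borel" "bounded \<Omega>" "f \<in> borel_measurable (lebesgue_on \<Omega>)" "\<And>x. x \<in> \<Omega> \<Longrightarrow> norm (f x) \<le> M"
  shows "f \<in> L2 \<Omega>"
proof (rule L2I[OF assms(3)])
  interpret finite_measure "lebesgue_on \<Omega>" using assms(1,2) by (rule finite_measure_lebesgue_on_bounded)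
  note assms(3)[measurable]
  show "integrable (lebesgue_on \<Omega>) (\<lambda>x. (norm (f x))\<^sup>2)"
    by (rule integrable_const_bound[where B="M\<^sup>2"]) (use assms(4) in \<open>auto intro!: AE_I2 power_mono\<close>)
qed

lemma continuous_L2:
  fixes f :: "'a::euclidean_space \<Rightarrow> 'b::euclidean_space"
  assumes "\<Omega> \<in> sets borel" "bounded \<Omega>" "continuous_on UNIV f"
  shows "f \<in> L2 \<Omega>"
proof -
  have "bounded (f ` closure \<Omega>)"
    using assms by (intro compact_imp_bounded compact_continuous_image) (auto intro: continuous_on_subset simp: compact_closure)
  then obtain M where M: "\<And>x. x \<in> closure \<Omega> \<Longrightarrow> norm (f x) \<le> M" by (auto simp: bounded_iff)
  have "f \<in> borel_measurable borel" using assms(3) by (rule borel_measurable_continuous_onI)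
  then have "f \<in> borel_measurable lebesgue" by (intro measurable_completion) simp
  then have "f \<in> borel_measurable (lebesgue_on \<Omega>)" by (rule measurable_restrict_space1)
  then show ?thesis using M closure_subset by (intro bounded_measurable_L2[OF assms(1,2)]) auto
qed

lemma L2_norm_1_le:
  fixes f :: "'a::euclidean_space \<Rightarrow> 'b::euclidean_space"
  assumes "\<Omega> \<in> sets borel" "bounded \<Omega>" "f \<in> L2 \<Omega>"
  shows "(LINT x|lebesgue_on \<Omega>. norm (f x)) \<le> sqrt (measure lebesgue \<Omega>) * L2_norm \<Omega> f"
proof -
  have \<Omega>: "\<Omega> \<in> lmeasurable" using assms by (intro bounded_set_imp_lmeasurable) auto
  have 1: "(\<lambda>x. 1::real) \<in> L2 \<Omega>" using assms by (intro continuous_L2 continuous_intros) auto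
  have "L2_norm \<Omega> (\<lambda>x. 1::real) = sqrt (measure lebesgue \<Omega>)"
    using \<Omega> by (simp add: L2_norm_def measure_restrict_space)
  then show ?thesis using L2_Cauchy_Schwarz[OF 1 assms(3)] by simp
qed

section \<open>Weak gradients\<close>

lemma H1_L2: "f \<in> H1 \<Omega> \<Longrightarrow> f \<in> L2 \<Omega>"
  by (simp add: H1_def)

lemma wgrad:
  assumes "f \<in> H1 \<Omega>"
  shows wgrad_L2: "wgrad \<Omega> f \<in> L2 \<Omega>" and weak_gradient_wgrad: "weak_gradient \<Omega> f (wgrad \<Omega> f)"
proof -
  have "wgrad \<Omega> f \<in> L2 \<Omega> \<and> weak_gradient \<Omega> f (wgrad \<Omega> f)"
    unfolding wgrad_def using assms by (intro someI_ex[of "\<lambda>G. G \<in> L2 \<Omega> \<and> weak_gradient \<Omega> f G"]) (auto simp: H1_def)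
  then show "wgrad \<Omega> f \<in> L2 \<Omega>" "weak_gradient \<Omega> f (wgrad \<Omega> f)" by auto
qed

lemma test_function_measurable:
  assumes "test_function \<Omega> \<phi>"
  shows "\<phi> \<in> borel_measurable borel" "\<phi> \<in> borel_measurable (lebesgue_on U)"
proof -
  show "\<phi> \<in> borel_measurable borel" using assms by (auto simp: test_function_def intro: smooth_borel_measurable)
  then have "\<phi> \<in> borel_measurable lebesgue" by (intro measurable_completion) simp
  then show "\<phi> \<in> borel_measurable (lebesgue_on U)" by (rule measurable_restrict_space1)
qed

lemma test_function_partial_measurable:
  fixes \<phi> :: "real^'n \<Rightarrow> real"
  assumes "test_function \<Omega> \<phi>"
  shows "(\<lambda>x. partial i \<phi> x) \<in> borel_measurable borel"
    "(\<lambda>x. partial i \<phi> x) \<in> borel_measurable (lebesgue_on U)"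
proof -
  show "(\<lambda>x. partial i \<phi> x) \<in> borel_measurable borel"
    using assms by (auto simp: test_function_def intro: smooth_partial_borel_measurable)
  then have "(\<lambda>x. partial i \<phi> x) \<in> borel_measurable lebesgue" by (intro measurable_completion) simp
  then show "(\<lambda>x. partial i \<phi> x) \<in> borel_measurable (lebesgue_on U)" by (rule measurable_restrict_space1)
qed

lemma integrable_bounded_scaleR:
  fixes f :: "'a \<Rightarrow> 'b::euclidean_space"
  assumes "integrable M f" "\<phi> \<in> borel_measurable M" "\<And>x. \<bar>\<phi> x\<bar> \<le> c"
  shows "integrable M (\<lambda>x. \<phi> x *\<^sub>R f x)"
proof (rule Bochner_Integration.integrable_bound[OF integrable_scaleR_right[OF assms(1), of c]])
  note assms(2)[measurable] borel_measurable_integrable[OF assms(1), measurable]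
  show "(\<lambda>x. \<phi> x *\<^sub>R f x) \<in> borel_measurable M" by measurable
  show "AE x in M. norm (\<phi> x *\<^sub>R f x) \<le> norm (c *\<^sub>R f x)"
    using assms(3) abs_ge_self[of c] by (intro AE_I2) (auto intro!: mult_right_mono intro: order_trans)
qed

lemma test_function_integrable:
  fixes \<phi> :: "real^'n \<Rightarrow> real" and f :: "real^'n \<Rightarrow> 'b::euclidean_space"
  assumes "test_function \<Omega> \<phi>" "integrable (lebesgue_on U) f"
  shows "integrable (lebesgue_on U) (\<lambda>x. \<phi> x *\<^sub>R f x)"
    "integrable (lebesgue_on U) (\<lambda>x. partial i \<phi> x *\<^sub>R f x)"
proof -
  obtain M where M: "\<And>x. \<bar>\<phi> x\<bar> \<le> M" "\<And>x i. \<bar>partial i \<phi> x\<bar> \<le> M"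
    using test_function_bounded[OF assms(1)] by metis
  show "integrable (lebesgue_on U) (\<lambda>x. \<phi> x *\<^sub>R f x)"
    by (rule integrable_bounded_scaleR[OF assms(2) test_function_measurable(2)[OF assms(1)] M(1)])
  show "integrable (lebesgue_on U) (\<lambda>x. partial i \<phi> x *\<^sub>R f x)"
    by (rule integrable_bounded_scaleR[OF assms(2) test_function_partial_measurable(2)[OF assms(1)] M(2)])
qed

lemma borel_measurable_vec_nth [measurable (raw)]:
  fixes G :: "'a \<Rightarrow> 'b::euclidean_space^'n"
  shows "G \<in> borel_measurable M \<Longrightarrow> (\<lambda>x. G x $ i) \<in> borel_measurable M"
  by (rule borel_measurable_continuous_on[OF linear_continuous_on[OF bounded_linear_vec_nth]])

lemma integrable_vec_nth:
  fixes G :: "'a \<Rightarrow> 'b::euclidean_space^'n"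
  shows "integrable M G \<Longrightarrow> integrable M (\<lambda>x. G x $ i)"
  by (rule integrable_bounded_linear[OF bounded_linear_vec_nth])

lemma weak_gradient_lincomb:
  fixes f g :: "real^'n \<Rightarrow> 'b::euclidean_space"
  assumes "integrable (lebesgue_on \<Omega>) f" "integrable (lebesgue_on \<Omega>) g"
    "integrable (lebesgue_on \<Omega>) F" "integrable (lebesgue_on \<Omega>) G"
    "weak_gradient \<Omega> f F" "weak_gradient \<Omega> g G"
  shows "weak_gradient \<Omega> (\<lambda>x. a *\<^sub>R f x + b *\<^sub>R g x) (\<lambda>x. a *\<^sub>R F x + b *\<^sub>R G x)"
  unfolding weak_gradient_def
proof (intro allI impI)
  fix \<phi> :: "real^'n \<Rightarrow> real" and i assume \<phi>: "test_function \<Omega> \<phi>"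
  let ?d = "\<lambda>x. partial i \<phi> x"
  have "(LINT x|lebesgue_on \<Omega>. ?d x *\<^sub>R (a *\<^sub>R f x + b *\<^sub>R g x)) = (LINT x|lebesgue_on \<Omega>. a *\<^sub>R (?d x *\<^sub>R f x) + b *\<^sub>R (?d x *\<^sub>R g x))"
    by (simp add: scaleR_add_right mult.commute)
  also have "\<dots> = a *\<^sub>R (LINT x|lebesgue_on \<Omega>. ?d x *\<^sub>R f x) + b *\<^sub>R (LINT x|lebesgue_on \<Omega>. ?d x *\<^sub>R g x)"
    using test_function_integrable[OF \<phi> assms(1)] test_function_integrable[OF \<phi> assms(2)] by (simp del: scaleR_scaleR)
  also have "\<dots> = a *\<^sub>R - (LINT x|lebesgue_on \<Omega>. \<phi> x *\<^sub>R (F x $ i)) + b *\<^sub>R - (LINT x|lebesgue_on \<Omega>. \<phi> x *\<^sub>R (G x $ i))"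
    using assms(5,6) \<phi> by (simp add: weak_gradient_def)
  also have "\<dots> = - (LINT x|lebesgue_on \<Omega>. a *\<^sub>R (\<phi> x *\<^sub>R (F x $ i)) + b *\<^sub>R (\<phi> x *\<^sub>R (G x $ i)))"
    using test_function_integrable[OF \<phi> integrable_vec_nth[OF assms(3)]] test_function_integrable[OF \<phi> integrable_vec_nth[OF assms(4)]] by (simp del: scaleR_scaleR)
  also have "\<dots> = - (LINT x|lebesgue_on \<Omega>. \<phi> x *\<^sub>R ((a *\<^sub>R F x + b *\<^sub>R G x) $ i))"
    by (simp add: scaleR_add_right mult.commute)
  finally show "(LINT x|lebesgue_on \<Omega>. ?d x *\<^sub>R (a *\<^sub>R f x + b *\<^sub>R g x)) = - (LINT x|lebesgue_on \<Omega>. \<phi> x *\<^sub>R ((a *\<^sub>R F x + b *\<^sub>R G x) $ i))" .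
qed

lemma H1_lincomb:
  fixes f g :: "real^'n \<Rightarrow> 'b::euclidean_space"
  assumes "open \<Omega>" "bounded \<Omega>" "f \<in> H1 \<Omega>" "g \<in> H1 \<Omega>"
  shows "(\<lambda>x. a *\<^sub>R f x + b *\<^sub>R g x) \<in> H1 \<Omega>"
    and "weak_gradient \<Omega> (\<lambda>x. a *\<^sub>R f x + b *\<^sub>R g x) (\<lambda>x. a *\<^sub>R wgrad \<Omega> f x + b *\<^sub>R wgrad \<Omega> g x)"
proof -
  note L2_integrable[OF borel_open[OF assms(1)] assms(2)]
  note int = this[OF H1_L2[OF assms(3)]] this[OF H1_L2[OF assms(4)]] this[OF wgrad_L2[OF assms(3)]] this[OF wgrad_L2[OF assms(4)]]
  show *: "weak_gradient \<Omega> (\<lambda>x. a *\<^sub>R f x + b *\<^sub>R g x) (\<lambda>x. a *\<^sub>R wgrad \<Omega> f x + b *\<^sub>R wgrad \<Omega> g x)"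
    by (intro weak_gradient_lincomb int weak_gradient_wgrad assms)
  have "(\<lambda>x. a *\<^sub>R wgrad \<Omega> f x + b *\<^sub>R wgrad \<Omega> g x) \<in> L2 \<Omega>"
    by (intro L2_add L2_scaleR wgrad_L2 assms)
  moreover have "(\<lambda>x. a *\<^sub>R f x + b *\<^sub>R g x) \<in> L2 \<Omega>"
    by (intro L2_add L2_scaleR H1_L2 assms)
  ultimately show "(\<lambda>x. a *\<^sub>R f x + b *\<^sub>R g x) \<in> H1 \<Omega>" using * by (auto simp: H1_def)
qed

text \<open>Two weak gradients differ by a function that annihilates all test functions. All algebra
  of \<open>wgrad\<close> rests on this, because \<open>wgrad\<close> is an arbitrary choice and its
  identities hold only almost everywhere.\<close>

lemma weak_gradient_unique:
  fixes f :: "real^'n \<Rightarrow> 'b::euclidean_space"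
  assumes "open \<Omega>" "integrable (lebesgue_on \<Omega>) f"
    "integrable (lebesgue_on \<Omega>) F" "integrable (lebesgue_on \<Omega>) G"
    "weak_gradient \<Omega> f F" "weak_gradient \<Omega> f G"
  shows "AE x in lebesgue_on \<Omega>. F x = G x"
proof -
  have \<Omega>: "\<Omega> \<in> sets borel" using assms(1) by simp
  define D where "D x = F x - G x" for x
  have D: "integrable (lebesgue_on \<Omega>) D" unfolding D_def using assms by simp
  have z: "(LINT x|lebesgue_on \<Omega>. \<phi> x *\<^sub>R (D x $ i)) = 0" if \<phi>: "test_function \<Omega> \<phi>" for \<phi> i
    using assms(5,6) \<phi> test_function_integrable[OF \<phi> integrable_vec_nth[OF assms(3)]] test_function_integrable[OF \<phi> integrable_vec_nth[OF assms(4)]]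
    by (simp add: weak_gradient_def D_def scaleR_diff_right)
  obtain D' where D': "D' \<in> borel_measurable borel" "AE x in lebesgue_on \<Omega>. D' x = D x" "\<And>x. x \<notin> \<Omega> \<Longrightarrow> D' x = 0"
    using borel_representative[OF \<Omega> borel_measurable_integrable[OF D]] by metis
  note D'(1)[measurable]
  have D'm: "D' \<in> borel_measurable (lebesgue_on \<Omega>)"
    by (intro measurable_restrict_space1 measurable_completion) simp
  have D'i: "integrable (lebesgue_on \<Omega>) D'"
    using D D'm borel_measurable_integrable[OF D] D'(2) by (subst integrable_cong_AE[of _ _ D]) auto
  then have int: "integrable lborel D'" using lebesgue_on_lborel(1)[OF \<Omega> D'(1,3)] by simp
  have "AE x in lborel. x \<in> \<Omega> \<longrightarrow> D' x $ i = 0" for i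
  proof (rule fundamental_lemma[OF integrable_vec_nth[OF int] assms(1)])
    fix \<phi> assume \<phi>: "test_function \<Omega> \<phi>"
    have [measurable]: "\<phi> \<in> borel_measurable borel" by (rule test_function_measurable[OF \<phi>])
    have "(LBINT x. \<phi> x *\<^sub>R D' x $ i) = (LINT x|lebesgue_on \<Omega>. \<phi> x *\<^sub>R D' x $ i)"
      by (rule lebesgue_on_lborel(2)[OF \<Omega>, symmetric]) (auto simp: D'(3))
    also have "\<dots> = (LINT x|lebesgue_on \<Omega>. \<phi> x *\<^sub>R D x $ i)"
    proof (rule integral_cong_AE)
      show "(\<lambda>x. \<phi> x *\<^sub>R D' x $ i) \<in> borel_measurable (lebesgue_on \<Omega>)"
        by (rule borel_measurable_integrable[OF test_function_integrable(1)[OF \<phi> integrable_vec_nth[OF D'i]]])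
      show "(\<lambda>x. \<phi> x *\<^sub>R D x $ i) \<in> borel_measurable (lebesgue_on \<Omega>)"
        by (rule borel_measurable_integrable[OF test_function_integrable(1)[OF \<phi> integrable_vec_nth[OF D]]])
      show "AE x in lebesgue_on \<Omega>. \<phi> x *\<^sub>R D' x $ i = \<phi> x *\<^sub>R D x $ i"
        using D'(2) by eventually_elim simp
    qed
    finally show "(LBINT x. \<phi> x *\<^sub>R D' x $ i) = 0" using z[OF \<phi>] by simp
  qed
  then have "AE x in lborel. \<forall>i\<in>UNIV. x \<in> \<Omega> \<longrightarrow> D' x $ i = 0"
    by (subst AE_ball_countable) auto
  then have "AE x in lebesgue_on \<Omega>. D' x = 0"
    unfolding AE_lebesgue_on_iff[OF \<Omega>] by eventually_elim (simp add: vec_eq_iff)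
  with D'(2) show ?thesis by eventually_elim (simp add: D_def)
qed

lemma wgrad_AE_eq:
  fixes f :: "real^'n \<Rightarrow> 'b::euclidean_space"
  assumes "open \<Omega>" "bounded \<Omega>" "f \<in> L2 \<Omega>" "G \<in> L2 \<Omega>" "weak_gradient \<Omega> f G"
  shows "AE x in lebesgue_on \<Omega>. wgrad \<Omega> f x = G x"
proof -
  note int = L2_integrable[OF borel_open[OF assms(1)] assms(2)]
  have f: "f \<in> H1 \<Omega>" using assms by (auto simp: H1_def)
  show ?thesis
    by (rule weak_gradient_unique[OF assms(1) int[OF assms(3)] int[OF wgrad_L2[OF f]] int[OF assms(4)] weak_gradient_wgrad[OF f] assms(5)])
qed

lemma wgrad_lincomb:
  fixes f g :: "real^'n \<Rightarrow> 'b::euclidean_space"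
  assumes "open \<Omega>" "bounded \<Omega>" "f \<in> H1 \<Omega>" "g \<in> H1 \<Omega>"
  shows "AE x in lebesgue_on \<Omega>. wgrad \<Omega> (\<lambda>x. a *\<^sub>R f x + b *\<^sub>R g x) x = a *\<^sub>R wgrad \<Omega> f x + b *\<^sub>R wgrad \<Omega> g x"
  by (rule wgrad_AE_eq[OF assms(1,2) H1_L2[OF H1_lincomb(1)[OF assms]] _ H1_lincomb(2)[OF assms]])
    (intro L2_add L2_scaleR wgrad_L2 assms)

lemma H1_diff:
  fixes f g :: "real^'n \<Rightarrow> 'b::euclidean_space"
  assumes "open \<Omega>" "bounded \<Omega>" "f \<in> H1 \<Omega>" "g \<in> H1 \<Omega>"
  shows "(\<lambda>x. f x - g x) \<in> H1 \<Omega>"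
  using H1_lincomb(1)[OF assms, of 1 "-1"] by simp

lemma wgrad_diff:
  fixes f g :: "real^'n \<Rightarrow> 'b::euclidean_space"
  assumes "open \<Omega>" "bounded \<Omega>" "f \<in> H1 \<Omega>" "g \<in> H1 \<Omega>"
  shows "AE x in lebesgue_on \<Omega>. wgrad \<Omega> (\<lambda>x. f x - g x) x = wgrad \<Omega> f x - wgrad \<Omega> g x"
  using wgrad_lincomb[OF assms, of 1 "-1"] by simp

lemma L2_norm_le_H1_norm: "L2_norm \<Omega> f \<le> H1_norm \<Omega> f" "L2_norm \<Omega> (wgrad \<Omega> f) \<le> H1_norm \<Omega> f"
  unfolding H1_norm_def by (auto intro!: real_le_rsqrt)

lemma H1_norm_le: "H1_norm \<Omega> f \<le> L2_norm \<Omega> f + L2_norm \<Omega> (wgrad \<Omega> f)"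
  unfolding H1_norm_def by (rule sqrt_sum_squares_le_sum) auto

lemma H1_norm_nonneg [simp]: "0 \<le> H1_norm \<Omega> f"
  by (simp add: H1_norm_def)

lemma L2_norm_wgrad_lincomb_le:
  fixes f g :: "real^'n \<Rightarrow> 'b::euclidean_space"
  assumes "open \<Omega>" "bounded \<Omega>" "f \<in> H1 \<Omega>" "g \<in> H1 \<Omega>"
  shows "L2_norm \<Omega> (wgrad \<Omega> (\<lambda>x. a *\<^sub>R f x + b *\<^sub>R g x)) \<le> \<bar>a\<bar> * L2_norm \<Omega> (wgrad \<Omega> f) + \<bar>b\<bar> * L2_norm \<Omega> (wgrad \<Omega> g)"
proof -
  have L: "(\<lambda>x. a *\<^sub>R wgrad \<Omega> f x) \<in> L2 \<Omega>" "(\<lambda>x. b *\<^sub>R wgrad \<Omega> g x) \<in> L2 \<Omega>"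
    by (intro L2_scaleR wgrad_L2 assms)+
  have "L2_norm \<Omega> (wgrad \<Omega> (\<lambda>x. a *\<^sub>R f x + b *\<^sub>R g x)) = L2_norm \<Omega> (\<lambda>x. a *\<^sub>R wgrad \<Omega> f x + b *\<^sub>R wgrad \<Omega> g x)"
    by (rule L2_AE_cong[OF wgrad_L2[OF H1_lincomb(1)[OF assms]] L2_add[OF L] wgrad_lincomb[OF assms]])
  also have "\<dots> \<le> \<bar>a\<bar> * L2_norm \<Omega> (wgrad \<Omega> f) + \<bar>b\<bar> * L2_norm \<Omega> (wgrad \<Omega> g)"
    using L2_norm_triangle[OF L] by (simp add: L2_norm_scaleR)
  finally show ?thesis .
qed

text \<open>The factors 2 come from bounding the Euclidean combination of the function norm and the
  gradient norm by their sum.\<close>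

lemma H1_norm_lincomb_le:
  fixes f g :: "real^'n \<Rightarrow> 'b::euclidean_space"
  assumes "open \<Omega>" "bounded \<Omega>" "f \<in> H1 \<Omega>" "g \<in> H1 \<Omega>"
  shows "H1_norm \<Omega> (\<lambda>x. a *\<^sub>R f x + b *\<^sub>R g x) \<le> 2 * \<bar>a\<bar> * H1_norm \<Omega> f + 2 * \<bar>b\<bar> * H1_norm \<Omega> g"
proof -
  have "L2_norm \<Omega> (\<lambda>x. a *\<^sub>R f x + b *\<^sub>R g x) \<le> \<bar>a\<bar> * L2_norm \<Omega> f + \<bar>b\<bar> * L2_norm \<Omega> g"
    using L2_norm_triangle[OF L2_scaleR[OF H1_L2[OF assms(3)], of a] L2_scaleR[OF H1_L2[OF assms(4)], of b]] by (simp add: L2_norm_scaleR)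
  also have "\<dots> \<le> \<bar>a\<bar> * H1_norm \<Omega> f + \<bar>b\<bar> * H1_norm \<Omega> g"
    by (intro add_mono mult_left_mono L2_norm_le_H1_norm) auto
  finally have 1: "L2_norm \<Omega> (\<lambda>x. a *\<^sub>R f x + b *\<^sub>R g x) \<le> \<bar>a\<bar> * H1_norm \<Omega> f + \<bar>b\<bar> * H1_norm \<Omega> g" .
  have "\<bar>a\<bar> * L2_norm \<Omega> (wgrad \<Omega> f) + \<bar>b\<bar> * L2_norm \<Omega> (wgrad \<Omega> g) \<le> \<bar>a\<bar> * H1_norm \<Omega> f + \<bar>b\<bar> * H1_norm \<Omega> g"
    by (intro add_mono mult_left_mono L2_norm_le_H1_norm) auto
  with 1 L2_norm_wgrad_lincomb_le[OF assms, of a b] H1_norm_le[of \<Omega> "\<lambda>x. a *\<^sub>R f x + b *\<^sub>R g x"]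
  show ?thesis by linarith
qed

section \<open>Translations of weakly differentiable functions\<close>

lemma integral_lborel_translate:
  fixes f :: "'a::euclidean_space \<Rightarrow> 'b::euclidean_space"
  assumes "f \<in> borel_measurable borel"
  shows "(LBINT x. f (x + z)) = (LBINT x. f x)"
    and "integrable lborel (\<lambda>x. f (x + z)) \<longleftrightarrow> integrable lborel f"
proof -
  have "integral\<^sup>L (distr lborel borel ((+) z)) f = (LBINT x. f (z + x))"
    using assms by (intro integral_distr) auto
  then show "(LBINT x. f (x + z)) = (LBINT x. f x)" by (simp add: lborel_distr_plus add.commute)
  have "integrable (distr lborel borel ((+) z)) f \<longleftrightarrow> integrable lborel (\<lambda>x. f (z + x))"
    using assms by (intro integrable_distr_eq) auto
  then show "integrable lborel (\<lambda>x. f (x + z)) \<longleftrightarrow> integrable lborel f" by (simp add: lborel_distr_plus add.commute)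
qed

section \<open>Averages over segments\<close>

text \<open>Jensen's inequality for the square, read off from the nonnegative variance of
  \<open>norm (F x)\<close>.\<close>

lemma norm_integral_power2_le:
  fixes F :: "'a \<Rightarrow> 'b::euclidean_space"
  assumes "finite_measure M" "0 < measure M (space M)" "integrable M F" "integrable M (\<lambda>x. (norm (F x))\<^sup>2)"
  shows "(norm (LINT x|M. F x))\<^sup>2 \<le> measure M (space M) * (LINT x|M. (norm (F x))\<^sup>2)"
proof -
  interpret finite_measure M by fact
  let ?m = "measure M (space M)"
  define A where "A = (LINT x|M. norm (F x))"
  have "0 \<le> (LINT x|M. (norm (F x) - A / ?m)\<^sup>2)" by (intro integral_nonneg_AE) simp
  also have "\<dots> = (LINT x|M. (norm (F x))\<^sup>2 + ((A / ?m)\<^sup>2 - norm (F x) * (2 * A / ?m)))"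
    by (intro Bochner_Integration.integral_cong) (auto simp: power2_diff)
  also have "\<dots> = (LINT x|M. (norm (F x))\<^sup>2) + ((LINT x|M. (A / ?m)\<^sup>2) - A * (2 * A / ?m))"
    using assms by (subst Bochner_Integration.integral_add) (auto simp: A_def)
  also have "(LINT x|M. (A / ?m)\<^sup>2) = A\<^sup>2 / ?m" using assms(2) by (simp add: power2_eq_square)
  finally have "A\<^sup>2 / ?m \<le> (LINT x|M. (norm (F x))\<^sup>2)" by (simp add: power2_eq_square)
  then have "A\<^sup>2 \<le> ?m * (LINT x|M. (norm (F x))\<^sup>2)" using assms(2) by (simp add: field_simps)
  moreover have "norm (LINT x|M. F x) \<le> A" unfolding A_def by (rule integral_norm_bound)
  then have "(norm (LINT x|M. F x))\<^sup>2 \<le> A\<^sup>2" by (intro power_mono) auto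
  ultimately show ?thesis by linarith
qed

text \<open>The parameter interval of a segment as a finite measure space of its own, so that
  Fubini's theorem with the Lebesgue measure in space is available.\<close>

definition unit_measure :: "real measure" where
  "unit_measure = restrict_space lborel {0..1}"

lemma unit_measure:
  shows sets_unit_measure: "sets unit_measure = sets (restrict_space borel {0..1})"
    and finite_measure_unit_interval: "finite_measure unit_measure"
    and space_unit_measure: "space unit_measure = {0..1}"
    and measure_unit_interval: "measure unit_measure (space unit_measure) = 1"
    "emeasure unit_measure (space unit_measure) = 1"
proof -
  show "sets unit_measure = sets (restrict_space borel {0..1})" unfolding unit_measure_def
    by (rule sets_restrict_space_cong) simp
  show sp: "space unit_measure = {0..1}" by (simp add: unit_measure_def space_restrict_space)
  show e: "emeasure unit_measure (space unit_measure) = 1"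
    unfolding sp by (simp add: unit_measure_def emeasure_restrict_space)
  then show "finite_measure unit_measure" by (intro finite_measureI) simp
  show "measure unit_measure (space unit_measure) = 1" by (simp add: measure_def e)
qed

lemma pair_unit_interval_measurable [measurable]:
  "fst \<in> borel_measurable (unit_measure \<Otimes>\<^sub>M lborel)"
proof -
  have "(\<lambda>x. x) \<in> borel_measurable unit_measure"
    unfolding unit_measure_def by (rule measurable_restrict_space1) simp
  then show ?thesis by measurable
qed

lemma unit_interval_FTC:
  fixes g :: "real \<Rightarrow> 'b::euclidean_space"
  assumes "\<And>s. (g has_vector_derivative g' s) (at s)" "continuous_on UNIV g'"
  shows "(LINT s|unit_measure. g' s) = g 1 - g 0"
proof -
  have "(LINT s|unit_measure. g' s) = (LINT s:{0..1}|lborel. g' s)"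
    unfolding unit_measure_def set_lebesgue_integral_def by (intro integral_restrict_space) simp
  also have "\<dots> = g 1 - g 0" unfolding set_lebesgue_integral_def
    by (rule integral_FTC_Icc) (use assms in \<open>auto intro: has_vector_derivative_at_within continuous_on_subset\<close>)
  finally show ?thesis .
qed

text \<open>Applied to a gradient, whose i-th entry is the i-th partial derivative, this is the
  derivative in direction z.\<close>

definition dir_comp :: "real^'n \<Rightarrow> 'b::euclidean_space^'n \<Rightarrow> 'b" where
  "dir_comp z A = (\<Sum>i\<in>UNIV. z $ i *\<^sub>R A $ i)"

lemma norm_dir_comp_le: "norm (dir_comp z A) \<le> norm z * norm A"
proof -
  have "norm (dir_comp z A) \<le> (\<Sum>i\<in>UNIV. \<bar>norm (z $ i)\<bar> * \<bar>norm (A $ i)\<bar>)"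
    unfolding dir_comp_def by (rule order_trans[OF norm_sum]) simp
  also have "\<dots> \<le> L2_set (\<lambda>i. norm (z $ i)) UNIV * L2_set (\<lambda>i. norm (A $ i)) UNIV"
    by (rule L2_set_mult_ineq)
  finally show ?thesis by (simp add: norm_vec_def)
qed

lemma dir_comp_measurable [measurable (raw)]:
  "G \<in> borel_measurable M \<Longrightarrow> (\<lambda>x. dir_comp z (G x)) \<in> borel_measurable M"
  unfolding dir_comp_def by measurable

lemma dir_comp_integrable: "integrable M G \<Longrightarrow> integrable M (\<lambda>x. dir_comp z (G x))"
  unfolding dir_comp_def by (intro Bochner_Integration.integrable_sum integrable_scaleR_right integrable_vec_nth)

text \<open>By translation invariance the inner integral of the norm is the same number for every s,
  and the parameter interval has mass 1.\<close>

lemma translation_kernel_integrable: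
  fixes f :: "real^'n \<Rightarrow> 'b::euclidean_space"
  assumes [measurable]: "f \<in> borel_measurable borel" and f: "integrable lborel f"
  shows "integrable (unit_measure \<Otimes>\<^sub>M lborel) (\<lambda>(s, x). f (x + s *\<^sub>R z))"
proof -
  interpret I: finite_measure unit_measure by (rule finite_measure_unit_interval)
  interpret pair_sigma_finite unit_measure "lborel :: (real^'n) measure" by standard
  show ?thesis
  proof (rule Fubini_integrable)
    show "(\<lambda>(s, x). f (x + s *\<^sub>R z)) \<in> borel_measurable (unit_measure \<Otimes>\<^sub>M lborel)" by measurable
    have "(LBINT x. norm (f (x + s *\<^sub>R z))) = (LBINT x. norm (f x))" for s
      by (rule integral_lborel_translate(1)[where f="\<lambda>x. norm (f x)"]) measurable
    then show "integrable unit_measure (\<lambda>s. LBINT y. norm (case (s, y) of (s, x) \<Rightarrow> f (x + s *\<^sub>R z)))"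
      by simp
    show "AE s in unit_measure. integrable lborel (\<lambda>y. case (s, y) of (s, x) \<Rightarrow> f (x + s *\<^sub>R z))"
      using f by (simp add: integral_lborel_translate(2))
  qed
qed

lemma has_derivative_axis_sum:
  fixes \<phi> :: "real^'n \<Rightarrow> real"
  assumes "\<phi> differentiable (at x)"
  shows "frechet_derivative \<phi> (at x) z = (\<Sum>i\<in>UNIV. z $ i * partial i \<phi> x)"
proof -
  have l: "linear (frechet_derivative \<phi> (at x))"
    using assms by (simp add: frechet_derivative_works has_derivative_linear)
  have "frechet_derivative \<phi> (at x) (\<Sum>i\<in>UNIV. z $ i *\<^sub>R axis i 1) = (\<Sum>i\<in>UNIV. z $ i * partial i \<phi> x)"
    using l by (simp add: linear_sum linear_cmul)
  moreover have "(\<Sum>i\<in>UNIV. z $ i *\<^sub>R axis i 1) = z" using basis_expansion[of z] by (simp add: scalar_mult_eq_scaleR)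
  ultimately show ?thesis by simp
qed

text \<open>The fundamental theorem of calculus along segments for weak derivatives. Tested against
  \<phi>, the translation is moved onto \<phi>, the weak derivative is integrated by parts there,
  and the s-integral of the derivative of the translated \<phi> is evaluated classically; the
  fundamental lemma then removes the test function.\<close>

lemma translation_AE:
  fixes f :: "real^'n \<Rightarrow> 'b::euclidean_space" and G :: "real^'n \<Rightarrow> 'b^'n"
  assumes [measurable]: "f \<in> borel_measurable borel" "G \<in> borel_measurable borel"
    and f: "integrable lborel f" and G: "integrable lborel G"
    and wg: "\<And>\<phi> i. test_function \<Omega> \<phi> \<Longrightarrow>
      (LBINT x. partial i \<phi> x *\<^sub>R f x) = - (LBINT x. \<phi> x *\<^sub>R G x $ i)"
    and U: "open U" "\<And>x s. x \<in> U \<Longrightarrow> 0 \<le> s \<Longrightarrow> s \<le> 1 \<Longrightarrow> x + s *\<^sub>R z \<in> \<Omega>"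
  shows "AE x in lborel. x \<in> U \<longrightarrow> f (x + z) - f x = (LINT s|unit_measure. dir_comp z (G (x + s *\<^sub>R z)))"
proof -
  interpret I: finite_measure unit_measure by (rule finite_measure_unit_interval)
  interpret P: pair_sigma_finite unit_measure "lborel :: (real^'n) measure" by standard
  define h where "h x = (LINT s|unit_measure. dir_comp z (G (x + s *\<^sub>R z)))" for x
  have K: "integrable (unit_measure \<Otimes>\<^sub>M lborel) (\<lambda>(s, x). dir_comp z (G (x + s *\<^sub>R z)))"
    by (rule translation_kernel_integrable) (auto intro: dir_comp_integrable G)
  have h: "integrable lborel h" unfolding h_def
    by (rule P.integrable_snd[OF K])
  have ft: "integrable lborel (\<lambda>x. f (x + z))" using f by (simp add: integral_lborel_translate(2))
  have "AE x in lborel. x \<in> U \<longrightarrow> f (x + z) - f x - h x = 0"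
  proof (rule fundamental_lemma[OF _ U(1)])
    show "integrable lborel (\<lambda>x. f (x + z) - f x - h x)" using f ft h by simp
    fix \<phi> assume \<phi>: "test_function U \<phi>"
    have sm: "smooth \<phi>" using \<phi> by (simp add: test_function_def)
    have [measurable]: "\<phi> \<in> borel_measurable borel" by (rule test_function_measurable[OF \<phi>])
    obtain M where M: "\<And>x. \<bar>\<phi> x\<bar> \<le> M" "\<And>x i. \<bar>partial i \<phi> x\<bar> \<le> M"
      using test_function_bounded[OF \<phi>] by metis
    define D where "D x = frechet_derivative \<phi> (at x) z" for x
    have Dsum: "D x = (\<Sum>i\<in>UNIV. z $ i * partial i \<phi> x)" for x
      unfolding D_def by (rule has_derivative_axis_sum[OF smooth_differentiable[OF sm]])
    have Dcont: "continuous_on A D" for A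
      unfolding Dsum by (intro continuous_intros smooth_continuous_partial sm) (auto simp: axis_in_Basis_iff)
    have [measurable]: "D \<in> borel_measurable borel" by (rule borel_measurable_continuous_onI[OF Dcont])
    have Dbd: "\<bar>D x\<bar> \<le> (\<Sum>i\<in>UNIV. \<bar>z $ i\<bar> * M)" for x
      unfolding Dsum by (rule order_trans[OF sum_abs]) (auto simp: abs_mult intro!: sum_mono mult_left_mono M)
    have bint: "integrable lborel (\<lambda>x. \<psi> x *\<^sub>R k x)" if "integrable lborel k" "\<psi> \<in> borel_measurable borel" "\<And>x. \<bar>\<psi> x\<bar> \<le> c"
      for \<psi> and k :: "real^'n \<Rightarrow> 'b" and c using that by (intro integrable_bounded_scaleR[of _ _ _ c]) auto
    have "(LBINT x. \<phi> x *\<^sub>R h x) = (LBINT x. LINT s|unit_measure. \<phi> x *\<^sub>R dir_comp z (G (x + s *\<^sub>R z)))"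
      unfolding h_def by simp
    also have "\<dots> = (LINT s|unit_measure. LINT x|lborel. \<phi> x *\<^sub>R dir_comp z (G (x + s *\<^sub>R z)))"
    proof (rule P.Fubini_integral)
      have "integrable (unit_measure \<Otimes>\<^sub>M lborel) (\<lambda>p. \<phi> (snd p) *\<^sub>R (case p of (s, x) \<Rightarrow> dir_comp z (G (x + s *\<^sub>R z))))"
        by (rule integrable_bounded_scaleR[OF K _ M(1)]) measurable
      then show "integrable (unit_measure \<Otimes>\<^sub>M lborel) (\<lambda>(s, x). \<phi> x *\<^sub>R dir_comp z (G (x + s *\<^sub>R z)))"
        by (simp add: case_prod_beta')
    qed
    also have "\<dots> = (LINT s|unit_measure. - (LBINT x. D (x - s *\<^sub>R z) *\<^sub>R f x))"
    proof (rule Bochner_Integration.integral_cong[OF refl])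
      fix s assume "s \<in> space unit_measure"
      then have s: "0 \<le> s" "s \<le> 1" by (auto simp: space_unit_measure)
      \<comment> \<open>The segments starting in \<open>U\<close> stay in the domain, so the
        translated test function is admissible for the weak gradient.\<close>
      have \<psi>: "test_function \<Omega> (\<lambda>x. \<phi> (x - s *\<^sub>R z))"
        by (rule test_function_translate[OF \<phi>]) (use U(2) s in auto)
      have fd: "frechet_derivative (\<lambda>x. \<phi> (x - s *\<^sub>R z)) (at x) v = frechet_derivative \<phi> (at (x - s *\<^sub>R z)) v" for x v
        using frechet_derivative_affine(2)[of \<phi> 1 x "- (s *\<^sub>R z)"] smooth_differentiable[OF sm] by simp
      have "(LBINT x. \<phi> x *\<^sub>R dir_comp z (G (x + s *\<^sub>R z))) = (LBINT x. \<phi> (x - s *\<^sub>R z) *\<^sub>R dir_comp z (G x))"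
        using integral_lborel_translate(1)[of "\<lambda>x. \<phi> (x - s *\<^sub>R z) *\<^sub>R dir_comp z (G x)" "s *\<^sub>R z"] by simp
      also have "\<dots> = (LBINT x. (\<Sum>i\<in>UNIV. z $ i *\<^sub>R (\<phi> (x - s *\<^sub>R z) *\<^sub>R G x $ i)))"
        by (simp add: dir_comp_def scaleR_sum_right mult.commute)
      also have "\<dots> = (\<Sum>i\<in>UNIV. z $ i *\<^sub>R (LBINT x. \<phi> (x - s *\<^sub>R z) *\<^sub>R G x $ i))"
        by (subst Bochner_Integration.integral_sum)
          (auto simp del: scaleR_scaleR intro!: integrable_scaleR_right bint[of _ _ M] M integrable_vec_nth G)
      also have "\<dots> = (\<Sum>i\<in>UNIV. z $ i *\<^sub>R - (LBINT x. partial i \<phi> (x - s *\<^sub>R z) *\<^sub>R f x))"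
        using wg[OF \<psi>] by (simp add: fd)
      also have "\<dots> = - (LBINT x. (\<Sum>i\<in>UNIV. z $ i *\<^sub>R (partial i \<phi> (x - s *\<^sub>R z) *\<^sub>R f x)))"
      proof -
        have [measurable]: "(\<lambda>x. partial i \<phi> x) \<in> borel_measurable borel" for i
          by (rule test_function_partial_measurable[OF \<phi>])
        have m: "(\<lambda>x. partial i \<phi> (x - s *\<^sub>R z)) \<in> borel_measurable borel" for i
          using measurable_compose[of "\<lambda>x. x - s *\<^sub>R z" borel borel "\<lambda>x. partial i \<phi> x"] by simp
        show ?thesis by (subst Bochner_Integration.integral_sum)
          (auto simp del: scaleR_scaleR simp: sum_negf intro!: integrable_scaleR_right bint[of _ _ M] M f m)
      qed
      also have "(\<lambda>x. \<Sum>i\<in>UNIV. z $ i *\<^sub>R (partial i \<phi> (x - s *\<^sub>R z) *\<^sub>R f x)) = (\<lambda>x. D (x - s *\<^sub>R z) *\<^sub>R f x)"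
        by (simp add: Dsum scaleR_sum_left)
      finally show "(LBINT x. \<phi> x *\<^sub>R dir_comp z (G (x + s *\<^sub>R z))) = - (LBINT x. D (x - s *\<^sub>R z) *\<^sub>R f x)" .
    qed
    also have "\<dots> = - (LINT s|unit_measure. LINT x|lborel. D (x - s *\<^sub>R z) *\<^sub>R f x)" by simp
    also have "(LINT s|unit_measure. LINT x|lborel. D (x - s *\<^sub>R z) *\<^sub>R f x)
        = (LBINT x. LINT s|unit_measure. D (x - s *\<^sub>R z) *\<^sub>R f x)"
    proof (rule P.Fubini_integral[symmetric])
      have "integrable (unit_measure \<Otimes>\<^sub>M lborel) (\<lambda>(s, x). f (x + s *\<^sub>R 0))"
        by (rule translation_kernel_integrable) (use f in auto)
      from integrable_bounded_scaleR[OF this, of "\<lambda>p. D (snd p - fst p *\<^sub>R z)", OF _ Dbd]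
      show "integrable (unit_measure \<Otimes>\<^sub>M lborel) (\<lambda>(s, x). D (x - s *\<^sub>R z) *\<^sub>R f x)"
        by (simp add: case_prod_beta')
    qed
    \<comment> \<open>With x fixed, the s-integral is that of the derivative of a smooth function
      along a segment, so only the endpoint values of \<phi> remain.\<close>
    also have "\<dots> = (LBINT x. (\<phi> x - \<phi> (x - z)) *\<^sub>R f x)"
    proof (rule Bochner_Integration.integral_cong[OF refl])
      fix x
      have "((\<lambda>s. - \<phi> (x - s *\<^sub>R z)) has_vector_derivative D (x - s *\<^sub>R z)) (at s)" for s
      proof -
        have "((\<lambda>s. x - s *\<^sub>R z) has_derivative (\<lambda>h. - (h *\<^sub>R z))) (at s)"
          by (auto intro!: derivative_eq_intros)
        from has_derivative_compose[OF this smooth_has_derivative[OF sm]]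
        have "((\<lambda>s. \<phi> (x - s *\<^sub>R z)) has_derivative (\<lambda>h. frechet_derivative \<phi> (at (x - s *\<^sub>R z)) (- (h *\<^sub>R z)))) (at s)" .
        moreover have "linear (frechet_derivative \<phi> (at (x - s *\<^sub>R z)))"
          by (rule has_derivative_linear[OF smooth_has_derivative[OF sm]])
        then have "frechet_derivative \<phi> (at (x - s *\<^sub>R z)) (- (h *\<^sub>R z)) = - (h * D (x - s *\<^sub>R z))" for h
          by (simp add: linear_neg linear_cmul D_def)
        ultimately have "((\<lambda>s. - \<phi> (x - s *\<^sub>R z)) has_derivative (\<lambda>h. h * D (x - s *\<^sub>R z))) (at s)"
          using has_derivative_minus by fastforce
        then show ?thesis by (simp add: has_vector_derivative_def)
      qed
      moreover have "continuous_on UNIV (\<lambda>s. D (x - s *\<^sub>R z))"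
        by (rule continuous_on_compose2[OF Dcont[of UNIV]]) (auto intro!: continuous_intros)
      ultimately have "(LINT s|unit_measure. D (x - s *\<^sub>R z)) = - \<phi> (x - 1 *\<^sub>R z) - - \<phi> (x - 0 *\<^sub>R z)"
        by (rule unit_interval_FTC)
      moreover have "integrable unit_measure (\<lambda>s. D (x - s *\<^sub>R z))"
      proof (rule I.integrable_const_bound[OF AE_I2])
        show "norm (D (x - s *\<^sub>R z)) \<le> (\<Sum>i\<in>UNIV. \<bar>z $ i\<bar> * M)" for s using Dbd by simp
        have "(\<lambda>x. x) \<in> borel_measurable unit_measure"
          unfolding unit_measure_def by (rule measurable_restrict_space1) simp
        then show "(\<lambda>s. D (x - s *\<^sub>R z)) \<in> borel_measurable unit_measure" by measurable
      qed
      ultimately show "(LINT s|unit_measure. D (x - s *\<^sub>R z) *\<^sub>R f x) = (\<phi> x - \<phi> (x - z)) *\<^sub>R f x"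
        by (subst integral_scaleR_left) auto
    qed
    also have "\<dots> = (LBINT x. \<phi> x *\<^sub>R f x) - (LBINT x. \<phi> (x - z) *\<^sub>R f x)"
      unfolding scaleR_diff_left by (intro Bochner_Integration.integral_diff bint[of _ _ M] f M) measurable
    also have "(LBINT x. \<phi> (x - z) *\<^sub>R f x) = (LBINT x. \<phi> x *\<^sub>R f (x + z))"
      using integral_lborel_translate(1)[of "\<lambda>x. \<phi> (x - z) *\<^sub>R f x" z] by simp
    finally have *: "(LBINT x. \<phi> x *\<^sub>R h x) = (LBINT x. \<phi> x *\<^sub>R f (x + z)) - (LBINT x. \<phi> x *\<^sub>R f x)" by simp
    have i: "integrable lborel (\<lambda>x. \<phi> x *\<^sub>R f (x + z))" "integrable lborel (\<lambda>x. \<phi> x *\<^sub>R f x)" "integrable lborel (\<lambda>x. \<phi> x *\<^sub>R h x)"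
      by (intro bint[of _ _ M] M f ft h; measurable)+
    show "(LBINT x. \<phi> x *\<^sub>R (f (x + z) - f x - h x)) = 0"
      unfolding scaleR_diff_right using i * by simp
  qed
  then show ?thesis by eventually_elim (auto simp: h_def)
qed

text \<open>Jensen's inequality in the segment parameter, then Fubini's theorem: every translate of
  the squared gradient has the same integral.\<close>

lemma translation_L2_le:
  fixes f :: "real^'n \<Rightarrow> 'b::euclidean_space" and G :: "real^'n \<Rightarrow> 'b^'n"
  assumes [measurable]: "f \<in> borel_measurable borel" "G \<in> borel_measurable borel"
    and f: "integrable lborel f" and G: "integrable lborel G" and G2: "integrable lborel (\<lambda>x. (norm (G x))\<^sup>2)"
    and wg: "\<And>\<phi> i. test_function \<Omega> \<phi> \<Longrightarrow>
      (LBINT x. partial i \<phi> x *\<^sub>R f x) = - (LBINT x. \<phi> x *\<^sub>R G x $ i)"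
    and U: "open U" "\<And>x s. x \<in> U \<Longrightarrow> 0 \<le> s \<Longrightarrow> s \<le> 1 \<Longrightarrow> x + s *\<^sub>R z \<in> \<Omega>"
  shows "(\<integral>\<^sup>+x. ennreal ((norm (f (x + z) - f x))\<^sup>2) * indicator U x \<partial>lborel) \<le> ennreal ((norm z)\<^sup>2 * (LBINT x. (norm (G x))\<^sup>2))"
proof -
  interpret I: finite_measure unit_measure by (rule finite_measure_unit_interval)
  interpret P: pair_sigma_finite unit_measure "lborel :: (real^'n) measure" by standard
  have K: "integrable (unit_measure \<Otimes>\<^sub>M lborel) (\<lambda>(s, x). dir_comp z (G (x + s *\<^sub>R z)))"
    by (rule translation_kernel_integrable) (auto intro: dir_comp_integrable G)
  have K2: "integrable (unit_measure \<Otimes>\<^sub>M lborel) (\<lambda>(s, x). (norm (G (x + s *\<^sub>R z)))\<^sup>2)"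
    by (rule translation_kernel_integrable[where f="\<lambda>x. (norm (G x))\<^sup>2"]) (use G2 in auto)
  define c where "c = (LBINT x. (norm (G x))\<^sup>2)"
  have AE0: "AE x in lborel. x \<in> U \<longrightarrow> f (x + z) - f x = (LINT s|unit_measure. dir_comp z (G (x + s *\<^sub>R z)))"
    by (rule translation_AE[where \<Omega>=\<Omega>]) (use f G wg U in auto)
  have AE1: "AE x in lborel. integrable unit_measure (\<lambda>s. dir_comp z (G (x + s *\<^sub>R z)))"
    using P.AE_integrable_snd[OF K] by simp
  have AE2: "AE x in lborel. integrable unit_measure (\<lambda>s. (norm (G (x + s *\<^sub>R z)))\<^sup>2)"
    using P.AE_integrable_snd[OF K2] by simp
  have "(\<integral>\<^sup>+x. ennreal ((norm (f (x + z) - f x))\<^sup>2) * indicator U x \<partial>lborel)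
      \<le> (\<integral>\<^sup>+x. ennreal ((norm z)\<^sup>2 * (LINT s|unit_measure. (norm (G (x + s *\<^sub>R z)))\<^sup>2)) \<partial>lborel)"
  proof (rule nn_integral_mono_AE)
    show "AE x in lborel. ennreal ((norm (f (x + z) - f x))\<^sup>2) * indicator U x 
        \<le> ennreal ((norm z)\<^sup>2 * (LINT s|unit_measure. (norm (G (x + s *\<^sub>R z)))\<^sup>2))"
      using AE0 AE1 AE2
    proof eventually_elim
      case (elim x)
      show ?case
      proof (cases "x \<in> U")
        case True
        have le: "(norm (dir_comp z (G (x + s *\<^sub>R z))))\<^sup>2 \<le> (norm z)\<^sup>2 * (norm (G (x + s *\<^sub>R z)))\<^sup>2" for s
          using power_mono[OF norm_dir_comp_le, of z _ 2] by (simp add: power_mult_distrib)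
        have int: "integrable unit_measure (\<lambda>s. (norm (dir_comp z (G (x + s *\<^sub>R z))))\<^sup>2)"
        proof (rule Bochner_Integration.integrable_bound)
          show "integrable unit_measure (\<lambda>s. (norm z)\<^sup>2 * (norm (G (x + s *\<^sub>R z)))\<^sup>2)" using elim(3) by simp
          show "(\<lambda>s. (norm (dir_comp z (G (x + s *\<^sub>R z))))\<^sup>2) \<in> borel_measurable unit_measure"
            using borel_measurable_integrable[OF elim(2)] by measurable
          show "AE s in unit_measure. norm ((norm (dir_comp z (G (x + s *\<^sub>R z))))\<^sup>2) \<le> norm ((norm z)\<^sup>2 * (norm (G (x + s *\<^sub>R z)))\<^sup>2)"
            using le by simp
        qed
        have "(norm (f (x + z) - f x))\<^sup>2 \<le> (LINT s|unit_measure. (norm (dir_comp z (G (x + s *\<^sub>R z))))\<^sup>2)"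
          using norm_integral_power2_le[OF finite_measure_unit_interval _ elim(2) int] elim(1) True
          by (simp add: measure_unit_interval)
        also have "\<dots> \<le> (LINT s|unit_measure. (norm z)\<^sup>2 * (norm (G (x + s *\<^sub>R z)))\<^sup>2)"
          by (intro integral_mono int integrable_mult_right elim le)
        finally show ?thesis using True by (simp add: ennreal_leI)
      qed simp
    qed
  qed
  also have "\<dots> = ennreal (LBINT x. (norm z)\<^sup>2 * (LINT s|unit_measure. (norm (G (x + s *\<^sub>R z)))\<^sup>2))"
    using P.integrable_snd[OF K2] by (intro nn_integral_eq_integral) (auto intro!: AE_I2 mult_nonneg_nonneg integral_nonneg_AE)
  also have "(LBINT x. (norm z)\<^sup>2 * (LINT s|unit_measure. (norm (G (x + s *\<^sub>R z)))\<^sup>2))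
     = (norm z)\<^sup>2 * (LINT s|unit_measure. LINT x|lborel. (norm (G (x + s *\<^sub>R z)))\<^sup>2)"
    using P.Fubini_integral[OF K2] by simp
  also have "\<dots> = (norm z)\<^sup>2 * c"
    using integral_lborel_translate(1)[of "\<lambda>x. (norm (G x))\<^sup>2"] by (simp add: c_def measure_unit_interval)
  finally show ?thesis by (simp add: c_def)
qed

section \<open>An interpolation inequality on Lipschitz domains\<close>

text \<open>Borel versions of f and of its gradient, extended by zero, together with the integrals
  that the estimates use. The pair satisfies the weak identity for test functions inside the domain;
  on the whole space this requires a zero trace.\<close>

definition H1_representative ::
  "(real^'n) set \<Rightarrow> (real^'n \<Rightarrow> 'b::euclidean_space) \<Rightarrow> (real^'n \<Rightarrow> 'b^'n) \<Rightarrow> (real^'n \<Rightarrow> 'b) \<Rightarrow> (real^'n \<Rightarrow> 'b^'n) \<Rightarrow> bool" where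
  "H1_representative \<Omega> f G F D \<longleftrightarrow>
     F \<in> borel_measurable borel \<and> D \<in> borel_measurable borel \<and>
     (\<forall>x. x \<notin> \<Omega> \<longrightarrow> F x = 0) \<and> (\<forall>x. x \<notin> \<Omega> \<longrightarrow> D x = 0) \<and>
     (AE x in lebesgue_on \<Omega>. F x = f x) \<and> (AE x in lebesgue_on \<Omega>. D x = G x) \<and>
     integrable lborel F \<and> integrable lborel D \<and>
     integrable lborel (\<lambda>x. (norm (F x))\<^sup>2) \<and> integrable lborel (\<lambda>x. (norm (D x))\<^sup>2) \<and>
     (LBINT x. (norm (F x))\<^sup>2) = (L2_norm \<Omega> f)\<^sup>2 \<and> (LBINT x. (norm (D x))\<^sup>2) = (L2_norm \<Omega> G)\<^sup>2 \<and>
     (LBINT x. norm (F x)) = (LINT x|lebesgue_on \<Omega>. norm (f x))"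

lemma H1_representative_exists:
  fixes f :: "real^'n \<Rightarrow> 'b::euclidean_space"
  assumes \<Omega>: "open \<Omega>" "bounded \<Omega>" and f: "f \<in> L2 \<Omega>" and G: "G \<in> L2 \<Omega>"
  obtains F D where "H1_representative \<Omega> f G F D"
proof -
  have \<Omega>b: "\<Omega> \<in> sets borel" using \<Omega> by simp
  \<comment> \<open>A single transfer statement serves values, norms and squared norms; the
    condition at 0 makes the transformed integrand vanish off the domain.\<close>
  have transfer: "integrable lborel (\<lambda>x. h x (K x)) \<and> (LBINT x. h x (K x)) = (LINT x|lebesgue_on \<Omega>. h x (k x))"
    if "(\<lambda>x. h x (K x)) \<in> borel_measurable borel" "integrable (lebesgue_on \<Omega>) (\<lambda>x. h x (k x))" "\<And>x. h x 0 = 0"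
      "AE x in lebesgue_on \<Omega>. K x = k x" "\<And>x. x \<notin> \<Omega> \<Longrightarrow> K x = 0"
    for h :: "real^'n \<Rightarrow> 'c::euclidean_space \<Rightarrow> 'd::euclidean_space" and K k
  proof -
    have m: "(\<lambda>x. h x (K x)) \<in> borel_measurable (lebesgue_on \<Omega>)"
      using that(1) by (intro measurable_restrict_space1 measurable_completion) simp
    have ae: "AE x in lebesgue_on \<Omega>. h x (K x) = h x (k x)" using that(4) by eventually_elim simp
    note L = lebesgue_on_lborel[OF \<Omega>b that(1)]
    show ?thesis using that(2,3,5) L integrable_cong_AE[OF m _ ae] integral_cong_AE[OF m _ ae] borel_measurable_integrable[OF that(2)]
      by simp
  qed
  note int = L2_integrable[OF \<Omega>b \<Omega>(2)]
  obtain F where F: "F \<in> borel_measurable borel" "AE x in lebesgue_on \<Omega>. F x = f x" "\<And>x. x \<notin> \<Omega> \<Longrightarrow> F x = 0"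
    using borel_representative[OF \<Omega>b L2_measurable[OF f]] by metis
  obtain D where D: "D \<in> borel_measurable borel" "AE x in lebesgue_on \<Omega>. D x = G x" "\<And>x. x \<notin> \<Omega> \<Longrightarrow> D x = 0"
    using borel_representative[OF \<Omega>b L2_measurable[OF G]] by metis
  note [measurable] = F(1) D(1)
  have F': "integrable lborel F \<and> (LBINT x. norm (F x)) = (LINT x|lebesgue_on \<Omega>. norm (f x))"
    using transfer[of "\<lambda>x y. y" F f] transfer[of "\<lambda>x y. norm y" F f] F int[OF f] by simp
  have D': "integrable lborel D" using transfer[of "\<lambda>x y. y" D G] D int[OF G] by simp
  have F2: "integrable lborel (\<lambda>x. (norm (F x))\<^sup>2) \<and> (LBINT x. (norm (F x))\<^sup>2) = (L2_norm \<Omega> f)\<^sup>2"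
    using transfer[of "\<lambda>x y. (norm y)\<^sup>2" F f] F f by (simp add: L2_norm_power2 L2_integrable_square)
  have D2: "integrable lborel (\<lambda>x. (norm (D x))\<^sup>2) \<and> (LBINT x. (norm (D x))\<^sup>2) = (L2_norm \<Omega> G)\<^sup>2"
    using transfer[of "\<lambda>x y. (norm y)\<^sup>2" D G] D G by (simp add: L2_norm_power2 L2_integrable_square)
  show ?thesis
    by (rule that[of F D]) (use F D F' D' F2 D2 in \<open>simp add: H1_representative_def\<close>)
qed

lemma integral_AE_lborel:
  fixes h :: "real^'n \<Rightarrow> 'c::euclidean_space"
  assumes \<Omega>: "open \<Omega>" and k: "integrable (lebesgue_on \<Omega>) k"
    and h: "h \<in> borel_measurable borel" "AE x in lebesgue_on \<Omega>. h x = k x" "\<And>x. x \<notin> \<Omega> \<Longrightarrow> h x = 0"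
  shows "(LBINT x. h x) = (LINT x|lebesgue_on \<Omega>. k x)"
proof -
  have "h \<in> borel_measurable (lebesgue_on \<Omega>)"
    using h(1) by (intro measurable_restrict_space1 measurable_completion) simp
  then show ?thesis using lebesgue_on_lborel(2)[OF borel_open[OF \<Omega>] h(1,3)]
      integral_cong_AE[OF _ borel_measurable_integrable[OF k] h(2)] by simp
qed

lemma weak_gradient_representative:
  fixes f :: "real^'n \<Rightarrow> 'b::euclidean_space"
  assumes \<Omega>: "open \<Omega>" "bounded \<Omega>" and f: "f \<in> L2 \<Omega>" and G: "G \<in> L2 \<Omega>" and wg: "weak_gradient \<Omega> f G"
    and R: "H1_representative \<Omega> f G F D" and \<phi>: "test_function \<Omega> \<phi>"
  shows "(LBINT x. partial i \<phi> x *\<^sub>R F x) = - (LBINT x. \<phi> x *\<^sub>R D x $ i)"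
proof -
  note int = L2_integrable[OF borel_open[OF \<Omega>(1)] \<Omega>(2)]
  note R = R[unfolded H1_representative_def]
  have [measurable]: "F \<in> borel_measurable borel" "D \<in> borel_measurable borel" using R by auto
  note [measurable] = test_function_measurable(1)[OF \<phi>] test_function_partial_measurable(1)[OF \<phi>]
  have "(LBINT x. partial i \<phi> x *\<^sub>R F x) = (LINT x|lebesgue_on \<Omega>. partial i \<phi> x *\<^sub>R f x)"
  proof (rule integral_AE_lborel[OF \<Omega>(1) test_function_integrable(2)[OF \<phi> int[OF f]]])
    show "AE x in lebesgue_on \<Omega>. partial i \<phi> x *\<^sub>R F x = partial i \<phi> x *\<^sub>R f x"
      using R by (auto elim: eventually_mono)
  qed (use R in auto)
  also have "\<dots> = - (LINT x|lebesgue_on \<Omega>. \<phi> x *\<^sub>R G x $ i)" using wg \<phi> by (simp add: weak_gradient_def)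
  also have "(LINT x|lebesgue_on \<Omega>. \<phi> x *\<^sub>R G x $ i) = (LBINT x. \<phi> x *\<^sub>R D x $ i)"
  proof (rule integral_AE_lborel[OF \<Omega>(1) test_function_integrable(1)[OF \<phi> integrable_vec_nth[OF int[OF G]]], symmetric])
    have "AE x in lebesgue_on \<Omega>. D x = G x" using R by auto
    then show "AE x in lebesgue_on \<Omega>. \<phi> x *\<^sub>R D x $ i = \<phi> x *\<^sub>R G x $ i" by eventually_elim simp
  qed (use R in auto)
  finally show ?thesis .
qed

text \<open>Averaging |F(x)| \<le> |F(x+z) - F(x)| + |F(x+z)| over directions z in Z bounds the
  first part by the gradient times the length \<rho> of the directions, and the second by the L1
  norm divided by the volume of Z. Short directions make the gradient part small while the L1
  constant grows.\<close>

lemma local_interpolation: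
  fixes F :: "real^'n \<Rightarrow> 'b::euclidean_space" and D :: "real^'n \<Rightarrow> 'b^'n"
  assumes [measurable]: "F \<in> borel_measurable borel" "D \<in> borel_measurable borel"
    and F: "integrable lborel F" and D: "integrable lborel D"
    and F2: "integrable lborel (\<lambda>x. (norm (F x))\<^sup>2)" and D2: "integrable lborel (\<lambda>x. (norm (D x))\<^sup>2)"
    and wg: "\<And>\<phi> i. test_function \<Omega> \<phi> \<Longrightarrow>
      (LBINT x. partial i \<phi> x *\<^sub>R F x) = - (LBINT x. \<phi> x *\<^sub>R D x $ i)"
    and U: "open U" "bounded U" "\<And>x s z. x \<in> U \<Longrightarrow> z \<in> Z \<Longrightarrow> 0 \<le> s \<Longrightarrow> s \<le> 1 \<Longrightarrow> x + s *\<^sub>R z \<in> \<Omega>"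
    and Z: "Z \<in> sets borel" "bounded Z" "0 < measure lborel Z" "\<And>z. z \<in> Z \<Longrightarrow> norm z \<le> \<rho>"
  shows "(LBINT x. indicator U x * (norm (F x))\<^sup>2) \<le> 2 * \<rho>\<^sup>2 * (LBINT x. (norm (D x))\<^sup>2)
     + 2 * measure lborel U / (measure lborel Z)\<^sup>2 * (LBINT x. norm (F x))\<^sup>2"
proof -
  let ?m = "measure lborel Z"
  define M where "M = restrict_space lborel Z"
  define N1 where "N1 = (LBINT x. norm (F x))"
  define N2 where "N2 = (LBINT x. (norm (D x))\<^sup>2)"
  note Z(1)[measurable]
  have [measurable]: "U \<in> sets borel" using U by simp
  have finZ: "emeasure lborel Z < \<infinity>" using emeasure_bounded_finite[OF Z(2)] by simp
  have finU: "emeasure lborel U < \<infinity>" using emeasure_bounded_finite[OF U(2)] by simp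
  have M: "finite_measure M" "measure M (space M) = ?m"
    unfolding M_def using finZ
    by (auto intro!: finite_measureI simp: space_restrict_space emeasure_restrict_space measure_restrict_space)
  interpret M: finite_measure M by fact
  have N: "0 \<le> N1" "0 \<le> N2" unfolding N1_def N2_def by (auto intro!: integral_nonneg_AE)
  have M_int: "integrable M g \<longleftrightarrow> integrable lborel (\<lambda>x. indicator Z x *\<^sub>R g x)"
     "(LINT z|M. g z) = (LBINT x. indicator Z x *\<^sub>R g x)" for g :: "real^'n \<Rightarrow> real"
    unfolding M_def by (auto simp: integrable_restrict_space integral_restrict_space)
  have M_nn: "(\<integral>\<^sup>+z. g z \<partial>M) = (\<integral>\<^sup>+z. g z * indicator Z z \<partial>lborel)" for g
    unfolding M_def by (simp add: nn_integral_restrict_space)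
  have M_meas: "g \<in> borel_measurable borel \<Longrightarrow> g \<in> borel_measurable M" for g :: "real^'n \<Rightarrow> real"
    unfolding M_def by (intro measurable_restrict_space1) simp
  have intM: "integrable M g" if "integrable lborel g" for g :: "real^'n \<Rightarrow> real"
    unfolding M_int using that integrable_mult_indicator[of Z lborel g] by simp
  \<comment> \<open>The pointwise form: average over Z, square, and apply Jensen's inequality to the
    increment only. The L1 part is already a number independent of x.\<close>
  have point: "(norm (F x))\<^sup>2 \<le> 2 / ?m * (LINT z|M. (norm (F (z + x) - F x))\<^sup>2) + 2 / ?m\<^sup>2 * N1\<^sup>2"
    and intM2: "integrable M (\<lambda>z. (norm (F (z + x) - F x))\<^sup>2)" for x
  proof -
    have i1: "integrable M (\<lambda>z. norm (F (z + x)))"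
      using F integral_lborel_translate(2)[of "\<lambda>x. norm (F x)" x] by (intro intM) auto
    have i2: "integrable M (\<lambda>z. (norm (F (z + x)))\<^sup>2)"
      using F2 integral_lborel_translate(2)[of "\<lambda>x. (norm (F x))\<^sup>2" x] by (intro intM) auto
    show i3: "integrable M (\<lambda>z. (norm (F (z + x) - F x))\<^sup>2)"
    proof (rule Bochner_Integration.integrable_bound)
      show "integrable M (\<lambda>z. 2 * (norm (F (z + x)))\<^sup>2 + 2 * (norm (F x))\<^sup>2)" using i2 by simp
      show "(\<lambda>z. (norm (F (z + x) - F x))\<^sup>2) \<in> borel_measurable M" by (rule M_meas) measurable
      show "AE z in M. norm ((norm (F (z + x) - F x))\<^sup>2) \<le> norm (2 * (norm (F (z + x)))\<^sup>2 + 2 * (norm (F x))\<^sup>2)"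
        using power2_norm_add_le[of "F (_ + x)" "- F x"] by (intro AE_I2) simp
    qed
    have i4: "integrable M (\<lambda>z. norm (F (z + x) - F x))"
    proof (rule Bochner_Integration.integrable_bound)
      show "integrable M (\<lambda>z. norm (F (z + x)) + norm (F x))" using i1 by simp
      show "(\<lambda>z. norm (F (z + x) - F x)) \<in> borel_measurable M" by (rule M_meas) measurable
      show "AE z in M. norm (norm (F (z + x) - F x)) \<le> norm (norm (F (z + x)) + norm (F x))"
        by (intro AE_I2) (simp add: norm_triangle_ineq4)
    qed
    have "?m * norm (F x) = (LINT z|M. norm (F x))" by (simp add: M)
    also have "\<dots> \<le> (LINT z|M. norm (F (z + x) - F x) + norm (F (z + x)))"
    proof (rule integral_mono)
      show "norm (F x) \<le> norm (F (z + x) - F x) + norm (F (z + x))" for z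
        using norm_triangle_sub[of "F x" "F (z + x)"] by (simp add: norm_minus_commute)
    qed (use i1 i4 in auto)
    also have "\<dots> = (LINT z|M. norm (F (z + x) - F x)) + (LINT z|M. norm (F (z + x)))"
      using i1 i4 by simp
    also have "(LINT z|M. norm (F (z + x))) \<le> (LBINT z. norm (F (z + x)))"
      unfolding M_int using F integral_lborel_translate(2)[of "\<lambda>x. norm (F x)" x] integrable_mult_indicator[of Z lborel "\<lambda>z. norm (F (z + x))"]
      by (intro integral_mono) (auto simp: indicator_def)
    also have "\<dots> = N1" using integral_lborel_translate(1)[of "\<lambda>x. norm (F x)" x] by (simp add: N1_def)
    finally have le: "?m * norm (F x) \<le> (LINT z|M. norm (F (z + x) - F x)) + N1" by simp
    have "?m\<^sup>2 * (norm (F x))\<^sup>2 \<le> ((LINT z|M. norm (F (z + x) - F x)) + N1)\<^sup>2"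
      using power_mono[OF le, of 2] Z(3) by (simp add: power_mult_distrib)
    also have "\<dots> \<le> 2 * (LINT z|M. norm (F (z + x) - F x))\<^sup>2 + 2 * N1\<^sup>2"
      using power2_norm_add_le[of "(LINT z|M. norm (F (z + x) - F x))" N1] by simp
    also have "(LINT z|M. norm (F (z + x) - F x))\<^sup>2 \<le> ?m * (LINT z|M. (norm (F (z + x) - F x))\<^sup>2)"
      using norm_integral_power2_le[OF M(1) _ i4] i3 Z(3) by (simp add: M)
    finally have "?m\<^sup>2 * (norm (F x))\<^sup>2 \<le> 2 * (?m * (LINT z|M. (norm (F (z + x) - F x))\<^sup>2)) + 2 * N1\<^sup>2" by simp
    then have "(norm (F x))\<^sup>2 \<le> (2 * (?m * (LINT z|M. (norm (F (z + x) - F x))\<^sup>2)) + 2 * N1\<^sup>2) / ?m\<^sup>2"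
      using Z(3) by (simp add: pos_le_divide_eq mult.commute)
    also have "\<dots> = 2 / ?m * (LINT z|M. (norm (F (z + x) - F x))\<^sup>2) + 2 / ?m\<^sup>2 * N1\<^sup>2"
      using Z(3) by (simp add: power2_eq_square add_divide_distrib)
    finally show "(norm (F x))\<^sup>2 \<le> 2 / ?m * (LINT z|M. (norm (F (z + x) - F x))\<^sup>2) + 2 / ?m\<^sup>2 * N1\<^sup>2" .
  qed
  have "(\<integral>\<^sup>+x. ennreal ((norm (F x))\<^sup>2) * indicator U x \<partial>lborel)
     \<le> (\<integral>\<^sup>+x. ennreal (2 / ?m) * ((\<integral>\<^sup>+z. ennreal ((norm (F (x + z) - F x))\<^sup>2) * indicator U x * indicator Z z \<partial>lborel)) + ennreal (2 / ?m\<^sup>2 * N1\<^sup>2) * indicator U x \<partial>lborel)"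
  proof (rule nn_integral_mono)
    fix x
    show "ennreal ((norm (F x))\<^sup>2) * indicator U x \<le> ennreal (2 / ?m) * ((\<integral>\<^sup>+z. ennreal ((norm (F (x + z) - F x))\<^sup>2) * indicator U x * indicator Z z \<partial>lborel)) + ennreal (2 / ?m\<^sup>2 * N1\<^sup>2) * indicator U x"
    proof (cases "x \<in> U")
      case True
      have "(\<integral>\<^sup>+z. ennreal ((norm (F (x + z) - F x))\<^sup>2) * indicator Z z \<partial>lborel) = ennreal (LINT z|M. (norm (F (z + x) - F x))\<^sup>2)"
        unfolding M_nn[symmetric] using nn_integral_eq_integral[OF intM2[of x]] by (simp add: add.commute[of x])
      moreover have "ennreal ((norm (F x))\<^sup>2) \<le> ennreal (2 / ?m) * ennreal (LINT z|M. (norm (F (z + x) - F x))\<^sup>2) + ennreal (2 / ?m\<^sup>2 * N1\<^sup>2)"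
      proof -
        have split: "ennreal (a * l + b) = ennreal a * ennreal l + ennreal b" if "0 \<le> a" "0 \<le> l" "0 \<le> b" for a l b :: real
          using that by (simp add: ennreal_mult)
        show ?thesis using Z(3)
          by (subst split[symmetric]) (use ennreal_leI[OF point[of x]] in \<open>auto intro!: integral_nonneg_AE\<close>)
      qed
      ultimately show ?thesis using True by simp
    qed simp
  qed
  also have "\<dots> = ennreal (2 / ?m) * (\<integral>\<^sup>+x. (\<integral>\<^sup>+z. ennreal ((norm (F (x + z) - F x))\<^sup>2) * indicator U x * indicator Z z \<partial>lborel) \<partial>lborel)
      + ennreal (2 / ?m\<^sup>2 * N1\<^sup>2) * emeasure lborel U"
    by (subst nn_integral_add) (auto simp: nn_integral_cmult nn_integral_cmult_indicator)
  \<comment> \<open>With the order exchanged the inner integral has a fixed direction z, which is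
    the setting of the translation estimate.\<close>
  also have "(\<integral>\<^sup>+x. (\<integral>\<^sup>+z. ennreal ((norm (F (x + z) - F x))\<^sup>2) * indicator U x * indicator Z z \<partial>lborel) \<partial>lborel)
     = (\<integral>\<^sup>+z. (\<integral>\<^sup>+x. ennreal ((norm (F (x + z) - F x))\<^sup>2) * indicator U x * indicator Z z \<partial>lborel) \<partial>lborel)"
    by (rule lborel_pair.Fubini') measurable
  also have "\<dots> \<le> (\<integral>\<^sup>+z. ennreal (\<rho>\<^sup>2 * N2) * indicator Z z \<partial>lborel)"
  proof (rule nn_integral_mono)
    fix z
    show "(\<integral>\<^sup>+x. ennreal ((norm (F (x + z) - F x))\<^sup>2) * indicator U x * indicator Z z \<partial>lborel) \<le> ennreal (\<rho>\<^sup>2 * N2) * indicator Z z"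
    proof (cases "z \<in> Z")
      case True
      have "(\<integral>\<^sup>+x. ennreal ((norm (F (x + z) - F x))\<^sup>2) * indicator U x \<partial>lborel) \<le> ennreal ((norm z)\<^sup>2 * N2)"
        unfolding N2_def by (rule translation_L2_le[where \<Omega>=\<Omega>]) (use F D D2 wg U True in auto)
      also have "\<dots> \<le> ennreal (\<rho>\<^sup>2 * N2)"
        using Z(4)[OF True] N by (intro ennreal_leI mult_right_mono power_mono) auto
      finally show ?thesis using True by simp
    qed simp
  qed
  also have "\<dots> = ennreal (\<rho>\<^sup>2 * N2) * emeasure lborel Z" by (simp add: nn_integral_cmult_indicator)
  also have "emeasure lborel Z = ennreal ?m" using finZ by (simp add: emeasure_eq_ennreal_measure)
  also have "emeasure lborel U = ennreal (measure lborel U)" using finU by (simp add: emeasure_eq_ennreal_measure)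
  also have "ennreal (2 / ?m) * (ennreal (\<rho>\<^sup>2 * N2) * ennreal ?m) + ennreal (2 / ?m\<^sup>2 * N1\<^sup>2) * ennreal (measure lborel U)
     = ennreal (2 * \<rho>\<^sup>2 * N2 + 2 * measure lborel U / ?m\<^sup>2 * N1\<^sup>2)"
    using Z(3) N by (simp add: ennreal_mult[symmetric] ennreal_plus[symmetric] del: ennreal_plus)
  finally have "(\<integral>\<^sup>+x. ennreal ((norm (F x))\<^sup>2) * indicator U x \<partial>lborel) \<le> ennreal (2 * \<rho>\<^sup>2 * N2 + 2 * measure lborel U / ?m\<^sup>2 * N1\<^sup>2)"
    by (simp add: mult_left_mono add_right_mono)
  moreover have "(\<integral>\<^sup>+x. ennreal ((norm (F x))\<^sup>2) * indicator U x \<partial>lborel) = ennreal (LBINT x. indicator U x * (norm (F x))\<^sup>2)"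
    using integrable_mult_indicator[of U lborel "\<lambda>x. (norm (F x))\<^sup>2"] F2
    by (subst nn_integral_eq_integral[symmetric]) (auto intro!: nn_integral_cong simp: indicator_def)
  ultimately have "ennreal (LBINT x. indicator U x * (norm (F x))\<^sup>2) \<le> ennreal (2 * \<rho>\<^sup>2 * N2 + 2 * measure lborel U / ?m\<^sup>2 * N1\<^sup>2)" by simp
  moreover have "0 \<le> 2 * \<rho>\<^sup>2 * N2 + 2 * measure lborel U / ?m\<^sup>2 * N1\<^sup>2" using N by simp
  ultimately show ?thesis unfolding N1_def[symmetric] N2_def[symmetric] by (simp only: ennreal_le_iff)
qed

section \<open>Inner cones and the interpolation inequality\<close>

text \<open>The uniform inner cone property, with the cone cut into balls of radius
  \<open>c * \<tau>\<close> around \<open>\<tau> *\<^sub>R \<nu>\<close>. Neither the opening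
  \<open>c\<close> nor the neighbourhood depends on \<tau>, so \<tau> may later be chosen according
  to the wanted smallness.\<close>

lemma lipschitz_domain_interior_cone:
  fixes \<Omega> :: "'a::euclidean_space set"
  assumes "open \<Omega>" "lipschitz_boundary \<Omega>" "x0 \<in> closure \<Omega>"
  obtains r \<tau>0 c \<nu> where "0 < r" "0 < \<tau>0" "0 < c" "c \<le> 1" "norm \<nu> = 1"
    "\<And>\<tau> x z s. 0 < \<tau> \<Longrightarrow> \<tau> \<le> \<tau>0 \<Longrightarrow> x \<in> \<Omega> \<Longrightarrow> x \<in> ball x0 r \<Longrightarrow> z \<in> ball (\<tau> *\<^sub>R \<nu>) (c * \<tau>) \<Longrightarrow> 0 \<le> s \<Longrightarrow> s \<le> 1 \<Longrightarrow> x + s *\<^sub>R z \<in> \<Omega>"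
proof (cases "x0 \<in> \<Omega>")
  case True
  then obtain r where r: "r > 0" "ball x0 r \<subseteq> \<Omega>" using assms(1) open_contains_ball by blast
  obtain \<nu> :: 'a where \<nu>: "norm \<nu> = 1" using vector_choose_size[of 1] by auto
  show ?thesis
  proof (rule that[of "r/2" "r/4" 1 \<nu>])
    fix \<tau> s :: real and x z assume H: "0 < \<tau>" "\<tau> \<le> r / 4" "x \<in> ball x0 (r / 2)" "z \<in> ball (\<tau> *\<^sub>R \<nu>) (1 * \<tau>)" "0 \<le> s" "s \<le> 1"
    have "norm z \<le> norm (\<tau> *\<^sub>R \<nu>) + norm (z - \<tau> *\<^sub>R \<nu>)" by (rule norm_triangle_sub)
    moreover have "norm (z - \<tau> *\<^sub>R \<nu>) < \<tau>" using H by (simp add: dist_norm norm_minus_commute)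
    ultimately have "norm z < r / 2" using H \<nu> by simp
    moreover have "norm (s *\<^sub>R z) \<le> norm z" using H by (simp add: mult_left_le_one_le)
    moreover have "norm (x0 - (x + s *\<^sub>R z)) \<le> norm (x0 - x) + norm (s *\<^sub>R z)"
      using norm_triangle_ineq4[of "x0 - x" "s *\<^sub>R z"] by (simp add: algebra_simps)
    ultimately have "norm (x0 - (x + s *\<^sub>R z)) < r" using H by (simp add: dist_norm)
    then show "x + s *\<^sub>R z \<in> \<Omega>" using r by (auto simp: dist_norm)
  qed (use r \<nu> in auto)
next
  case False
  then have "x0 \<in> frontier \<Omega>" using assms by (simp add: frontier_def interior_open)
  then obtain r \<nu> h L where r: "r > 0" "norm \<nu> = 1" and L: "L-lipschitz_on {y. y \<bullet> \<nu> = 0} (h :: 'a \<Rightarrow> real)"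
    and eq: "\<Omega> \<inter> ball x0 r = {y \<in> ball x0 r. h (y - (y \<bullet> \<nu>) *\<^sub>R \<nu>) < y \<bullet> \<nu>}"
    using assms(2) unfolding lipschitz_boundary_def by blast
  have L0: "L \<ge> 0" using L by (rule lipschitz_on_nonneg)
  have \<nu>\<nu>: "\<nu> \<bullet> \<nu> = 1" using r(2) by (simp add: dot_square_norm)
  \<comment> \<open>Moving by s z raises the height above the hyperplane by at least s (\<tau> - c
    \<tau>), while the graph rises by at most L s c \<tau>. For c = 1/(1+L) these bounds coincide,
    and strictness is inherited from the starting point, which lies strictly above the
    graph.\<close>
  let ?c = "1 / (1 + L)"
  show ?thesis
  proof (rule that[of "r/2" "r/4" ?c \<nu>])
    fix \<tau> s :: real and x z assume H: "0 < \<tau>" "\<tau> \<le> r / 4" "x \<in> \<Omega>" "x \<in> ball x0 (r / 2)" "z \<in> ball (\<tau> *\<^sub>R \<nu>) (?c * \<tau>)" "0 \<le> s" "s \<le> 1"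
    define y where "y = x + s *\<^sub>R z"
    define \<zeta> where "\<zeta> = z - \<tau> *\<^sub>R \<nu>"
    have zeta: "norm \<zeta> < ?c * \<tau>" using H by (simp add: \<zeta>_def dist_norm norm_minus_commute)
    have "?c * \<tau> \<le> \<tau>" using L0 H by (simp add: field_simps)
    have z: "z = \<tau> *\<^sub>R \<nu> + \<zeta>" by (simp add: \<zeta>_def)
    have "norm z \<le> norm (\<tau> *\<^sub>R \<nu>) + norm \<zeta>" unfolding z by (rule norm_triangle_ineq)
    then have "norm z < r / 2" using H r zeta \<open>?c * \<tau> \<le> \<tau>\<close> by simp
    moreover have "norm (s *\<^sub>R z) \<le> norm z" using H by (simp add: mult_left_le_one_le)
    moreover have "norm (x0 - y) \<le> norm (x0 - x) + norm (s *\<^sub>R z)"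
      unfolding y_def using norm_triangle_ineq4[of "x0 - x" "s *\<^sub>R z"] by (simp add: algebra_simps)
    ultimately have yr: "y \<in> ball x0 r" using H by (simp add: dist_norm)
    define P where "P v = v - (v \<bullet> \<nu>) *\<^sub>R \<nu>" for v
    have P0: "P v \<in> {y. y \<bullet> \<nu> = 0}" for v by (simp add: P_def inner_diff_left \<nu>\<nu>)
    have normP: "norm (P v) \<le> norm v" for v
    proof -
      have "(norm (P v))\<^sup>2 = (norm v)\<^sup>2 - (v \<bullet> \<nu>)\<^sup>2"
        unfolding power2_norm_eq_inner P_def
        by (simp add: inner_diff_left inner_diff_right \<nu>\<nu> inner_commute power2_eq_square)
      then have "(norm (P v))\<^sup>2 \<le> (norm v)\<^sup>2" by simp
      then show ?thesis by (rule power2_le_imp_le) simp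
    qed
    have Py: "P y - P x = s *\<^sub>R P \<zeta>"
      by (simp add: P_def y_def z inner_add_left \<nu>\<nu> algebra_simps)
    have "\<bar>h (P y) - h (P x)\<bar> \<le> L * norm (P y - P x)"
      using lipschitz_onD[OF L P0 P0] by (simp add: dist_norm)
    also have "\<dots> \<le> L * (s * (?c * \<tau>))"
    proof -
      have "s * norm (P \<zeta>) \<le> s * (?c * \<tau>)" using H zeta normP[of \<zeta>] by (intro mult_left_mono) linarith+
      then show ?thesis unfolding Py using H L0 by (intro mult_left_mono) simp_all
    qed
    finally have 1: "h (P y) \<le> h (P x) + L * (s * (?c * \<tau>))" by linarith
    have "x \<in> \<Omega> \<inter> ball x0 r" using H r by auto
    then have 2: "h (P x) < x \<bullet> \<nu>" unfolding eq P_def by simp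
    have "\<bar>\<zeta> \<bullet> \<nu>\<bar> \<le> ?c * \<tau>" using Cauchy_Schwarz_ineq2[of \<zeta> \<nu>] r zeta by simp
    then have "y \<bullet> \<nu> \<ge> x \<bullet> \<nu> + s * (\<tau> - ?c * \<tau>)"
    proof -
      have "s * (\<zeta> \<bullet> \<nu>) \<ge> s * (- (?c * \<tau>))"
        using H \<open>\<bar>\<zeta> \<bullet> \<nu>\<bar> \<le> ?c * \<tau>\<close> by (intro mult_left_mono) auto
      then show ?thesis by (simp add: y_def z inner_add_left \<nu>\<nu> algebra_simps)
    qed
    moreover have "L * (s * (?c * \<tau>)) = s * (\<tau> - ?c * \<tau>)" using L0 by (simp add: field_simps)
    ultimately have "h (P y) < y \<bullet> \<nu>" using 1 2 by linarith
    then have "y \<in> \<Omega> \<inter> ball x0 r" unfolding eq using yr by (simp add: P_def)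
    then show "x + s *\<^sub>R z \<in> \<Omega>" by (simp add: y_def)
  qed (use r L0 in auto)
qed

text \<open>An inequality of Ehrling type, proved by translations along inner cones instead of
  compact embedding. The length of the translations fixes \<epsilon>, and a finite cover of the
  closure makes the cones uniform.\<close>

lemma lipschitz_domain_interpolation:
  fixes \<Omega> :: "(real^'n) set"
  assumes \<Omega>: "open \<Omega>" "bounded \<Omega>" "lipschitz_boundary \<Omega>" and \<epsilon>: "0 < \<epsilon>"
  obtains C where "0 \<le> C" "\<And>f :: real^'n \<Rightarrow> 'b::euclidean_space. f \<in> H1 \<Omega> \<Longrightarrow>
     (L2_norm \<Omega> f)\<^sup>2 \<le> \<epsilon> * (L2_norm \<Omega> (wgrad \<Omega> f))\<^sup>2 + C * (LINT x|lebesgue_on \<Omega>. norm (f x))\<^sup>2"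
proof -
  have "\<forall>x\<in>closure \<Omega>. \<exists>r \<tau>0 c \<nu>. 0 < r \<and> 0 < \<tau>0 \<and> 0 < c \<and> c \<le> 1 \<and> norm \<nu> = 1 \<and>
    (\<forall>\<tau> y z s. 0 < \<tau> \<longrightarrow> \<tau> \<le> \<tau>0 \<longrightarrow> y \<in> \<Omega> \<longrightarrow> y \<in> ball x r \<longrightarrow> z \<in> ball (\<tau> *\<^sub>R \<nu>) (c * \<tau>) \<longrightarrow> 0 \<le> s \<longrightarrow> s \<le> 1 \<longrightarrow> y + s *\<^sub>R z \<in> \<Omega>)"
    by (rule ballI, rule lipschitz_domain_interior_cone[OF \<Omega>(1,3)], assumption) blast
  then obtain r \<tau>0 c \<nu> where cone: "\<And>x. x \<in> closure \<Omega> \<Longrightarrow> 0 < r x \<and> 0 < \<tau>0 x \<and> 0 < c x \<and> c x \<le> 1 \<and> norm (\<nu> x) = (1::real)"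
    "\<And>x \<tau> y z s. x \<in> closure \<Omega> \<Longrightarrow> 0 < \<tau> \<Longrightarrow> \<tau> \<le> \<tau>0 x \<Longrightarrow> y \<in> \<Omega> \<Longrightarrow> y \<in> ball x (r x) \<Longrightarrow> z \<in> ball (\<tau> *\<^sub>R \<nu> x) (c x * \<tau>) \<Longrightarrow> 0 \<le> s \<Longrightarrow> s \<le> 1 \<Longrightarrow> y + s *\<^sub>R z \<in> \<Omega>"
    by metis
  have "compact (closure \<Omega>)" using \<Omega> by (simp add: compact_closure)
  moreover have "closure \<Omega> \<subseteq> (\<Union>x\<in>closure \<Omega>. ball x (r x))" using cone(1) by force
  ultimately obtain X where X: "X \<subseteq> closure \<Omega>" "finite X" "closure \<Omega> \<subseteq> (\<Union>x\<in>X. ball x (r x))"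
    by (metis (no_types, lifting) compactE_image open_ball)
  \<comment> \<open>Directions have length at most 2 \<tau>, so each of the \<open>card X\<close>
    pieces contributes 2 (2 \<tau>)^2 = 8 \<tau>^2 times the squared gradient norm. The extra 1
    avoids division by zero for an empty cover.\<close>
  define \<tau> where "\<tau> = Min (insert (sqrt (\<epsilon> / (8 * (1 + card X)))) (\<tau>0 ` X))"
  have \<tau>0: "0 < \<tau>" unfolding \<tau>_def using X \<epsilon> cone(1) by (subst Min_gr_iff) auto
  have \<tau>1: "\<tau> \<le> \<tau>0 x" if "x \<in> X" for x unfolding \<tau>_def using X that by (intro Min_le) auto
  have "\<tau> \<le> sqrt (\<epsilon> / (8 * (1 + card X)))" unfolding \<tau>_def using X by (intro Min_le) auto
  then have "\<tau>\<^sup>2 \<le> (sqrt (\<epsilon> / (8 * (1 + card X))))\<^sup>2" using \<tau>0 by (intro power_mono) auto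
  then have "\<tau>\<^sup>2 \<le> \<epsilon> / (8 * (1 + card X))" using \<epsilon> by simp
  then have \<tau>2: "card X * (8 * \<tau>\<^sup>2) \<le> \<epsilon>" using \<epsilon>
  proof -
    have "card X * (8 * \<tau>\<^sup>2) \<le> (1 + card X) * (8 * \<tau>\<^sup>2)" by (intro mult_right_mono) auto
    also have "\<dots> \<le> \<epsilon>" using \<open>\<tau>\<^sup>2 \<le> \<epsilon> / (8 * (1 + card X))\<close> by (simp add: field_simps)
    finally show ?thesis .
  qed
  define Z where "Z x = ball (\<tau> *\<^sub>R \<nu> x) (c x * \<tau>)" for x
  define U where "U x = \<Omega> \<inter> ball x (r x)" for x
  define C where "C = (\<Sum>x\<in>X. 2 * measure lborel (U x) / (measure lborel (Z x))\<^sup>2)"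
  show ?thesis
  proof (rule that[of C])
    show "0 \<le> C" unfolding C_def by (intro sum_nonneg) auto
    fix f :: "real^'n \<Rightarrow> 'b" assume f: "f \<in> H1 \<Omega>"
    obtain F D where R: "H1_representative \<Omega> f (wgrad \<Omega> f) F D"
      using H1_representative_exists[OF \<Omega>(1,2) H1_L2[OF f] wgrad_L2[OF f]] by metis
    note wg = weak_gradient_representative[OF \<Omega>(1,2) H1_L2[OF f] wgrad_L2[OF f] weak_gradient_wgrad[OF f] R]
    have F: "F \<in> borel_measurable borel" "D \<in> borel_measurable borel" "\<And>x. x \<notin> \<Omega> \<Longrightarrow> F x = 0"
      and FD: "integrable lborel F" "integrable lborel D"
      "integrable lborel (\<lambda>x. (norm (F x))\<^sup>2)" "integrable lborel (\<lambda>x. (norm (D x))\<^sup>2)"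
      and eqs: "(LBINT x. (norm (F x))\<^sup>2) = (L2_norm \<Omega> f)\<^sup>2" "(LBINT x. (norm (D x))\<^sup>2) = (L2_norm \<Omega> (wgrad \<Omega> f))\<^sup>2"
      "(LBINT x. norm (F x)) = (LINT x|lebesgue_on \<Omega>. norm (f x))"
      using R unfolding H1_representative_def by blast+
    have "(L2_norm \<Omega> f)\<^sup>2 = (LBINT x. (norm (F x))\<^sup>2)" using eqs by simp
    also have "\<dots> \<le> (LBINT y. (\<Sum>x\<in>X. indicator (U x) y * (norm (F y))\<^sup>2))"
    proof (rule integral_mono[OF FD(3)])
      show "integrable lborel (\<lambda>y. \<Sum>x\<in>X. indicator (U x) y * (norm (F y))\<^sup>2)"
        using integrable_mult_indicator[OF _ FD(3)] \<Omega> by (intro Bochner_Integration.integrable_sum) (auto simp: U_def)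
      fix y
      show "(norm (F y))\<^sup>2 \<le> (\<Sum>x\<in>X. indicator (U x) y * (norm (F y))\<^sup>2)"
      proof (cases "y \<in> \<Omega>")
        case True
        then obtain x where x: "x \<in> X" "y \<in> U x" using X(3) closure_subset unfolding U_def by blast
        have "indicator (U x) y * (norm (F y))\<^sup>2 \<le> (\<Sum>x\<in>X. indicator (U x) y * (norm (F y))\<^sup>2)"
          by (rule member_le_sum) (use x X in auto)
        then show ?thesis using x by simp
      qed (use F(3) in simp)
    qed
    also have "\<dots> = (\<Sum>x\<in>X. LBINT y. indicator (U x) y * (norm (F y))\<^sup>2)"
      using integrable_mult_indicator[OF _ FD(3)] \<Omega> by (intro Bochner_Integration.integral_sum) (auto simp: U_def)
    also have "\<dots> \<le> (\<Sum>x\<in>X. 2 * (2 * \<tau>)\<^sup>2 * (LBINT x. (norm (D x))\<^sup>2)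
       + 2 * measure lborel (U x) / (measure lborel (Z x))\<^sup>2 * (LBINT x. norm (F x))\<^sup>2)"
    proof (rule sum_mono)
      fix x assume x: "x \<in> X"
      then have cl: "x \<in> closure \<Omega>" using X by auto
      show "(LBINT y. indicator (U x) y * (norm (F y))\<^sup>2) \<le> 2 * (2 * \<tau>)\<^sup>2 * (LBINT x. (norm (D x))\<^sup>2)
       + 2 * measure lborel (U x) / (measure lborel (Z x))\<^sup>2 * (LBINT x. norm (F x))\<^sup>2"
      proof (rule local_interpolation[OF F(1,2) FD wg])
        show "open (U x)" "bounded (U x)" using \<Omega> by (auto simp: U_def)
        show "y + s *\<^sub>R z \<in> \<Omega>" if "y \<in> U x" "z \<in> Z x" "0 \<le> s" "s \<le> 1" for y s z
          using cone(2)[OF cl \<tau>0 \<tau>1[OF x]] that by (auto simp: U_def Z_def)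
        show "Z x \<in> sets borel" "bounded (Z x)" by (auto simp: Z_def)
        show "0 < measure lborel (Z x)"
          unfolding Z_def using cone(1)[OF cl] \<tau>0 content_ball_pos[of "c x * \<tau>" "\<tau> *\<^sub>R \<nu> x"] by simp
        fix z assume z: "z \<in> Z x"
        have "norm z \<le> norm (\<tau> *\<^sub>R \<nu> x) + norm (z - \<tau> *\<^sub>R \<nu> x)" by (rule norm_triangle_sub)
        moreover have "norm (z - \<tau> *\<^sub>R \<nu> x) < c x * \<tau>" using z by (simp add: Z_def dist_norm norm_minus_commute)
        moreover have "c x * \<tau> \<le> 1 * \<tau>" using cone(1)[OF cl] \<tau>0 by (intro mult_right_mono) auto
        moreover have "norm (\<tau> *\<^sub>R \<nu> x) = \<tau>" using cone(1)[OF cl] \<tau>0 by simp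
        ultimately show "norm z \<le> 2 * \<tau>" by linarith
      qed
    qed
    also have "\<dots> = (card X * (8 * \<tau>\<^sup>2)) * (L2_norm \<Omega> (wgrad \<Omega> f))\<^sup>2 + C * (LINT x|lebesgue_on \<Omega>. norm (f x))\<^sup>2"
      unfolding eqs(2,3) C_def by (simp add: sum.distrib sum_distrib_right power_mult_distrib)
    also have "\<dots> \<le> \<epsilon> * (L2_norm \<Omega> (wgrad \<Omega> f))\<^sup>2 + C * (LINT x|lebesgue_on \<Omega>. norm (f x))\<^sup>2"
      using \<tau>2 by (intro add_right_mono mult_right_mono) auto
    finally show "(L2_norm \<Omega> f)\<^sup>2 \<le> \<epsilon> * (L2_norm \<Omega> (wgrad \<Omega> f))\<^sup>2 + C * (LINT x|lebesgue_on \<Omega>. norm (f x))\<^sup>2" .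
  qed
qed

section \<open>The Hausdorff measure\<close>

definition hausdorff_cost :: "real \<Rightarrow> 'a::euclidean_space set \<Rightarrow> ennreal" where
  "hausdorff_cost s A = ennreal (unit_ball_vol s * (diameter A / 2) powr s)"

definition hausdorff_covers :: "real \<Rightarrow> 'a::euclidean_space set \<Rightarrow> (nat \<Rightarrow> 'a set) set" where
  "hausdorff_covers \<delta> A = {C. A \<subseteq> (\<Union>i. C i) \<and> (\<forall>i. bounded (C i) \<and> diameter (C i) \<le> \<delta>)}"

lemma hausdorff_pre_eq: "hausdorff_pre s \<delta> A = (INF C \<in> hausdorff_covers \<delta> A. \<Sum>i. hausdorff_cost s (C i))"
  by (simp add: hausdorff_pre_def hausdorff_covers_def hausdorff_cost_def)

lemma hausdorff_cost_empty [simp]: "hausdorff_cost s {} = 0"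
  by (simp add: hausdorff_cost_def)

lemma hausdorff_pre_le: "C \<in> hausdorff_covers \<delta> A \<Longrightarrow> hausdorff_pre s \<delta> A \<le> (\<Sum>i. hausdorff_cost s (C i))"
  unfolding hausdorff_pre_eq by (rule INF_lower)

lemma hausdorff_pre_empty: "0 \<le> \<delta> \<Longrightarrow> hausdorff_pre s \<delta> {} = 0"
  using hausdorff_pre_le[of "\<lambda>_. {}" \<delta> "{}" s] by (simp add: hausdorff_covers_def)

lemma hausdorff_pre_mono: "A \<subseteq> B \<Longrightarrow> hausdorff_pre s \<delta> A \<le> hausdorff_pre s \<delta> B"
  unfolding hausdorff_pre_eq by (rule INF_superset_mono) (auto simp: hausdorff_covers_def)

lemma hausdorff_pre_antimono: "\<delta>' \<le> \<delta> \<Longrightarrow> hausdorff_pre s \<delta> A \<le> hausdorff_pre s \<delta>' A"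
  unfolding hausdorff_pre_eq by (rule INF_superset_mono) (auto simp: hausdorff_covers_def intro: order_trans)

lemma hausdorff_pre_le_outer: "0 < \<delta> \<Longrightarrow> hausdorff_pre s \<delta> A \<le> hausdorff_outer s A"
  unfolding hausdorff_outer_def by (rule SUP_upper) simp

lemma hausdorff_pre_close:
  assumes "hausdorff_pre s \<delta> A < e"
  obtains C where "C \<in> hausdorff_covers \<delta> A" "(\<Sum>i. hausdorff_cost s (C i)) < e"
  using assms unfolding hausdorff_pre_eq INF_less_iff by blast

text \<open>Each set gets a cover with excess e/2^(n+1), and the covers are merged through an
  enumeration of pairs.\<close>

lemma hausdorff_pre_countably_subadditive:
  "hausdorff_pre s \<delta> (\<Union>n. A n) \<le> (\<Sum>n. hausdorff_pre s \<delta> (A n))"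
proof (rule ennreal_le_epsilon)
  fix e :: real assume e: "0 < e" and fin: "(\<Sum>n. hausdorff_pre s \<delta> (A n)) < top"
  then have "hausdorff_pre s \<delta> (A n) < hausdorff_pre s \<delta> (A n) + e * (1/2) ^ Suc n" for n
    by (auto simp add: less_top dest!: ennreal_suminf_lessD)
  then have "\<exists>C. C \<in> hausdorff_covers \<delta> (A n) \<and> (\<Sum>i. hausdorff_cost s (C i)) < hausdorff_pre s \<delta> (A n) + e * (1/2) ^ Suc n" for n
    by (metis hausdorff_pre_close)
  then obtain B where B: "\<And>n. B n \<in> hausdorff_covers \<delta> (A n)"
    "\<And>n. (\<Sum>i. hausdorff_cost s (B n i)) < hausdorff_pre s \<delta> (A n) + e * (1/2) ^ Suc n" by metis
  define C where "C = case_prod B o prod_decode"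
  have "(\<Union>n. A n) \<subseteq> (\<Union>i. C i)"
  proof
    fix x assume "x \<in> (\<Union>n. A n)"
    then obtain n i where "x \<in> B n i" using B(1) unfolding hausdorff_covers_def by blast
    then have "x \<in> C (prod_encode (n, i))" by (simp add: C_def)
    then show "x \<in> (\<Union>i. C i)" by blast
  qed
  then have "C \<in> hausdorff_covers \<delta> (\<Union>n. A n)"
    using B(1) by (auto simp: hausdorff_covers_def C_def split_def)
  then have "hausdorff_pre s \<delta> (\<Union>n. A n) \<le> (\<Sum>i. hausdorff_cost s (C i))" by (rule hausdorff_pre_le)
  also have "\<dots> = (\<Sum>n. \<Sum>i. hausdorff_cost s (B n i))"
    unfolding C_def comp_def
    using suminf_ennreal_2dimen[of "\<lambda>n. \<Sum>i. hausdorff_cost s (B n i)" "\<lambda>p. hausdorff_cost s (case p of (n, i) \<Rightarrow> B n i)"] by simp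
  also have "\<dots> \<le> (\<Sum>n. hausdorff_pre s \<delta> (A n) + e * (1/2) ^ Suc n)"
    by (intro suminf_le less_imp_le[OF B(2)] summableI)
  also have "\<dots> = (\<Sum>n. hausdorff_pre s \<delta> (A n)) + (\<Sum>n. ennreal e * ennreal ((1/2) ^ Suc n))"
    using e by (subst suminf_add[symmetric]) (auto simp del: ennreal_suminf_cmult simp add: ennreal_mult[symmetric])
  also have "\<dots> = (\<Sum>n. hausdorff_pre s \<delta> (A n)) + e"
    unfolding ennreal_suminf_cmult by (subst suminf_ennreal_eq[OF zero_le_power power_half_series]) auto
  finally show "hausdorff_pre s \<delta> (\<Union>n. A n) \<le> (\<Sum>n. hausdorff_pre s \<delta> (A n)) + e" .
qed

lemma hausdorff_outer_empty: "hausdorff_outer s {} = 0"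
  unfolding hausdorff_outer_def by (auto simp: hausdorff_pre_empty intro!: antisym SUP_least)

lemma hausdorff_outer_mono: "A \<subseteq> B \<Longrightarrow> hausdorff_outer s A \<le> hausdorff_outer s B"
  unfolding hausdorff_outer_def by (intro SUP_mono) (auto intro: hausdorff_pre_mono)

lemma hausdorff_outer_countably_subadditive:
  "hausdorff_outer s (\<Union>n. A n) \<le> (\<Sum>n. hausdorff_outer s (A n))"
proof -
  have "hausdorff_pre s \<delta> (\<Union>n. A n) \<le> (\<Sum>n. hausdorff_outer s (A n))" if "\<delta> > 0" for \<delta>
    by (rule order_trans[OF hausdorff_pre_countably_subadditive])
      (intro suminf_le hausdorff_pre_le_outer that summableI)
  then show ?thesis unfolding hausdorff_outer_def[of s "\<Union>n. A n"] by (intro SUP_least) auto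
qed

lemma hausdorff_outer_subadditive: "hausdorff_outer s (A \<union> B) \<le> hausdorff_outer s A + hausdorff_outer s B"
proof -
  define X where "X n = (if n = 0 then A else if n = 1 then B else {})" for n :: nat
  have "(\<Union>n. X n) = A \<union> B" by (auto simp: X_def split: if_splits)
  moreover have "(\<Sum>n. hausdorff_outer s (X n)) = (\<Sum>n\<in>{0,1}. hausdorff_outer s (X n))"
    by (rule suminf_finite) (auto simp: X_def hausdorff_outer_empty)
  ultimately show ?thesis using hausdorff_outer_countably_subadditive[of s X] by (simp add: X_def)
qed

lemma outer_measure_space_hausdorff: "outer_measure_space (Pow UNIV) (hausdorff_outer s)"
  unfolding outer_measure_space_def
  by (auto simp: positive_def increasing_def countably_subadditive_def hausdorff_outer_empty
      intro: hausdorff_outer_mono hausdorff_outer_countably_subadditive)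

section \<open>Caratheodory's criterion\<close>

text \<open>A covering set of diameter below the separation cannot meet both A and B, so a cover of
  the union splits into a cover of each without repeating costs.\<close>

lemma hausdorff_outer_metric:
  assumes "0 < \<eta>" and sep: "\<And>x y. x \<in> A \<Longrightarrow> y \<in> B \<Longrightarrow> \<eta> \<le> dist x y"
  shows "hausdorff_outer s A + hausdorff_outer s B \<le> hausdorff_outer s (A \<union> B)"
proof -
  have small: "hausdorff_pre s \<delta> A + hausdorff_pre s \<delta> B \<le> hausdorff_pre s \<delta> (A \<union> B)" if "\<delta> < \<eta>" "0 \<le> \<delta>" for \<delta>
    unfolding hausdorff_pre_eq[of s \<delta> "A \<union> B"]
  proof (rule INF_greatest)
    fix C assume C: "C \<in> hausdorff_covers \<delta> (A \<union> B)"
    define CA where "CA i = (if C i \<inter> A = {} then {} else C i)" for i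
    define CB where "CB i = (if C i \<inter> B = {} then {} else C i)" for i
    have "A \<subseteq> (\<Union>i. CA i)" "B \<subseteq> (\<Union>i. CB i)"
      using C unfolding hausdorff_covers_def CA_def CB_def by fastforce+
    then have "CA \<in> hausdorff_covers \<delta> A" "CB \<in> hausdorff_covers \<delta> B"
      using C that by (auto simp: hausdorff_covers_def CA_def CB_def)
    then have "hausdorff_pre s \<delta> A + hausdorff_pre s \<delta> B \<le> (\<Sum>i. hausdorff_cost s (CA i)) + (\<Sum>i. hausdorff_cost s (CB i))"
      by (intro add_mono hausdorff_pre_le)
    also have "\<dots> = (\<Sum>i. hausdorff_cost s (CA i) + hausdorff_cost s (CB i))"
      by (rule suminf_add) auto
    also have "\<dots> \<le> (\<Sum>i. hausdorff_cost s (C i))"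
    proof (intro suminf_le summableI)
      fix i
      have "C i \<inter> A = {} \<or> C i \<inter> B = {}"
      proof (rule ccontr)
        assume "\<not> (C i \<inter> A = {} \<or> C i \<inter> B = {})"
        then obtain x y where xy: "x \<in> C i" "x \<in> A" "y \<in> C i" "y \<in> B" by blast
        have "dist x y \<le> \<delta>"
        proof -
          have "bounded (C i)" "diameter (C i) \<le> \<delta>" using C by (auto simp: hausdorff_covers_def)
          then show ?thesis using diameter_bounded_bound[of "C i" x y] xy by simp
        qed
        then show False using sep[OF xy(2,4)] that by simp
      qed
      then show "hausdorff_cost s (CA i) + hausdorff_cost s (CB i) \<le> hausdorff_cost s (C i)"
        by (auto simp: CA_def CB_def)
    qed
    finally show "hausdorff_pre s \<delta> A + hausdorff_pre s \<delta> B \<le> (\<Sum>i. hausdorff_cost s (C i))" .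
  qed
  \<comment> \<open>Each of the two outer measures is a supremum over its own scale. A common scale
    below both and below the separation serves them simultaneously, because the premeasure grows as
    the scale shrinks.\<close>
  have two: "hausdorff_pre s \<delta>1 A + hausdorff_pre s \<delta>2 B \<le> hausdorff_outer s (A \<union> B)" if "\<delta>1 > 0" "\<delta>2 > 0" for \<delta>1 \<delta>2
  proof -
    let ?\<delta> = "min (\<eta> / 2) (min \<delta>1 \<delta>2)"
    have "hausdorff_pre s \<delta>1 A + hausdorff_pre s \<delta>2 B \<le> hausdorff_pre s ?\<delta> A + hausdorff_pre s ?\<delta> B"
      by (intro add_mono hausdorff_pre_antimono) auto
    also have "\<dots> \<le> hausdorff_pre s ?\<delta> (A \<union> B)" using that assms by (intro small) (auto simp: min_less_iff_disj)
    also have "\<dots> \<le> hausdorff_outer s (A \<union> B)" using that assms by (intro hausdorff_pre_le_outer) auto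
    finally show ?thesis .
  qed
  have "hausdorff_outer s A + hausdorff_pre s \<delta>2 B \<le> hausdorff_outer s (A \<union> B)" if "\<delta>2 > 0" for \<delta>2
    unfolding hausdorff_outer_def[of s A] using two that
    by (subst ennreal_SUP_add_left[symmetric]) (auto intro!: SUP_least)
  then show ?thesis
    unfolding hausdorff_outer_def[of s B]
    by (subst ennreal_SUP_add_right) (auto intro!: SUP_least)
qed

text \<open>Outside F the set E is exhausted by the parts at distance at least 1/(k+1) from F, to
  which additivity on separated sets applies. What is left over consists of thin shells whose total
  outer measure has to be shown to have small tails.\<close>

lemma closed_in_hausdorff_lambda_system:
  fixes F :: "'a::euclidean_space set"
  assumes "closed F"
  shows "F \<in> lambda_system UNIV (Pow UNIV) (hausdorff_outer s)"
  unfolding lambda_system_def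
proof (intro CollectI conjI ballI)
  fix E :: "'a set"
  let ?h = "hausdorff_outer s"
  show "?h (F \<inter> E) + ?h ((UNIV - F) \<inter> E) = ?h E"
  proof (rule antisym)
    have "(F \<inter> E) \<union> ((UNIV - F) \<inter> E) = E" by auto
    then show "?h E \<le> ?h (F \<inter> E) + ?h ((UNIV - F) \<inter> E)"
      using hausdorff_outer_subadditive[of s "F \<inter> E" "(UNIV - F) \<inter> E"] by simp
    show "?h (F \<inter> E) + ?h ((UNIV - F) \<inter> E) \<le> ?h E"
    proof (cases "F = {}")
      case True then show ?thesis by (simp add: hausdorff_outer_empty)
    next
      case F: False
      define r where "r x = infdist x F" for x
      have r_sep: "a - b \<le> dist x y" if "a \<le> r x" "r y \<le> b" for a b x y
        using infdist_triangle[of x F y] that by (simp add: r_def dist_commute)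
      have r_pos: "0 < r x" if "x \<notin> F" for x
        using that assms F infdist_pos_not_in_closed unfolding r_def by blast
      define A where "A k = {x \<in> E - F. 1 / real (Suc k) \<le> r x}" for k
      define R where "R k = A (Suc k) - A k" for k
      have mono: "A k \<subseteq> A (Suc k)" for k
      proof -
        have "1 / real (Suc (Suc k)) \<le> 1 / real (Suc k)" by (intro divide_left_mono) auto
        then show ?thesis unfolding A_def by (auto simp del: of_nat_Suc)
      qed
      have mono': "A k \<subseteq> A l" if "k \<le> l" for k l using mono that by (rule lift_Suc_mono_le)
      have R_lt: "r x < 1 / real (Suc k)" if "x \<in> R k" for x k using that by (auto simp: R_def A_def)
      have R_ge: "1 / real (Suc (Suc k)) \<le> r x" if "x \<in> R k" for x k using that by (auto simp: R_def A_def)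
      \<comment> \<open>Neighbouring shells touch, but shells whose indices differ by 2 or more are
        separated. Summing over one parity is therefore additive, and the bound by E holds for each
        parity.\<close>
      have every_other: "(\<Sum>j<N. ?h (R (2 * j + i))) \<le> ?h (\<Union>j<N. R (2 * j + i))" for N i
      proof (induction N)
        case (Suc N)
        have 1: "?h (\<Union>j<N. R (2 * j + i)) + ?h (R (2 * N + i)) \<le> ?h ((\<Union>j<N. R (2 * j + i)) \<union> R (2 * N + i))"
        proof (cases "N = 0")
          case False
          show ?thesis
          proof (rule hausdorff_outer_metric)
            \<comment> \<open>Earlier shells of this parity lie at distance at least 1/(2N+i) from
              F, the new one at distance below 1/(2N+i+1); the gap is the difference. For N = 0
              there is no earlier shell.\<close>
            show "0 < 1 / real (2 * N + i) - 1 / real (Suc (2 * N + i))"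
              using False divide_strict_left_mono[of "real (2 * N + i)" "real (Suc (2 * N + i))" 1] by simp
            fix x y assume x: "x \<in> (\<Union>j<N. R (2 * j + i))" and y: "y \<in> R (2 * N + i)"
            obtain j where j: "j < N" "x \<in> R (2 * j + i)" using x by auto
            have "1 / real (2 * N + i) \<le> 1 / real (Suc (Suc (2 * j + i)))"
              using j by (intro divide_left_mono) auto
            also have "\<dots> \<le> r x" by (rule R_ge[OF j(2)])
            finally show "1 / real (2 * N + i) - 1 / real (Suc (2 * N + i)) \<le> dist x y"
              using r_sep R_lt[OF y] by (meson less_imp_le)
          qed
        qed (simp add: hausdorff_outer_empty)
        have 2: "(\<Union>j<N. R (2 * j + i)) \<union> R (2 * N + i) = (\<Union>j<Suc N. R (2 * j + i))"
          by (auto simp: lessThan_Suc)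
        have 3: "(\<Sum>j<Suc N. ?h (R (2 * j + i))) \<le> ?h (\<Union>j<N. R (2 * j + i)) + ?h (R (2 * N + i))"
          using Suc.IH by (simp add: add_right_mono)
        show ?case using order_trans[OF 3 1] unfolding 2 .
      qed (simp add: hausdorff_outer_empty)
      have every_other_E: "(\<Sum>j<N. ?h (R (2 * j + i))) \<le> ?h E" for N i
        by (rule order_trans[OF every_other]) (auto intro!: hausdorff_outer_mono simp: R_def A_def)
      have A_le: "?h (F \<inter> E) + ?h (A k) \<le> ?h E" for k
      proof -
        have "?h (F \<inter> E) + ?h (A k) \<le> ?h ((F \<inter> E) \<union> A k)"
        proof (rule hausdorff_outer_metric)
          fix x y assume "x \<in> F \<inter> E" "y \<in> A k"
          then have "1 / real (Suc k) \<le> r y" "r x \<le> 0" by (auto simp: A_def r_def)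
          then show "1 / real (Suc k) \<le> dist x y" using r_sep[of "1 / real (Suc k)" y x 0] by (simp add: dist_commute)
        qed simp
        also have "\<dots> \<le> ?h E" by (rule hausdorff_outer_mono) (auto simp: A_def)
        finally show ?thesis .
      qed
      show ?thesis
      proof (rule ennreal_le_epsilon)
        fix e :: real assume e: "0 < e" and fin: "?h E < top"
        have fin': "?h (R j) < top" for j
        proof -
          have "R j \<subseteq> E" by (auto simp: R_def A_def)
          then show ?thesis using hausdorff_outer_mono fin by (metis le_less_trans)
        qed
        \<comment> \<open>Finite outer measure of E turns each parity into a convergent series of
          real numbers; cutting both at tail e/2 leaves the total error e.\<close>
        define g where "g i j = enn2real (?h (R (2 * j + i)))" for i j
        have g: "?h (R (2 * j + i)) = ennreal (g i j)" for i j using fin' by (simp add: g_def)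
        have g0: "0 \<le> g i j" for i j by (simp add: g_def)
        have "summable (g i)" for i
        proof (rule summableI_nonneg_bounded)
          fix N
          have "ennreal (\<Sum>j<N. g i j) \<le> ?h E" using every_other_E[of i N] by (simp add: g sum_ennreal g0)
          also have "\<dots> = ennreal (enn2real (?h E))" using fin by simp
          finally show "(\<Sum>j<N. g i j) \<le> enn2real (?h E)" by (simp add: ennreal_le_iff)
        qed (simp add: g0)
        then have "\<exists>N. \<forall>n\<ge>N. norm (\<Sum>j. g i (j + n)) < e / 2" for i using e by (intro suminf_exist_split) auto
        then obtain M where M: "\<And>i n. n \<ge> M i \<Longrightarrow> norm (\<Sum>j. g i (j + n)) < e / 2" by metis
        define n where "n = max (M 0) (M 1)"
        have tail: "(\<Sum>j. ?h (R (2 * (j + n) + i))) \<le> ennreal (e / 2)" if "i = 0 \<or> i = 1" for i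
        proof -
          have s: "summable (\<lambda>j. g i (j + n))" using \<open>\<And>i. summable (g i)\<close> by (simp add: summable_iff_shift)
          have "(\<Sum>j. ?h (R (2 * (j + n) + i))) = (\<Sum>j. ennreal (g i (j + n)))" by (simp only: g)
          also have "\<dots> = ennreal (\<Sum>j. g i (j + n))" by (rule suminf_ennreal2[OF g0 s])
          also have "\<dots> \<le> ennreal (e / 2)" using M[of i n] that by (intro ennreal_leI) (auto simp: n_def)
          finally show ?thesis .
        qed
        have cover: "E - F \<subseteq> A (2 * n) \<union> ((\<Union>j. R (2 * (j + n) + 0)) \<union> (\<Union>j. R (2 * (j + n) + 1)))"
        proof
          fix x assume x: "x \<in> E - F"
          then have "0 < r x" using r_pos by auto
          then obtain k where k: "inverse (real (Suc k)) < r x" using reals_Archimedean by blast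
          then have "\<exists>k. x \<in> A k" using x by (auto simp: A_def inverse_eq_divide intro: less_imp_le)
          define l where "l = (LEAST k. x \<in> A k)"
          have l: "x \<in> A l" unfolding l_def using \<open>\<exists>k. x \<in> A k\<close> by (rule LeastI_ex)
          show "x \<in> A (2 * n) \<union> ((\<Union>j. R (2 * (j + n) + 0)) \<union> (\<Union>j. R (2 * (j + n) + 1)))"
          proof (cases "l \<le> 2 * n")
            case True then show ?thesis using mono' l by blast
          next
            \<comment> \<open>The first index at which x is reached is m + 1 with m beyond the cut,
              so x lies in the shell \<open>R m\<close>; the parity of m decides which of the two
              unions contains it.\<close>
            case False
            then obtain m where m: "l = Suc m" "2 * n \<le> m" by (cases l) auto
            have "x \<notin> A m" using not_less_Least[of m "\<lambda>k. x \<in> A k"] m(1) by (simp add: l_def)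
            then have xR: "x \<in> R m" using l by (simp add: R_def m(1))
            have "m = 2 * (m div 2 - n + n) + m mod 2" using m(2) by simp
            moreover have "m mod 2 = 0 \<or> m mod 2 = 1" by auto
            ultimately show ?thesis using xR by (metis UN_I UNIV_I UnCI)
          qed
        qed
        have "?h ((UNIV - F) \<inter> E) \<le> ?h (A (2 * n) \<union> ((\<Union>j. R (2 * (j + n) + 0)) \<union> (\<Union>j. R (2 * (j + n) + 1))))"
          using cover by (intro hausdorff_outer_mono) auto
        also have "\<dots> \<le> ?h (A (2 * n)) + (?h (\<Union>j. R (2 * (j + n) + 0)) + ?h (\<Union>j. R (2 * (j + n) + 1)))"
          by (intro order_trans[OF hausdorff_outer_subadditive] add_left_mono hausdorff_outer_subadditive)
        also have "\<dots> \<le> ?h (A (2 * n)) + (ennreal (e / 2) + ennreal (e / 2))"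
          by (intro add_left_mono add_mono order_trans[OF hausdorff_outer_countably_subadditive] tail) auto
        also have "ennreal (e / 2) + ennreal (e / 2) = ennreal e" using e by (simp flip: ennreal_plus)
        finally have "?h (F \<inter> E) + ?h ((UNIV - F) \<inter> E) \<le> ?h (F \<inter> E) + (?h (A (2 * n)) + e)" by (rule add_left_mono)
        also have "\<dots> \<le> ?h E + e" using A_le[of "2 * n"] by (simp add: add.assoc[symmetric] add_right_mono)
        finally show "?h (F \<inter> E) + ?h ((UNIV - F) \<inter> E) \<le> ?h E + e" .
      qed
    qed
  qed
qed auto

lemma sets_hausdorff_measure [simp, measurable_cong]: "sets (hausdorff_measure s) = sets borel"
  using sets.sigma_sets_eq[of borel] by (simp add: hausdorff_measure_def)

text \<open>\<open>measure_of\<close> yields the outer measure only where that is countably additive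
  and is zero otherwise; the Borel sets lie in the Caratheodory sigma-algebra, so the first case
  applies.\<close>

lemma emeasure_hausdorff_measure:
  assumes "A \<in> sets borel"
  shows "emeasure (hausdorff_measure s) A = hausdorff_outer s A"
proof -
  let ?L = "lambda_system UNIV (Pow UNIV) (hausdorff_outer s) :: 'a set set"
  interpret sigma_algebra UNIV "Pow UNIV :: 'a set set" by (rule sigma_algebra_Pow)
  have L: "measure_space UNIV ?L (hausdorff_outer s)"
    by (rule caratheodory_lemma[OF outer_measure_space_hausdorff])
  then have "sigma_algebra UNIV ?L" by (simp add: measure_space_def)
  moreover have "sets borel = sigma_sets UNIV (Collect closed :: 'a set set)"
    by (metis borel_eq_closed sets_measure_of subset_Pow_Union top_greatest Pow_UNIV)
  ultimately have sub: "sets borel \<subseteq> ?L"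
    using sigma_algebra.sigma_sets_subset[of UNIV ?L "Collect closed"] closed_in_hausdorff_lambda_system by blast
  have "measure_space UNIV (sets borel) (hausdorff_outer s :: 'a set \<Rightarrow> ennreal)"
    by (rule measure_down[OF L _ sub]) (use sets.sigma_algebra_axioms[of "borel :: 'a measure"] in simp)
  then show ?thesis unfolding hausdorff_measure_def measure_space_def
    by (intro emeasure_measure_of_sigma) (use assms in auto)
qed

section \<open>Finite surface measure of a Lipschitz boundary\<close>

text \<open>A packing bound of order \<delta>^(1-n) instead of \<delta>^(-n). Every projected point
  is stacked with about 1/\<delta> copies along \<nu>, so that disjoint full-dimensional balls of
  radius \<delta>/2 can be counted by volume.\<close>

lemma separated_balls_card:
  fixes S :: "'a::euclidean_space set"
  assumes S: "finite S" and \<nu>: "norm \<nu> = 1" and P: "\<And>v. P v = v - (v \<bullet> \<nu>) *\<^sub>R \<nu>"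
    and sep: "\<And>x y. x \<in> S \<Longrightarrow> y \<in> S \<Longrightarrow> x \<noteq> y \<Longrightarrow> \<delta> \<le> norm (P x - P y)"
    and bd: "\<And>x. x \<in> S \<Longrightarrow> norm x \<le> \<rho>" and \<delta>: "0 < \<delta>" "\<delta> \<le> 1" and \<rho>: "0 \<le> \<rho>"
  shows "real (card S) * \<delta> ^ DIM('a) \<le> \<delta> * (2 * (\<rho> + 2)) ^ DIM('a)"
proof -
  let ?n = "DIM('a)"
  have \<nu>\<nu>: "\<nu> \<bullet> \<nu> = 1" using \<nu> by (simp add: dot_square_norm)
  have normP: "norm (P v) \<le> norm v" for v
  proof -
    have "(norm (P v))\<^sup>2 = (norm v)\<^sup>2 - (v \<bullet> \<nu>)\<^sup>2"
      unfolding power2_norm_eq_inner P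
      by (simp add: inner_diff_left inner_diff_right \<nu>\<nu> inner_commute power2_eq_square)
    then have "(norm (P v))\<^sup>2 \<le> (norm v)\<^sup>2" by simp
    then show ?thesis by (rule power2_le_imp_le) simp
  qed
  have P_lin: "P (a - b) = P a - P b" "P (a + b) = P a + P b" "P (c *\<^sub>R \<nu>) = 0" "P (P a) = P a" for a b c
    by (simp_all add: P inner_diff_left inner_add_left \<nu>\<nu> algebra_simps)
  \<comment> \<open>The J + 1 layers at heights 0, \<delta>, ..., J \<delta> stay within height 1,
    while (J + 1) \<delta> \<ge> 1. The first bound keeps all balls in a fixed ball, the second
    recovers the extra factor \<delta>.\<close>
  define J where "J = nat \<lfloor>1 / \<delta>\<rfloor>"
  have J: "real J * \<delta> \<le> 1" "1 \<le> real (Suc J) * \<delta>"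
  proof -
    have "real J = of_int \<lfloor>1 / \<delta>\<rfloor>" using \<delta> by (simp add: J_def)
    then have "real J \<le> 1 / \<delta>" "1 / \<delta> < real J + 1" by linarith+
    then show "real J * \<delta> \<le> 1" "1 \<le> real (Suc J) * \<delta>" using \<delta> by (auto simp: field_simps)
  qed
  \<comment> \<open>The stacks start at the projections and not at the points themselves: copies
    from different points are separated by their projections, copies in one stack by their
    heights.\<close>
  define c where "c = (\<lambda>(x, j). P x + (real j * \<delta>) *\<^sub>R \<nu>)"
  define B where "B p = ball (c p) (\<delta> / 2)" for p
  let ?I = "S \<times> {..J}"
  have far: "\<delta> \<le> norm (c p - c q)" if p: "p \<in> ?I" and q: "q \<in> ?I" and "p \<noteq> q" for p q
  proof -
    obtain x j y k where pq: "p = (x, j)" "q = (y, k)" by (metis surj_pair)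
    show ?thesis
    proof (cases "x = y")
      case True
      then have "j \<noteq> k" using pq that by simp
      then have "1 \<le> \<bar>real j - real k\<bar>" by (cases "j < k") auto
      have "c p - c q = ((real j - real k) * \<delta>) *\<^sub>R \<nu>" by (simp add: c_def pq True algebra_simps)
      then have "norm (c p - c q) = \<bar>real j - real k\<bar> * \<delta>" using \<delta> by (simp add: \<nu> abs_mult)
      also have "\<dots> \<ge> 1 * \<delta>" using \<open>1 \<le> \<bar>real j - real k\<bar>\<close> \<delta> by (intro mult_right_mono) auto
      finally show ?thesis by simp
    next
      case False
      then have "\<delta> \<le> norm (P x - P y)" using sep pq p q by auto
      also have "P x - P y = P (c p - c q)" by (simp add: c_def pq P_lin)
      also have "norm \<dots> \<le> norm (c p - c q)" by (rule normP)
      finally show ?thesis .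
    qed
  qed
  have disj: "disjoint_family_on B ?I"
    unfolding disjoint_family_on_def
  proof (intro ballI impI, rule ccontr)
    fix p q assume pq: "p \<in> ?I" "q \<in> ?I" "p \<noteq> q" "B p \<inter> B q \<noteq> {}"
    then obtain x where "dist (c p) x < \<delta> / 2" "dist (c q) x < \<delta> / 2"
      using pq(4) unfolding B_def by (metis Int_emptyI mem_ball)
    then have "dist (c p) (c q) < \<delta>" using dist_triangle_half_r[of x "c p" \<delta> "c q"] by (simp add: dist_commute)
    then show False using far[OF pq(1-3)] by (simp add: dist_norm)
  qed
  have sub: "(\<Union>p\<in>?I. B p) \<subseteq> ball 0 (\<rho> + 2)"
  proof
    fix y assume "y \<in> (\<Union>p\<in>?I. B p)"
    then obtain x j where xj: "x \<in> S" "j \<le> J" "dist (c (x, j)) y < \<delta> / 2" by (auto simp: B_def)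
    have "norm (c (x, j)) \<le> norm (P x) + real j * \<delta>" unfolding c_def
      using norm_triangle_ineq[of "P x" "(real j * \<delta>) *\<^sub>R \<nu>"] \<delta> \<nu> by simp
    also have "\<dots> \<le> \<rho> + 1"
    proof (intro add_mono)
      show "norm (P x) \<le> \<rho>" using normP[of x] bd[OF xj(1)] by simp
      have "real j * \<delta> \<le> real J * \<delta>" using xj \<delta> by (intro mult_right_mono) auto
      then show "real j * \<delta> \<le> 1" using J by simp
    qed
    finally have "norm (c (x, j)) \<le> \<rho> + 1" .
    then have "norm y < \<rho> + 2" using xj(3) \<delta> norm_triangle_sub[of y "c (x, j)"] by (simp add: dist_norm norm_minus_commute)
    then show "y \<in> ball 0 (\<rho> + 2)" by (simp add: dist_norm)
  qed
  have "real (card ?I) * (unit_ball_vol (real ?n) * (\<delta> / 2) ^ ?n) = (\<Sum>p\<in>?I. measure lborel (B p))"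
    using \<delta> by (simp add: B_def content_ball)
  also have "\<dots> = measure lborel (\<Union>p\<in>?I. B p)"
    using S emeasure_bounded_finite[OF bounded_ball]
    by (intro measure_finite_Union[symmetric] disj) (auto simp: B_def less_top[symmetric])
  also have "\<dots> \<le> measure lborel (ball 0 (\<rho> + 2) :: 'a set)"
    using S emeasure_bounded_finite[OF bounded_ball]
    by (intro measure_mono_fmeasurable sub fmeasurableI) (auto simp: B_def)
  also have "\<dots> = unit_ball_vol (real ?n) * (\<rho> + 2) ^ ?n" using \<rho> by (simp add: content_ball)
  finally have "unit_ball_vol (real ?n) * (real (card ?I) * (\<delta> / 2) ^ ?n) \<le> unit_ball_vol (real ?n) * (\<rho> + 2) ^ ?n"
    by (simp add: algebra_simps)
  then have "real (card ?I) * (\<delta> / 2) ^ ?n \<le> (\<rho> + 2) ^ ?n" by (simp add: mult_le_cancel_left_pos unit_ball_vol_pos)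
  then have "real (card S) * real (Suc J) * \<delta> ^ ?n \<le> 2 ^ ?n * (\<rho> + 2) ^ ?n"
    by (simp add: card_cartesian_product power_divide field_simps)
  then have *: "real (card S) * real (Suc J) * \<delta> ^ ?n \<le> (2 * (\<rho> + 2)) ^ ?n" by (simp add: power_mult_distrib[symmetric])
  have "real (card S) * \<delta> ^ ?n * 1 \<le> real (card S) * \<delta> ^ ?n * (real (Suc J) * \<delta>)"
    using J(2) \<delta> by (intro mult_left_mono) auto
  also have "\<dots> = \<delta> * (real (card S) * real (Suc J) * \<delta> ^ ?n)" by simp
  also have "\<dots> \<le> \<delta> * (2 * (\<rho> + 2)) ^ ?n" using * \<delta> by (intro mult_left_mono) auto
  finally show ?thesis by simp
qed

text \<open>A separated subset of maximal cardinality is also a net. On a graph separation passes to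
  the projections up to the factor \<kappa>, so the packing bound limits the number of covering
  balls by a multiple of \<delta>^(1-n), and their total cost is bounded uniformly in
  \<delta>.\<close>

lemma hausdorff_outer_graph_finite:
  fixes A :: "'a::euclidean_space set"
  assumes \<nu>: "norm \<nu> = 1" and P: "\<And>v. P v = v - (v \<bullet> \<nu>) *\<^sub>R \<nu>"
    and graph: "\<And>x y. x \<in> A \<Longrightarrow> y \<in> A \<Longrightarrow> norm (x - y) \<le> \<kappa> * norm (P x - P y)"
    and bd: "bounded A" and \<kappa>: "1 \<le> \<kappa>"
  shows "hausdorff_outer (real DIM('a) - 1) A < \<infinity>"
proof -
  let ?n = "DIM('a)" and ?s = "real DIM('a) - 1"
  obtain \<rho> where \<rho>: "0 \<le> \<rho>" "\<And>x. x \<in> A \<Longrightarrow> norm x \<le> \<rho>"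
    using bd by (meson bounded_pos less_imp_le)
  define K where "K = unit_ball_vol ?s * \<kappa> ^ ?n * (2 * (\<rho> + 2)) ^ ?n"
  have main: "hausdorff_pre ?s (2 * \<delta>) A \<le> ennreal K" if \<delta>: "0 < \<delta>" "\<delta> \<le> 1" for \<delta>
  proof -
    let ?sep = "\<lambda>S. finite S \<and> S \<subseteq> A \<and> (\<forall>x\<in>S. \<forall>y\<in>S. x \<noteq> y \<longrightarrow> \<delta> \<le> norm (x - y))"
    let ?d = "\<delta> / \<kappa>"
    have d: "0 < ?d" "?d \<le> 1" using \<delta> \<kappa> by (auto simp: field_simps)
    have card: "real (card S) * ?d ^ ?n \<le> ?d * (2 * (\<rho> + 2)) ^ ?n" if S: "?sep S" for S
    proof (rule separated_balls_card[OF _ \<nu> P])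
      fix x y assume xy: "x \<in> S" "y \<in> S" "x \<noteq> y"
      then have "\<delta> \<le> \<kappa> * norm (P x - P y)" using S graph[of x y] by force
      then show "?d \<le> norm (P x - P y)" using \<kappa> by (simp add: field_simps)
    qed (use S \<rho> d in auto)
    have card_le: "card S < Suc (nat \<lceil>?d * (2 * (\<rho> + 2)) ^ ?n / ?d ^ ?n\<rceil>)" if S: "?sep S" for S
    proof -
      have "real (card S) \<le> ?d * (2 * (\<rho> + 2)) ^ ?n / ?d ^ ?n"
        unfolding pos_le_divide_eq[OF zero_less_power[OF d(1)]] by (rule card[OF S])
      then show ?thesis by linarith
    qed
    \<comment> \<open>The packing bound limits the cardinalities, so a largest separated set exists;
      a point farther than \<delta> from all its members could be added to it.\<close>
    have "\<exists>S. ?sep S \<and> (\<forall>S'. ?sep S' \<longrightarrow> card S' \<le> card S)"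
      by (rule ex_has_greatest_nat[of ?sep "{}" card]) (use card_le in auto)
    then obtain S where S: "?sep S" "\<And>S'. ?sep S' \<Longrightarrow> card S' \<le> card S" by blast
    have cover: "A \<subseteq> (\<Union>x\<in>S. cball x \<delta>)"
    proof
      fix y assume y: "y \<in> A"
      show "y \<in> (\<Union>x\<in>S. cball x \<delta>)"
      proof (rule ccontr)
        assume n: "y \<notin> (\<Union>x\<in>S. cball x \<delta>)"
        then have "\<forall>x\<in>S. \<delta> < norm (x - y)" by (auto simp: dist_norm)
        then have "?sep (insert y S)" using S(1) y by (auto simp: norm_minus_commute less_imp_le)
        moreover have "y \<notin> S" using n \<delta> by auto
        ultimately show False using S(2)[of "insert y S"] S(1) by simp
      qed
    qed
    obtain x where x: "bij_betw x {..<card S} S" using S(1) by (metis ex_bij_betw_nat_finite atLeast0LessThan)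
    define C where "C i = (if i < card S then cball (x i) \<delta> else {})" for i
    have "A \<subseteq> (\<Union>i. C i)"
    proof
      fix y assume "y \<in> A"
      then obtain z where z: "z \<in> S" "y \<in> cball z \<delta>" using cover by blast
      then obtain i where "i < card S" "z = x i" using x by (auto simp: bij_betw_def)
      then have "y \<in> C i" using z by (simp add: C_def)
      then show "y \<in> (\<Union>i. C i)" by blast
    qed
    then have "C \<in> hausdorff_covers (2 * \<delta>) A"
      using \<delta> by (auto simp: hausdorff_covers_def C_def)
    then have "hausdorff_pre ?s (2 * \<delta>) A \<le> (\<Sum>i. hausdorff_cost ?s (C i))" by (rule hausdorff_pre_le)
    also have "\<dots> = (\<Sum>i<card S. hausdorff_cost ?s (C i))" by (rule suminf_finite) (auto simp: C_def)
    also have "\<dots> = (\<Sum>i<card S. ennreal (unit_ball_vol ?s * \<delta> powr ?s))"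
      using \<delta> by (intro sum.cong) (auto simp: C_def hausdorff_cost_def)
    also have "\<dots> = ennreal (real (card S) * (unit_ball_vol ?s * \<delta> powr ?s))"
      by (simp add: ennreal_mult ennreal_of_nat_eq_real_of_nat)
    also have "real (card S) * (unit_ball_vol ?s * \<delta> powr ?s) \<le> K"
    proof -
      have "\<delta> powr ?s = \<delta> ^ ?n / \<delta>" using \<delta> by (simp add: powr_diff powr_realpow)
      have "real (card S) * \<delta> ^ ?n \<le> (\<kappa> ^ ?n / \<kappa>) * \<delta> * (2 * (\<rho> + 2)) ^ ?n"
        using card[OF S(1)] \<kappa> by (simp add: power_divide field_simps)
      also have "\<dots> \<le> \<kappa> ^ ?n * \<delta> * (2 * (\<rho> + 2)) ^ ?n"
        using \<kappa> \<delta> \<rho> by (intro mult_right_mono) (auto simp: field_simps)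
      finally have "real (card S) * \<delta> ^ ?n / \<delta> \<le> \<kappa> ^ ?n * (2 * (\<rho> + 2)) ^ ?n" using \<delta> by (simp add: field_simps)
      then have "unit_ball_vol ?s * (real (card S) * \<delta> ^ ?n / \<delta>) \<le> K"
        unfolding K_def mult.assoc by (intro mult_left_mono unit_ball_vol_nonneg) auto
      then show ?thesis by (simp add: \<open>\<delta> powr ?s = \<delta> ^ ?n / \<delta>\<close> mult.left_commute)
    qed
    finally show ?thesis by (simp add: ennreal_leI)
  qed
  have "hausdorff_outer ?s A \<le> ennreal K"
    unfolding hausdorff_outer_def
  proof (rule SUP_least)
    fix \<delta> :: real assume "\<delta> \<in> {0<..}"
    then have "hausdorff_pre ?s \<delta> A \<le> hausdorff_pre ?s (2 * min 1 (\<delta> / 2)) A" by (intro hausdorff_pre_antimono) auto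
    also have "\<dots> \<le> ennreal K" using \<open>\<delta> \<in> {0<..}\<close> by (intro main) auto
    finally show "hausdorff_pre ?s \<delta> A \<le> ennreal K" .
  qed
  then show ?thesis by (simp add: le_less_trans)
qed

text \<open>Inside a chart the boundary lies on the Lipschitz graph, where distances are controlled
  by those of the projections; the boundary is compact, so finitely many charts suffice.\<close>

lemma hausdorff_frontier_finite:
  fixes \<Omega> :: "'a::euclidean_space set"
  assumes "open \<Omega>" "bounded \<Omega>" "lipschitz_boundary \<Omega>"
  shows "hausdorff_outer (real DIM('a) - 1) (frontier \<Omega>) < \<infinity>"
proof -
  let ?H = "hausdorff_outer (real DIM('a) - 1) :: 'a set \<Rightarrow> ennreal"
  have local: "\<exists>r>0. ?H (frontier \<Omega> \<inter> ball x0 r) < \<infinity>" if x0: "x0 \<in> frontier \<Omega>" for x0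
  proof -
    obtain r \<nu> h L where r: "r > 0" "norm \<nu> = 1" and L: "L-lipschitz_on {y. y \<bullet> \<nu> = 0} (h :: 'a \<Rightarrow> real)"
      and eq: "\<Omega> \<inter> ball x0 r = {y \<in> ball x0 r. h (y - (y \<bullet> \<nu>) *\<^sub>R \<nu>) < y \<bullet> \<nu>}"
      using assms(3) x0 unfolding lipschitz_boundary_def by blast
    have L0: "L \<ge> 0" using L by (rule lipschitz_on_nonneg)
    have \<nu>\<nu>: "\<nu> \<bullet> \<nu> = 1" using r(2) by (simp add: dot_square_norm)
    define P where "P v = v - (v \<bullet> \<nu>) *\<^sub>R \<nu>" for v
    have P0: "P v \<in> {y. y \<bullet> \<nu> = 0}" for v by (simp add: P_def inner_diff_left \<nu>\<nu>)
    have normP: "norm (P v) \<le> norm v" for v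
    proof -
      have "(norm (P v))\<^sup>2 = (norm v)\<^sup>2 - (v \<bullet> \<nu>)\<^sup>2"
        unfolding power2_norm_eq_inner P_def
        by (simp add: inner_diff_left inner_diff_right \<nu>\<nu> inner_commute power2_eq_square)
      then have "(norm (P v))\<^sup>2 \<le> (norm v)\<^sup>2" by simp
      then show ?thesis by (rule power2_le_imp_le) simp
    qed
    have P_diff: "P x - P y = P (x - y)" for x y by (simp add: P_def inner_diff_left algebra_simps)
    have hL: "\<bar>h (P x) - h (P y)\<bar> \<le> L * norm (P x - P y)" for x y
      using lipschitz_onD[OF L P0 P0] by (simp add: dist_norm)
    \<comment> \<open>A boundary point is outside the open domain, which puts it on or below the
      graph. It is also a limit of points above the graph, and a positive gap would contradict the
      Lipschitz bound on h.\<close>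
    have on_graph: "x \<bullet> \<nu> = h (P x)" if x: "x \<in> frontier \<Omega> \<inter> ball x0 r" for x
    proof (rule antisym)
      have "x \<notin> \<Omega>" using x assms(1) by (auto simp: frontier_def interior_open)
      then have "x \<notin> {y \<in> ball x0 r. h (y - (y \<bullet> \<nu>) *\<^sub>R \<nu>) < y \<bullet> \<nu>}" unfolding eq[symmetric] by simp
      then show "x \<bullet> \<nu> \<le> h (P x)" using x unfolding P_def by (simp add: not_less)
      show "h (P x) \<le> x \<bullet> \<nu>"
      proof (rule ccontr)
        assume "\<not> h (P x) \<le> x \<bullet> \<nu>"
        then have gap: "0 < (h (P x) - x \<bullet> \<nu>) / (L + 1)" using L0 by simp
        obtain e where e: "e > 0" "ball x e \<subseteq> ball x0 r"
          using openE[OF open_ball, of x x0 r] x by blast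
        obtain y where y: "y \<in> \<Omega>" "dist y x < min e ((h (P x) - x \<bullet> \<nu>) / (L + 1))"
        proof -
          have "x \<in> closure \<Omega>" using x by (simp add: frontier_def)
          moreover have "0 < min e ((h (P x) - x \<bullet> \<nu>) / (L + 1))" using gap e(1) by simp
          ultimately show ?thesis using that unfolding closure_approachable by blast
        qed
        have "y \<in> \<Omega> \<inter> ball x0 r" using y e by (auto simp: dist_commute)
        then have "h (P y) < y \<bullet> \<nu>" unfolding eq P_def by simp
        moreover have "\<bar>h (P y) - h (P x)\<bar> \<le> L * norm (y - x)"
          using hL[of y x] normP[of "y - x"] L0 unfolding P_diff by (meson mult_left_mono order_trans)
        moreover have "\<bar>(y - x) \<bullet> \<nu>\<bar> \<le> norm (y - x)" using Cauchy_Schwarz_ineq2[of "y - x" \<nu>] r by simp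
        then have "\<bar>y \<bullet> \<nu> - x \<bullet> \<nu>\<bar> \<le> norm (y - x)" by (simp add: inner_diff_left)
        moreover have "(L + 1) * norm (y - x) < h (P x) - x \<bullet> \<nu>"
          using y(2) L0 by (simp add: dist_norm field_simps)
        ultimately show False by (simp add: algebra_simps)
      qed
    qed
    have "?H (frontier \<Omega> \<inter> ball x0 r) < \<infinity>"
    proof (rule hausdorff_outer_graph_finite[OF r(2) P_def])
      fix x y assume xy: "x \<in> frontier \<Omega> \<inter> ball x0 r" "y \<in> frontier \<Omega> \<inter> ball x0 r"
      have "x - y = P (x - y) + ((x - y) \<bullet> \<nu>) *\<^sub>R \<nu>" by (simp add: P_def)
      then have "norm (x - y) \<le> norm (P (x - y)) + \<bar>(x - y) \<bullet> \<nu>\<bar>"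
        using norm_triangle_ineq[of "P (x - y)" "((x - y) \<bullet> \<nu>) *\<^sub>R \<nu>"] r by simp
      also have "(x - y) \<bullet> \<nu> = h (P x) - h (P y)" using on_graph xy by (simp add: inner_diff_left)
      also have "norm (P (x - y)) + \<bar>h (P x) - h (P y)\<bar> \<le> (1 + L) * norm (P x - P y)"
        using hL[of x y] by (simp add: P_diff algebra_simps)
      finally show "norm (x - y) \<le> (1 + L) * norm (P x - P y)" .
    qed (use L0 in auto)
    then show ?thesis using r by blast
  qed
  then obtain r where r: "\<And>x. x \<in> frontier \<Omega> \<Longrightarrow> r x > 0" "\<And>x. x \<in> frontier \<Omega> \<Longrightarrow> ?H (frontier \<Omega> \<inter> ball x (r x)) < \<infinity>"
    by metis
  have "compact (frontier \<Omega>)" using assms(2) by (simp add: compact_frontier_bounded)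
  moreover have "frontier \<Omega> \<subseteq> (\<Union>x\<in>frontier \<Omega>. ball x (r x))" using r(1) by force
  ultimately obtain X where X: "X \<subseteq> frontier \<Omega>" "finite X" "frontier \<Omega> \<subseteq> (\<Union>x\<in>X. ball x (r x))"
    by (metis (no_types, lifting) compactE_image open_ball)
  have "?H (\<Union>x\<in>X. frontier \<Omega> \<inter> ball x (r x)) < \<infinity>" using X(2,1)
  proof (induction X rule: finite_induct)
    case empty then show ?case by (simp add: hausdorff_outer_empty)
  next
    case (insert x X)
    have "?H (\<Union>x\<in>insert x X. frontier \<Omega> \<inter> ball x (r x)) \<le> ?H (frontier \<Omega> \<inter> ball x (r x)) + ?H (\<Union>x\<in>X. frontier \<Omega> \<inter> ball x (r x))"
      using hausdorff_outer_subadditive by simp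
    also have "\<dots> < \<infinity>" using insert r(2) by (simp add: ennreal_add_less_top)
    finally show ?case .
  qed
  moreover have "(\<Union>x\<in>X. frontier \<Omega> \<inter> ball x (r x)) = frontier \<Omega>" using X by blast
  ultimately show ?thesis by simp
qed

section \<open>Smooth functions as Sobolev functions\<close>

text \<open>Translation invariance gives every difference quotient the integral zero. The quotients
  are bounded and supported in one ball, so dominated convergence passes this on to the
  derivative.\<close>

lemma integral_partial_derivative_eq_0:
  fixes F :: "real^'n \<Rightarrow> 'b::euclidean_space"
  assumes der: "\<And>x. (F has_derivative F' x) (at x)" and cont: "continuous_on UNIV (\<lambda>x. F' x e)"
    and supp: "compact S" "\<And>x. x \<notin> S \<Longrightarrow> F x = 0" "\<And>x. x \<notin> S \<Longrightarrow> F' x e = 0"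
  shows "(LBINT x. F' x e) = 0"
proof -
  obtain M where M: "M > 0" "\<And>x. norm (F' x e) \<le> M"
    using continuous_compact_support_bounded[OF cont supp(1,3)] by metis
  obtain R where R: "R > 0" "\<And>x. x \<in> S \<Longrightarrow> norm x \<le> R"
    using compact_imp_bounded[OF supp(1)] by (meson bounded_pos)
  have Fcont: "continuous_on UNIV F" using der by (meson has_derivative_continuous continuous_at_imp_continuous_on)
  have [measurable]: "F \<in> borel_measurable borel" by (rule borel_measurable_continuous_onI[OF Fcont])
  have [measurable]: "(\<lambda>x. F' x e) \<in> borel_measurable borel" by (rule borel_measurable_continuous_onI[OF cont])
  obtain M0 where M0: "M0 > 0" "\<And>x. norm (F x) \<le> M0"
    using continuous_compact_support_bounded[OF Fcont supp(1,2)] by metis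
  have bint: "integrable lborel (\<lambda>x. c * indicator (cball 0 \<rho>) x :: real)" for c \<rho>
    using emeasure_bounded_finite[OF bounded_cball] by (intro integrable_mult_right integrable_real_indicator) auto
  have Fint: "integrable lborel F"
    by (rule Bochner_Integration.integrable_bound[OF bint[of M0 R]]) (use M0 R supp(2) in \<open>auto simp: indicator_def\<close>)
  define h where "h k = 1 / real (Suc k)" for k
  have h: "0 < h k" "h k \<le> 1" for k by (auto simp: h_def)
  define Q where "Q k x = (1 / h k) *\<^sub>R (F (x + h k *\<^sub>R e) - F x)" for k x
  have line: "((\<lambda>s. F (x + s *\<^sub>R e)) has_derivative (\<lambda>d. d *\<^sub>R F' (x + s *\<^sub>R e) e)) (at s)" for x s
  proof -
    have "((\<lambda>s. F (x + s *\<^sub>R e)) has_derivative (\<lambda>d. F' (x + s *\<^sub>R e) (d *\<^sub>R e))) (at s)"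
      by (rule has_derivative_compose[OF _ der]) (auto intro!: derivative_eq_intros)
    moreover have "F' (x + s *\<^sub>R e) (d *\<^sub>R e) = d *\<^sub>R F' (x + s *\<^sub>R e) e" for d
      using has_derivative_linear[OF der] by (simp add: linear_cmul)
    ultimately show ?thesis by simp
  qed
  have Qbd: "norm (Q k x) \<le> M" for k x
  proof -
    have "norm (F (x + h k *\<^sub>R e) - F (x + 0 *\<^sub>R e)) \<le> M * norm (h k - 0)"
    proof (rule differentiable_bound[of UNIV "\<lambda>s. F (x + s *\<^sub>R e)" "\<lambda>s d. d *\<^sub>R F' (x + s *\<^sub>R e) e"])
      show "onorm (\<lambda>d. d *\<^sub>R F' (x + s *\<^sub>R e) e) \<le> M" for s :: real
        by (rule onorm_le) (use M in \<open>auto simp: mult.commute[of M] intro: mult_left_mono\<close>)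
    qed (use line in auto)
    then have "norm (F (x + h k *\<^sub>R e) - F x) \<le> M * h k" using h[of k] by simp
    then show ?thesis using h[of k] unfolding Q_def norm_scaleR by (simp add: field_simps)
  qed
  \<comment> \<open>The increments satisfy h \<le> 1, so all quotients vanish outside the support
    enlarged by the length of e; this provides the common integrable majorant.\<close>
  have Q0: "Q k x = 0" if "x \<notin> cball 0 (R + norm e)" for k x
  proof -
    have "norm (h k *\<^sub>R e) \<le> norm e" using h[of k] by (simp add: mult_left_le_one_le)
    moreover have "norm x \<le> norm (x + h k *\<^sub>R e) + norm (h k *\<^sub>R e)" by (metis add_diff_cancel_right' norm_triangle_ineq4)
    ultimately have "x + h k *\<^sub>R e \<notin> S" "x \<notin> S" using that R(2)[of "x + h k *\<^sub>R e"] R(2)[of x] norm_ge_zero[of e]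
      by (auto simp: not_le)
    then show ?thesis using supp(2) by (simp add: Q_def)
  qed
  have "(\<lambda>k. LBINT x. Q k x) \<longlonglongrightarrow> (LBINT x. F' x e)"
  proof (rule integral_dominated_convergence[OF _ _ bint[of M "R + norm e"]])
    show "(\<lambda>x. F' x e) \<in> borel_measurable lborel" by measurable
    show "Q k \<in> borel_measurable lborel" for k unfolding Q_def by measurable
    show "AE x in lborel. norm (Q k x) \<le> M * indicator (cball 0 (R + norm e)) x" for k
      using Qbd[of k] Q0[of _ k] by (intro AE_I2) (auto simp: indicator_def)
    show "AE x in lborel. (\<lambda>k. Q k x) \<longlonglongrightarrow> F' x e"
    proof (rule AE_I2)
      fix x
      have "((\<lambda>s. F (x + s *\<^sub>R e)) has_vector_derivative F' x e) (at 0)"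
        using line[of x 0] by (simp add: has_vector_derivative_def)
      then have "((\<lambda>s. norm (F (x + s *\<^sub>R e) - F x - s *\<^sub>R F' x e) / norm s) \<longlongrightarrow> 0) (at 0)"
        unfolding has_vector_derivative_def has_derivative_at by simp
      then have "((\<lambda>s. norm ((1 / s) *\<^sub>R (F (x + s *\<^sub>R e) - F x) - F' x e)) \<longlongrightarrow> 0) (at 0)"
      proof (rule Lim_transform_eventually)
        have "norm (F (x + s *\<^sub>R e) - F x - s *\<^sub>R F' x e) / norm s = norm ((1 / s) *\<^sub>R (F (x + s *\<^sub>R e) - F x) - F' x e)"
          if "s \<noteq> 0" for s
        proof -
          have "(1 / s) *\<^sub>R (F (x + s *\<^sub>R e) - F x) - F' x e = (1 / s) *\<^sub>R (F (x + s *\<^sub>R e) - F x - s *\<^sub>R F' x e)"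
            using that by (simp add: scaleR_diff_right)
          then show ?thesis by (simp only: norm_scaleR) simp
        qed
        then show "\<forall>\<^sub>F s in at 0. norm (F (x + s *\<^sub>R e) - F x - s *\<^sub>R F' x e) / norm s = norm ((1 / s) *\<^sub>R (F (x + s *\<^sub>R e) - F x) - F' x e)"
          by (auto simp: eventually_at_filter)
      qed
      then have "((\<lambda>s. (1 / s) *\<^sub>R (F (x + s *\<^sub>R e) - F x)) \<longlongrightarrow> F' x e) (at 0)"
        by (subst (asm) tendsto_norm_zero_iff) (simp add: LIM_zero_iff)
      moreover have "filterlim h (at 0) sequentially"
        unfolding filterlim_at using h LIMSEQ_Suc[OF lim_1_over_n] by (auto simp: h_def[abs_def] less_imp_neq)
      ultimately show "(\<lambda>k. Q k x) \<longlonglongrightarrow> F' x e" unfolding Q_def by (rule filterlim_compose)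
    qed
  qed
  moreover have "(LBINT x. Q k x) = 0" for k
    using Fint integral_lborel_translate[of F "h k *\<^sub>R e"] by (simp add: Q_def)
  ultimately show ?thesis by (simp add: LIMSEQ_const_iff)
qed

text \<open>The product with the test function has compact support, so its partial derivative
  integrates to zero; the product rule is then the weak identity.\<close>

lemma smooth_weak_gradient:
  fixes f :: "real^'n \<Rightarrow> 'b::euclidean_space"
  assumes "open \<Omega>" "smooth f"
  shows "weak_gradient \<Omega> f (\<lambda>x. \<chi> i. partial i f x)"
  unfolding weak_gradient_def
proof (intro allI impI)
  fix \<phi> :: "real^'n \<Rightarrow> real" and i assume \<phi>: "test_function \<Omega> \<phi>"
  obtain S where S: "smooth \<phi>" "compact S" "S \<subseteq> \<Omega>" "\<And>x. x \<notin> S \<Longrightarrow> \<phi> x = 0"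
    "\<And>x b. x \<notin> S \<Longrightarrow> frechet_derivative \<phi> (at x) b = 0"
    using test_functionE[OF \<phi>] by metis
  let ?e = "axis i 1 :: real^'n"
  have e: "?e \<in> Basis" by (simp add: axis_in_Basis_iff)
  have c: "continuous_on UNIV \<phi>" "continuous_on UNIV f" "continuous_on UNIV (\<lambda>x. frechet_derivative \<phi> (at x) ?e)"
    "continuous_on UNIV (\<lambda>x. frechet_derivative f (at x) ?e)"
    by (intro smooth_continuous_on smooth_continuous_partial S assms e)+
  have "(LBINT x. (\<lambda>h. \<phi> x *\<^sub>R frechet_derivative f (at x) h + frechet_derivative \<phi> (at x) h *\<^sub>R f x) ?e) = 0"
  proof (rule integral_partial_derivative_eq_0[where F="\<lambda>x. \<phi> x *\<^sub>R f x" and S=S])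
    show "((\<lambda>x. \<phi> x *\<^sub>R f x) has_derivative (\<lambda>h. \<phi> x *\<^sub>R frechet_derivative f (at x) h + frechet_derivative \<phi> (at x) h *\<^sub>R f x)) (at x)" for x
      by (intro has_derivative_scaleR smooth_has_derivative S assms)
    show "continuous_on UNIV (\<lambda>x. \<phi> x *\<^sub>R frechet_derivative f (at x) ?e + frechet_derivative \<phi> (at x) ?e *\<^sub>R f x)"
      by (intro continuous_intros c)
  qed (use S in auto)
  moreover have int: "integrable lborel (\<lambda>x. \<phi> x *\<^sub>R frechet_derivative f (at x) ?e)" "integrable lborel (\<lambda>x. frechet_derivative \<phi> (at x) ?e *\<^sub>R f x)"
  proof -
    have *: "integrable lborel k" if k: "continuous_on UNIV k" "\<And>x. x \<notin> S \<Longrightarrow> k x = 0" for k :: "real^'n \<Rightarrow> 'b"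
    proof -
      have "integrable lborel (\<lambda>x. indicator S x *\<^sub>R k x)"
        using S(2) k(1) by (intro borel_integrable_compact) (auto intro: continuous_on_subset)
      moreover have "(\<lambda>x. indicator S x *\<^sub>R k x) = k" using k(2) by (auto simp: indicator_def)
      ultimately show ?thesis by simp
    qed
    show "integrable lborel (\<lambda>x. \<phi> x *\<^sub>R frechet_derivative f (at x) ?e)" "integrable lborel (\<lambda>x. frechet_derivative \<phi> (at x) ?e *\<^sub>R f x)"
      by (intro * continuous_intros c; simp add: S)+
  qed
  ultimately have "(LBINT x. frechet_derivative \<phi> (at x) ?e *\<^sub>R f x) = - (LBINT x. \<phi> x *\<^sub>R frechet_derivative f (at x) ?e)"
    by (simp add: eq_neg_iff_add_eq_0 add.commute)
  moreover have "(LINT x|lebesgue_on \<Omega>. frechet_derivative \<phi> (at x) ?e *\<^sub>R f x) = (LBINT x. frechet_derivative \<phi> (at x) ?e *\<^sub>R f x)"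
    using S assms(1) by (intro lebesgue_on_lborel(2) borel_measurable_continuous_onI continuous_intros c) auto
  moreover have "(LINT x|lebesgue_on \<Omega>. \<phi> x *\<^sub>R frechet_derivative f (at x) ?e) = (LBINT x. \<phi> x *\<^sub>R frechet_derivative f (at x) ?e)"
    using S assms(1) by (intro lebesgue_on_lborel(2) borel_measurable_continuous_onI continuous_intros c) auto
  ultimately show "(LINT x|lebesgue_on \<Omega>. frechet_derivative \<phi> (at x) ?e *\<^sub>R f x)
    = - (LINT x|lebesgue_on \<Omega>. \<phi> x *\<^sub>R (\<chi> i. partial i f x) $ i)" by simp
qed

lemma smooth_H1:
  fixes f :: "real^'n \<Rightarrow> 'b::euclidean_space"
  assumes "open \<Omega>" "bounded \<Omega>" "smooth f"
  shows "f \<in> H1 \<Omega>"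
proof -
  have "continuous_on UNIV (\<lambda>x. \<chi> i. partial i f x)"
    by (intro continuous_on_vec_lambda smooth_continuous_partial assms) (simp add: axis_in_Basis_iff)
  then have "(\<lambda>x. \<chi> i. partial i f x) \<in> L2 \<Omega>"
    using assms by (intro continuous_L2) auto
  moreover have "f \<in> L2 \<Omega>" using assms by (intro continuous_L2 smooth_continuous_on) auto
  ultimately show ?thesis using smooth_weak_gradient[OF assms(1,3)] by (auto simp: H1_def)
qed

section \<open>Zero extension of functions with zero trace\<close>

text \<open>A covering set may be a single point, whereas a ball needs a positive radius strictly
  above the diameter. The assumption d \<le> \<delta>/2 leaves room to enlarge while staying below
  \<delta>.\<close>

lemma hausdorff_cover_radius:
  fixes d \<delta> \<epsilon> s :: real
  assumes "0 \<le> d" "d \<le> \<delta> / 2" "0 < \<delta>" "0 < \<epsilon>" "0 < s"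
  obtains r where "d < r" "0 < r" "r \<le> \<delta>" "r powr s \<le> d powr s + \<epsilon>"
proof -
  \<comment> \<open>The cap is the room between \<open>(\<delta> / 2) powr s\<close> and
    \<open>\<delta> powr s\<close>, so the enlarged radius cannot exceed \<delta>.\<close>
  define \<epsilon>' where "\<epsilon>' = min \<epsilon> (\<delta> powr s - (\<delta> / 2) powr s)"
  have "(\<delta> / 2) powr s < \<delta> powr s" using assms by (intro powr_less_mono2) auto
  then have \<epsilon>': "0 < \<epsilon>'" using assms by (simp add: \<epsilon>'_def)
  define r where "r = (d powr s + \<epsilon>') powr (1 / s)"
  have pos: "0 < d powr s + \<epsilon>'" using \<epsilon>' by (simp add: add_nonneg_pos)
  then have r0: "0 < r" by (simp add: r_def)
  have rs: "r powr s = d powr s + \<epsilon>'" using pos assms by (simp add: r_def powr_powr)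
  show ?thesis
  proof (rule that[OF _ r0])
    show "d < r"
    proof (rule ccontr)
      assume "\<not> d < r"
      then have "r powr s \<le> d powr s" using r0 assms by (intro powr_mono2) auto
      then show False using rs \<epsilon>' by simp
    qed
    show "r powr s \<le> d powr s + \<epsilon>" unfolding rs by (simp add: \<epsilon>'_def)
    show "r \<le> \<delta>"
    proof (rule ccontr)
      assume "\<not> r \<le> \<delta>"
      then have "\<delta> powr s < r powr s" using assms by (intro powr_less_mono2) auto
      moreover have "d powr s \<le> (\<delta> / 2) powr s" using assms by (intro powr_mono2) auto
      ultimately show False unfolding rs by (simp add: \<epsilon>'_def)
    qed
  qed
qed

text \<open>A discrete upper bound for the surface integral of g. The set is sliced by the values of
  g, each slice is covered almost optimally, and compactness selects finitely many balls. The weight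
  bounds g on balls enlarged by \<kappa>, because later cutoffs reach that far. The factor
  \<open>2 powr s / unit_ball_vol s\<close> appears as the Hausdorff cost uses half the diameter,
  while a ball about a point of the covering set needs about the full diameter as radius.\<close>

lemma hausdorff_weighted_cover:
  fixes S :: "'a::euclidean_space set" and g :: "'a \<Rightarrow> real"
  assumes S: "compact S" and s: "0 < s" and fin: "hausdorff_outer s S < \<infinity>"
    and g: "continuous_on UNIV g" "\<And>x. 0 \<le> g x" and \<eta>: "0 < \<eta>" and \<kappa>: "1 \<le> \<kappa>" and \<tau>: "0 < \<tau>"
  shows "\<exists>(J :: (nat \<times> nat) set) c r m. finite J \<and> (\<forall>j\<in>J. c j \<in> S) \<and> (\<forall>j\<in>J. 0 < r j \<and> r j \<le> \<tau>) \<and>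
    (\<forall>j\<in>J. \<forall>y\<in>cball (c j) (\<kappa> * r j). g y \<le> m j) \<and> (\<forall>j\<in>J. 0 \<le> m j) \<and> S \<subseteq> (\<Union>j\<in>J. ball (c j) (r j)) \<and>
    (\<Sum>j\<in>J. ennreal (m j * r j powr s)) \<le> ennreal (2 powr s / unit_ball_vol s)
       * (\<integral>\<^sup>+x. ennreal (g x + 2 * \<eta>) * indicator S x \<partial>hausdorff_measure s) + ennreal \<eta>"
proof -
  let ?H = "hausdorff_measure s :: 'a measure"
  define Cs where "Cs = 2 powr s / unit_ball_vol s"
  have ubv: "0 < unit_ball_vol s" using s by (intro unit_ball_vol_pos) auto
  then have Cs: "0 < Cs" by (simp add: Cs_def)
  obtain R where R: "S \<subseteq> cball 0 R" using compact_imp_bounded[OF S] by (metis bounded_iff mem_cball_0 subsetI)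
  have "uniformly_continuous_on (cball 0 (R + 1)) g"
    using g(1) by (intro compact_uniformly_continuous) (auto intro: continuous_on_subset)
  then obtain d0 where d0: "d0 > 0" "\<And>x y. x \<in> cball 0 (R + 1) \<Longrightarrow> y \<in> cball 0 (R + 1) \<Longrightarrow> dist y x < d0 \<Longrightarrow> dist (g y) (g x) < \<eta>"
    unfolding uniformly_continuous_on_def using \<eta> by metis
  \<comment> \<open>Balls of radius \<kappa> \<delta> are to stay where uniform continuity was taken
    and to change g by less than \<eta>; the bound \<tau> on the radii is imposed as well.\<close>
  define \<delta> where "\<delta> = min \<tau> (min (d0 / (2 * \<kappa>)) (1 / \<kappa>))"
  have \<delta>: "0 < \<delta>" "\<delta> \<le> \<tau>" "\<kappa> * \<delta> < d0" "\<kappa> * \<delta> \<le> 1"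
  proof -
    show "0 < \<delta>" "\<delta> \<le> \<tau>" using \<tau> d0 \<kappa> by (auto simp: \<delta>_def)
    have "\<delta> \<le> d0 / (2 * \<kappa>)" "\<delta> \<le> 1 / \<kappa>" by (auto simp: \<delta>_def)
    then show "\<kappa> * \<delta> < d0" "\<kappa> * \<delta> \<le> 1" using \<kappa> d0(1) by (auto simp: field_simps)
  qed
  have close: "g y \<le> g x + \<eta>" if "x \<in> S" "y \<in> cball z (\<kappa> * \<delta>)" "z = x" for x y z
  proof -
    have "dist y x < d0" using that \<delta> by (simp add: dist_commute)
    moreover have "y \<in> cball 0 (R + 1)" "x \<in> cball 0 (R + 1)"
    proof -
      have "norm x \<le> R" using R that by auto
      moreover have "norm y \<le> norm x + dist x y" using norm_triangle_sub[of y x] by (simp add: dist_norm norm_minus_commute)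
      moreover have "dist x y \<le> 1" using that \<delta>(4) by simp
      ultimately show "y \<in> cball 0 (R + 1)" "x \<in> cball 0 (R + 1)" by auto
    qed
    ultimately have "dist (g y) (g x) < \<eta>" using d0(2) by blast
    then show ?thesis by (simp add: dist_real_def)
  qed
  obtain b where b: "\<And>x. x \<in> S \<Longrightarrow> g x \<le> b"
  proof -
    have "bounded (g ` S)" using S g(1) by (intro compact_imp_bounded compact_continuous_image) (auto intro: continuous_on_subset)
    then show ?thesis using that by (auto simp: bounded_iff) (metis abs_le_D1)
  qed
  obtain M :: nat where M: "b < real M * \<eta>" using \<eta> reals_Archimedean3 by blast
  \<comment> \<open>Slices of height \<eta>: on each of them g is constant up to \<eta>, so one
    weight per slice loses only a multiple of \<eta>.\<close>
  define A where "A k = {x \<in> S. real k * \<eta> \<le> g x \<and> g x < (real k + 1) * \<eta>}" for k :: nat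
  have [measurable]: "g \<in> borel_measurable borel" by (rule borel_measurable_continuous_onI[OF g(1)])
  have Sb[measurable]: "S \<in> sets borel" using S by (simp add: borel_compact)
  have A[measurable]: "A k \<in> sets borel" for k unfolding A_def by measurable
  have A_S: "A k \<subseteq> S" for k by (auto simp: A_def)
  have cover_A: "\<exists>k<M. x \<in> A k" if "x \<in> S" for x
  proof -
    define k where "k = nat \<lfloor>g x / \<eta>\<rfloor>"
    have "real k = of_int \<lfloor>g x / \<eta>\<rfloor>" using g(2)[of x] \<eta> by (simp add: k_def)
    then have k: "real k \<le> g x / \<eta>" "g x / \<eta> < real k + 1" by linarith+
    then have "x \<in> A k" using \<eta> that by (simp add: A_def field_simps)
    moreover have "k < M"
    proof -
      have "real k * \<eta> \<le> g x" using k \<eta> by (simp add: field_simps)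
      also have "\<dots> < real M * \<eta>" using b[OF that] M by simp
      finally show ?thesis using \<eta> by simp
    qed
    ultimately show ?thesis by blast
  qed
  have disj_A: "x \<notin> A l" if "x \<in> A k" "k \<noteq> l" for x k l
  proof
    assume "x \<in> A l"
    then have "real k * \<eta> < (real l + 1) * \<eta>" "real l * \<eta> < (real k + 1) * \<eta>" using that(1) by (auto simp: A_def)
    then have "real k < real l + 1" "real l < real k + 1" using \<eta> by (auto simp: mult_less_cancel_right)
    then show False using that(2) by linarith
  qed
  have HA_fin: "hausdorff_outer s (A k) < \<infinity>" for k
    using hausdorff_outer_mono[OF A_S[of k]] fin by (rule le_less_trans)
  define Q where "Q = (\<Sum>k<M. (real k + 2) * \<eta>)"
  have Q0: "0 \<le> Q" unfolding Q_def using \<eta> by (intro sum_nonneg) auto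
  \<comment> \<open>Each slice exceeds its optimal cost by at most (Cs + 1) \<zeta>, and the weights
    of all slices add up to Q. The excess in total is then at most \<eta> Q/(Q+1), hence at most
    \<eta>.\<close>
  define \<zeta> where "\<zeta> = \<eta> / ((Q + 1) * (Cs + 1))"
  have \<zeta>: "0 < \<zeta>" unfolding \<zeta>_def using \<eta> Q0 Cs by simp
  have "\<exists>C. C \<in> hausdorff_covers (\<delta> / 2) (A k) \<and> (\<Sum>i. hausdorff_cost s (C i)) < hausdorff_outer s (A k) + ennreal \<zeta>" for k
  proof -
    have "hausdorff_pre s (\<delta> / 2) (A k) \<le> hausdorff_outer s (A k)" using \<delta> by (intro hausdorff_pre_le_outer) auto
    also have "\<dots> < hausdorff_outer s (A k) + ennreal \<zeta>" using HA_fin[of k] \<zeta> by (simp add: ennreal_add_left_cancel_less) 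
    finally show ?thesis using hausdorff_pre_close by metis
  qed
  then obtain C where C: "\<And>k. C k \<in> hausdorff_covers (\<delta> / 2) (A k)"
    "\<And>k. (\<Sum>i. hausdorff_cost s (C k i)) < hausdorff_outer s (A k) + ennreal \<zeta>" by metis
  have C': "bounded (C k i)" "diameter (C k i) \<le> \<delta> / 2" for k i using C(1)[of k] by (auto simp: hausdorff_covers_def)
  have diam0: "0 \<le> diameter (C k i)" for k i by (rule diameter_ge_0[OF C'(1)])
  have "\<exists>r. diameter (C k i) < r \<and> 0 < r \<and> r \<le> \<delta> \<and> r powr s \<le> diameter (C k i) powr s + \<zeta> * (1/2) ^ Suc i" for k i
    by (rule hausdorff_cover_radius[OF diam0 C'(2) \<delta>(1) _ s, of "\<zeta> * (1/2) ^ Suc i" k i]) (use \<zeta> in auto)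
  then obtain \<rho> where \<rho>: "\<And>k i. diameter (C k i) < \<rho> k i" "\<And>k i. 0 < \<rho> k i" "\<And>k i. \<rho> k i \<le> \<delta>"
    "\<And>k i. \<rho> k i powr s \<le> diameter (C k i) powr s + \<zeta> * (1/2) ^ Suc i" by metis
  \<comment> \<open>The centre is taken in the slice itself, so it belongs to S and the value of g
    there is known up to \<eta>. Covering sets missing their slice are dropped from the index
    set.\<close>
  define z where "z k i = (SOME x. x \<in> C k i \<inter> A k)" for k i
  have z: "z k i \<in> C k i" "z k i \<in> A k" if "C k i \<inter> A k \<noteq> {}" for k i
    using that some_in_eq[of "C k i \<inter> A k"] unfolding z_def by auto
  define I where "I = {(k, i). k < M \<and> C k i \<inter> A k \<noteq> {}}"
  have "S \<subseteq> (\<Union>j\<in>I. ball (z (fst j) (snd j)) (\<rho> (fst j) (snd j)))"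
  proof
    fix x assume "x \<in> S"
    then obtain k where k: "k < M" "x \<in> A k" using cover_A by blast
    then obtain i where i: "x \<in> C k i" using C(1)[of k] by (auto simp: hausdorff_covers_def)
    have "(k, i) \<in> I" using k i by (auto simp: I_def)
    moreover have "dist (z k i) x \<le> diameter (C k i)"
      using z(1)[of k i] k i C'(1)[of k i] by (intro diameter_bounded_bound) auto
    then have "x \<in> ball (z k i) (\<rho> k i)" using \<rho>(1)[of k i] by simp
    ultimately show "x \<in> (\<Union>j\<in>I. ball (z (fst j) (snd j)) (\<rho> (fst j) (snd j)))" by force
  qed
  then obtain J where J: "J \<subseteq> I" "finite J" "S \<subseteq> (\<Union>j\<in>J. ball (z (fst j) (snd j)) (\<rho> (fst j) (snd j)))"
    using compactE_image[OF S, of I "\<lambda>j. ball (z (fst j) (snd j)) (\<rho> (fst j) (snd j))"] by auto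
  \<comment> \<open>At the centre g is below (k+1) \<eta>, and it varies by at most \<eta> on the
    enlarged ball; on the slice itself the weight is at most g + 2 \<eta>.\<close>
  define m where "m j = (real (fst j) + 2) * \<eta>" for j :: "nat \<times> nat"
  show ?thesis
  proof (rule exI[of _ J], rule exI[of _ "\<lambda>j. z (fst j) (snd j)"], rule exI[of _ "\<lambda>j. \<rho> (fst j) (snd j)"],
      rule exI[of _ m], intro conjI ballI)
    show "finite J" by fact
    show "S \<subseteq> (\<Union>j\<in>J. ball (z (fst j) (snd j)) (\<rho> (fst j) (snd j)))" by fact
    fix j assume j: "j \<in> J"
    then have "j \<in> I" using J(1) by blast
    then have "C (fst j) (snd j) \<inter> A (fst j) \<noteq> {}" by (auto simp: I_def)
    then have zj: "z (fst j) (snd j) \<in> A (fst j)" by (rule z(2))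
    then show zS: "z (fst j) (snd j) \<in> S" using A_S by blast
    show "0 < \<rho> (fst j) (snd j)" "\<rho> (fst j) (snd j) \<le> \<tau>" using \<rho>(2,3)[of "fst j" "snd j"] \<delta>(2) by simp_all
    show "0 \<le> m j" using \<eta> by (simp add: m_def)
    fix y assume "y \<in> cball (z (fst j) (snd j)) (\<kappa> * \<rho> (fst j) (snd j))"
    moreover have "\<kappa> * \<rho> (fst j) (snd j) \<le> \<kappa> * \<delta>" using \<rho>(3) \<kappa> by (intro mult_left_mono) auto
    ultimately have "y \<in> cball (z (fst j) (snd j)) (\<kappa> * \<delta>)" by auto
    then have "g y \<le> g (z (fst j) (snd j)) + \<eta>" using close[OF zS] by blast
    also have "g (z (fst j) (snd j)) \<le> (real (fst j) + 1) * \<eta>" using zj by (simp add: A_def)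
    finally show "g y \<le> m j" by (simp add: m_def algebra_simps)
  next
    have r_le: "ennreal (\<rho> k i powr s) \<le> ennreal Cs * hausdorff_cost s (C k i) + ennreal (\<zeta> * (1/2) ^ Suc i)" for k i
    proof -
      have "ennreal Cs * hausdorff_cost s (C k i) = ennreal (diameter (C k i) powr s)"
        unfolding hausdorff_cost_def Cs_def using ubv diam0[of k i]
        by (simp add: ennreal_mult[symmetric] powr_divide)
      moreover have "ennreal (\<rho> k i powr s) \<le> ennreal (diameter (C k i) powr s + \<zeta> * (1/2) ^ Suc i)" by (rule ennreal_leI[OF \<rho>(4)])
      ultimately show ?thesis using \<zeta> by (simp add: ennreal_plus)
    qed
    have row: "(\<Sum>i. ennreal (\<rho> k i powr s)) \<le> ennreal Cs * hausdorff_outer s (A k) + ennreal ((Cs + 1) * \<zeta>)" for k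
    proof -
      have "(\<Sum>i. ennreal (\<rho> k i powr s)) \<le> (\<Sum>i. ennreal Cs * hausdorff_cost s (C k i) + ennreal (\<zeta> * (1/2) ^ Suc i))"
        by (intro suminf_le r_le summableI)
      also have "\<dots> = ennreal Cs * (\<Sum>i. hausdorff_cost s (C k i)) + (\<Sum>i. ennreal \<zeta> * ennreal ((1/2) ^ Suc i))"
        using \<zeta> by (subst suminf_add[symmetric]) (auto simp add: ennreal_mult[symmetric] simp del: power_Suc)
      also have "(\<Sum>i. ennreal \<zeta> * ennreal ((1/2) ^ Suc i)) = ennreal \<zeta>"
        unfolding ennreal_suminf_cmult by (subst suminf_ennreal_eq[OF zero_le_power power_half_series]) auto
      also have "ennreal Cs * (\<Sum>i. hausdorff_cost s (C k i)) + ennreal \<zeta> \<le> ennreal Cs * (hausdorff_outer s (A k) + ennreal \<zeta>) + ennreal \<zeta>"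
        by (intro add_right_mono mult_left_mono less_imp_le[OF C(2)]) auto
      also have "\<dots> = ennreal Cs * hausdorff_outer s (A k) + ennreal ((Cs + 1) * \<zeta>)"
        using Cs \<zeta> by (simp add: distrib_left ennreal_mult[symmetric] add.assoc ennreal_plus[symmetric] algebra_simps del: ennreal_plus)
      finally show ?thesis .
    qed
    have "(\<Sum>j\<in>J. ennreal (m j * \<rho> (fst j) (snd j) powr s)) \<le> (\<Sum>k<M. \<Sum>i. ennreal ((real k + 2) * \<eta>) * ennreal (\<rho> k i powr s))"
    proof -
      obtain L where L: "snd ` J \<subseteq> {..<L}" using J(2) finite_nat_iff_bounded by blast
      have "J \<subseteq> {..<M} \<times> {..<L}" using J(1) L by (force simp: I_def)
      then have "(\<Sum>j\<in>J. ennreal (m j * \<rho> (fst j) (snd j) powr s)) \<le> (\<Sum>j\<in>{..<M} \<times> {..<L}. ennreal (m j * \<rho> (fst j) (snd j) powr s))"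
        by (intro sum_mono2) auto
      also have "\<dots> = (\<Sum>k<M. \<Sum>i<L. ennreal ((real k + 2) * \<eta>) * ennreal (\<rho> k i powr s))"
        using \<eta> unfolding sum.cartesian_product by (intro sum.cong) (auto simp: m_def ennreal_mult)
      also have "\<dots> \<le> (\<Sum>k<M. \<Sum>i. ennreal ((real k + 2) * \<eta>) * ennreal (\<rho> k i powr s))"
        by (intro sum_mono sum_le_suminf) auto
      finally show ?thesis .
    qed
    also have "\<dots> = (\<Sum>k<M. ennreal ((real k + 2) * \<eta>) * (\<Sum>i. ennreal (\<rho> k i powr s)))" by simp
    also have "\<dots> \<le> (\<Sum>k<M. ennreal ((real k + 2) * \<eta>) * (ennreal Cs * hausdorff_outer s (A k) + ennreal ((Cs + 1) * \<zeta>)))"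
      by (intro sum_mono mult_left_mono row) auto
    also have "\<dots> = ennreal Cs * (\<Sum>k<M. ennreal ((real k + 2) * \<eta>) * hausdorff_outer s (A k)) + ennreal ((Cs + 1) * \<zeta>) * (\<Sum>k<M. ennreal ((real k + 2) * \<eta>))"
      by (simp add: distrib_left sum.distrib sum_distrib_left mult_ac)
    also have "ennreal ((Cs + 1) * \<zeta>) * (\<Sum>k<M. ennreal ((real k + 2) * \<eta>)) \<le> ennreal \<eta>"
    proof -
      have "(\<Sum>k<M. ennreal ((real k + 2) * \<eta>)) = ennreal Q" unfolding Q_def using \<eta> by (intro sum_ennreal) auto
      moreover have "(Cs + 1) * \<zeta> * Q \<le> \<eta>"
      proof -
        have cancel: "a * (\<eta> / (b * a)) * q = \<eta> * (q / b)" if "a \<noteq> 0" for a b q :: real using that by simp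
        have "(Cs + 1) * \<zeta> * Q = \<eta> * (Q / (Q + 1))" unfolding \<zeta>_def by (rule cancel) (use Cs in simp)
        also have "\<dots> \<le> \<eta> * 1" using \<eta> Q0 by (intro mult_left_mono) auto
        finally show ?thesis by simp
      qed
      ultimately show ?thesis using Q0 Cs \<zeta> by (simp add: ennreal_mult[symmetric] ennreal_leI)
    qed
    also have "(\<Sum>k<M. ennreal ((real k + 2) * \<eta>) * hausdorff_outer s (A k)) \<le> (\<integral>\<^sup>+x. ennreal (g x + 2 * \<eta>) * indicator S x \<partial>?H)"
    proof -
      have "(\<Sum>k<M. ennreal ((real k + 2) * \<eta>) * hausdorff_outer s (A k)) = (\<Sum>k<M. \<integral>\<^sup>+x. ennreal ((real k + 2) * \<eta>) * indicator (A k) x \<partial>?H)"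
        by (intro sum.cong refl) (simp add: nn_integral_cmult_indicator emeasure_hausdorff_measure)
      also have "\<dots> = (\<integral>\<^sup>+x. (\<Sum>k<M. ennreal ((real k + 2) * \<eta>) * indicator (A k) x) \<partial>?H)"
        by (intro nn_integral_sum[symmetric]) measurable
      also have "\<dots> \<le> (\<integral>\<^sup>+x. ennreal (g x + 2 * \<eta>) * indicator S x \<partial>?H)"
      proof (rule nn_integral_mono)
        fix x
        show "(\<Sum>k<M. ennreal ((real k + 2) * \<eta>) * indicator (A k) x) \<le> ennreal (g x + 2 * \<eta>) * indicator S x"
        proof (cases "x \<in> S")
          case True
          then obtain k where k: "k < M" "x \<in> A k" using cover_A by blast
          have "(\<Sum>l<M. ennreal ((real l + 2) * \<eta>) * indicator (A l) x) = (\<Sum>l\<in>{k}. ennreal ((real l + 2) * \<eta>) * indicator (A l) x)"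
            using k disj_A by (intro sum.mono_neutral_right) (auto simp: indicator_def)
          also have "\<dots> \<le> ennreal (g x + 2 * \<eta>)"
          proof -
            have "(real k + 2) * \<eta> \<le> g x + 2 * \<eta>" using k(2) by (simp add: A_def algebra_simps)
            then show ?thesis using k(2) by (simp add: ennreal_leI)
          qed
          finally show ?thesis using True by simp
        next
          case False
          then have "x \<notin> A k" for k using A_S by blast
          then show ?thesis by simp
        qed
      qed
      finally show ?thesis .
    qed
    finally show "(\<Sum>j\<in>J. ennreal (m j * \<rho> (fst j) (snd j) powr s)) \<le> ennreal (2 powr s / unit_ball_vol s)
       * (\<integral>\<^sup>+x. ennreal (g x + 2 * \<eta>) * indicator S x \<partial>?H) + ennreal \<eta>"
      unfolding Cs_def by (simp add: mult_left_mono add_mono)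
  qed
qed

section \<open>Cutoffs vanishing near the boundary\<close>

text \<open>In the product rule all other factors lie between 0 and 1. A product of cutoffs is thus
  controlled by the sum of their derivatives, however often their supports overlap.\<close>

lemma partial_prod_le:
  fixes f :: "'i \<Rightarrow> real^'n \<Rightarrow> real"
  assumes "finite I" "\<And>i. i \<in> I \<Longrightarrow> f i differentiable (at x)" "\<And>i. i \<in> I \<Longrightarrow> 0 \<le> f i x" "\<And>i. i \<in> I \<Longrightarrow> f i x \<le> 1"
  shows "(\<lambda>x. \<Prod>i\<in>I. f i x) differentiable (at x) \<and>
    \<bar>frechet_derivative (\<lambda>x. \<Prod>i\<in>I. f i x) (at x) e\<bar> \<le> (\<Sum>i\<in>I. \<bar>frechet_derivative (f i) (at x) e\<bar>)"
  using assms
proof (induction I rule: finite_induct)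
  case empty
  then show ?case by (simp add: frechet_derivative_const)
next
  case (insert i I)
  let ?P = "\<lambda>x. \<Prod>i\<in>I. f i x"
  have IH: "?P differentiable (at x)" "\<bar>frechet_derivative ?P (at x) e\<bar> \<le> (\<Sum>i\<in>I. \<bar>frechet_derivative (f i) (at x) e\<bar>)"
    using insert.IH insert.prems by auto
  have d: "((\<lambda>x. f i x * ?P x) has_derivative (\<lambda>h. f i x * frechet_derivative ?P (at x) h + frechet_derivative (f i) (at x) h * ?P x)) (at x)"
    using insert.prems IH by (intro has_derivative_mult) (auto simp: frechet_derivative_works)
  have P01: "0 \<le> ?P x" "?P x \<le> 1" using insert.prems by (auto intro!: prod_nonneg prod_le_1)
  have f01: "0 \<le> f i x" "f i x \<le> 1" using insert.prems by auto
  have "\<bar>f i x * frechet_derivative ?P (at x) e + frechet_derivative (f i) (at x) e * ?P x\<bar>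
     \<le> \<bar>f i x\<bar> * \<bar>frechet_derivative ?P (at x) e\<bar> + \<bar>frechet_derivative (f i) (at x) e\<bar> * \<bar>?P x\<bar>"
    by (rule order_trans[OF abs_triangle_ineq]) (simp add: abs_mult)
  also have "\<dots> \<le> 1 * \<bar>frechet_derivative ?P (at x) e\<bar> + \<bar>frechet_derivative (f i) (at x) e\<bar> * 1"
    using P01 f01 by (intro add_mono mult_right_mono mult_left_mono) auto
  finally have "\<bar>frechet_derivative (\<lambda>x. f i x * ?P x) (at x) e\<bar> \<le> \<bar>frechet_derivative (f i) (at x) e\<bar> + (\<Sum>i\<in>I. \<bar>frechet_derivative (f i) (at x) e\<bar>)"
    unfolding frechet_derivative_at[OF d, symmetric] using IH by simp
  then show ?case using insert.hyps differentiableI[OF d] by simp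
qed

lemma plateau_exists:
  obtains pl :: "real \<Rightarrow> real" and M where "smooth pl" "\<And>y. 0 \<le> pl y" "\<And>y. pl y \<le> 1" "\<And>y. \<bar>y\<bar> \<le> 1 \<Longrightarrow> pl y = 1"
    "\<And>y. \<bar>y\<bar> \<ge> 2 \<Longrightarrow> pl y = 0" "0 < M" "\<And>y. \<bar>frechet_derivative pl (at y) 1\<bar> \<le> M"
proof -
  obtain \<theta> :: "real \<Rightarrow> real" where \<theta>: "smooth \<theta>" "\<And>x. x \<le> 0 \<Longrightarrow> \<theta> x = 0" "\<And>x. x \<ge> 1 \<Longrightarrow> \<theta> x = 1"
    "\<And>x. 0 \<le> \<theta> x" "\<And>x. \<theta> x \<le> 1" using smooth_step_exists by metis
  define pl where "pl y = \<theta> ((-1) *\<^sub>R y + 2) * \<theta> (1 *\<^sub>R y + 2)" for y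
  have sm: "smooth pl" unfolding pl_def by (intro smooth_mult smooth_affine \<theta>)
  have z: "pl y = 0" if "\<bar>y\<bar> \<ge> 2" for y using that \<theta>(2) by (auto simp: pl_def abs_if split: if_splits)
  have "test_function UNIV pl"
    by (rule test_functionI[OF sm, of "{-2..2}"]) (auto intro!: z simp: abs_if)
  then obtain S where S: "compact S" "\<And>x b. x \<notin> S \<Longrightarrow> frechet_derivative pl (at x) b = 0" using test_functionE by metis
  obtain M where M: "M > 0" "\<And>x. norm (frechet_derivative pl (at x) 1) \<le> M"
    using continuous_compact_support_bounded[OF smooth_continuous_partial[OF sm, of 1] S(1)] S(2) by auto
  show ?thesis
  proof (rule that[OF sm _ _ _ z M(1)])
    show "\<bar>frechet_derivative pl (at y) 1\<bar> \<le> M" for y using M(2)[of y] by simp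
  qed (use \<theta> in \<open>auto simp: pl_def mult_le_one\<close>)
qed

text \<open>A product of one-dimensional plateaus rescaled by r. It lives in the cube of half side
  2r, which lies in the ball of radius 2 n r by the bound of the Euclidean norm by the sum of the
  coordinates; hence the enlargement factor.\<close>

lemma cube_cutoff_exists:
  "\<exists>C>0. \<forall>c r. 0 < r \<longrightarrow> (\<exists>\<Lambda> :: real^'n \<Rightarrow> real. smooth \<Lambda> \<and> (\<forall>x. 0 \<le> \<Lambda> x \<and> \<Lambda> x \<le> 1) \<and>
     (\<forall>x\<in>cball c r. \<Lambda> x = 1) \<and> (\<forall>x. x \<notin> cball c (2 * real CARD('n) * r) \<longrightarrow> \<Lambda> x = 0) \<and>
     (\<forall>x i. \<bar>partial i \<Lambda> x\<bar> \<le> C / r) \<and>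
     (\<forall>x i. x \<notin> cball c (2 * real CARD('n) * r) \<longrightarrow> partial i \<Lambda> x = 0))"
proof -
  obtain pl :: "real \<Rightarrow> real" and M where pl: "smooth pl" "\<And>y. 0 \<le> pl y" "\<And>y. pl y \<le> 1" "\<And>y. \<bar>y\<bar> \<le> 1 \<Longrightarrow> pl y = 1"
    "\<And>y. \<bar>y\<bar> \<ge> 2 \<Longrightarrow> pl y = 0" "0 < M" "\<And>y. \<bar>frechet_derivative pl (at y) 1\<bar> \<le> M"
    using plateau_exists by blast
  have main: "\<exists>\<Lambda> :: real^'n \<Rightarrow> real. smooth \<Lambda> \<and> (\<forall>x. 0 \<le> \<Lambda> x \<and> \<Lambda> x \<le> 1) \<and>
     (\<forall>x\<in>cball c r. \<Lambda> x = 1) \<and> (\<forall>x. x \<notin> cball c (2 * real CARD('n) * r) \<longrightarrow> \<Lambda> x = 0) \<and>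
     (\<forall>x i. \<bar>partial i \<Lambda> x\<bar> \<le> real CARD('n) * M / r) \<and>
     (\<forall>x i. x \<notin> cball c (2 * real CARD('n) * r) \<longrightarrow> partial i \<Lambda> x = 0)"
    if r: "0 < r" for c r
  proof -
    define f where "f i x = pl ((1 / r) *\<^sub>R x $ i + (- c $ i / r))" for i and x :: "real^'n"
    have feq: "f i x = pl ((x $ i - c $ i) / r)" for i x by (simp add: f_def diff_divide_distrib)
    have fsm: "smooth (f i)" for i unfolding f_def
      using smooth_coordinate[OF smooth_affine[OF pl(1), of "1 / r" "- c $ i / r"], of i] by simp
    have fder: "\<bar>partial j (f i) x\<bar> \<le> M / r" for i j x
    proof -
      let ?y = "(x $ i - c $ i) / r"
      have "((\<lambda>x. (x $ i - c $ i) / r) has_derivative (\<lambda>h. h $ i / r)) (at x)"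
      proof -
        have "((\<lambda>x. (1 / r) *\<^sub>R (x $ i - c $ i)) has_derivative (\<lambda>h. (1 / r) *\<^sub>R (h $ i - 0))) (at x)"
          by (intro has_derivative_scaleR_right has_derivative_diff has_derivative_const
              bounded_linear_imp_has_derivative bounded_linear_vec_nth)
        then show ?thesis by simp
      qed
      from has_derivative_compose[OF this smooth_has_derivative[OF pl(1)]]
      have d: "((\<lambda>x. f i x) has_derivative (\<lambda>h. frechet_derivative pl (at ?y) (h $ i / r))) (at x)" unfolding feq .
      have "partial j (f i) x = frechet_derivative pl (at ?y) ((axis j 1 :: real^'n) $ i / r)"
        using fun_cong[OF frechet_derivative_at[OF d], of "axis j 1"] by simp
      also have "\<dots> = ((axis j 1 :: real^'n) $ i / r) * frechet_derivative pl (at ?y) 1"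
        by (rule frechet_derivative_real[OF smooth_differentiable[OF pl(1)], unfolded real_scaleR_def])
      finally show ?thesis using pl(6) pl(7)[of ?y] r by (auto simp: axis_def abs_mult divide_right_mono)
    qed
    define \<Lambda> where "\<Lambda> x = (\<Prod>i\<in>UNIV. f i x)" for x
    let ?K = "cball c (2 * real CARD('n) * r)"
    have out: "\<Lambda> x = 0" if "x \<notin> ?K" for x
    proof -
      have "\<exists>i. 2 * r \<le> \<bar>(x - c) $ i\<bar>"
      proof (rule ccontr)
        assume "\<not> (\<exists>i. 2 * r \<le> \<bar>(x - c) $ i\<bar>)"
        then have "(\<Sum>i\<in>UNIV. \<bar>(x - c) $ i\<bar>) \<le> (\<Sum>i\<in>(UNIV::'n set). 2 * r)" by (intro sum_mono) (simp add: not_le less_imp_le)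
        then have "norm (x - c) \<le> 2 * real CARD('n) * r" using norm_le_l1_cart[of "x - c"] by simp
        then show False using that by (simp add: dist_norm norm_minus_commute)
      qed
      then obtain i where "2 * r \<le> \<bar>x $ i - c $ i\<bar>" by auto
      then have "2 \<le> \<bar>(x $ i - c $ i) / r\<bar>" using r by (simp add: field_simps)
      then have "f i x = 0" unfolding feq by (rule pl(5))
      then show ?thesis unfolding \<Lambda>_def by (intro prod_zero) auto
    qed
    have sm: "smooth \<Lambda>" unfolding \<Lambda>_def by (intro smooth_prod fsm)
    have der0: "partial i \<Lambda> x = 0" if "x \<notin> ?K" for x i
    proof -
      have ev: "\<forall>\<^sub>F y in nhds x. \<Lambda> y = 0" unfolding eventually_nhds
        using that out by (intro exI[of _ "- ?K"]) auto
      have "(\<Lambda> has_derivative (\<lambda>_. 0)) (at x)"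
      proof (rule has_derivative_transform_eventually[where f="\<lambda>_. 0"])
        show "((\<lambda>_. 0) has_derivative (\<lambda>_. 0)) (at x)" by (rule has_derivative_const)
        show "\<forall>\<^sub>F y in at x. 0 = \<Lambda> y" using ev by (auto simp: eventually_at_filter elim: eventually_mono)
        show "0 = \<Lambda> x" using eventually_nhds_x_imp_x[OF ev] by simp
      qed simp
      from frechet_derivative_at[OF this] show ?thesis by metis
    qed
    show ?thesis
    proof (intro exI[of _ \<Lambda>] conjI allI ballI impI)
      show "0 \<le> \<Lambda> x" "\<Lambda> x \<le> 1" for x unfolding \<Lambda>_def by (auto intro!: prod_nonneg prod_le_1 simp: feq pl)
      show "\<Lambda> x = 1" if x: "x \<in> cball c r" for x
      proof -
        have "f i x = 1" for i
        proof -
          have "\<bar>x $ i - c $ i\<bar> \<le> norm (x - c)" using component_le_norm_cart[of "x - c" i] by simp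
          then have "\<bar>(x $ i - c $ i) / r\<bar> \<le> 1" using x r by (simp add: dist_norm norm_minus_commute)
          then show ?thesis unfolding feq by (rule pl(4))
        qed
        then show ?thesis by (simp add: \<Lambda>_def)
      qed
      show "\<bar>partial i \<Lambda> x\<bar> \<le> real CARD('n) * M / r" for x i
      proof -
        have "\<bar>partial i \<Lambda> x\<bar> \<le> (\<Sum>j\<in>UNIV. \<bar>partial i (f j) x\<bar>)"
          using partial_prod_le[of UNIV f x "axis i 1"] smooth_differentiable[OF fsm] pl(2,3) by (auto simp: \<Lambda>_def[abs_def] feq)
        also have "\<dots> \<le> (\<Sum>j\<in>(UNIV::'n set). M / r)" by (intro sum_mono fder)
        finally show ?thesis by simp
      qed
    qed (use sm out der0 in auto)
  qed
  have "0 < real CARD('n) * M" using pl(6) by simp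
  with main show ?thesis by blast
qed

text \<open>The cutoff \<open>\<psi>\<close> vanishes near \<open>S\<close>; its gradient costs \<open>1/r\<close> on a ball of volume \<open>r\<^sup>n\<close>,
  so the weighted covering bounds the error by the boundary integral.\<close>

definition boundary_cutoff ::
  "(real^'n) set \<Rightarrow> (real^'n \<Rightarrow> real) \<Rightarrow> real \<Rightarrow> real \<Rightarrow> (real^'n \<Rightarrow> real) \<Rightarrow> bool" where
  "boundary_cutoff S g \<eta> C \<psi> \<longleftrightarrow> smooth \<psi> \<and> (\<forall>x. 0 \<le> \<psi> x \<and> \<psi> x \<le> 1) \<and>
     (\<exists>U. open U \<and> S \<subseteq> U \<and> (\<forall>x\<in>U. \<psi> x = 0)) \<and>
     (\<forall>x. (\<forall>y\<in>S. \<eta> < dist x y) \<longrightarrow> \<psi> x = 1) \<and>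
     (\<forall>i. (\<integral>\<^sup>+x. ennreal (\<bar>partial i \<psi> x\<bar> * g x) \<partial>lborel) \<le> 
        ennreal C * ((\<integral>\<^sup>+x. ennreal (g x + 2 * \<eta>) * indicator S x \<partial>hausdorff_measure (real CARD('n) - 1)) + ennreal \<eta>))"

text \<open>The cutoff is the product of 1 minus the ball cutoffs of a weighted cover. Its constant
  is chosen before S, g and \<eta>, so it stays fixed when \<eta> tends to zero.\<close>

lemma boundary_cutoff_exists:
  assumes card: "2 \<le> CARD('n)"
  shows "\<exists>C\<ge>0. \<forall>(S :: (real^'n) set) g \<eta>. compact S \<longrightarrow> hausdorff_outer (real CARD('n) - 1) S < \<infinity> \<longrightarrow>
     continuous_on UNIV g \<longrightarrow> (\<forall>x. 0 \<le> g x) \<longrightarrow> 0 < \<eta> \<longrightarrow> (\<exists>\<psi>. boundary_cutoff S g \<eta> C \<psi>)"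
proof -
  let ?s = "real CARD('n) - 1"
  let ?\<kappa> = "2 * real CARD('n)"
  obtain C0 where C0: "0 < C0" "\<And>c r. 0 < r \<Longrightarrow> \<exists>\<Lambda> :: real^'n \<Rightarrow> real. smooth \<Lambda> \<and> (\<forall>x. 0 \<le> \<Lambda> x \<and> \<Lambda> x \<le> 1) \<and>
     (\<forall>x\<in>cball c r. \<Lambda> x = 1) \<and> (\<forall>x. x \<notin> cball c (2 * real CARD('n) * r) \<longrightarrow> \<Lambda> x = 0) \<and>
     (\<forall>x i. \<bar>partial i \<Lambda> x\<bar> \<le> C0 / r) \<and>
     (\<forall>x i. x \<notin> cball c (2 * real CARD('n) * r) \<longrightarrow> partial i \<Lambda> x = 0)"
    using cube_cutoff_exists by blast
  define Cs where "Cs = 2 powr ?s / unit_ball_vol ?s"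
  have s: "0 < ?s" using card by simp
  have \<kappa>: "1 \<le> ?\<kappa>" using card by simp
  have Cs0: "0 \<le> Cs" unfolding Cs_def using s by (intro divide_nonneg_nonneg unit_ball_vol_nonneg) auto
  \<comment> \<open>Gradient bound times volume of the enlarged ball: (C0/r) times a multiple of r^n
    is C1 r^(n-1), the quantity summed in the weighted cover.\<close>
  define C1 where "C1 = C0 * unit_ball_vol (real CARD('n)) * ?\<kappa> ^ CARD('n)"
  have C1: "0 \<le> C1" unfolding C1_def using C0(1) by (intro mult_nonneg_nonneg unit_ball_vol_nonneg) auto
  show ?thesis
  proof (rule exI[of _ "C1 * (Cs + 1)"], intro conjI allI impI)
    show "0 \<le> C1 * (Cs + 1)" using C1 Cs0 by simp
    fix S :: "(real^'n) set" and g :: "real^'n \<Rightarrow> real" and \<eta> :: real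
    assume S: "compact S" and fin: "hausdorff_outer ?s S < \<infinity>" and g1: "continuous_on UNIV g" and g2: "\<forall>x. 0 \<le> g x" and \<eta>: "0 < \<eta>"
    have g: "continuous_on UNIV g" "\<And>x. 0 \<le> g x" using g1 g2 by auto
    define I where "I = (\<integral>\<^sup>+x. ennreal (g x + 2 * \<eta>) * indicator S x \<partial>hausdorff_measure ?s)"
    \<comment> \<open>With radii at most \<eta>/\<kappa> the enlarged balls reach no farther than
      \<eta> from their centres in S, so the cutoff equals 1 beyond that distance.\<close>
    have \<tau>: "0 < \<eta> / ?\<kappa>" using \<eta> \<kappa> by simp
    obtain J :: "(nat \<times> nat) set" and c r m where H: "finite J \<and> (\<forall>j\<in>J. c j \<in> S) \<and> (\<forall>j\<in>J. 0 < r j \<and> r j \<le> \<eta> / ?\<kappa>) \<and>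
      (\<forall>j\<in>J. \<forall>y\<in>cball (c j) (?\<kappa> * r j). g y \<le> m j) \<and> (\<forall>j\<in>J. 0 \<le> m j) \<and> S \<subseteq> (\<Union>j\<in>J. ball (c j) (r j)) \<and>
      (\<Sum>j\<in>J. ennreal (m j * r j powr ?s)) \<le> ennreal Cs * I + ennreal \<eta>"
      using hausdorff_weighted_cover[OF S s fin g \<eta> \<kappa> \<tau>, folded Cs_def I_def] by (elim exE) (rule that)
    have J: "finite J" "\<And>j. j \<in> J \<Longrightarrow> c j \<in> S" "\<And>j. j \<in> J \<Longrightarrow> 0 < r j \<and> r j \<le> \<eta> / ?\<kappa>"
      "\<And>j y. j \<in> J \<Longrightarrow> y \<in> cball (c j) (?\<kappa> * r j) \<Longrightarrow> g y \<le> m j" "\<And>j. j \<in> J \<Longrightarrow> 0 \<le> m j" "S \<subseteq> (\<Union>j\<in>J. ball (c j) (r j))"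
      "(\<Sum>j\<in>J. ennreal (m j * r j powr ?s)) \<le> ennreal Cs * I + ennreal \<eta>"
      using H by (simp_all del: sum_ennreal)
    have "\<forall>j\<in>J. \<exists>\<Lambda>. smooth \<Lambda> \<and> (\<forall>x. 0 \<le> \<Lambda> x \<and> \<Lambda> x \<le> 1) \<and>
     (\<forall>x\<in>cball (c j) (r j). \<Lambda> x = 1) \<and> (\<forall>x. x \<notin> cball (c j) (?\<kappa> * r j) \<longrightarrow> \<Lambda> x = 0) \<and>
     (\<forall>x i. \<bar>partial i \<Lambda> x\<bar> \<le> C0 / r j) \<and>
     (\<forall>x i. x \<notin> cball (c j) (?\<kappa> * r j) \<longrightarrow> partial i \<Lambda> x = 0)"
      using C0(2) J(3) by blast
    from bchoice[OF this] obtain L where "\<forall>j\<in>J. smooth (L j) \<and> (\<forall>x. 0 \<le> L j x \<and> L j x \<le> 1) \<and>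
     (\<forall>x\<in>cball (c j) (r j). L j x = 1) \<and> (\<forall>x. x \<notin> cball (c j) (?\<kappa> * r j) \<longrightarrow> L j x = 0) \<and>
     (\<forall>x i. \<bar>partial i (L j) x\<bar> \<le> C0 / r j) \<and>
     (\<forall>x i. x \<notin> cball (c j) (?\<kappa> * r j) \<longrightarrow> partial i (L j) x = 0)"
      by (elim exE) (rule that)
    then have L: "\<And>j. j \<in> J \<Longrightarrow> smooth (L j)" "\<And>j x. j \<in> J \<Longrightarrow> 0 \<le> L j x" "\<And>j x. j \<in> J \<Longrightarrow> L j x \<le> 1"
      "\<And>j x. j \<in> J \<Longrightarrow> x \<in> cball (c j) (r j) \<Longrightarrow> L j x = 1" "\<And>j x. j \<in> J \<Longrightarrow> x \<notin> cball (c j) (?\<kappa> * r j) \<Longrightarrow> L j x = 0"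
      "\<And>j x i. j \<in> J \<Longrightarrow> \<bar>partial i (L j) x\<bar> \<le> C0 / r j"
      "\<And>j x i. j \<in> J \<Longrightarrow> x \<notin> cball (c j) (?\<kappa> * r j) \<Longrightarrow> partial i (L j) x = 0"
      by blast+
    define \<psi> where "\<psi> x = (\<Prod>j\<in>J. 1 - L j x)" for x
    have Lsm: "smooth (\<lambda>x. 1 - L j x)" if "j \<in> J" for j by (intro smooth_diff smooth_const L that)
    have der1: "frechet_derivative (\<lambda>x. 1 - L j x) (at x) e = - frechet_derivative (L j) (at x) e" if "j \<in> J" for j x e
    proof -
      have "((\<lambda>x. 1 - L j x) has_derivative (\<lambda>h. 0 - frechet_derivative (L j) (at x) h)) (at x)"
        by (intro has_derivative_diff has_derivative_const smooth_has_derivative L that)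
      from frechet_derivative_at[OF this] show ?thesis by (metis diff_0)
    qed
    have point: "\<bar>partial i \<psi> x\<bar> * g x \<le> (\<Sum>j\<in>J. C0 / r j * m j * indicator (cball (c j) (?\<kappa> * r j)) x)" for x i
    proof -
      have "\<bar>partial i \<psi> x\<bar> \<le> (\<Sum>j\<in>J. \<bar>partial i (\<lambda>x. 1 - L j x) x\<bar>)"
        unfolding \<psi>_def
        using partial_prod_le[of J "\<lambda>j x. 1 - L j x" x "axis i 1", OF J(1) smooth_differentiable[OF Lsm]] L(2,3) by auto
      also have "\<dots> = (\<Sum>j\<in>J. \<bar>partial i (L j) x\<bar>)" using der1 by (intro sum.cong) auto
      finally have "\<bar>partial i \<psi> x\<bar> * g x \<le> (\<Sum>j\<in>J. \<bar>partial i (L j) x\<bar> * g x)"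
        using g(2)[of x] by (simp add: sum_distrib_right[symmetric] mult_right_mono)
      also have "\<dots> \<le> (\<Sum>j\<in>J. C0 / r j * m j * indicator (cball (c j) (?\<kappa> * r j)) x)"
      proof (rule sum_mono)
        fix j assume j: "j \<in> J"
        show "\<bar>partial i (L j) x\<bar> * g x \<le> C0 / r j * m j * indicator (cball (c j) (?\<kappa> * r j)) x"
        proof (cases "x \<in> cball (c j) (?\<kappa> * r j)")
          case True
          have "\<bar>partial i (L j) x\<bar> * g x \<le> C0 / r j * m j"
            using L(6)[OF j] J(4)[OF j True] g(2)[of x] C0(1) J(3)[OF j] by (intro mult_mono) auto
          then show ?thesis using True by simp
        qed (use L(7)[OF j] in simp)
      qed
      finally show ?thesis .
    qed
    have "(\<integral>\<^sup>+x. ennreal (\<bar>partial i \<psi> x\<bar> * g x) \<partial>lborel) \<le> ennreal (C1 * (Cs + 1)) * (I + ennreal \<eta>)" for i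
    proof -
      have "(\<integral>\<^sup>+x. ennreal (\<bar>partial i \<psi> x\<bar> * g x) \<partial>lborel)
        \<le> (\<integral>\<^sup>+x. (\<Sum>j\<in>J. ennreal (C0 / r j * m j) * indicator (cball (c j) (?\<kappa> * r j)) x) \<partial>lborel)"
      proof (rule nn_integral_mono)
        fix x
        have "ennreal (\<bar>partial i \<psi> x\<bar> * g x) \<le> ennreal (\<Sum>j\<in>J. C0 / r j * m j * indicator (cball (c j) (?\<kappa> * r j)) x)"
          by (rule ennreal_leI[OF point])
        also have "\<dots> = (\<Sum>j\<in>J. ennreal (C0 / r j * m j * indicator (cball (c j) (?\<kappa> * r j)) x))"
          using C0(1) J(3,5) by (intro sum_ennreal[symmetric]) (auto intro!: mult_nonneg_nonneg divide_nonneg_nonneg simp: less_imp_le)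
        also have "\<dots> = (\<Sum>j\<in>J. ennreal (C0 / r j * m j) * indicator (cball (c j) (?\<kappa> * r j)) x)"
          by (intro sum.cong) (auto simp: indicator_def)
        finally show "ennreal (\<bar>partial i \<psi> x\<bar> * g x) \<le> (\<Sum>j\<in>J. ennreal (C0 / r j * m j) * indicator (cball (c j) (?\<kappa> * r j)) x)" .
      qed
      also have "\<dots> = (\<Sum>j\<in>J. ennreal (C0 / r j * m j) * emeasure lborel (cball (c j) (?\<kappa> * r j)))"
        by (subst nn_integral_sum) (simp_all add: nn_integral_cmult_indicator borel_measurable_times_ennreal borel_measurable_indicator)
      also have "\<dots> = (\<Sum>j\<in>J. ennreal C1 * ennreal (m j * r j powr ?s))"
      proof (rule sum.cong[OF refl])
        fix j assume j: "j \<in> J"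
        have rj: "0 < r j" using J(3)[OF j] by simp
        have "emeasure lborel (cball (c j) (?\<kappa> * r j)) = ennreal (unit_ball_vol (real CARD('n)) * (?\<kappa> * r j) ^ CARD('n))"
          using rj by (simp add: emeasure_cball)
        moreover have "C0 / r j * m j * (unit_ball_vol (real CARD('n)) * (?\<kappa> * r j) ^ CARD('n)) = C1 * (m j * r j powr ?s)"
          using rj by (simp add: C1_def powr_diff powr_realpow power_mult_distrib field_simps)
        ultimately show "ennreal (C0 / r j * m j) * emeasure lborel (cball (c j) (?\<kappa> * r j)) = ennreal C1 * ennreal (m j * r j powr ?s)"
          using C0(1) J(5)[OF j] rj C1 by (simp add: ennreal_mult[symmetric] unit_ball_vol_nonneg)
      qed
      also have "\<dots> = ennreal C1 * (\<Sum>j\<in>J. ennreal (m j * r j powr ?s))" by (simp add: sum_distrib_left)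
      also have "\<dots> \<le> ennreal C1 * (ennreal (Cs + 1) * (I + ennreal \<eta>))"
      proof (rule mult_left_mono)
        have "ennreal Cs * I + ennreal \<eta> \<le> ennreal (Cs + 1) * I + ennreal (Cs + 1) * ennreal \<eta>"
        proof (intro add_mono mult_right_mono ennreal_leI)
          show "ennreal \<eta> \<le> ennreal (Cs + 1) * ennreal \<eta>"
            using Cs0 \<eta> by (simp add: ennreal_mult[symmetric] ennreal_leI algebra_simps)
        qed auto
        then show "(\<Sum>j\<in>J. ennreal (m j * r j powr ?s)) \<le> ennreal (Cs + 1) * (I + ennreal \<eta>)"
          using J(7) by (simp add: distrib_left)
      qed simp
      also have "\<dots> = ennreal (C1 * (Cs + 1)) * (I + ennreal \<eta>)" using C1 Cs0 by (simp add: ennreal_mult mult.assoc)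
      finally show ?thesis .
    qed
    moreover have "smooth \<psi>" unfolding \<psi>_def by (intro smooth_prod Lsm)
    moreover have "0 \<le> \<psi> x" "\<psi> x \<le> 1" for x unfolding \<psi>_def using L(2,3) by (auto intro!: prod_nonneg prod_le_1)
    moreover have "\<psi> x = 0" if "x \<in> (\<Union>j\<in>J. ball (c j) (r j))" for x
      unfolding \<psi>_def using that L(4) J(1) by (intro prod_zero) (force simp: less_imp_le)+
    moreover have "\<psi> x = 1" if "\<forall>y\<in>S. \<eta> < dist x y" for x
      unfolding \<psi>_def
    proof (intro prod.neutral ballI)
      fix j assume j: "j \<in> J"
      have "?\<kappa> * r j \<le> \<eta>" using J(3)[OF j] \<kappa> by (simp add: field_simps)
      then have "x \<notin> cball (c j) (?\<kappa> * r j)" using that J(2)[OF j] by (auto simp: dist_commute not_le)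
      then show "1 - L j x = 1" using L(5)[OF j] by simp
    qed
    moreover have "open (\<Union>j\<in>J. ball (c j) (r j))" by auto
    ultimately show "\<exists>\<psi>. boundary_cutoff S g \<eta> (C1 * (Cs + 1)) \<psi>"
      using J(6) unfolding I_def boundary_cutoff_def by (intro exI[of _ \<psi>]) blast
  qed
qed

text \<open>A test function on the whole space becomes one on the domain after multiplication by a
  cutoff vanishing near the boundary. Smoothness is checked locally: inside the domain, near its
  boundary, and off its closure.\<close>

lemma cutoff_test_function:
  fixes \<phi> \<psi> :: "real^'n \<Rightarrow> real"
  assumes \<Omega>: "open \<Omega>" and \<phi>: "test_function UNIV \<phi>" and \<psi>: "smooth \<psi>"
    and U: "open U" "frontier \<Omega> \<subseteq> U" "\<And>x. x \<in> U \<Longrightarrow> \<psi> x = 0"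
  defines "\<theta> \<equiv> \<lambda>x. if x \<in> \<Omega> then \<phi> x * \<psi> x else 0"
  shows "test_function \<Omega> \<theta>"
    and "\<And>x e. x \<in> \<Omega> \<Longrightarrow> frechet_derivative \<theta> (at x) e = \<phi> x * frechet_derivative \<psi> (at x) e + frechet_derivative \<phi> (at x) e * \<psi> x"
proof -
  obtain S where S: "smooth \<phi>" "compact S" "\<And>x. x \<notin> S \<Longrightarrow> \<phi> x = 0"
    using test_functionE[OF \<phi>] by metis
  have cl: "closure \<Omega> = \<Omega> \<union> frontier \<Omega>" using \<Omega> by (auto simp: frontier_def interior_open intro: closure_subset[THEN subsetD])
  have prod: "smooth (\<lambda>x. \<phi> x * \<psi> x)" by (intro smooth_mult S \<psi>)
  have "smooth \<theta>" unfolding smooth_def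
  proof
    fix k
    show "Ck k \<theta>"
    proof (rule Ck_local)
      fix x
      consider "x \<in> \<Omega>" | "x \<in> U" | "x \<in> - closure \<Omega>" using cl U(2) by blast
      then show "\<exists>U g. open U \<and> x \<in> U \<and> Ck k g \<and> (\<forall>y\<in>U. \<theta> y = g y)"
      proof cases
        case 1
        then show ?thesis using prod \<Omega>
          by (intro exI[of _ \<Omega>] exI[of _ "\<lambda>x. \<phi> x * \<psi> x"]) (auto simp: \<theta>_def smooth_def)
      next
        case 2
        then show ?thesis using U
          by (intro exI[of _ U] exI[of _ "\<lambda>x. 0"]) (auto simp: \<theta>_def Ck_const)
      next
        case 3
        then show ?thesis using closure_subset
          by (intro exI[of _ "- closure \<Omega>"] exI[of _ "\<lambda>x. 0"]) (auto simp: \<theta>_def Ck_const)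
      qed
    qed
  qed
  then show "test_function \<Omega> \<theta>"
  proof (rule test_functionI)
    have "compact (S \<inter> (closure \<Omega> - U))" using S(2) U(1) by (intro compact_Int_closed closed_Diff) auto
    then show "compact (S \<inter> (closure \<Omega> - U))" .
    show "S \<inter> (closure \<Omega> - U) \<subseteq> \<Omega>" using cl U(2) by blast
    show "\<theta> x = 0" if "x \<notin> S \<inter> (closure \<Omega> - U)" for x
      using that closure_subset S(3)[of x] U(3)[of x] by (auto simp: \<theta>_def)
  qed
  fix x e assume x: "x \<in> \<Omega>"
  have "((\<lambda>x. \<phi> x * \<psi> x) has_derivative (\<lambda>h. \<phi> x * frechet_derivative \<psi> (at x) h + frechet_derivative \<phi> (at x) h * \<psi> x)) (at x)"
    by (intro has_derivative_mult smooth_has_derivative S \<psi>)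
  then have "(\<theta> has_derivative (\<lambda>h. \<phi> x * frechet_derivative \<psi> (at x) h + frechet_derivative \<phi> (at x) h * \<psi> x)) (at x)"
  proof (rule has_derivative_transform_eventually)
    show "\<forall>\<^sub>F y in at x. \<phi> y * \<psi> y = \<theta> y"
      using \<Omega> x unfolding eventually_at_topological by (intro exI[of _ \<Omega>]) (auto simp: \<theta>_def)
  qed (use x in \<open>auto simp: \<theta>_def\<close>)
  from fun_cong[OF frechet_derivative_at[OF this], of e]
  show "frechet_derivative \<theta> (at x) e = \<phi> x * frechet_derivative \<psi> (at x) e + frechet_derivative \<phi> (at x) e * \<psi> x" by simp
qed

section \<open>Integration by parts without a boundary contribution\<close>

text \<open>The defect of integration by parts over the domain. By the Gauss theorem it would be the
  surface integral of \<phi> f times the i-th component of the normal; it is estimated here without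
  a normal.\<close>

definition boundary_term ::
  "(real^'n) set \<Rightarrow> (real^'n \<Rightarrow> real) \<Rightarrow> 'n \<Rightarrow> (real^'n \<Rightarrow> 'b::euclidean_space) \<Rightarrow> (real^'n \<Rightarrow> 'b^'n) \<Rightarrow> 'b" where
  "boundary_term \<Omega> \<phi> i f G = (LINT x|lebesgue_on \<Omega>. partial i \<phi> x *\<^sub>R f x)
     + (LINT x|lebesgue_on \<Omega>. \<phi> x *\<^sub>R G x $ i)"

text \<open>The weak identity is applied to \<phi> times a boundary cutoff, so the only remaining
  term carries the gradient of the cutoff. The weighted cover bounds that term by the surface
  integral of the norm of v, and the cutoffs converge to 1 inside the domain.\<close>

lemma boundary_term_smooth_le:
  fixes v :: "real^'n \<Rightarrow> 'b::euclidean_space" and C :: real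
  assumes \<Omega>: "open \<Omega>" "bounded \<Omega>" and fin: "hausdorff_outer (real CARD('n) - 1) (frontier \<Omega>) < \<infinity>"
    and v: "smooth v" and G: "G \<in> L2 \<Omega>" "weak_gradient \<Omega> v G" and \<phi>: "test_function UNIV \<phi>" and M: "\<And>x. \<bar>\<phi> x\<bar> \<le> M" "0 \<le> M"
    and C: "0 \<le> C" "\<And>g \<eta>. continuous_on UNIV g \<Longrightarrow> \<forall>x. 0 \<le> g x \<Longrightarrow> 0 < \<eta> \<Longrightarrow> \<exists>\<psi>. boundary_cutoff (frontier \<Omega>) g \<eta> C \<psi>"
  shows "norm (boundary_term \<Omega> \<phi> i v G) \<le> M * C * enn2real (\<integral>\<^sup>+x. ennreal (norm (v x)) * indicator (frontier \<Omega>) x \<partial>hausdorff_measure (real CARD('n) - 1))"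
proof -
  let ?S = "frontier \<Omega>"
  let ?H = "hausdorff_measure (real CARD('n) - 1) :: (real^'n) measure"
  have S: "compact ?S" using \<Omega> by (simp add: compact_frontier_bounded)
  have Sb[measurable]: "?S \<in> sets borel" using S by (simp add: borel_compact)
  have vc: "continuous_on UNIV v" by (rule smooth_continuous_on[OF v])
  have gc: "continuous_on UNIV (\<lambda>x. norm (v x))" by (intro continuous_intros vc)
  have [measurable]: "v \<in> borel_measurable borel" by (rule borel_measurable_continuous_onI[OF vc])
  have HS: "emeasure ?H ?S < \<infinity>" using fin by (simp add: emeasure_hausdorff_measure)
  define h where "h = enn2real (emeasure ?H ?S)"
  have h: "emeasure ?H ?S = ennreal h" "0 \<le> h" using HS by (auto simp: h_def)
  obtain b where b: "\<And>x. x \<in> ?S \<Longrightarrow> norm (v x) \<le> b" "0 \<le> b"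
  proof -
    have "bounded (v ` ?S)" using S vc by (intro compact_imp_bounded compact_continuous_image) (auto intro: continuous_on_subset)
    then obtain b where "b > 0" "\<forall>y\<in>v ` ?S. norm y \<le> b" using bounded_pos by blast
    then show ?thesis using that[of b] by auto
  qed
  define I where "I = (\<integral>\<^sup>+x. ennreal (norm (v x)) * indicator ?S x \<partial>?H)"
  have "I \<le> (\<integral>\<^sup>+x. ennreal b * indicator ?S x \<partial>?H)" unfolding I_def
    by (intro nn_integral_mono) (auto simp: indicator_def b intro!: ennreal_leI)
  also have "\<dots> = ennreal (b * h)" using h b by (simp add: nn_integral_cmult_indicator ennreal_mult)
  finally have "I < \<infinity>" by (simp add: le_less_trans)
  define r where "r = enn2real I"
  have r: "I = ennreal r" "0 \<le> r" using \<open>I < \<infinity>\<close> by (auto simp: r_def)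
  define \<eta> where "\<eta> k = 1 / real (Suc k)" for k
  have \<eta>: "0 < \<eta> k" for k by (simp add: \<eta>_def)
  have \<eta>0: "\<eta> \<longlonglongrightarrow> 0" unfolding \<eta>_def by (rule LIMSEQ_Suc[OF lim_1_over_n])
  have "\<exists>\<psi>. boundary_cutoff ?S (\<lambda>x. norm (v x)) (\<eta> k) C \<psi>" for k
    by (rule C(2)[OF gc _ \<eta>]) simp
  then obtain \<psi> where \<psi>C: "\<And>k. boundary_cutoff ?S (\<lambda>x. norm (v x)) (\<eta> k) C (\<psi> k)" by metis
  have \<psi>: "\<And>k. smooth (\<psi> k)" "\<And>k x. 0 \<le> \<psi> k x" "\<And>k x. \<psi> k x \<le> 1"
     "\<And>k. \<exists>U. open U \<and> ?S \<subseteq> U \<and> (\<forall>x\<in>U. \<psi> k x = 0)"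
     "\<And>k x. (\<forall>y\<in>?S. \<eta> k < dist x y) \<Longrightarrow> \<psi> k x = 1"
     "\<And>k i. (\<integral>\<^sup>+x. ennreal (\<bar>partial i (\<psi> k) x\<bar> * norm (v x)) \<partial>lborel) \<le> 
        ennreal C * ((\<integral>\<^sup>+x. ennreal (norm (v x) + 2 * \<eta> k) * indicator ?S x \<partial>?H) + ennreal (\<eta> k))"
    using \<psi>C unfolding boundary_cutoff_def by blast+
  have \<Omega>b: "\<Omega> \<in> sets borel" using \<Omega> by simp
  have m: "k \<in> borel_measurable borel \<Longrightarrow> k \<in> borel_measurable (lebesgue_on \<Omega>)" for k :: "real^'n \<Rightarrow> real"
    by (intro measurable_restrict_space1 measurable_completion) simp
  note L1 = L2_integrable[OF \<Omega>b \<Omega>(2)]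
  have vL2: "v \<in> L2 \<Omega>" by (rule continuous_L2[OF \<Omega>b \<Omega>(2) vc])
  let ?d = "\<lambda>x. partial i \<phi> x"
  have i1: "integrable (lebesgue_on \<Omega>) (\<lambda>x. ?d x *\<^sub>R v x)" by (rule test_function_integrable(2)[OF \<phi> L1[OF vL2]])
  have i2: "integrable (lebesgue_on \<Omega>) (\<lambda>x. \<phi> x *\<^sub>R G x $ i)"
    by (rule test_function_integrable(1)[OF \<phi> integrable_vec_nth[OF L1[OF G(1)]]])
  have \<psi>m: "\<psi> k \<in> borel_measurable (lebesgue_on \<Omega>)" for k by (intro m smooth_borel_measurable \<psi>)
  have \<psi>1: "\<bar>\<psi> k x\<bar> \<le> 1" for k x using \<psi>(2,3)[where k=k and x=x] by simp
  \<comment> \<open>The cut-off boundary term: it converges to the full one by dominated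
    convergence, and for each k the weak identity equates it with minus the integral of \<phi> v
    times the derivative of the cutoff.\<close>
  define X where "X k = (LINT x|lebesgue_on \<Omega>. \<psi> k x *\<^sub>R (?d x *\<^sub>R v x)) + (LINT x|lebesgue_on \<Omega>. \<psi> k x *\<^sub>R (\<phi> x *\<^sub>R G x $ i))" for k
  have lim1: "(\<lambda>k. \<psi> k x) \<longlonglongrightarrow> 1" if x: "x \<in> \<Omega>" for x
  proof -
    have "x \<notin> ?S" using x \<Omega> by (simp add: frontier_def interior_open)
    then obtain e where e: "e > 0" "\<And>y. y \<in> ?S \<Longrightarrow> e \<le> dist x y"
      using separate_point_closed[of ?S x] by auto
    have "\<forall>\<^sub>F k in sequentially. \<eta> k < e" using order_tendstoD(2)[OF \<eta>0 e(1)] .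
    then have "\<forall>\<^sub>F k in sequentially. \<psi> k x = 1"
      by eventually_elim (use e(2) in \<open>auto intro!: \<psi>(5) elim: less_le_trans\<close>)
    then show ?thesis by (rule tendsto_eventually)
  qed
  have dct: "(\<lambda>k. LINT x|lebesgue_on \<Omega>. \<psi> k x *\<^sub>R u x) \<longlonglongrightarrow> (LINT x|lebesgue_on \<Omega>. u x)"
    if u: "integrable (lebesgue_on \<Omega>) u" for u :: "real^'n \<Rightarrow> 'b"
  proof (rule integral_dominated_convergence[where w="\<lambda>x. norm (u x)"])
    show "AE x in lebesgue_on \<Omega>. (\<lambda>k. \<psi> k x *\<^sub>R u x) \<longlonglongrightarrow> u x"
    proof (rule AE_I2)
      fix x assume "x \<in> space (lebesgue_on \<Omega>)"
      then have "(\<lambda>k. \<psi> k x *\<^sub>R u x) \<longlonglongrightarrow> 1 *\<^sub>R u x" by (intro tendsto_scaleR lim1 tendsto_const) simp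
      then show "(\<lambda>k. \<psi> k x *\<^sub>R u x) \<longlonglongrightarrow> u x" by simp
    qed
    show "(\<lambda>x. \<psi> k x *\<^sub>R u x) \<in> borel_measurable (lebesgue_on \<Omega>)" for k
      by (intro borel_measurable_scaleR \<psi>m borel_measurable_integrable[OF u])
    show "AE x in lebesgue_on \<Omega>. norm (\<psi> k x *\<^sub>R u x) \<le> norm (u x)" for k
      by (intro AE_I2) (simp add: \<psi>1 mult_left_le_one_le)
  qed (use u in \<open>auto dest: borel_measurable_integrable\<close>)
  have "X \<longlonglongrightarrow> boundary_term \<Omega> \<phi> i v G"
    unfolding X_def boundary_term_def by (intro tendsto_add dct i1 i2)
  then have limX: "(\<lambda>k. norm (X k)) \<longlonglongrightarrow> norm (boundary_term \<Omega> \<phi> i v G)" by (rule tendsto_norm)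
  have Xle: "norm (X k) \<le> M * C * (r + 2 * \<eta> k * h + \<eta> k)" for k
  proof -
    obtain U where U: "open U" "?S \<subseteq> U" "\<And>x. x \<in> U \<Longrightarrow> \<psi> k x = 0" using \<psi>(4)[of k] by blast
    define \<theta> where "\<theta> = (\<lambda>x. if x \<in> \<Omega> then \<phi> x * \<psi> k x else 0)"
    have \<theta>: "test_function \<Omega> \<theta>"
      and d\<theta>: "\<And>x. x \<in> \<Omega> \<Longrightarrow> partial i \<theta> x = \<phi> x * partial i (\<psi> k) x + ?d x * \<psi> k x"
      unfolding \<theta>_def using cutoff_test_function[OF \<Omega>(1) \<phi> \<psi>(1) U] by blast+
    let ?e = "\<lambda>x. partial i (\<psi> k) x"
    have j1: "integrable (lebesgue_on \<Omega>) (\<lambda>x. \<psi> k x *\<^sub>R (?d x *\<^sub>R v x))" by (rule integrable_bounded_scaleR[OF i1 \<psi>m \<psi>1])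
    have em: "?e \<in> borel_measurable borel" by (rule smooth_partial_borel_measurable[OF \<psi>(1)])
    have int: "integrable (lebesgue_on \<Omega>) (\<lambda>x. (\<phi> x * ?e x) *\<^sub>R v x)"
    proof -
      have "integrable (lebesgue_on \<Omega>) (\<lambda>x. partial i \<theta> x *\<^sub>R v x - \<psi> k x *\<^sub>R (?d x *\<^sub>R v x))"
        using test_function_integrable(2)[OF \<theta> L1[OF vL2]] j1 by simp
      then show ?thesis
        by (rule Bochner_Integration.integrable_cong[THEN iffD1, rotated 2]) (auto simp: d\<theta> algebra_simps)
    qed
    have "(LINT x|lebesgue_on \<Omega>. \<psi> k x *\<^sub>R (\<phi> x *\<^sub>R G x $ i)) = (LINT x|lebesgue_on \<Omega>. \<theta> x *\<^sub>R G x $ i)"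
      by (intro Bochner_Integration.integral_cong) (auto simp: \<theta>_def)
    also have "\<dots> = - (LINT x|lebesgue_on \<Omega>. partial i \<theta> x *\<^sub>R v x)"
      using G(2) \<theta> by (simp add: weak_gradient_def)
    also have "(LINT x|lebesgue_on \<Omega>. partial i \<theta> x *\<^sub>R v x)
       = (LINT x|lebesgue_on \<Omega>. (\<phi> x * ?e x) *\<^sub>R v x + \<psi> k x *\<^sub>R (?d x *\<^sub>R v x))"
      by (intro Bochner_Integration.integral_cong) (auto simp: d\<theta> algebra_simps)
    also have "\<dots> = (LINT x|lebesgue_on \<Omega>. (\<phi> x * ?e x) *\<^sub>R v x) + (LINT x|lebesgue_on \<Omega>. \<psi> k x *\<^sub>R (?d x *\<^sub>R v x))"
      by (rule Bochner_Integration.integral_add[OF int j1])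
    finally have "X k = - (LINT x|lebesgue_on \<Omega>. (\<phi> x * ?e x) *\<^sub>R v x)" by (simp add: X_def)
    then have "norm (X k) \<le> (LINT x|lebesgue_on \<Omega>. norm ((\<phi> x * ?e x) *\<^sub>R v x))"
      using integral_norm_bound[of "lebesgue_on \<Omega>" "\<lambda>x. (\<phi> x * ?e x) *\<^sub>R v x"] by simp
    then have "ennreal (norm (X k)) \<le> ennreal (LINT x|lebesgue_on \<Omega>. norm ((\<phi> x * ?e x) *\<^sub>R v x))" by (rule ennreal_leI)
    also have "\<dots> = (\<integral>\<^sup>+x. ennreal (norm ((\<phi> x * ?e x) *\<^sub>R v x)) \<partial>lebesgue_on \<Omega>)"
      by (intro nn_integral_eq_integral[symmetric] integrable_norm int) auto
    also have "\<dots> \<le> (\<integral>\<^sup>+x. ennreal M * ennreal (\<bar>?e x\<bar> * norm (v x)) \<partial>lborel)"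
      unfolding nn_integral_lebesgue_on_lborel[OF \<Omega>b]
    proof (rule nn_integral_mono)
      fix x
      have "norm ((\<phi> x * ?e x) *\<^sub>R v x) \<le> M * (\<bar>?e x\<bar> * norm (v x))"
        using M(1)[of x] by (simp add: abs_mult mult.assoc mult_right_mono)
      then have "ennreal (norm ((\<phi> x * ?e x) *\<^sub>R v x)) \<le> ennreal M * ennreal (\<bar>?e x\<bar> * norm (v x))"
        using M(2) by (simp add: ennreal_mult[symmetric] ennreal_leI)
      then show "ennreal (norm ((\<phi> x * ?e x) *\<^sub>R v x)) * indicator \<Omega> x \<le> ennreal M * ennreal (\<bar>?e x\<bar> * norm (v x))"
        by (auto simp: indicator_def)
    qed
    also have "\<dots> = ennreal M * (\<integral>\<^sup>+x. ennreal (\<bar>?e x\<bar> * norm (v x)) \<partial>lborel)"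
      using em by (intro nn_integral_cmult) auto
    also have "\<dots> \<le> ennreal M * (ennreal C * ((\<integral>\<^sup>+x. ennreal (norm (v x) + 2 * \<eta> k) * indicator ?S x \<partial>?H) + ennreal (\<eta> k)))"
      by (intro mult_left_mono \<psi>(6)) auto
    also have "(\<integral>\<^sup>+x. ennreal (norm (v x) + 2 * \<eta> k) * indicator ?S x \<partial>?H) = (\<integral>\<^sup>+x. ennreal (norm (v x)) * indicator ?S x + ennreal (2 * \<eta> k) * indicator ?S x \<partial>?H)"
      using \<eta>[of k] by (intro nn_integral_cong) (auto simp: indicator_def ennreal_plus)
    also have "\<dots> = I + (\<integral>\<^sup>+x. ennreal (2 * \<eta> k) * indicator ?S x \<partial>?H)" unfolding I_def by (intro nn_integral_add) auto
    also have "\<dots> = ennreal (r + 2 * \<eta> k * h)"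
      using \<eta>[of k] h r by (simp add: nn_integral_cmult_indicator ennreal_mult ennreal_plus)
    also have "ennreal M * (ennreal C * (ennreal (r + 2 * \<eta> k * h) + ennreal (\<eta> k))) = ennreal (M * C * (r + 2 * \<eta> k * h + \<eta> k))"
      using \<eta>[of k] h r C(1) M(2) by (simp add: ennreal_mult ennreal_plus mult.assoc)
    finally show ?thesis using \<eta>[of k] h r C(1) M(2) by (subst (asm) ennreal_le_iff) auto
  qed
  have "(\<lambda>k. M * C * (r + 2 * \<eta> k * h + \<eta> k)) \<longlonglongrightarrow> M * C * (r + 2 * 0 * h + 0)"
    by (intro tendsto_intros \<eta>0)
  then have "norm (boundary_term \<Omega> \<phi> i v G) \<le> M * C * (r + 2 * 0 * h + 0)"
    using Xle by (intro LIMSEQ_le[OF limX]) auto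
  then show ?thesis by (simp add: r_def I_def)
qed

text \<open>Continuity of the defect in the H1 norm; it carries the smooth estimate over to limits
  of smooth functions.\<close>

lemma boundary_term_le:
  fixes f :: "real^'n \<Rightarrow> 'b::euclidean_space"
  assumes \<Omega>: "open \<Omega>" "bounded \<Omega>" and f: "f \<in> L2 \<Omega>" "G \<in> L2 \<Omega>" and \<phi>: "test_function UNIV \<phi>"
    and M: "\<And>x. \<bar>\<phi> x\<bar> \<le> M" "\<And>x i. \<bar>partial i \<phi> x\<bar> \<le> M" "0 \<le> M"
  shows "norm (boundary_term \<Omega> \<phi> i f G) \<le> M * sqrt (measure lebesgue \<Omega>) * (L2_norm \<Omega> f + L2_norm \<Omega> G)"
proof -
  have \<Omega>b: "\<Omega> \<in> sets borel" using \<Omega> by simp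
  note L1 = L2_integrable[OF \<Omega>b \<Omega>(2)]
  have *: "norm (LINT x|lebesgue_on \<Omega>. a x *\<^sub>R u x) \<le> M * (LINT x|lebesgue_on \<Omega>. norm (w x))"
    if "integrable (lebesgue_on \<Omega>) (\<lambda>x. a x *\<^sub>R u x)" "integrable (lebesgue_on \<Omega>) w" "\<And>x. \<bar>a x\<bar> \<le> M" "\<And>x. norm (u x) \<le> norm (w x)"
    for a and u :: "real^'n \<Rightarrow> 'b" and w :: "real^'n \<Rightarrow> 'c::euclidean_space"
  proof -
    have "norm (LINT x|lebesgue_on \<Omega>. a x *\<^sub>R u x) \<le> (LINT x|lebesgue_on \<Omega>. norm (a x *\<^sub>R u x))" by (rule integral_norm_bound)
    also have "\<dots> \<le> (LINT x|lebesgue_on \<Omega>. M * norm (w x))"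
    proof (rule integral_mono)
      show "integrable (lebesgue_on \<Omega>) (\<lambda>x. norm (a x *\<^sub>R u x))" by (rule integrable_norm[OF that(1)])
      show "integrable (lebesgue_on \<Omega>) (\<lambda>x. M * norm (w x))" using that(2) by simp
      show "norm (a x *\<^sub>R u x) \<le> M * norm (w x)" for x using that(3,4) M(3) by (auto intro!: mult_mono)
    qed
    finally show ?thesis by simp
  qed
  have "norm (boundary_term \<Omega> \<phi> i f G) \<le> M * (LINT x|lebesgue_on \<Omega>. norm (f x)) + M * (LINT x|lebesgue_on \<Omega>. norm (G x))"
    unfolding boundary_term_def
    by (intro order_trans[OF norm_triangle_ineq] add_mono * M test_function_integrable[OF \<phi>] integrable_vec_nth L1 f Finite_Cartesian_Product.norm_nth_le order_refl)
  also have "\<dots> \<le> M * (sqrt (measure lebesgue \<Omega>) * L2_norm \<Omega> f) + M * (sqrt (measure lebesgue \<Omega>) * L2_norm \<Omega> G)"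
    by (intro add_mono mult_left_mono L2_norm_1_le[OF \<Omega>b \<Omega>(2)] f M)
  finally show ?thesis by (simp add: algebra_simps)
qed

text \<open>The defect of v is that of a smooth approximant minus that of the error. The first is
  bounded by the surface integral of the approximant, which tends to zero because the trace is zero;
  the second by the H1 distance.\<close>

lemma zero_trace_weak_gradient:
  fixes v :: "real^'n \<Rightarrow> 'b::euclidean_space"
  assumes \<Omega>: "open \<Omega>" "bounded \<Omega>" "lipschitz_boundary \<Omega>" and card: "2 \<le> CARD('n)" and tr: "has_trace \<Omega> v (\<lambda>x. 0)"
    and \<phi>: "test_function UNIV \<phi>"
  shows "(LINT x|lebesgue_on \<Omega>. partial i \<phi> x *\<^sub>R v x) = - (LINT x|lebesgue_on \<Omega>. \<phi> x *\<^sub>R wgrad \<Omega> v x $ i)"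
proof -
  let ?S = "frontier \<Omega>"
  let ?H = "hausdorff_measure (real CARD('n) - 1) :: (real^'n) measure"
  have \<Omega>b: "\<Omega> \<in> sets borel" using \<Omega> by simp
  have Sb[measurable]: "?S \<in> sets borel" by simp
  have fin: "hausdorff_outer (real CARD('n) - 1) ?S < \<infinity>"
    using hausdorff_frontier_finite[OF \<Omega>] by simp
  have S: "compact ?S" using \<Omega> by (simp add: compact_frontier_bounded)
  from boundary_cutoff_exists[OF card] obtain C where C0: "0 \<le> C \<and> (\<forall>(S :: (real^'n) set) g \<eta>. compact S \<longrightarrow> hausdorff_outer (real CARD('n) - 1) S < \<infinity> \<longrightarrow>
     continuous_on UNIV g \<longrightarrow> (\<forall>x. 0 \<le> g x) \<longrightarrow> 0 < \<eta> \<longrightarrow> (\<exists>\<psi>. boundary_cutoff S g \<eta> C \<psi>))"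
    by (elim exE) (rule that)
  have C: "0 \<le> C" "\<And>g \<eta>. continuous_on UNIV g \<Longrightarrow> \<forall>x. 0 \<le> g x \<Longrightarrow> 0 < \<eta> \<Longrightarrow> \<exists>\<psi>. boundary_cutoff ?S g \<eta> C \<psi>"
    using C0 S fin by simp_all
  obtain M where M: "M > 0" "\<And>x. \<bar>\<phi> x\<bar> \<le> M" "\<And>x i. \<bar>partial i \<phi> x\<bar> \<le> M"
    using test_function_bounded[OF \<phi>] by metis
  have v: "v \<in> H1 \<Omega>" using tr by (simp add: has_trace_def)
  obtain \<xi> :: "nat \<Rightarrow> real^'n \<Rightarrow> 'b" where \<xi>: "\<And>k. smooth (\<xi> k)" "(\<lambda>k. H1_norm \<Omega> (\<lambda>x. \<xi> k x - v x)) \<longlonglongrightarrow> 0"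
    "(\<lambda>k. \<integral>\<^sup>+x. ennreal ((norm (\<xi> k x - 0))\<^sup>2) * indicator ?S x \<partial>?H) \<longlonglongrightarrow> 0"
    using tr unfolding has_trace_def by blast
  have \<xi>H: "\<xi> k \<in> H1 \<Omega>" for k by (rule smooth_H1[OF \<Omega>(1,2) \<xi>(1)])
  define D where "D k = (\<integral>\<^sup>+x. ennreal ((norm (\<xi> k x))\<^sup>2) * indicator ?S x \<partial>?H)" for k
  define I where "I k = (\<integral>\<^sup>+x. ennreal (norm (\<xi> k x)) * indicator ?S x \<partial>?H)" for k
  have D0: "D \<longlonglongrightarrow> 0" using \<xi>(3) by (simp add: D_def[abs_def])
  have HS: "emeasure ?H ?S < \<infinity>" using fin by (simp add: emeasure_hausdorff_measure)
  define h where "h = enn2real (emeasure ?H ?S)"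
  have h: "emeasure ?H ?S = ennreal h" "0 \<le> h" using HS by (auto simp: h_def)
  \<comment> \<open>The trace gives convergence of squares on the boundary, whereas the cutoff
    estimate needs first powers; the finite surface measure bridges the two.\<close>
  have I0: "(\<lambda>k. enn2real (I k)) \<longlonglongrightarrow> 0"
  proof (rule LIMSEQ_I)
    fix \<epsilon> :: real assume \<epsilon>: "0 < \<epsilon>"
    \<comment> \<open>Young's inequality t \<le> \<kappa> + t^2/\<kappa> costs \<kappa> times the
      surface measure h. The choice keeps this below \<epsilon>/4, and the extra 1 covers h =
      0.\<close>
    define \<kappa> where "\<kappa> = \<epsilon> / (4 * (h + 1))"
    have \<kappa>: "0 < \<kappa>" using \<epsilon> h by (simp add: \<kappa>_def)
    have \<kappa>h: "\<kappa> * h \<le> \<epsilon> / 4" using \<epsilon> h by (simp add: \<kappa>_def field_simps)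
    have "\<forall>\<^sub>F k in sequentially. D k < ennreal (\<kappa> * \<epsilon> / 4)"
      using order_tendstoD(2)[OF D0, of "ennreal (\<kappa> * \<epsilon> / 4)"] \<kappa> \<epsilon> by simp
    then have "\<forall>\<^sub>F k in sequentially. norm (enn2real (I k) - 0) < \<epsilon>"
    proof eventually_elim
      case (elim k)
      have [measurable]: "\<xi> k \<in> borel_measurable borel" by (rule smooth_borel_measurable[OF \<xi>(1)])
      have "I k \<le> (\<integral>\<^sup>+x. ennreal \<kappa> * indicator ?S x + ennreal (1 / \<kappa>) * (ennreal ((norm (\<xi> k x))\<^sup>2) * indicator ?S x) \<partial>?H)"
        unfolding I_def
      proof (rule nn_integral_mono)
        fix x
        have "norm (\<xi> k x) \<le> \<kappa> + (1 / \<kappa>) * (norm (\<xi> k x))\<^sup>2"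
        proof -
          have "0 \<le> (norm (\<xi> k x) - \<kappa>)\<^sup>2" by simp
          then have "2 * \<kappa> * norm (\<xi> k x) \<le> \<kappa>\<^sup>2 + (norm (\<xi> k x))\<^sup>2" by (simp add: power2_diff algebra_simps)
          moreover have "0 \<le> \<kappa> * norm (\<xi> k x)" using \<kappa> by simp
          ultimately have "\<kappa> * norm (\<xi> k x) \<le> \<kappa>\<^sup>2 + (norm (\<xi> k x))\<^sup>2" by linarith
          then have "norm (\<xi> k x) \<le> (\<kappa>\<^sup>2 + (norm (\<xi> k x))\<^sup>2) / \<kappa>" using \<kappa> by (simp add: pos_le_divide_eq mult.commute)
          then show ?thesis using \<kappa> by (simp add: add_divide_distrib power2_eq_square)
        qed
        then have "ennreal (norm (\<xi> k x)) \<le> ennreal (\<kappa> + (1 / \<kappa>) * (norm (\<xi> k x))\<^sup>2)" by (rule ennreal_leI)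
        also have "\<dots> = ennreal \<kappa> + ennreal (1 / \<kappa>) * ennreal ((norm (\<xi> k x))\<^sup>2)"
        proof -
          have "ennreal ((1 / \<kappa>) * (norm (\<xi> k x))\<^sup>2) = ennreal (1 / \<kappa>) * ennreal ((norm (\<xi> k x))\<^sup>2)"
            using \<kappa> by (intro ennreal_mult) auto
          then show ?thesis using \<kappa> by simp
        qed
        finally show "ennreal (norm (\<xi> k x)) * indicator ?S x \<le> ennreal \<kappa> * indicator ?S x + ennreal (1 / \<kappa>) * (ennreal ((norm (\<xi> k x))\<^sup>2) * indicator ?S x)"
          by (auto simp: indicator_def)
      qed
      also have "\<dots> = ennreal \<kappa> * ennreal h + ennreal (1 / \<kappa>) * D k"
        unfolding D_def by (subst nn_integral_add) (auto simp: nn_integral_cmult nn_integral_cmult_indicator h(1))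
      also have "\<dots> \<le> ennreal (\<epsilon> / 4) + ennreal (1 / \<kappa>) * ennreal (\<kappa> * \<epsilon> / 4)"
        using elim \<kappa>h \<kappa> h by (intro add_mono mult_left_mono) (auto simp: ennreal_mult[symmetric] ennreal_leI less_imp_le)
      also have "\<dots> = ennreal (\<epsilon> / 2)"
        using \<kappa> \<epsilon> by (simp add: ennreal_mult[symmetric] ennreal_plus[symmetric] del: ennreal_plus)
      finally have "I k \<le> ennreal (\<epsilon> / 2)" .
      then have "enn2real (I k) \<le> \<epsilon> / 2" using \<epsilon> by (intro enn2real_leI) auto
      then show ?case using \<epsilon> by simp
    qed
    then show "\<exists>no. \<forall>n\<ge>no. norm (enn2real (I n) - 0) < \<epsilon>" by (simp add: eventually_sequentially)
  qed
  let ?B = "boundary_term \<Omega> \<phi> i"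
  note L1 = L2_integrable[OF \<Omega>b \<Omega>(2)]
  have bound: "norm (?B v (wgrad \<Omega> v)) \<le> M * C * enn2real (I k) + M * sqrt (measure lebesgue \<Omega>) * (2 * H1_norm \<Omega> (\<lambda>x. \<xi> k x - v x))" for k
  proof -
    let ?g = "\<lambda>x. \<xi> k x - v x" and ?G = "\<lambda>x. wgrad \<Omega> (\<xi> k) x - wgrad \<Omega> v x"
    have gL: "?g \<in> L2 \<Omega>" "?G \<in> L2 \<Omega>" by (intro L2_diff H1_L2 wgrad_L2 \<xi>H v)+
    have "?B ?g ?G = ?B (\<xi> k) (wgrad \<Omega> (\<xi> k)) - ?B v (wgrad \<Omega> v)"
      unfolding boundary_term_def
      using test_function_integrable(2)[OF \<phi> L1[OF H1_L2[OF \<xi>H]], of i k] test_function_integrable(2)[OF \<phi> L1[OF H1_L2[OF v]], of i]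
        test_function_integrable(1)[OF \<phi> integrable_vec_nth[OF L1[OF wgrad_L2[OF \<xi>H]]], of k i] test_function_integrable(1)[OF \<phi> integrable_vec_nth[OF L1[OF wgrad_L2[OF v]]], of i]
      by (simp add: scaleR_diff_right)
    then have "norm (?B v (wgrad \<Omega> v)) \<le> norm (?B (\<xi> k) (wgrad \<Omega> (\<xi> k))) + norm (?B ?g ?G)"
      by (metis diff_add_cancel diff_diff_eq2 norm_triangle_ineq4 add_diff_cancel_left')
    also have "norm (?B (\<xi> k) (wgrad \<Omega> (\<xi> k))) \<le> M * C * enn2real (I k)" unfolding I_def
      by (rule boundary_term_smooth_le[OF \<Omega>(1,2) fin \<xi>(1) wgrad_L2[OF \<xi>H] weak_gradient_wgrad[OF \<xi>H] \<phi> M(2) _ C(1)])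
        (use M C(2) in auto)
    also have "norm (?B ?g ?G) \<le> M * sqrt (measure lebesgue \<Omega>) * (L2_norm \<Omega> ?g + L2_norm \<Omega> ?G)"
      by (rule boundary_term_le[OF \<Omega>(1,2) gL \<phi>]) (use M in auto)
    also have "L2_norm \<Omega> ?G = L2_norm \<Omega> (wgrad \<Omega> ?g)"
    proof (intro L2_AE_cong gL wgrad_L2 H1_diff \<Omega> \<xi>H v)
      show "AE x in lebesgue_on \<Omega>. wgrad \<Omega> (\<xi> k) x - wgrad \<Omega> v x = wgrad \<Omega> ?g x"
        using wgrad_diff[OF \<Omega>(1,2) \<xi>H[of k] v] by eventually_elim simp
    qed
    also have "M * sqrt (measure lebesgue \<Omega>) * (L2_norm \<Omega> ?g + L2_norm \<Omega> (wgrad \<Omega> ?g)) \<le> M * sqrt (measure lebesgue \<Omega>) * (2 * H1_norm \<Omega> ?g)"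
      using L2_norm_le_H1_norm[of \<Omega> ?g] M(1) by (intro mult_left_mono) auto
    finally show ?thesis by simp
  qed
  have "(\<lambda>k. M * C * enn2real (I k) + M * sqrt (measure lebesgue \<Omega>) * (2 * H1_norm \<Omega> (\<lambda>x. \<xi> k x - v x))) \<longlonglongrightarrow> M * C * 0 + M * sqrt (measure lebesgue \<Omega>) * (2 * 0)"
    by (intro tendsto_intros I0 \<xi>(2))
  then have "norm (?B v (wgrad \<Omega> v)) \<le> M * C * 0 + M * sqrt (measure lebesgue \<Omega>) * (2 * 0)"
    by (rule LIMSEQ_le_const) (use bound in auto)
  then show ?thesis by (simp add: boundary_term_def eq_neg_iff_add_eq_0)
qed

section \<open>Korn's and Poincare's inequalities for zero traces\<close>

text \<open>By density everything reduces to indicators, and outer regularity replaces a measurable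
  set by an open one. For an open set a point survives all small translations, so pointwise
  convergence is immediate.\<close>

lemma translation_L1_continuous:
  fixes f :: "'a::euclidean_space \<Rightarrow> real"
  assumes z: "z \<longlonglongrightarrow> 0" and f: "integrable lborel f"
  shows "(\<lambda>k. LBINT x. \<bar>f (x + z k) - f x\<bar>) \<longlonglongrightarrow> 0"
  using f
proof (induction f rule: integrable_induct)
  have tr: "integrable lborel (\<lambda>x. g (x + y))" if "integrable lborel g" for g :: "'a \<Rightarrow> real" and y
    using that borel_measurable_integrable[OF that] by (subst integral_lborel_translate(2)) auto
  have trI: "(LBINT x. g (x + y)) = (LBINT x. g x)" if "integrable lborel g" for g :: "'a \<Rightarrow> real" and y
    using borel_measurable_integrable[OF that] by (intro integral_lborel_translate(1)) auto
  have approx: "(LBINT x. \<bar>g (x + y) - g x\<bar>) \<le> 2 * (LBINT x. \<bar>g x - h x\<bar>) + (LBINT x. \<bar>h (x + y) - h x\<bar>)"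
    if gh: "integrable lborel g" "integrable lborel h" for g h :: "'a \<Rightarrow> real" and y
  proof -
    have "(LBINT x. \<bar>g (x + y) - g x\<bar>) \<le> (LBINT x. \<bar>g (x + y) - h (x + y)\<bar> + \<bar>g x - h x\<bar> + \<bar>h (x + y) - h x\<bar>)"
      using gh tr[OF gh(1)] tr[OF gh(2)] by (intro integral_mono) auto
    also have "\<dots> = (LBINT x. \<bar>g (x + y) - h (x + y)\<bar>) + (LBINT x. \<bar>g x - h x\<bar>) + (LBINT x. \<bar>h (x + y) - h x\<bar>)"
      using gh tr[OF gh(1)] tr[OF gh(2)] by simp
    also have "(LBINT x. \<bar>g (x + y) - h (x + y)\<bar>) = (LBINT x. \<bar>g x - h x\<bar>)"
      using trI[of "\<lambda>x. \<bar>g x - h x\<bar>" y] gh by simp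
    finally show ?thesis by simp
  qed
  \<comment> \<open>The property is closed under L1 approximation; this serves both the passage to
    an open set and the limit case of the induction.\<close>
  have conv: "(\<lambda>k. LBINT x. \<bar>g (x + z k) - g x\<bar>) \<longlonglongrightarrow> 0"
    if g: "integrable lborel g" and ap: "\<And>e. 0 < e \<Longrightarrow> \<exists>h. integrable lborel h \<and> (LBINT x. \<bar>g x - h x\<bar>) < e \<and>
       (\<lambda>k. LBINT x. \<bar>h (x + z k) - h x\<bar>) \<longlonglongrightarrow> 0" for g :: "'a \<Rightarrow> real"
  proof (rule LIMSEQ_I)
    fix e :: real assume e: "0 < e"
    obtain h where h: "integrable lborel h" "(LBINT x. \<bar>g x - h x\<bar>) < e / 4" "(\<lambda>k. LBINT x. \<bar>h (x + z k) - h x\<bar>) \<longlonglongrightarrow> 0"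
      using ap[of "e / 4"] e by auto
    obtain N where N: "\<And>k. k \<ge> N \<Longrightarrow> norm ((LBINT x. \<bar>h (x + z k) - h x\<bar>) - 0) < e / 2"
      using LIMSEQ_D[OF h(3), of "e / 2"] e by auto
    show "\<exists>N. \<forall>k\<ge>N. norm ((LBINT x. \<bar>g (x + z k) - g x\<bar>) - 0) < e"
    proof (intro exI allI impI)
      fix k assume "N \<le> k"
      from N[OF this] have "(LBINT x. \<bar>h (x + z k) - h x\<bar>) < e / 2" by simp
      moreover have "0 \<le> (LBINT x. \<bar>g (x + z k) - g x\<bar>)" by (intro integral_nonneg_AE) simp
      ultimately show "norm ((LBINT x. \<bar>g (x + z k) - g x\<bar>) - 0) < e" using approx[OF g h(1), of "z k"] h(2) by simp
    qed
  qed
  {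
    case (base A c)
    have A[measurable]: "A \<in> sets borel" and Afin: "emeasure lborel A < \<infinity>" using base by auto
    have iA: "integrable lborel (\<lambda>x. indicator A x *\<^sub>R c)" using base by simp
    show ?case
    proof (rule conv[OF iA])
      fix e :: real assume e: "0 < e"
      define d where "d = e / (1 + \<bar>c\<bar>)"
      have d: "0 < d" using e by (simp add: d_def)
      obtain U where U: "open U" "A \<subseteq> U" "emeasure lborel (U - A) < d" using outer_regular_lborel[OF A d] by metis
      have [measurable]: "U \<in> sets borel" using U by simp
      have "emeasure lborel U \<le> emeasure lborel A + emeasure lborel (U - A)"
        using U(2) by (intro order_trans[OF _ emeasure_subadditive] emeasure_mono) auto
      also have "\<dots> < \<infinity>" using Afin U(3) by (simp add: ennreal_add_less_top less_top)  (metis ennreal_less_top order_less_trans)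
      finally have Ufin: "emeasure lborel U < \<infinity>" .
      have iU: "integrable lborel (\<lambda>x. indicator U x :: real)" using Ufin by (intro integrable_real_indicator) auto
      \<comment> \<open>The points of U that a translation throws out of U. The points entering U
        have the same measure, since translations preserve it, so the L1 distance is twice this
        loss.\<close>
      define q :: "nat \<Rightarrow> 'a \<Rightarrow> real" where "q k x = indicator U x * (1 - indicator U (x + z k))" for k x
      have "(\<lambda>k. LBINT x. q k x) \<longlonglongrightarrow> integral\<^sup>L lborel (\<lambda>x::'a. 0::real)"
      proof (rule integral_dominated_convergence[OF _ _ iU])
        show "AE x in lborel. (\<lambda>k. q k x) \<longlonglongrightarrow> 0"
        proof (rule AE_I2)
          fix x
          show "(\<lambda>k. q k x) \<longlonglongrightarrow> 0"
          proof (cases "x \<in> U")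
            case True
            have "(\<lambda>k. x + z k) \<longlonglongrightarrow> x + 0" by (intro tendsto_intros z)
            then have "\<forall>\<^sub>F k in sequentially. x + z k \<in> U" using topological_tendstoD[OF _ U(1)] True by simp
            then have "\<forall>\<^sub>F k in sequentially. q k x = 0" by eventually_elim (simp add: q_def)
            then show ?thesis by (rule tendsto_eventually)
          qed (simp add: q_def)
        qed
        show "AE x in lborel. norm (q k x) \<le> indicator U x" for k
          by (auto simp: indicator_def q_def)
        show "q k \<in> borel_measurable lborel" for k unfolding q_def by measurable
      qed simp
      then have *: "(\<lambda>k. 2 * \<bar>c\<bar> * (LBINT x. q k x)) \<longlonglongrightarrow> 2 * \<bar>c\<bar> * 0"
        by (intro tendsto_intros) simp
      have "(LBINT x. \<bar>indicator U (x + z k) *\<^sub>R c - indicator U x *\<^sub>R c\<bar>) = 2 * \<bar>c\<bar> * (LBINT x. q k x)" for k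
      proof -
        have i2: "integrable lborel (\<lambda>x. indicator U (x + z k) :: real)" by (rule tr[OF iU])
        have i3: "integrable lborel (\<lambda>x. indicator U x * (1 - indicator U (x + z k)) :: real)"
          by (rule Bochner_Integration.integrable_bound[OF iU]) (auto simp: indicator_def)
        have "(LBINT x. \<bar>indicator U (x + z k) *\<^sub>R c - indicator U x *\<^sub>R c\<bar>)
          = (LBINT x. \<bar>c\<bar> * ((indicator U (x + z k) - indicator U x) + 2 * (indicator U x * (1 - indicator U (x + z k)))))"
          by (intro Bochner_Integration.integral_cong) (auto simp: indicator_def)
        also have "\<dots> = \<bar>c\<bar> * (((LBINT x. indicator U (x + z k)) - (LBINT x. indicator U x)) + 2 * (LBINT x. indicator U x * (1 - indicator U (x + z k))))"
          unfolding integral_mult_right_zero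
          by (subst Bochner_Integration.integral_add) (use i2 iU i3 in auto)
        also have "(LBINT x. indicator U (x + z k)) = (LBINT x. indicator U x :: real)" by (rule trI[OF iU])
        finally show ?thesis by (simp add: q_def)
      qed
      with * have convU: "(\<lambda>k. LBINT x. \<bar>indicator U (x + z k) *\<^sub>R c - indicator U x *\<^sub>R c\<bar>) \<longlonglongrightarrow> 0" by simp
      have "(LBINT x. \<bar>indicator A x *\<^sub>R c - indicator U x *\<^sub>R c\<bar>) = (LBINT x. \<bar>c\<bar> * indicator (U - A) x)"
        using U(2) by (intro Bochner_Integration.integral_cong) (auto simp: indicator_def)
      also have "\<dots> = \<bar>c\<bar> * measure lborel (U - A)" by simp
      also have "\<dots> \<le> \<bar>c\<bar> * d"
      proof (intro mult_left_mono)
        have "emeasure lborel (U - A) = ennreal (measure lborel (U - A))"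
          using U(3) by (intro emeasure_eq_ennreal_measure) (auto simp: top_unique)
        then show "measure lborel (U - A) \<le> d" using U(3) d by (simp add: ennreal_less_iff less_imp_le)
      qed simp
      also have "\<dots> < e" using e by (simp add: d_def field_simps)
      finally show "\<exists>h. integrable lborel h \<and> (LBINT x. \<bar>indicator A x *\<^sub>R c - h x\<bar>) < e \<and> (\<lambda>k. LBINT x. \<bar>h (x + z k) - h x\<bar>) \<longlonglongrightarrow> 0"
        using iU convU by (intro exI[of _ "\<lambda>x. indicator U x *\<^sub>R c"]) auto
    qed
  next
    case (add f g)
    have "(\<lambda>k. (LBINT x. \<bar>f (x + z k) - f x\<bar>) + (LBINT x. \<bar>g (x + z k) - g x\<bar>)) \<longlonglongrightarrow> 0"
      using tendsto_add[OF add.IH] by simp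
    then show ?case
    proof (rule Lim_null_comparison[rotated])
      show "\<forall>\<^sub>F k in sequentially. norm (LBINT x. \<bar>f (x + z k) + g (x + z k) - (f x + g x)\<bar>) \<le> (LBINT x. \<bar>f (x + z k) - f x\<bar>) + (LBINT x. \<bar>g (x + z k) - g x\<bar>)"
      proof (intro always_eventually allI)
        fix k
        have "(LBINT x. \<bar>f (x + z k) + g (x + z k) - (f x + g x)\<bar>) \<le> (LBINT x. \<bar>f (x + z k) - f x\<bar> + \<bar>g (x + z k) - g x\<bar>)"
          using add.hyps tr[OF add.hyps(1)] tr[OF add.hyps(2)] by (intro integral_mono) auto
        also have "\<dots> = (LBINT x. \<bar>f (x + z k) - f x\<bar>) + (LBINT x. \<bar>g (x + z k) - g x\<bar>)"
          using add.hyps tr[OF add.hyps(1)] tr[OF add.hyps(2)] by simp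
        finally show "norm (LBINT x. \<bar>f (x + z k) + g (x + z k) - (f x + g x)\<bar>) \<le> (LBINT x. \<bar>f (x + z k) - f x\<bar>) + (LBINT x. \<bar>g (x + z k) - g x\<bar>)"
          by (simp add: abs_of_nonneg integral_nonneg_AE)
      qed
    qed
  next
    case (lim f s)
    have "(\<lambda>i. LBINT x. \<bar>f x - s i x\<bar>) \<longlonglongrightarrow> integral\<^sup>L lborel (\<lambda>x::'a. 0::real)"
    proof (rule integral_dominated_convergence[where w="\<lambda>x. 3 * \<bar>f x\<bar>"])
      show "AE x in lborel. (\<lambda>i. \<bar>f x - s i x\<bar>) \<longlonglongrightarrow> 0"
      proof (rule AE_I2)
        fix x
        have "(\<lambda>i. \<bar>f x - s i x\<bar>) \<longlonglongrightarrow> \<bar>f x - f x\<bar>" using lim.hyps(2)[of x] by (intro tendsto_intros) simp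
        then show "(\<lambda>i. \<bar>f x - s i x\<bar>) \<longlonglongrightarrow> 0" by simp
      qed
      show "AE x in lborel. norm \<bar>f x - s i x\<bar> \<le> 3 * \<bar>f x\<bar>" for i
      proof (rule AE_I2)
        fix x show "norm \<bar>f x - s i x\<bar> \<le> 3 * \<bar>f x\<bar>" using lim.hyps(3)[of x i] by simp
      qed
    qed (use lim.hyps(1,4) in \<open>auto dest: borel_measurable_integrable\<close>)
    then have l: "(\<lambda>i. LBINT x. \<bar>f x - s i x\<bar>) \<longlonglongrightarrow> 0" by simp
    show ?case
    proof (rule conv[OF lim.hyps(4)])
      fix e :: real assume "0 < e"
      then obtain i where "norm ((LBINT x. \<bar>f x - s i x\<bar>) - 0) < e" using LIMSEQ_D[OF l] by blast
      then show "\<exists>h. integrable lborel h \<and> (LBINT x. \<bar>f x - h x\<bar>) < e \<and> (\<lambda>k. LBINT x. \<bar>h (x + z k) - h x\<bar>) \<longlonglongrightarrow> 0"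
        using lim.hyps(1) lim.IH by (intro exI[of _ "s i"]) auto
    qed
  }
qed

text \<open>The signed square a|a| turns a square integrable function into an integrable one. The
  inequality then gives L2 continuity of translations from the L1 case.\<close>

lemma power2_diff_le_signed_squares: "(a - b)\<^sup>2 \<le> 2 * \<bar>a * \<bar>a\<bar> - b * \<bar>b\<bar>\<bar>" for a b :: real
proof -
  have *: "(a - b)\<^sup>2 \<le> 2 * \<bar>a * \<bar>a\<bar> - b * \<bar>b\<bar>\<bar>" if "b \<le> a" for a b :: real
  proof (cases "0 \<le> b")
    case True
    then have "(a - b) * (a - b) \<le> (a - b) * (a + b)" using that by (intro mult_left_mono) auto
    moreover have "0 \<le> (a - b) * (a + b)" using that True by simp
    ultimately show ?thesis using True that by (simp add: power2_eq_square algebra_simps)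
  next
    case b: False
    show ?thesis
    proof (cases "0 \<le> a")
      case True
      have "0 \<le> (a + b)\<^sup>2" by simp
      then show ?thesis using True b by (simp add: power2_eq_square algebra_simps abs_of_nonneg)
    next
      case False
      then have 1: "a * a \<le> a * b" using that by (intro mult_left_mono_neg) auto
      have 2: "a * b \<le> b * b" using that b by (intro mult_right_mono_neg) auto
      have "\<bar>a * \<bar>a\<bar> - b * \<bar>b\<bar>\<bar> = b * b - a * a" using False b order_trans[OF 1 2] by simp
      then show ?thesis using 1 2 by (simp add: power2_eq_square algebra_simps)
    qed
  qed
  show ?thesis using *[of b a] *[of a b] by (cases "b \<le> a") (auto simp: power2_commute abs_minus_commute)
qed

lemma translation_L2_bound:
  fixes f :: "'a::euclidean_space \<Rightarrow> real"
  assumes [measurable]: "f \<in> borel_measurable borel" and f: "integrable lborel (\<lambda>x. (f x)\<^sup>2)"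
  shows "integrable lborel (\<lambda>x. (f (x + y) - f x)\<^sup>2)"
    and "(LBINT x. (f (x + y) - f x)\<^sup>2) \<le> 4 * (LBINT x. (f x)\<^sup>2)"
proof -
  have f': "integrable lborel (\<lambda>x. (f (x + y))\<^sup>2)"
    using f integral_lborel_translate(2)[of "\<lambda>x. (f x)\<^sup>2" y] by simp
  have le4: "(f (x + y) - f x)\<^sup>2 \<le> 2 * (f (x + y))\<^sup>2 + 2 * (f x)\<^sup>2" for x
    using power2_norm_add_le[of "f (x + y)" "- f x"] by simp
  show i: "integrable lborel (\<lambda>x. (f (x + y) - f x)\<^sup>2)"
    by (rule Bochner_Integration.integrable_bound[where f="\<lambda>x. 2 * (f (x + y))\<^sup>2 + 2 * (f x)\<^sup>2"])
      (use f f' le4 in auto)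
  have "(LBINT x. (f (x + y) - f x)\<^sup>2) \<le> (LBINT x. 2 * (f (x + y))\<^sup>2 + 2 * (f x)\<^sup>2)"
    using f f' i by (intro integral_mono le4) auto
  also have "\<dots> = 4 * (LBINT x. (f x)\<^sup>2)"
    using f f' integral_lborel_translate(1)[of "\<lambda>x. (f x)\<^sup>2" y] by simp
  finally show "(LBINT x. (f (x + y) - f x)\<^sup>2) \<le> 4 * (LBINT x. (f x)\<^sup>2)" .
qed

lemma translation_L2_continuous:
  fixes f :: "'a::euclidean_space \<Rightarrow> real"
  assumes z: "z \<longlonglongrightarrow> 0" and [measurable]: "f \<in> borel_measurable borel" and f: "integrable lborel (\<lambda>x. (f x)\<^sup>2)"
  shows "(\<lambda>k. LBINT x. (f (x + z k) - f x)\<^sup>2) \<longlonglongrightarrow> 0"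
proof -
  let ?s = "\<lambda>x. f x * \<bar>f x\<bar>"
  have s: "integrable lborel ?s"
    by (rule Bochner_Integration.integrable_bound[OF f]) (auto simp: power2_eq_square abs_mult)
  have st: "integrable lborel (\<lambda>x. ?s (x + y))" for y
    using s integral_lborel_translate(2)[of ?s y] by simp
  have "(\<lambda>k. 2 * (LBINT x. \<bar>?s (x + z k) - ?s x\<bar>)) \<longlonglongrightarrow> 0"
    using tendsto_mult_right_zero[OF translation_L1_continuous[OF z s], of 2] by simp
  then show "(\<lambda>k. LBINT x. (f (x + z k) - f x)\<^sup>2) \<longlonglongrightarrow> 0"
  proof (rule Lim_null_comparison[rotated])
    show "\<forall>\<^sub>F k in sequentially. norm (LBINT x. (f (x + z k) - f x)\<^sup>2) \<le> 2 * (LBINT x. \<bar>?s (x + z k) - ?s x\<bar>)"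
    proof (intro always_eventually allI)
      fix k
      have "(LBINT x. (f (x + z k) - f x)\<^sup>2) \<le> (LBINT x. 2 * \<bar>?s (x + z k) - ?s x\<bar>)"
        using translation_L2_bound(1)[OF assms(2) f, of "z k"] s st[of "z k"] by (intro integral_mono power2_diff_le_signed_squares) auto
      then show "norm (LBINT x. (f (x + z k) - f x)\<^sup>2) \<le> 2 * (LBINT x. \<bar>?s (x + z k) - ?s x\<bar>)"
        by (simp add: abs_of_nonneg integral_nonneg_AE)
    qed
  qed
qed

text \<open>The quotient minus g is the average over a segment of the translation error of g. Its
  squared norm is at most the average of the squared translation errors, which are bounded uniformly
  and tend to zero.\<close>

lemma difference_quotient_L2:
  fixes f g :: "real^'n \<Rightarrow> real"
  assumes [measurable]: "f \<in> borel_measurable borel" "g \<in> borel_measurable borel"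
    and g: "integrable lborel g" and g2: "integrable lborel (\<lambda>x. (g x)\<^sup>2)"
    and eq: "\<And>h. AE x in lborel. f (x + h *\<^sub>R e) - f x = h * (LINT s|unit_measure. g (x + s *\<^sub>R (h *\<^sub>R e)))"
    and h: "h \<longlonglongrightarrow> 0" "\<And>k. h k \<noteq> 0"
  shows "(\<lambda>k. LBINT x. ((f (x + h k *\<^sub>R e) - f x) / h k - g x)\<^sup>2) \<longlonglongrightarrow> 0"
    and "integrable lborel (\<lambda>x. ((f (x + h k *\<^sub>R e) - f x) / h k - g x)\<^sup>2)"
proof -
  interpret I: finite_measure unit_measure by (rule finite_measure_unit_interval)
  interpret P: pair_sigma_finite unit_measure "lborel :: (real^'n) measure" by standard
  let ?Q = "\<lambda>k x. ((f (x + h k *\<^sub>R e) - f x) / h k - g x)\<^sup>2"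
  let ?\<Phi> = "\<lambda>k s. LBINT x. (g (x + s *\<^sub>R (h k *\<^sub>R e)) - g x)\<^sup>2"
  have K: "integrable (unit_measure \<Otimes>\<^sub>M lborel) (\<lambda>(s, x). g (x + s *\<^sub>R (h k *\<^sub>R e)))" for k
    by (rule translation_kernel_integrable) (use g in auto)
  have Km: "(\<lambda>(s, x). (g (x + s *\<^sub>R (h k *\<^sub>R e)) - g x)\<^sup>2) \<in> borel_measurable (unit_measure \<Otimes>\<^sub>M lborel)" for k
    by measurable
  have \<Phi>m: "?\<Phi> k \<in> borel_measurable unit_measure" for k
    by (rule lborel.borel_measurable_lebesgue_integral[OF Km])
  have \<Phi>bd: "norm (?\<Phi> k s) \<le> 4 * (LBINT x. (g x)\<^sup>2)" for k s
    using translation_L2_bound(2)[OF assms(2) g2, of "s *\<^sub>R (h k *\<^sub>R e)"] by (simp add: abs_of_nonneg integral_nonneg_AE)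
  have \<Phi>i: "integrable unit_measure (?\<Phi> k)" for k
    by (rule I.integrable_const_bound[OF AE_I2[OF \<Phi>bd] \<Phi>m])
  have K2: "integrable (unit_measure \<Otimes>\<^sub>M lborel) (\<lambda>(s, x). (g (x + s *\<^sub>R (h k *\<^sub>R e)) - g x)\<^sup>2)" for k
  proof (rule P.Fubini_integrable[OF Km])
    show "integrable unit_measure (\<lambda>s. LBINT x. norm (case (s, x) of (s, x) \<Rightarrow> (g (x + s *\<^sub>R (h k *\<^sub>R e)) - g x)\<^sup>2))"
      using \<Phi>i[of k] by simp
    show "AE s in unit_measure. integrable lborel (\<lambda>x. case (s, x) of (s, x) \<Rightarrow> (g (x + s *\<^sub>R (h k *\<^sub>R e)) - g x)\<^sup>2)"
      using translation_L2_bound(1)[OF assms(2) g2] by simp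
  qed
  define W where "W k x = (LINT s|unit_measure. (g (x + s *\<^sub>R (h k *\<^sub>R e)) - g x)\<^sup>2)" for k x
  have Wi: "integrable lborel (W k)" for k unfolding W_def by (rule P.integrable_snd[OF K2])
  have WI: "(LBINT x. W k x) = (LINT s|unit_measure. ?\<Phi> k s)" for k
    unfolding W_def by (rule P.Fubini_integral[OF K2])
  \<comment> \<open>Jensen's inequality on the parameter interval, with the constant g(x) moved
    under the average.\<close>
  have QW: "AE x in lborel. ?Q k x \<le> W k x" for k
    using eq[of "h k"] P.AE_integrable_snd[OF K[of k]] P.AE_integrable_snd[OF K2[of k]]
  proof eventually_elim
    case (elim x)
    have "(f (x + h k *\<^sub>R e) - f x) / h k - g x = (LINT s|unit_measure. g (x + s *\<^sub>R (h k *\<^sub>R e)) - g x)"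
      using elim(1,2) h(2)[of k] by (simp add: measure_unit_interval)
    then show ?case
      using norm_integral_power2_le[OF finite_measure_unit_interval _ Bochner_Integration.integrable_diff[OF elim(2) I.integrable_const[of "g x"]]] elim(3)
      by (simp add: W_def measure_unit_interval)
  qed
  show Qi: "integrable lborel (?Q k)" for k
  proof (rule Bochner_Integration.integrable_bound[OF Wi])
    show "AE x in lborel. norm (?Q k x) \<le> norm (W k x)" using QW[of k] by eventually_elim simp
  qed measurable
  have "(\<lambda>k. LINT s|unit_measure. ?\<Phi> k s) \<longlonglongrightarrow> (LINT s|unit_measure. 0)"
  proof (rule integral_dominated_convergence[where w="\<lambda>_. 4 * (LBINT x. (g x)\<^sup>2)" and s="?\<Phi>" and f="\<lambda>_. 0" and M=unit_measure])
    show "AE s in unit_measure. (\<lambda>k. ?\<Phi> k s) \<longlonglongrightarrow> 0"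
    proof (rule AE_I2)
      fix s
      have "(\<lambda>k. s *\<^sub>R (h k *\<^sub>R e)) \<longlonglongrightarrow> s *\<^sub>R (0 *\<^sub>R e)" by (intro tendsto_intros h)
      then show "(\<lambda>k. ?\<Phi> k s) \<longlonglongrightarrow> 0" by (intro translation_L2_continuous[OF _ assms(2) g2]) simp
    qed
    show "AE s in unit_measure. norm (?\<Phi> k s) \<le> 4 * (LBINT x. (g x)\<^sup>2)" for k
      by (rule AE_I2[OF \<Phi>bd])
  qed (use \<Phi>m in auto)
  then have "(\<lambda>k. LBINT x. W k x) \<longlonglongrightarrow> 0" by (simp add: WI)
  then show "(\<lambda>k. LBINT x. ?Q k x) \<longlonglongrightarrow> 0"
  proof (rule Lim_null_comparison[rotated])
    show "\<forall>\<^sub>F k in sequentially. norm (LBINT x. ?Q k x) \<le> (LBINT x. W k x)"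
    proof (intro always_eventually allI)
      fix k
      have "(LBINT x. ?Q k x) \<le> (LBINT x. W k x)" by (rule integral_mono_AE[OF Qi Wi QW])
      then show "norm (LBINT x. ?Q k x) \<le> (LBINT x. W k x)" by (simp add: abs_of_nonneg integral_nonneg_AE)
    qed
  qed
qed

lemma integral_product_tendsto:
  fixes a b :: "nat \<Rightarrow> 'a::euclidean_space \<Rightarrow> real" and A B :: "'a \<Rightarrow> real"
  assumes L2: "\<And>k. a k \<in> L2 \<Omega>" "\<And>k. b k \<in> L2 \<Omega>" "A \<in> L2 \<Omega>" "B \<in> L2 \<Omega>"
    and lim: "(\<lambda>k. L2_norm \<Omega> (\<lambda>x. a k x - A x)) \<longlonglongrightarrow> 0" "(\<lambda>k. L2_norm \<Omega> (\<lambda>x. b k x - B x)) \<longlonglongrightarrow> 0"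
  shows "(\<lambda>k. LINT x|lebesgue_on \<Omega>. a k x * b k x) \<longlonglongrightarrow> (LINT x|lebesgue_on \<Omega>. A x * B x)"
proof -
  have prod: "integrable (lebesgue_on \<Omega>) (\<lambda>x. f x * g x)" "\<bar>LINT x|lebesgue_on \<Omega>. f x * g x\<bar> \<le> L2_norm \<Omega> f * L2_norm \<Omega> g"
    if "f \<in> L2 \<Omega>" "g \<in> L2 \<Omega>" for f g :: "'a \<Rightarrow> real"
  proof -
    have m: "(\<lambda>x. f x * g x) \<in> borel_measurable (lebesgue_on \<Omega>)"
      using L2_measurable[OF that(1)] L2_measurable[OF that(2)] by (rule borel_measurable_times)
    show i: "integrable (lebesgue_on \<Omega>) (\<lambda>x. f x * g x)"
      by (rule Bochner_Integration.integrable_bound[OF L2_integrable_mult[OF that] m]) (simp add: abs_mult)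
    have "\<bar>LINT x|lebesgue_on \<Omega>. f x * g x\<bar> \<le> (LINT x|lebesgue_on \<Omega>. \<bar>f x * g x\<bar>)" by (rule integral_abs_bound)
    also have "\<dots> = (LINT x|lebesgue_on \<Omega>. norm (f x) * norm (g x))" by (simp add: abs_mult)
    also have "\<dots> \<le> L2_norm \<Omega> f * L2_norm \<Omega> g" by (rule L2_Cauchy_Schwarz[OF that])
    finally show "\<bar>LINT x|lebesgue_on \<Omega>. f x * g x\<bar> \<le> L2_norm \<Omega> f * L2_norm \<Omega> g" .
  qed
  let ?da = "\<lambda>k x. a k x - A x" and ?db = "\<lambda>k x. b k x - B x"
  have e: "(LINT x|lebesgue_on \<Omega>. a k x * b k x) - (LINT x|lebesgue_on \<Omega>. A x * B x)
     = (LINT x|lebesgue_on \<Omega>. ?da k x * ?db k x) + (LINT x|lebesgue_on \<Omega>. ?da k x * B x) + (LINT x|lebesgue_on \<Omega>. A x * ?db k x)" for k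
  proof -
    note d = L2_diff[OF L2(1) L2(3), of k] L2_diff[OF L2(2) L2(4), of k]
    have "(LINT x|lebesgue_on \<Omega>. a k x * b k x) = (LINT x|lebesgue_on \<Omega>. ?da k x * ?db k x + ?da k x * B x + A x * ?db k x + A x * B x)"
      by (intro Bochner_Integration.integral_cong) (auto simp: algebra_simps)
    also have "\<dots> = (LINT x|lebesgue_on \<Omega>. ?da k x * ?db k x) + (LINT x|lebesgue_on \<Omega>. ?da k x * B x) + (LINT x|lebesgue_on \<Omega>. A x * ?db k x) + (LINT x|lebesgue_on \<Omega>. A x * B x)"
      using prod(1)[OF d] prod(1)[OF d(1) L2(4)] prod(1)[OF L2(3) d(2)] prod(1)[OF L2(3,4)] 
      by (simp only: Bochner_Integration.integral_add Bochner_Integration.integrable_add)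
    finally show ?thesis by simp
  qed
  have "\<bar>(LINT x|lebesgue_on \<Omega>. a k x * b k x) - (LINT x|lebesgue_on \<Omega>. A x * B x)\<bar>
     \<le> L2_norm \<Omega> (?da k) * L2_norm \<Omega> (?db k) + L2_norm \<Omega> (?da k) * L2_norm \<Omega> B + L2_norm \<Omega> A * L2_norm \<Omega> (?db k)" for k
    using e[of k] prod(2)[OF L2_diff[OF L2(1) L2(3)] L2_diff[OF L2(2) L2(4)], of k k] prod(2)[OF L2_diff[OF L2(1) L2(3)] L2(4), of k] prod(2)[OF L2(3) L2_diff[OF L2(2) L2(4)], of k]
    by linarith
  moreover have "(\<lambda>k. L2_norm \<Omega> (?da k) * L2_norm \<Omega> (?db k) + L2_norm \<Omega> (?da k) * L2_norm \<Omega> B + L2_norm \<Omega> A * L2_norm \<Omega> (?db k)) \<longlonglongrightarrow> 0"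
    using tendsto_add[OF tendsto_add[OF tendsto_mult[OF lim] tendsto_mult_left_zero[OF lim(1), of "L2_norm \<Omega> B"]]
        tendsto_mult_right_zero[OF lim(2), of "L2_norm \<Omega> A"]] by simp
  ultimately have "(\<lambda>k. (LINT x|lebesgue_on \<Omega>. a k x * b k x) - (LINT x|lebesgue_on \<Omega>. A x * B x)) \<longlonglongrightarrow> 0"
    unfolding real_norm_def[symmetric] by (rule Lim_null_comparison[OF always_eventually[OF allI]])
  then show ?thesis by (simp add: LIM_zero_iff)
qed

lemma borel_L2_UNIV:
  fixes f :: "'a::euclidean_space \<Rightarrow> real"
  assumes [measurable]: "f \<in> borel_measurable borel" and "integrable lborel (\<lambda>x. (f x)\<^sup>2)"
  shows "f \<in> L2 UNIV" "L2_norm UNIV f = sqrt (LBINT x. (f x)\<^sup>2)"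
proof -
  have "integrable (lebesgue_on UNIV) (\<lambda>x. (f x)\<^sup>2) \<longleftrightarrow> integrable lborel (\<lambda>x. (f x)\<^sup>2)"
    by (rule lebesgue_on_lborel(1)) auto
  moreover have "(LINT x|lebesgue_on UNIV. (f x)\<^sup>2) = (LBINT x. (f x)\<^sup>2)"
    by (rule lebesgue_on_lborel(2)) auto
  moreover have "f \<in> borel_measurable (lebesgue_on UNIV)"
    by (intro measurable_restrict_space1 measurable_completion) simp
  ultimately show "f \<in> L2 UNIV" "L2_norm UNIV f = sqrt (LBINT x. (f x)\<^sup>2)"
    using assms(2) by (auto simp: L2_def L2_norm_def)
qed

lemma partial_difference_quotient_L2:
  fixes f :: "real^'n \<Rightarrow> real" and G :: "real^'n \<Rightarrow> real^'n"
  assumes [measurable]: "f \<in> borel_measurable borel" "G \<in> borel_measurable borel"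
    and f: "integrable lborel f" "integrable lborel (\<lambda>x. (f x)\<^sup>2)"
    and G: "integrable lborel G" "integrable lborel (\<lambda>x. (norm (G x))\<^sup>2)"
    and wg: "\<And>\<phi> i. test_function UNIV \<phi> \<Longrightarrow>
      (LBINT x. partial i \<phi> x *\<^sub>R f x) = - (LBINT x. \<phi> x *\<^sub>R G x $ i)"
    and h: "h \<longlonglongrightarrow> 0" "\<And>k. h k \<noteq> 0"
  shows "(\<lambda>x. G x $ i) \<in> L2 UNIV"
    "(\<lambda>x. (f (x + h k *\<^sub>R axis i 1) - f x) / h k) \<in> L2 UNIV"
    "(\<lambda>k. L2_norm UNIV (\<lambda>x. (f (x + h k *\<^sub>R axis i 1) - f x) / h k - G x $ i)) \<longlonglongrightarrow> 0"
proof -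
  let ?e = "axis i 1 :: real^'n"
  let ?q = "\<lambda>k x. (f (x + h k *\<^sub>R ?e) - f x) / h k"
  have g2: "integrable lborel (\<lambda>x. (G x $ i)\<^sup>2)"
    by (rule Bochner_Integration.integrable_bound[OF G(2)]) (auto intro!: AE_I2 simp: abs_le_square_iff[symmetric] component_le_norm_cart)
  have eq: "AE x in lborel. f (x + t *\<^sub>R ?e) - f x = t * (LINT s|unit_measure. G (x + s *\<^sub>R (t *\<^sub>R ?e)) $ i)" for t
  proof -
    have "AE x in lborel. x \<in> UNIV \<longrightarrow> f (x + t *\<^sub>R ?e) - f x = (LINT s|unit_measure. dir_comp (t *\<^sub>R ?e) (G (x + s *\<^sub>R (t *\<^sub>R ?e))))"
      by (rule translation_AE[where \<Omega>=UNIV]) (use f G wg in auto)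
    moreover have "dir_comp (t *\<^sub>R ?e) A = t * A $ i" for A :: "real^'n"
    proof -
      have "dir_comp (t *\<^sub>R ?e) A = (\<Sum>j\<in>UNIV. if j = i then t * A $ i else 0)"
        unfolding dir_comp_def by (intro sum.cong) (auto simp: axis_def)
      then show ?thesis by simp
    qed
    ultimately show ?thesis by simp
  qed
  note dq = difference_quotient_L2[OF assms(1) _ integrable_vec_nth[OF G(1), of i] g2 eq h]
  have dq1: "(\<lambda>k. LBINT x. (?q k x - G x $ i)\<^sup>2) \<longlonglongrightarrow> 0" by (rule dq(1)) measurable
  have dq2: "integrable lborel (\<lambda>x. (?q k x - G x $ i)\<^sup>2)" for k by (rule dq(2)) measurable
  show GL: "(\<lambda>x. G x $ i) \<in> L2 UNIV" by (rule borel_L2_UNIV(1)[OF _ g2]) measurable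
  have dL: "(\<lambda>x. ?q k x - G x $ i) \<in> L2 UNIV" for k by (rule borel_L2_UNIV(1)[OF _ dq2]) measurable
  show "?q k \<in> L2 UNIV" for k using L2_add[OF dL[of k] GL] by simp
  have "L2_norm UNIV (\<lambda>x. ?q k x - G x $ i) = sqrt (LBINT x. (?q k x - G x $ i)\<^sup>2)" for k
    by (rule borel_L2_UNIV(2)[OF _ dq2]) measurable
  moreover have "(\<lambda>k. sqrt (LBINT x. (?q k x - G x $ i)\<^sup>2)) \<longlonglongrightarrow> 0"
    using tendsto_real_sqrt[OF dq1] by simp
  ultimately show "(\<lambda>k. L2_norm UNIV (\<lambda>x. ?q k x - G x $ i)) \<longlonglongrightarrow> 0" by simp
qed

text \<open>Difference quotients commute and their adjoints are difference quotients in the opposite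
  directions, by translation invariance of the integral; so no second derivatives are needed.\<close>

lemma integral_partials_swap:
  fixes f1 f2 :: "real^'n \<Rightarrow> real" and G1 G2 :: "real^'n \<Rightarrow> real^'n"
  assumes m[measurable]: "f1 \<in> borel_measurable borel" "G1 \<in> borel_measurable borel" "f2 \<in> borel_measurable borel" "G2 \<in> borel_measurable borel"
    and f1: "integrable lborel f1" "integrable lborel (\<lambda>x. (f1 x)\<^sup>2)"
    and G1: "integrable lborel G1" "integrable lborel (\<lambda>x. (norm (G1 x))\<^sup>2)"
    and wg1: "\<And>\<phi> i. test_function UNIV \<phi> \<Longrightarrow>
      (LBINT x. partial i \<phi> x *\<^sub>R f1 x) = - (LBINT x. \<phi> x *\<^sub>R G1 x $ i)"
    and f2: "integrable lborel f2" "integrable lborel (\<lambda>x. (f2 x)\<^sup>2)"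
    and G2: "integrable lborel G2" "integrable lborel (\<lambda>x. (norm (G2 x))\<^sup>2)"
    and wg2: "\<And>\<phi> i. test_function UNIV \<phi> \<Longrightarrow>
      (LBINT x. partial i \<phi> x *\<^sub>R f2 x) = - (LBINT x. \<phi> x *\<^sub>R G2 x $ i)"
  shows "(LBINT x. G1 x $ i * G2 x $ j) = (LBINT x. G1 x $ j * G2 x $ i)"
proof -
  define h where "h k = 1 / real (Suc k)" for k
  have h: "h \<longlonglongrightarrow> 0" "h k \<noteq> 0" for k
    unfolding h_def by (rule LIMSEQ_Suc[OF lim_1_over_n]) (simp del: of_nat_Suc)
  have h': "(\<lambda>k. - h k) \<longlonglongrightarrow> 0" "- h k \<noteq> 0" for k using tendsto_minus[OF h(1)] h(2) by auto
  let ?e = "\<lambda>i. axis i 1 :: real^'n"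
  let ?q = "\<lambda>f t i x. (f (x + t *\<^sub>R ?e i) - f x) / t :: real"
  note q1 = partial_difference_quotient_L2[OF m(1,2) f1 G1 wg1]
  note q2 = partial_difference_quotient_L2[OF m(3,4) f2 G2 wg2]
  have L: "(\<lambda>k. LINT x|lebesgue_on UNIV. ?q f1 (h k) i x * ?q f2 (h k) j x) \<longlonglongrightarrow> (LINT x|lebesgue_on UNIV. G1 x $ i * G2 x $ j)"
    by (rule integral_product_tendsto[OF q1(2)[OF _ h] q2(2)[OF _ h] q1(1)[OF _ h] q2(1)[OF _ h] q1(3)[OF _ h] q2(3)[OF _ h]])
  \<comment> \<open>The steps are negated here and the two directions exchanged, so that both
    sequences agree term by term while their limits are the two sides.\<close>
  have R: "(\<lambda>k. LINT x|lebesgue_on UNIV. ?q f1 (- h k) j x * ?q f2 (- h k) i x) \<longlonglongrightarrow> (LINT x|lebesgue_on UNIV. G1 x $ j * G2 x $ i)"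
    by (rule integral_product_tendsto[OF q1(2)[OF _ h'] q2(2)[OF _ h'] q1(1)[OF _ h'] q2(1)[OF _ h'] q1(3)[OF _ h'] q2(3)[OF _ h']])
  have prod_int: "integrable lborel (\<lambda>x. f1 (x + a) * f2 (x + b))" for a b
  proof (rule Bochner_Integration.integrable_bound)
    show "integrable lborel (\<lambda>x. (f1 (x + a))\<^sup>2 + (f2 (x + b))\<^sup>2)"
      using f1(2) f2(2) integral_lborel_translate(2)[of "\<lambda>x. (f1 x)\<^sup>2" a] integral_lborel_translate(2)[of "\<lambda>x. (f2 x)\<^sup>2" b] by simp
    have "\<bar>u * v\<bar> \<le> u\<^sup>2 + v\<^sup>2" for u v :: real
    proof -
      have "2 * \<bar>u\<bar> * \<bar>v\<bar> \<le> \<bar>u\<bar>\<^sup>2 + \<bar>v\<bar>\<^sup>2" by (rule sum_squares_bound)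
      moreover have "0 \<le> \<bar>u\<bar> * \<bar>v\<bar>" by simp
      ultimately show ?thesis unfolding abs_mult power2_abs mult.assoc by linarith
    qed
    then show "AE x in lborel. norm (f1 (x + a) * f2 (x + b)) \<le> norm ((f1 (x + a))\<^sup>2 + (f2 (x + b))\<^sup>2)"
      by (intro AE_I2) simp
  qed measurable
  define P where "P a b = (LBINT x. f1 (x + a) * f2 (x + b))" for a b
  have shift: "P a b = P (a + c) (b + c)" for a b c
    using integral_lborel_translate(1)[of "\<lambda>x. f1 (x + a) * f2 (x + b)" c] unfolding P_def by (simp add: ac_simps)
  have expand: "(LBINT x. (f1 (x + a) - f1 x) * (f2 (x + b) - f2 x)) = P a b - P a 0 - P 0 b + P 0 0" for a b
  proof -
    have "(LBINT x. (f1 (x + a) - f1 x) * (f2 (x + b) - f2 x)) = (LBINT x. f1 (x + a) * f2 (x + b) - f1 (x + a) * f2 (x + 0) - f1 (x + 0) * f2 (x + b) + f1 (x + 0) * f2 (x + 0))"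
      by (intro Bochner_Integration.integral_cong) (auto simp: algebra_simps)
    also have "\<dots> = P a b - P a 0 - P 0 b + P 0 0"
      unfolding P_def by (simp only: Bochner_Integration.integral_add Bochner_Integration.integral_diff Bochner_Integration.integrable_diff prod_int)
    finally show ?thesis .
  qed
  \<comment> \<open>The correlations \<open>P a b\<close> depend only on a - b. Shifts by -a-b, -a
    and -b carry the four terms for (a, b) into those for (-b, -a), so the two integrals are
    equal.\<close>
  have "(LBINT x. (f1 (x + a) - f1 x) * (f2 (x + b) - f2 x)) = (LBINT x. (f1 (x - b) - f1 x) * (f2 (x - a) - f2 x))" for a b
    using expand[of a b] expand[of "- b" "- a"] shift[of a b "- a - b"] shift[of a 0 "- a"] shift[of 0 b "- b"] by simp
  then have "(LBINT x. ?q f1 (h k) i x * ?q f2 (h k) j x) = (LBINT x. ?q f1 (- h k) j x * ?q f2 (- h k) i x)" for k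
    by simp
  moreover have leb: "(LINT x|lebesgue_on UNIV. u x) = (LBINT x. u x)" if "u \<in> borel_measurable borel" for u :: "real^'n \<Rightarrow> real"
    by (rule lebesgue_on_lborel(2)) (use that in auto)
  moreover have "(\<lambda>x. ?q f1 s i' x * ?q f2 s j' x) \<in> borel_measurable borel" for s i' j' by measurable
  ultimately have "(LINT x|lebesgue_on UNIV. ?q f1 (h k) i x * ?q f2 (h k) j x) = (LINT x|lebesgue_on UNIV. ?q f1 (- h k) j x * ?q f2 (- h k) i x)" for k
    by (simp only: leb)
  with L R have "(LINT x|lebesgue_on UNIV. G1 x $ i * G2 x $ j) = (LINT x|lebesgue_on UNIV. G1 x $ j * G2 x $ i)"
    by (simp only: LIMSEQ_unique)
  moreover have "(LINT x|lebesgue_on UNIV. G1 x $ i * G2 x $ j) = (LBINT x. G1 x $ i * G2 x $ j)" for i j by (rule leb) measurable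
  ultimately show ?thesis by (simp only:)
qed

section \<open>The inequalities of Poincare and Korn\<close>

lemma power2_norm_matrix: "(norm (A :: real^'n^'m))\<^sup>2 = (\<Sum>i\<in>UNIV. \<Sum>j\<in>UNIV. (A $ i $ j)\<^sup>2)"
  unfolding power2_norm_eq_inner inner_vec_def by (simp add: power2_eq_square)

lemma borel_measurable_vec_lambda [measurable (raw)]:
  fixes f :: "'n::finite \<Rightarrow> 'a \<Rightarrow> 'b::euclidean_space"
  assumes "\<And>i. f i \<in> borel_measurable M"
  shows "(\<lambda>x. \<chi> i. f i x) \<in> borel_measurable M"
proof -
  note assms[measurable]
  have "(\<lambda>x. (\<chi> i. f i x) \<bullet> b) \<in> borel_measurable M" if "b \<in> Basis" for b :: "'b^'n"
    using that by (auto simp: Basis_vec_def inner_axis)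
  then show ?thesis by (simp add: borel_measurable_euclidean_space[of "\<lambda>x. \<chi> i. f i x"])
qed

lemma borel_measurable_transpose [measurable (raw)]:
  fixes f :: "'a \<Rightarrow> real^'n^'m"
  shows "f \<in> borel_measurable M \<Longrightarrow> (\<lambda>x. transpose (f x)) \<in> borel_measurable M"
  unfolding transpose_def by measurable

lemma norm_transpose: "norm (transpose A) = norm (A :: real^'n^'m)"
proof (rule power2_eq_imp_eq)
  show "(norm (transpose A))\<^sup>2 = (norm A)\<^sup>2"
    unfolding power2_norm_matrix transpose_def by (simp, rule sum.swap)
qed simp_all

lemma norm_sym_part_le: "norm ((1/2) *\<^sub>R (A + transpose A)) \<le> norm (A :: real^'n^'n)"
  using norm_triangle_ineq[of A "transpose A"] by (simp add: norm_transpose)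

lemma sym_grad_L2:
  assumes "v \<in> H1 \<Omega>"
  shows "sym_grad \<Omega> v \<in> L2 \<Omega>"
proof (rule L2_bound[OF wgrad_L2[OF assms], where c=1])
  note [measurable] = L2_measurable[OF wgrad_L2[OF assms]]
  show "sym_grad \<Omega> v \<in> borel_measurable (lebesgue_on \<Omega>)" unfolding sym_grad_def[abs_def] by measurable
qed (simp only: sym_grad_def mult_1 norm_sym_part_le)

text \<open>The cross terms on the right are products of a partial derivative of one component with
  the transposed one; exchanging the partials under the integral turns their sum into the squared
  divergence.\<close>

lemma power2_norm_sym_part:
  fixes A :: "real^'n^'n"
  shows "2 * (norm ((1/2) *\<^sub>R (A + transpose A)))\<^sup>2 = (norm A)\<^sup>2 + (\<Sum>i\<in>UNIV. \<Sum>j\<in>UNIV. A $ i $ j * A $ j $ i)"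
proof -
  have "2 * (norm ((1/2) *\<^sub>R (A + transpose A)))\<^sup>2 = (\<Sum>i\<in>UNIV. \<Sum>j\<in>UNIV. (A $ i $ j)\<^sup>2 / 2 + (A $ j $ i)\<^sup>2 / 2 + A $ i $ j * A $ j $ i)"
    unfolding power2_norm_matrix sum_distrib_left
    by (intro sum.cong) (auto simp: transpose_def power2_eq_square field_simps)
  also have "\<dots> = (\<Sum>i\<in>UNIV. \<Sum>j\<in>UNIV. (A $ i $ j)\<^sup>2) / 2 + (\<Sum>i\<in>UNIV. \<Sum>j\<in>UNIV. (A $ j $ i)\<^sup>2) / 2 + (\<Sum>i\<in>UNIV. \<Sum>j\<in>UNIV. A $ i $ j * A $ j $ i)"
    by (simp add: sum.distrib sum_divide_distrib)
  also have "(\<Sum>i\<in>UNIV. \<Sum>j\<in>UNIV. (A $ j $ i)\<^sup>2) = (\<Sum>i\<in>UNIV. \<Sum>j\<in>UNIV. (A $ i $ j)\<^sup>2)" by (rule sum.swap)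
  finally show ?thesis by (simp add: power2_norm_matrix)
qed

text \<open>With zero trace the extensions by zero of a function and of its gradient satisfy the
  weak identity on the whole space, so translations out of the domain are allowed.\<close>

lemma zero_trace_representative:
  fixes v :: "real^'n \<Rightarrow> 'b::euclidean_space"
  assumes \<Omega>: "open \<Omega>" "bounded \<Omega>" "lipschitz_boundary \<Omega>" and card: "2 \<le> CARD('n)" and tr: "has_trace \<Omega> v (\<lambda>x. 0)"
    and R: "H1_representative \<Omega> v (wgrad \<Omega> v) F D" and \<phi>: "test_function UNIV \<phi>"
  shows "(LBINT x. partial i \<phi> x *\<^sub>R F x) = - (LBINT x. \<phi> x *\<^sub>R D x $ i)"
proof -
  have v: "v \<in> H1 \<Omega>" using tr by (simp add: has_trace_def)
  note int = L2_integrable[OF borel_open[OF \<Omega>(1)] \<Omega>(2)]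
  note R = R[unfolded H1_representative_def]
  have [measurable]: "F \<in> borel_measurable borel" "D \<in> borel_measurable borel" using R by auto
  note [measurable] = test_function_measurable(1)[OF \<phi>] test_function_partial_measurable(1)[OF \<phi>]
  have "(LBINT x. partial i \<phi> x *\<^sub>R F x) = (LINT x|lebesgue_on \<Omega>. partial i \<phi> x *\<^sub>R v x)"
  proof (rule integral_AE_lborel[OF \<Omega>(1) test_function_integrable(2)[OF \<phi> int[OF H1_L2[OF v]]]])
    show "AE x in lebesgue_on \<Omega>. partial i \<phi> x *\<^sub>R F x = partial i \<phi> x *\<^sub>R v x"
      using R by (auto elim: eventually_mono)
  qed (use R in auto)
  also have "\<dots> = - (LINT x|lebesgue_on \<Omega>. \<phi> x *\<^sub>R wgrad \<Omega> v x $ i)" by (rule zero_trace_weak_gradient[OF \<Omega> card tr \<phi>])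
  also have "(LINT x|lebesgue_on \<Omega>. \<phi> x *\<^sub>R wgrad \<Omega> v x $ i) = (LBINT x. \<phi> x *\<^sub>R D x $ i)"
  proof (rule integral_AE_lborel[OF \<Omega>(1) test_function_integrable(1)[OF \<phi> integrable_vec_nth[OF int[OF wgrad_L2[OF v]]]], symmetric])
    have "AE x in lebesgue_on \<Omega>. D x = wgrad \<Omega> v x" using R by auto
    then show "AE x in lebesgue_on \<Omega>. \<phi> x *\<^sub>R D x $ i = \<phi> x *\<^sub>R wgrad \<Omega> v x $ i" by eventually_elim simp
  qed (use R in auto)
  finally show ?thesis .
qed

text \<open>A translation longer than the diameter moves every point of the domain to where the
  extension is zero. The translation estimate then bounds the function itself, with the length of
  the translation as constant.\<close>

lemma poincare_zero_trace:
  fixes \<Omega> :: "(real^'n) set"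
  assumes \<Omega>: "open \<Omega>" "bounded \<Omega>" "lipschitz_boundary \<Omega>" and card: "2 \<le> CARD('n)"
  obtains C where "0 \<le> C" "\<And>v :: real^'n \<Rightarrow> 'b::euclidean_space. has_trace \<Omega> v (\<lambda>x. 0) \<Longrightarrow> L2_norm \<Omega> v \<le> C * L2_norm \<Omega> (wgrad \<Omega> v)"
proof -
  obtain \<rho> where \<rho>: "0 < \<rho>" "\<And>x. x \<in> \<Omega> \<Longrightarrow> norm x \<le> \<rho>" using \<Omega>(2) by (meson bounded_pos)
  \<comment> \<open>The direction is an arbitrary coordinate axis. Two points of norm at most \<rho>
    differ by at most 2 \<rho>, so the additional 1 forces the translated point out of the
    domain.\<close>
  define z :: "real^'n" where "z = (2 * \<rho> + 1) *\<^sub>R axis undefined 1"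
  have nz: "norm z = 2 * \<rho> + 1" using \<rho> by (simp add: z_def)
  show ?thesis
  proof (rule that[of "2 * \<rho> + 1"])
    show "0 \<le> 2 * \<rho> + 1" using \<rho> by simp
    fix v :: "real^'n \<Rightarrow> 'b" assume tr: "has_trace \<Omega> v (\<lambda>x. 0)"
    have v: "v \<in> H1 \<Omega>" using tr by (simp add: has_trace_def)
    obtain F D where R: "H1_representative \<Omega> v (wgrad \<Omega> v) F D"
      using H1_representative_exists[OF \<Omega>(1,2) H1_L2[OF v] wgrad_L2[OF v]] by metis
    note wg = zero_trace_representative[OF \<Omega> card tr R]
    note R = R[unfolded H1_representative_def]
    have F2: "integrable lborel (\<lambda>x. (norm (F x))\<^sup>2)" using R by simp
    have "ennreal (LBINT x. (norm (F x))\<^sup>2) = (\<integral>\<^sup>+x. ennreal ((norm (F x))\<^sup>2) \<partial>lborel)"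
      by (rule nn_integral_eq_integral[OF F2, symmetric]) simp
    also have "\<dots> \<le> (\<integral>\<^sup>+x. ennreal ((norm (F (x + z) - F x))\<^sup>2) * indicator UNIV x \<partial>lborel)"
    proof (rule nn_integral_mono)
      fix x
      show "ennreal ((norm (F x))\<^sup>2) \<le> ennreal ((norm (F (x + z) - F x))\<^sup>2) * indicator UNIV x"
      proof (cases "x \<in> \<Omega>")
        case True
        have "norm z \<le> norm (x + z) + norm x" using norm_triangle_ineq4[of "x + z" x] by simp
        then have "x + z \<notin> \<Omega>" using \<rho>(2)[of x] \<rho>(2)[of "x + z"] True nz by force
        then show ?thesis using R by simp
      qed (use R in simp)
    qed
    also have "\<dots> \<le> ennreal ((norm z)\<^sup>2 * (LBINT x. (norm (D x))\<^sup>2))"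
      by (rule translation_L2_le[where \<Omega>=UNIV]) (use R wg in auto)
    finally have "(L2_norm \<Omega> v)\<^sup>2 \<le> (norm z)\<^sup>2 * (L2_norm \<Omega> (wgrad \<Omega> v))\<^sup>2"
      using R by (subst (asm) ennreal_le_iff) auto
    then have "(L2_norm \<Omega> v)\<^sup>2 \<le> ((2 * \<rho> + 1) * L2_norm \<Omega> (wgrad \<Omega> v))\<^sup>2" by (simp add: nz power_mult_distrib)
    then show "L2_norm \<Omega> v \<le> (2 * \<rho> + 1) * L2_norm \<Omega> (wgrad \<Omega> v)"
      by (rule power2_le_imp_le) (use \<rho> in simp)
  qed
qed

text \<open>Twice the squared symmetric part is the squared gradient plus cross terms. The integral
  of the cross terms is that of the squared divergence, hence nonnegative; this gives the constant
  2.\<close>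

lemma korn_zero_trace:
  fixes v :: "real^'n \<Rightarrow> real^'n"
  assumes \<Omega>: "open \<Omega>" "bounded \<Omega>" "lipschitz_boundary \<Omega>" and card: "2 \<le> CARD('n)" and tr: "has_trace \<Omega> v (\<lambda>x. 0)"
  shows "(L2_norm \<Omega> (wgrad \<Omega> v))\<^sup>2 \<le> 2 * (L2_norm \<Omega> (sym_grad \<Omega> v))\<^sup>2"
proof -
  have v: "v \<in> H1 \<Omega>" using tr by (simp add: has_trace_def)
  obtain F D where R: "H1_representative \<Omega> v (wgrad \<Omega> v) F D"
    using H1_representative_exists[OF \<Omega>(1,2) H1_L2[OF v] wgrad_L2[OF v]] by metis
  note wg = zero_trace_representative[OF \<Omega> card tr R]
  note R = R[unfolded H1_representative_def]
  have [measurable]: "F \<in> borel_measurable borel" "D \<in> borel_measurable borel" using R by auto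
  have F: "integrable lborel F" "integrable lborel (\<lambda>x. (norm (F x))\<^sup>2)"
    and D: "integrable lborel D" "integrable lborel (\<lambda>x. (norm (D x))\<^sup>2)" using R by auto
  have entry: "\<bar>D x $ i $ j\<bar> \<le> norm (D x)" for x i j
    by (rule order_trans[OF component_le_norm_cart Finite_Cartesian_Product.norm_nth_le])
  have prod_int: "integrable lborel (\<lambda>x. D x $ i $ j * D x $ k $ l)" for i j k l
    by (rule Bochner_Integration.integrable_bound[OF D(2)])
      (auto intro!: AE_I2 mult_mono entry simp: abs_mult power2_eq_square)
  \<comment> \<open>In \<open>D x $ i $ j\<close> the first index is the direction of
    differentiation and the second the component. The gradient of the j-th component is therefore a
    column, collected by \<open>?G\<close>.\<close>
  let ?f = "\<lambda>j x. F x $ j" and ?G = "\<lambda>j x. \<chi> i. D x $ i $ j"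
  have Gm[measurable]: "?G j \<in> borel_measurable borel" for j
    by measurable
  have f1: "integrable lborel (?f j)" for j by (rule integrable_vec_nth[OF F(1)])
  have f2: "integrable lborel (\<lambda>x. (?f j x)\<^sup>2)" for j
    by (rule Bochner_Integration.integrable_bound[OF F(2)]) (auto intro!: AE_I2 simp: abs_le_square_iff[symmetric] component_le_norm_cart)
  have normG: "norm (?G j x) \<le> norm (D x)" for j x
  proof (rule power2_le_imp_le)
    have "(norm (?G j x))\<^sup>2 = (\<Sum>i\<in>UNIV. (D x $ i $ j)\<^sup>2)" unfolding power2_norm_eq_inner inner_vec_def by (simp add: power2_eq_square)
    also have "\<dots> \<le> (\<Sum>i\<in>UNIV. \<Sum>j\<in>UNIV. (D x $ i $ j)\<^sup>2)" by (intro sum_mono member_le_sum) auto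
    finally show "(norm (?G j x))\<^sup>2 \<le> (norm (D x))\<^sup>2" by (simp add: power2_norm_matrix)
  qed simp
  have G1: "integrable lborel (?G j)" for j
    by (rule Bochner_Integration.integrable_bound[OF D(1)]) (auto intro!: AE_I2 normG)
  have G2: "integrable lborel (\<lambda>x. (norm (?G j x))\<^sup>2)" for j
    by (rule Bochner_Integration.integrable_bound[OF D(2)]) (auto intro!: AE_I2 power_mono normG)
  have wgj: "(LBINT x. partial i \<phi> x *\<^sub>R ?f j x) = - (LBINT x. \<phi> x *\<^sub>R ?G j x $ i)"
    if \<phi>: "test_function UNIV \<phi>" for \<phi> i j
  proof -
    obtain M where M: "\<And>x. \<bar>\<phi> x\<bar> \<le> M" "\<And>x i. \<bar>partial i \<phi> x\<bar> \<le> M"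
      using test_function_bounded[OF \<phi>] by metis
    have i1: "integrable lborel (\<lambda>x. partial i \<phi> x *\<^sub>R F x)"
      using test_function_partial_measurable(1)[OF \<phi>] by (intro integrable_bounded_scaleR[OF F(1) _ M(2)]) simp
    have i2: "integrable lborel (\<lambda>x. \<phi> x *\<^sub>R D x $ i)"
      using test_function_measurable(1)[OF \<phi>] by (intro integrable_bounded_scaleR[OF integrable_vec_nth[OF D(1)] _ M(1)]) simp
    have "(LBINT x. (partial i \<phi> x *\<^sub>R F x) $ j) = (LBINT x. partial i \<phi> x *\<^sub>R F x) $ j"
      by (rule integral_bounded_linear[OF bounded_linear_vec_nth i1])
    also have "\<dots> = - (LBINT x. \<phi> x *\<^sub>R D x $ i) $ j" by (simp add: wg[OF \<phi>])
    also have "(LBINT x. \<phi> x *\<^sub>R D x $ i) $ j = (LBINT x. (\<phi> x *\<^sub>R D x $ i) $ j)"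
      by (rule integral_bounded_linear[OF bounded_linear_vec_nth i2, symmetric])
    finally show ?thesis by simp
  qed
  have swap: "(LBINT x. D x $ i $ j * D x $ j $ i) = (LBINT x. D x $ j $ j * D x $ i $ i)" for i j
  proof -
    have "(LBINT x. ?G j x $ i * ?G i x $ j) = (LBINT x. ?G j x $ j * ?G i x $ i)"
    proof (rule integral_partials_swap[OF _ Gm _ Gm f1 f2 G1 G2 _ f1 f2 G1 G2])
      show "?f j \<in> borel_measurable borel" "?f i \<in> borel_measurable borel" by measurable
    qed (use wgj in auto)
    then show ?thesis by simp
  qed
  have "(LBINT x. (\<Sum>i\<in>UNIV. \<Sum>j\<in>UNIV. D x $ i $ j * D x $ j $ i)) = (\<Sum>i\<in>UNIV. \<Sum>j\<in>UNIV. LBINT x. D x $ i $ j * D x $ j $ i)"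
    by (simp add: prod_int)
  also have "\<dots> = (\<Sum>i\<in>UNIV. \<Sum>j\<in>UNIV. LBINT x. D x $ j $ j * D x $ i $ i)" by (intro sum.cong refl swap)
  also have "\<dots> = (LBINT x. (\<Sum>i\<in>UNIV. \<Sum>j\<in>UNIV. D x $ j $ j * D x $ i $ i))"
    by (simp add: prod_int)
  \<comment> \<open>After the exchange of partials the double sum factorises into the square of the
    divergence.\<close>
  also have "\<dots> = (LBINT x. (\<Sum>i\<in>UNIV. D x $ i $ i)\<^sup>2)"
    by (simp add: power2_eq_square sum_product mult.commute)
  also have "\<dots> \<ge> 0" by (intro integral_nonneg_AE) simp
  finally have tr_nonneg: "0 \<le> (LBINT x. (\<Sum>i\<in>UNIV. \<Sum>j\<in>UNIV. D x $ i $ j * D x $ j $ i))" .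
  let ?S = "\<lambda>A :: real^'n^'n. (1/2) *\<^sub>R (A + transpose A)"
  have "(LBINT x. 2 * (norm (?S (D x)))\<^sup>2) = (LBINT x. (norm (D x))\<^sup>2) + (LBINT x. (\<Sum>i\<in>UNIV. \<Sum>j\<in>UNIV. D x $ i $ j * D x $ j $ i))"
    unfolding power2_norm_sym_part by (intro Bochner_Integration.integral_add D Bochner_Integration.integrable_sum prod_int)
  then have le: "(LBINT x. (norm (D x))\<^sup>2) \<le> 2 * (LBINT x. (norm (?S (D x)))\<^sup>2)" using tr_nonneg by simp
  have "(LBINT x. (norm (?S (D x)))\<^sup>2) = (LINT x|lebesgue_on \<Omega>. (norm (sym_grad \<Omega> v x))\<^sup>2)"
  proof (rule integral_AE_lborel[OF \<Omega>(1) L2_integrable_square[OF sym_grad_L2[OF v]]])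
    have "AE x in lebesgue_on \<Omega>. D x = wgrad \<Omega> v x" using R by auto
    then show "AE x in lebesgue_on \<Omega>. (norm (?S (D x)))\<^sup>2 = (norm (sym_grad \<Omega> v x))\<^sup>2"
      by eventually_elim (simp add: sym_grad_def)
    show "(norm (?S (D x)))\<^sup>2 = 0" if "x \<notin> \<Omega>" for x
      using that R norm_sym_part_le[of "D x"] by simp
  qed measurable
  then show ?thesis using le R by (simp add: L2_norm_power2)
qed

section \<open>Traces and displacements\<close>

lemma has_trace_lincomb:
  fixes u v :: "real^'n \<Rightarrow> 'b::euclidean_space"
  assumes \<Omega>: "open \<Omega>" "bounded \<Omega>" and u: "has_trace \<Omega> u g" and v: "has_trace \<Omega> v h"
  shows "has_trace \<Omega> (\<lambda>x. a *\<^sub>R u x + b *\<^sub>R v x) (\<lambda>x. a *\<^sub>R g x + b *\<^sub>R h x)"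
proof -
  let ?H = "hausdorff_measure (real CARD('n) - 1) :: (real^'n) measure"
  let ?I = "\<lambda>f. \<integral>\<^sup>+x. ennreal ((norm (f x :: 'b))\<^sup>2) * indicator (frontier \<Omega>) x \<partial>?H"
  obtain \<phi> where \<phi>: "\<And>k. smooth (\<phi> k)" "(\<lambda>k. H1_norm \<Omega> (\<lambda>x. \<phi> k x - u x)) \<longlonglongrightarrow> 0" "(\<lambda>k. ?I (\<lambda>x. \<phi> k x - g x)) \<longlonglongrightarrow> 0"
    using u unfolding has_trace_def by blast
  obtain \<psi> where \<psi>: "\<And>k. smooth (\<psi> k)" "(\<lambda>k. H1_norm \<Omega> (\<lambda>x. \<psi> k x - v x)) \<longlonglongrightarrow> 0" "(\<lambda>k. ?I (\<lambda>x. \<psi> k x - h x)) \<longlonglongrightarrow> 0"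
    using v unfolding has_trace_def by blast
  have H1: "u \<in> H1 \<Omega>" "v \<in> H1 \<Omega>" and [measurable]: "g \<in> borel_measurable borel" "h \<in> borel_measurable borel"
    using u v by (auto simp: has_trace_def)
  let ?\<chi> = "\<lambda>k x. a *\<^sub>R \<phi> k x + b *\<^sub>R \<psi> k x"
  have sm: "smooth (?\<chi> k)" for k by (intro smooth_add smooth_scaleR smooth_const \<phi>(1) \<psi>(1))
  have [measurable]: "\<phi> k \<in> borel_measurable borel" "\<psi> k \<in> borel_measurable borel" for k
    by (simp_all add: smooth_borel_measurable \<phi>(1) \<psi>(1))
  have "(\<lambda>k. H1_norm \<Omega> (\<lambda>x. ?\<chi> k x - (a *\<^sub>R u x + b *\<^sub>R v x))) \<longlonglongrightarrow> 0"
  proof (rule tendsto_sandwich[OF _ _ tendsto_const])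
    have "H1_norm \<Omega> (\<lambda>x. a *\<^sub>R (\<phi> k x - u x) + b *\<^sub>R (\<psi> k x - v x))
        \<le> 2 * \<bar>a\<bar> * H1_norm \<Omega> (\<lambda>x. \<phi> k x - u x) + 2 * \<bar>b\<bar> * H1_norm \<Omega> (\<lambda>x. \<psi> k x - v x)" for k
      by (intro H1_norm_lincomb_le H1_diff \<Omega> smooth_H1 \<phi>(1) \<psi>(1) H1)
    moreover have "(\<lambda>x. a *\<^sub>R (\<phi> k x - u x) + b *\<^sub>R (\<psi> k x - v x)) = (\<lambda>x. ?\<chi> k x - (a *\<^sub>R u x + b *\<^sub>R v x))" for k
      by (simp add: algebra_simps)
    ultimately show "\<forall>\<^sub>F k in sequentially. H1_norm \<Omega> (\<lambda>x. ?\<chi> k x - (a *\<^sub>R u x + b *\<^sub>R v x))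
        \<le> 2 * \<bar>a\<bar> * H1_norm \<Omega> (\<lambda>x. \<phi> k x - u x) + 2 * \<bar>b\<bar> * H1_norm \<Omega> (\<lambda>x. \<psi> k x - v x)" by simp
    show "(\<lambda>k. 2 * \<bar>a\<bar> * H1_norm \<Omega> (\<lambda>x. \<phi> k x - u x) + 2 * \<bar>b\<bar> * H1_norm \<Omega> (\<lambda>x. \<psi> k x - v x)) \<longlonglongrightarrow> 0"
      using tendsto_add[OF tendsto_mult_left[OF \<phi>(2), of "2 * \<bar>a\<bar>"] tendsto_mult_left[OF \<psi>(2), of "2 * \<bar>b\<bar>"]] by simp
  qed simp
  moreover have "(\<lambda>k. ?I (\<lambda>x. ?\<chi> k x - (a *\<^sub>R g x + b *\<^sub>R h x))) \<longlonglongrightarrow> 0"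
  proof (rule tendsto_sandwich[OF _ _ tendsto_const])
    have m: "(\<lambda>x. ennreal ((norm (f x))\<^sup>2) * indicator (frontier \<Omega>) x) \<in> borel_measurable ?H"
      if [measurable]: "f \<in> borel_measurable borel" for f :: "real^'n \<Rightarrow> 'b"
    proof -
      have "(\<lambda>x. ennreal ((norm (f x))\<^sup>2) * indicator (frontier \<Omega>) x) \<in> borel_measurable borel" by measurable
      then show ?thesis by (simp only: measurable_cong_sets[OF sets_hausdorff_measure refl])
    qed
    have "?I (\<lambda>x. ?\<chi> k x - (a *\<^sub>R g x + b *\<^sub>R h x))
      \<le> ennreal (2 * a\<^sup>2) * ?I (\<lambda>x. \<phi> k x - g x) + ennreal (2 * b\<^sup>2) * ?I (\<lambda>x. \<psi> k x - h x)" for k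
    proof -
      have "ennreal ((norm (?\<chi> k x - (a *\<^sub>R g x + b *\<^sub>R h x)))\<^sup>2) \<le> ennreal (2 * a\<^sup>2) * ennreal ((norm (\<phi> k x - g x))\<^sup>2) + ennreal (2 * b\<^sup>2) * ennreal ((norm (\<psi> k x - h x))\<^sup>2)" for x
      proof -
        have "(norm (a *\<^sub>R (\<phi> k x - g x) + b *\<^sub>R (\<psi> k x - h x)))\<^sup>2 \<le> 2 * (norm (a *\<^sub>R (\<phi> k x - g x)))\<^sup>2 + 2 * (norm (b *\<^sub>R (\<psi> k x - h x)))\<^sup>2"
          by (rule power2_norm_add_le)
        moreover have "a *\<^sub>R (\<phi> k x - g x) + b *\<^sub>R (\<psi> k x - h x) = ?\<chi> k x - (a *\<^sub>R g x + b *\<^sub>R h x)" by (simp add: algebra_simps)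
        ultimately have "(norm (?\<chi> k x - (a *\<^sub>R g x + b *\<^sub>R h x)))\<^sup>2 \<le> 2 * a\<^sup>2 * (norm (\<phi> k x - g x))\<^sup>2 + 2 * b\<^sup>2 * (norm (\<psi> k x - h x))\<^sup>2"
          by (simp add: power_mult_distrib)
        then show ?thesis by (simp add: ennreal_mult[symmetric] ennreal_plus[symmetric] del: ennreal_plus)
      qed
      then have "?I (\<lambda>x. ?\<chi> k x - (a *\<^sub>R g x + b *\<^sub>R h x))
        \<le> (\<integral>\<^sup>+x. ennreal (2 * a\<^sup>2) * (ennreal ((norm (\<phi> k x - g x))\<^sup>2) * indicator (frontier \<Omega>) x)
          + ennreal (2 * b\<^sup>2) * (ennreal ((norm (\<psi> k x - h x))\<^sup>2) * indicator (frontier \<Omega>) x) \<partial>?H)"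
        by (intro nn_integral_mono) (simp split: split_indicator)
      also have "\<dots> = ennreal (2 * a\<^sup>2) * ?I (\<lambda>x. \<phi> k x - g x) + ennreal (2 * b\<^sup>2) * ?I (\<lambda>x. \<psi> k x - h x)"
        by (subst nn_integral_add) (simp_all add: m nn_integral_cmult borel_measurable_times_ennreal)
      finally show ?thesis .
    qed
    then show "\<forall>\<^sub>F k in sequentially. ?I (\<lambda>x. ?\<chi> k x - (a *\<^sub>R g x + b *\<^sub>R h x))
      \<le> ennreal (2 * a\<^sup>2) * ?I (\<lambda>x. \<phi> k x - g x) + ennreal (2 * b\<^sup>2) * ?I (\<lambda>x. \<psi> k x - h x)" by simp
    show "(\<lambda>k. ennreal (2 * a\<^sup>2) * ?I (\<lambda>x. \<phi> k x - g x) + ennreal (2 * b\<^sup>2) * ?I (\<lambda>x. \<psi> k x - h x)) \<longlonglongrightarrow> 0"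
      using tendsto_add[OF ennreal_tendsto_cmult[OF _ \<phi>(3)] ennreal_tendsto_cmult[OF _ \<psi>(3)], of "ennreal (2 * a\<^sup>2)" "ennreal (2 * b\<^sup>2)"] by simp
  qed simp
  ultimately show ?thesis
    unfolding has_trace_def using H1_lincomb(1)[OF \<Omega> H1, of a b] sm by (intro conjI exI[of _ ?\<chi>]) auto
qed

lemma has_trace_diff:
  assumes "open \<Omega>" "bounded \<Omega>" "has_trace \<Omega> u g" "has_trace \<Omega> v h"
  shows "has_trace \<Omega> (\<lambda>x. u x - v x) (\<lambda>x. g x - h x)"
  using has_trace_lincomb[OF assms, of 1 "-1"] by simp

lemma same_trace_H1: "same_trace \<Omega> u w \<Longrightarrow> u \<in> H1 \<Omega> \<and> w \<in> H1 \<Omega>"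
  by (auto simp: same_trace_def has_trace_def)

lemma same_trace_zero:
  assumes \<Omega>: "open \<Omega>" "bounded \<Omega>" and "same_trace \<Omega> u1 w1" "same_trace \<Omega> u2 w2"
  shows "has_trace \<Omega> (\<lambda>x. (u1 x - u2 x) - (w1 x - w2 x)) (\<lambda>x. 0)"
proof -
  obtain g1 g2 where g: "has_trace \<Omega> u1 g1" "has_trace \<Omega> w1 g1" "has_trace \<Omega> u2 g2" "has_trace \<Omega> w2 g2"
    using assms by (auto simp: same_trace_def)
  show ?thesis using has_trace_diff[OF \<Omega> has_trace_diff[OF \<Omega> g(1,3)] has_trace_diff[OF \<Omega> g(2,4)]] by simp
qed

lemma same_trace_midpoint:
  assumes \<Omega>: "open \<Omega>" "bounded \<Omega>" and "same_trace \<Omega> u1 w1" "same_trace \<Omega> u2 w2"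
  shows "same_trace \<Omega> (\<lambda>x. (1/2) *\<^sub>R u1 x + (1/2) *\<^sub>R (u2 x - (w2 x - w1 x))) w1"
proof -
  obtain g1 g2 where g: "has_trace \<Omega> u1 g1" "has_trace \<Omega> w1 g1" "has_trace \<Omega> u2 g2" "has_trace \<Omega> w2 g2"
    using assms by (auto simp: same_trace_def)
  have "has_trace \<Omega> (\<lambda>x. (1/2) *\<^sub>R u1 x + (1/2) *\<^sub>R (u2 x - (w2 x - w1 x))) (\<lambda>x. (1/2) *\<^sub>R g1 x + (1/2) *\<^sub>R (g2 x - (g2 x - g1 x)))"
    by (intro has_trace_lincomb has_trace_diff \<Omega> g)
  moreover have "(1/2) *\<^sub>R g1 x + (1/2) *\<^sub>R (g2 x - (g2 x - g1 x)) = g1 x" for x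
    by (simp add: scaleR_add_left[symmetric])
  ultimately show ?thesis using g(2) by (auto simp: same_trace_def)
qed

lemma transpose_lincomb: "transpose (a *\<^sub>R A + b *\<^sub>R B) = a *\<^sub>R transpose A + b *\<^sub>R transpose (B :: real^'n^'m)"
  by (simp add: transpose_def vec_eq_iff)

lemma sym_grad_lincomb:
  assumes "open \<Omega>" "bounded \<Omega>" "f \<in> H1 \<Omega>" "g \<in> H1 \<Omega>"
  shows "AE x in lebesgue_on \<Omega>. sym_grad \<Omega> (\<lambda>x. a *\<^sub>R f x + b *\<^sub>R g x) x = a *\<^sub>R sym_grad \<Omega> f x + b *\<^sub>R sym_grad \<Omega> g x"
  using wgrad_lincomb[OF assms, of a b]
  by eventually_elim (simp add: sym_grad_def transpose_lincomb algebra_simps)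

lemma sym_grad_diff:
  assumes "open \<Omega>" "bounded \<Omega>" "f \<in> H1 \<Omega>" "g \<in> H1 \<Omega>"
  shows "AE x in lebesgue_on \<Omega>. sym_grad \<Omega> (\<lambda>x. f x - g x) x = sym_grad \<Omega> f x - sym_grad \<Omega> g x"
  using sym_grad_lincomb[OF assms, of 1 "-1"] by simp

lemma L2_norm_mono:
  assumes "f \<in> L2 \<Omega>" "g \<in> L2 \<Omega>" "AE x in lebesgue_on \<Omega>. norm (g x) \<le> norm (f x)"
  shows "L2_norm \<Omega> g \<le> L2_norm \<Omega> f"
  unfolding L2_norm_def using assms(3)
  by (intro real_sqrt_le_mono integral_mono_AE L2_integrable_square assms) (auto elim!: eventually_mono intro: power_mono)

lemma sym_grad_norm_le:
  assumes "v \<in> H1 \<Omega>"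
  shows "L2_norm \<Omega> (sym_grad \<Omega> v) \<le> H1_norm \<Omega> v"
proof -
  have "L2_norm \<Omega> (sym_grad \<Omega> v) \<le> L2_norm \<Omega> (wgrad \<Omega> v)"
    by (rule L2_norm_mono[OF wgrad_L2[OF assms] sym_grad_L2[OF assms]]) (simp only: sym_grad_def norm_sym_part_le, simp)
  then show ?thesis using L2_norm_le_H1_norm(2)[of \<Omega> v] by linarith
qed

text \<open>Subtracting the difference of the data leaves a function with zero trace, to which Korn
  and Poincare apply; the data are then added back.\<close>

lemma displacement_bound:
  fixes \<Omega> :: "(real^'n) set"
  assumes \<Omega>: "open \<Omega>" "bounded \<Omega>" "lipschitz_boundary \<Omega>" and card: "2 \<le> CARD('n)"
  obtains C where "0 \<le> C" "\<And>u1 u2 w1 w2 :: real^'n \<Rightarrow> real^'n. same_trace \<Omega> u1 w1 \<Longrightarrow> same_trace \<Omega> u2 w2 \<Longrightarrow>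
    H1_norm \<Omega> (\<lambda>x. u1 x - u2 x) \<le> C * (L2_norm \<Omega> (sym_grad \<Omega> (\<lambda>x. u1 x - u2 x)) + H1_norm \<Omega> (\<lambda>x. w1 x - w2 x))"
proof -
  obtain P where P: "0 \<le> P" "\<And>v :: real^'n \<Rightarrow> real^'n. has_trace \<Omega> v (\<lambda>x. 0) \<Longrightarrow> L2_norm \<Omega> v \<le> P * L2_norm \<Omega> (wgrad \<Omega> v)"
    using poincare_zero_trace[OF \<Omega> card] by blast
  show ?thesis
  \<comment> \<open>Korn is used with 2 in place of the square root of 2, Poincare turns the
    gradient bound into an H1 bound with factor P + 1, and adding back the data doubles both
    contributions.\<close>
  proof (rule that[of "4 * (P + 1) + 2"])
    show "0 \<le> 4 * (P + 1) + 2" using P(1) by simp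
    fix u1 u2 w1 w2 :: "real^'n \<Rightarrow> real^'n" assume tr: "same_trace \<Omega> u1 w1" "same_trace \<Omega> u2 w2"
    define u where "u x = u1 x - u2 x" for x
    define w where "w x = w1 x - w2 x" for x
    define v where "v x = u x - w x" for x
    have u: "u \<in> H1 \<Omega>" and w: "w \<in> H1 \<Omega>"
      unfolding u_def w_def using same_trace_H1[OF tr(1)] same_trace_H1[OF tr(2)] by (auto intro: H1_diff \<Omega>)
    then have v: "v \<in> H1 \<Omega>" unfolding v_def by (intro H1_diff \<Omega>)
    have z: "has_trace \<Omega> v (\<lambda>x. 0)" unfolding v_def u_def w_def by (rule same_trace_zero[OF \<Omega>(1,2) tr])
    let ?G = "L2_norm \<Omega> (wgrad \<Omega> v)" and ?S = "L2_norm \<Omega> (sym_grad \<Omega> v)"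
    have "?G\<^sup>2 \<le> (2 * ?S)\<^sup>2" using korn_zero_trace[OF \<Omega> card z] by (simp add: power_mult_distrib) (smt (verit) zero_le_power2)
    then have G: "?G \<le> 2 * ?S" by (rule power2_le_imp_le) simp
    have "L2_norm \<Omega> (sym_grad \<Omega> v) = L2_norm \<Omega> (\<lambda>x. sym_grad \<Omega> u x - sym_grad \<Omega> w x)"
      by (rule L2_AE_cong) (use sym_grad_diff[OF \<Omega>(1,2) u w] in \<open>auto simp: v_def[abs_def] intro!: L2_diff sym_grad_L2 u w H1_diff[OF \<Omega>(1,2) u w]\<close>)
    also have "\<dots> \<le> L2_norm \<Omega> (sym_grad \<Omega> u) + L2_norm \<Omega> (sym_grad \<Omega> w)" by (intro L2_norm_triangle_diff sym_grad_L2 u w)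
    also have "L2_norm \<Omega> (sym_grad \<Omega> w) \<le> H1_norm \<Omega> w" by (rule sym_grad_norm_le[OF w])
    finally have S: "?S \<le> L2_norm \<Omega> (sym_grad \<Omega> u) + H1_norm \<Omega> w" by simp
    have "H1_norm \<Omega> v \<le> L2_norm \<Omega> v + ?G" by (rule H1_norm_le)
    also have "\<dots> \<le> (P + 1) * ?G" using P(2)[OF z] by (simp add: algebra_simps)
    also have "\<dots> \<le> (P + 1) * (2 * (L2_norm \<Omega> (sym_grad \<Omega> u) + H1_norm \<Omega> w))"
      using G S P(1) by (intro mult_left_mono) auto
    finally have V: "H1_norm \<Omega> v \<le> (P + 1) * (2 * (L2_norm \<Omega> (sym_grad \<Omega> u) + H1_norm \<Omega> w))" .
    have "H1_norm \<Omega> u = H1_norm \<Omega> (\<lambda>x. 1 *\<^sub>R v x + 1 *\<^sub>R w x)" by (simp add: v_def)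
    also have "\<dots> \<le> 2 * H1_norm \<Omega> v + 2 * H1_norm \<Omega> w" using H1_norm_lincomb_le[OF \<Omega>(1,2) v w, of 1 1] by simp
    also have "\<dots> \<le> (4 * (P + 1) + 2) * (L2_norm \<Omega> (sym_grad \<Omega> u) + H1_norm \<Omega> w)"
    proof -
      define X where "X = L2_norm \<Omega> (sym_grad \<Omega> u) + H1_norm \<Omega> w"
      have "H1_norm \<Omega> w \<le> X" by (simp add: X_def)
      moreover have "(4 * (P + 1) + 2) * X = 2 * ((P + 1) * (2 * X)) + 2 * X" by (simp add: algebra_simps)
      ultimately show ?thesis using V unfolding X_def[symmetric] by linarith
    qed
    finally show "H1_norm \<Omega> (\<lambda>x. u1 x - u2 x) \<le> (4 * (P + 1) + 2) * (L2_norm \<Omega> (sym_grad \<Omega> (\<lambda>x. u1 x - u2 x)) + H1_norm \<Omega> (\<lambda>x. w1 x - w2 x))"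
      by (simp add: u_def[abs_def] w_def[abs_def])
  qed
qed

section \<open>Energy and dissipation\<close>

lemma bounded_bilinear_tapp: "bounded_bilinear (tapp :: 'n::finite tensor4 \<Rightarrow> _)"
  unfolding bilinear_conv_bounded_bilinear[symmetric] bilinear_def
  by (auto simp: linear_iff tapp_def vec_eq_iff sum.distrib sum_distrib_left algebra_simps)

interpretation tapp: bounded_bilinear tapp by (rule bounded_bilinear_tapp)

text \<open>A bound for the contraction that depends on the dimension alone, so one constant serves
  all tensors and thus all values of the damage.\<close>

definition tapp_const :: "'n::finite itself \<Rightarrow> real" where
  "tapp_const _ = (SOME c. 0 \<le> c \<and> (\<forall>(A :: 'n tensor4) \<xi>. norm (tapp A \<xi>) \<le> norm A * norm \<xi> * c))"

lemma tapp_const: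
  "0 \<le> tapp_const TYPE('n)" "norm (tapp A \<xi>) \<le> norm A * norm \<xi> * tapp_const TYPE('n)" for A :: "'n::finite tensor4"
proof -
  have "\<exists>c\<ge>0. \<forall>(A :: 'n tensor4) \<xi>. norm (tapp A \<xi>) \<le> norm A * norm \<xi> * c"
    using tapp.nonneg_bounded by blast
  from someI_ex[OF this]
  show "0 \<le> tapp_const TYPE('n)" "norm (tapp A \<xi>) \<le> norm A * norm \<xi> * tapp_const TYPE('n)"
    unfolding tapp_const_def by blast+
qed

lemma tapp_inner_bound: "\<bar>tapp A \<xi> \<bullet> \<zeta>\<bar> \<le> norm A * tapp_const TYPE('n) * norm \<xi> * norm \<zeta>" for A :: "'n::finite tensor4"
proof -
  have "\<bar>tapp A \<xi> \<bullet> \<zeta>\<bar> \<le> norm (tapp A \<xi>) * norm \<zeta>" by (rule Cauchy_Schwarz_ineq2)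
  also have "\<dots> \<le> (norm A * norm \<xi> * tapp_const TYPE('n)) * norm \<zeta>"
    by (intro mult_right_mono tapp_const) simp
  finally show ?thesis by (simp add: mult_ac)
qed

lemma tapp_parallelogram:
  "tapp A ((1/2) *\<^sub>R \<xi> + (1/2) *\<^sub>R \<zeta>) \<bullet> ((1/2) *\<^sub>R \<xi> + (1/2) *\<^sub>R \<zeta>) + (1/4) * (tapp A (\<xi> - \<zeta>) \<bullet> (\<xi> - \<zeta>))
    = (1/2) * (tapp A \<xi> \<bullet> \<xi>) + (1/2) * (tapp A \<zeta> \<bullet> \<zeta>)"
  by (simp add: tapp.add_right tapp.diff_right tapp.scaleR_right inner_add_left inner_add_right inner_diff_left inner_diff_right) argo

lemma borel_measurable_tapp [measurable (raw)]:
  assumes [measurable]: "A \<in> borel_measurable M" "f \<in> borel_measurable M"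
  shows "(\<lambda>x. tapp (A x) (f x)) \<in> borel_measurable M"
proof -
  have "continuous_on UNIV (\<lambda>z :: 'n::finite tensor4 \<times> _. tapp (fst z) (snd z))"
    by (intro tapp.continuous_on continuous_intros)
  then have "(\<lambda>z :: 'n::finite tensor4 \<times> _. tapp (fst z) (snd z)) \<in> borel_measurable borel" by (rule borel_measurable_continuous_onI)
  from measurable_compose[OF _ this, of "\<lambda>x. (A x, f x)" M] show ?thesis by (simp add: borel_prod[symmetric])
qed

text \<open>The derivative is Lipschitz on the unit interval and hence bounded there by its value at
  0 plus L, which serves as the Lipschitz constant of f.\<close>

lemma C11_unit_lipschitz:
  assumes "C11_unit f"
  obtains L where "0 \<le> L" "\<And>a b. a \<in> {0..1} \<Longrightarrow> b \<in> {0..1} \<Longrightarrow> norm (f a - f b) \<le> L * \<bar>a - b\<bar>"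
proof -
  obtain f' L where f': "\<And>a. a \<in> {0..1} \<Longrightarrow> (f has_vector_derivative f' a) (at a within {0..1})" and L: "L-lipschitz_on {0..1} f'"
    using assms unfolding C11_unit_def by blast
  let ?M = "norm (f' 0) + L"
  have M: "norm (f' a) \<le> ?M" if "a \<in> {0..1}" for a
  proof -
    have "norm (f' a - f' 0) \<le> L * \<bar>a - 0\<bar>" using lipschitz_onD[OF L that, of 0] by (simp add: dist_norm)
    also have "\<dots> \<le> L * 1" using that lipschitz_on_nonneg[OF L] by (intro mult_left_mono) auto
    finally show ?thesis using norm_triangle_sub[of "f' a" "f' 0"] by simp
  qed
  have "norm (f a - f b) \<le> ?M * norm (a - b)" if "a \<in> {0..1}" "b \<in> {0..1}" for a b
  proof (rule differentiable_bound[of "{0..1}" f "\<lambda>a h. h *\<^sub>R f' a"])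
    show "(f has_derivative (\<lambda>h. h *\<^sub>R f' x)) (at x within {0..1})" if "x \<in> {0..1}" for x
      using f'[OF that] by (simp add: has_vector_derivative_def)
    show "onorm (\<lambda>h. h *\<^sub>R f' x) \<le> ?M" if "x \<in> {0..1}" for x
      by (rule onorm_le) (simp add: mult.commute[of "\<bar>_\<bar>"] mult_right_mono M[OF that])
  qed (use that in auto)
  moreover have "0 \<le> ?M" using lipschitz_on_nonneg[OF L] by simp
  ultimately show ?thesis using that[of ?M] by (simp add: real_norm_def)
qed

lemma measurable_lebesgue_on_AE:
  fixes f g :: "'a::euclidean_space \<Rightarrow> 'b::euclidean_space"
  assumes \<Omega>: "\<Omega> \<in> sets borel" and f: "f \<in> borel_measurable (lebesgue_on \<Omega>)" and ae: "AE x in lebesgue_on \<Omega>. f x = g x"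
  shows "g \<in> borel_measurable (lebesgue_on \<Omega>)"
proof -
  have S: "\<Omega> \<in> sets lebesgue" using \<Omega> by simp
  have "AE x in lebesgue. (if x \<in> \<Omega> then f x else 0) = (if x \<in> \<Omega> then g x else 0)"
    using ae S by (auto simp: AE_restrict_space_iff elim: eventually_mono)
  from borel_measurable_AE[OF borel_measurable_if_I[OF f S] this]
  show ?thesis by (rule borel_measurable_if_D)
qed

text \<open>The function is continuous only on [0,1] and \<alpha> takes values there only almost
  everywhere. Clamping the argument extends f continuously to the line, and completeness of Lebesgue
  measure allows the change on a null set.\<close>

lemma measurable_unit_compose:
  fixes f :: "real \<Rightarrow> 'b::euclidean_space" and \<alpha> :: "'a::euclidean_space \<Rightarrow> real"
  assumes \<Omega>: "\<Omega> \<in> sets borel" and f: "continuous_on {0..1} f"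
    and \<alpha>[measurable]: "\<alpha> \<in> borel_measurable (lebesgue_on \<Omega>)" and ae: "AE x in lebesgue_on \<Omega>. 0 \<le> \<alpha> x \<and> \<alpha> x \<le> 1"
  shows "(\<lambda>x. f (\<alpha> x)) \<in> borel_measurable (lebesgue_on \<Omega>)"
proof (rule measurable_lebesgue_on_AE[OF \<Omega>])
  have "continuous_on UNIV (\<lambda>a. f (max 0 (min 1 a)))"
    by (rule continuous_on_compose2[OF f]) (auto intro!: continuous_intros)
  then have [measurable]: "(\<lambda>a. f (max 0 (min 1 a))) \<in> borel_measurable borel" by (rule borel_measurable_continuous_onI)
  show "(\<lambda>x. f (max 0 (min 1 (\<alpha> x)))) \<in> borel_measurable (lebesgue_on \<Omega>)" by measurable
  show "AE x in lebesgue_on \<Omega>. f (max 0 (min 1 (\<alpha> x))) = f (\<alpha> x)"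
    using ae by eventually_elim (simp add: min_absorb2 max_absorb2)
qed

lemma L2_norm_midpoint:
  assumes "f \<in> L2 \<Omega>" "g \<in> L2 \<Omega>"
  shows "(L2_norm \<Omega> (\<lambda>x. (1/2) *\<^sub>R f x + (1/2) *\<^sub>R g x))\<^sup>2 + (1/4) * (L2_norm \<Omega> (\<lambda>x. f x - g x))\<^sup>2
    = (1/2) * (L2_norm \<Omega> f)\<^sup>2 + (1/2) * (L2_norm \<Omega> g)\<^sup>2"
proof -
  let ?m = "\<lambda>x. (1/2) *\<^sub>R f x + (1/2) *\<^sub>R g x"
  note sq = L2_integrable_square
  have m: "?m \<in> L2 \<Omega>" "(\<lambda>x. f x - g x) \<in> L2 \<Omega>" by (intro L2_add L2_scaleR L2_diff assms)+
  have "(LINT x|lebesgue_on \<Omega>. (norm (?m x))\<^sup>2) + (1/4) * (LINT x|lebesgue_on \<Omega>. (norm (f x - g x))\<^sup>2)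
      = (LINT x|lebesgue_on \<Omega>. (norm (?m x))\<^sup>2 + (1/4) * (norm (f x - g x))\<^sup>2)"
    using sq[OF m(1)] sq[OF m(2)] by simp
  also have "\<dots> = (LINT x|lebesgue_on \<Omega>. (1/2) * (norm (f x))\<^sup>2 + (1/2) * (norm (g x))\<^sup>2)"
  proof (rule Bochner_Integration.integral_cong[OF refl])
    fix x
    show "(norm (?m x))\<^sup>2 + (1/4) * (norm (f x - g x))\<^sup>2 = (1/2) * (norm (f x))\<^sup>2 + (1/2) * (norm (g x))\<^sup>2"
      by (simp add: power2_norm_eq_inner inner_add_left inner_add_right inner_diff_left inner_diff_right inner_commute[of "g x" "f x"]) argo
  qed
  also have "\<dots> = (1/2) * (LINT x|lebesgue_on \<Omega>. (norm (f x))\<^sup>2) + (1/2) * (LINT x|lebesgue_on \<Omega>. (norm (g x))\<^sup>2)"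
    using sq[OF assms(1)] sq[OF assms(2)] by simp
  finally show ?thesis by (simp add: L2_norm_power2)
qed

lemma wgrad_midpoint:
  assumes \<Omega>: "open \<Omega>" "bounded \<Omega>" and "f \<in> H1 \<Omega>" "g \<in> H1 \<Omega>"
  shows "(L2_norm \<Omega> (wgrad \<Omega> (\<lambda>x. (1/2) *\<^sub>R f x + (1/2) *\<^sub>R g x)))\<^sup>2 + (1/4) * (L2_norm \<Omega> (wgrad \<Omega> (\<lambda>x. f x - g x)))\<^sup>2
    = (1/2) * (L2_norm \<Omega> (wgrad \<Omega> f))\<^sup>2 + (1/2) * (L2_norm \<Omega> (wgrad \<Omega> g))\<^sup>2"
proof -
  note L = wgrad_L2[OF assms(3)] wgrad_L2[OF assms(4)]
  have "L2_norm \<Omega> (wgrad \<Omega> (\<lambda>x. (1/2) *\<^sub>R f x + (1/2) *\<^sub>R g x)) = L2_norm \<Omega> (\<lambda>x. (1/2) *\<^sub>R wgrad \<Omega> f x + (1/2) *\<^sub>R wgrad \<Omega> g x)"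
    by (intro L2_AE_cong wgrad_L2 H1_lincomb wgrad_lincomb L2_add L2_scaleR L assms)
  moreover have "L2_norm \<Omega> (wgrad \<Omega> (\<lambda>x. f x - g x)) = L2_norm \<Omega> (\<lambda>x. wgrad \<Omega> f x - wgrad \<Omega> g x)"
    by (intro L2_AE_cong wgrad_L2 H1_diff wgrad_diff L2_diff L assms)
  ultimately show ?thesis using L2_norm_midpoint[OF L] by simp
qed

lemma integrable_tapp:
  fixes f g :: "'a::euclidean_space \<Rightarrow> real^'n::finite^'n"
  assumes "f \<in> L2 \<Omega>" "g \<in> L2 \<Omega>"
  shows "integrable (lebesgue_on \<Omega>) (\<lambda>x. tapp C (f x) \<bullet> g x)"
proof (rule Bochner_Integration.integrable_bound)
  note [measurable] = L2_measurable[OF assms(1)] L2_measurable[OF assms(2)]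
  show "(\<lambda>x. tapp C (f x) \<bullet> g x) \<in> borel_measurable (lebesgue_on \<Omega>)" by measurable
  show "integrable (lebesgue_on \<Omega>) (\<lambda>x. norm C * tapp_const TYPE('n) * (norm (f x) * norm (g x)))"
    using L2_integrable_mult[OF assms] by (intro integrable_mult_right)
  show "AE x in lebesgue_on \<Omega>. norm (tapp C (f x) \<bullet> g x) \<le> norm (norm C * tapp_const TYPE('n) * (norm (f x) * norm (g x)))"
    using tapp_inner_bound tapp_const(1)[where 'n='n] by (intro AE_I2) (simp add: abs_mult mult.assoc)
qed

lemma tapp_integral_bound:
  assumes "f \<in> L2 \<Omega>" "g \<in> L2 \<Omega>"
  shows "\<bar>LINT x|lebesgue_on \<Omega>. tapp C (f x) \<bullet> g x\<bar> \<le> norm C * tapp_const TYPE('n::finite) * (L2_norm \<Omega> f * L2_norm \<Omega> (g :: _ \<Rightarrow> real^'n^'n))"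
proof -
  let ?c = "norm C * tapp_const TYPE('n)"
  have "\<bar>LINT x|lebesgue_on \<Omega>. tapp C (f x) \<bullet> g x\<bar> \<le> (LINT x|lebesgue_on \<Omega>. \<bar>tapp C (f x) \<bullet> g x\<bar>)"
    by (rule integral_abs_bound)
  also have "\<dots> \<le> (LINT x|lebesgue_on \<Omega>. ?c * (norm (f x) * norm (g x)))"
    using tapp_inner_bound[of C] L2_integrable_mult[OF assms]
    by (intro integral_mono integrable_abs integrable_tapp assms integrable_mult_right) (simp_all add: mult.assoc)
  also have "\<dots> = ?c * (LINT x|lebesgue_on \<Omega>. norm (f x) * norm (g x))" by simp
  also have "\<dots> \<le> ?c * (L2_norm \<Omega> f * L2_norm \<Omega> g)"
    using tapp_const(1)[where 'n='n] by (intro mult_left_mono L2_Cauchy_Schwarz assms) auto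
  finally show ?thesis .
qed

section \<open>The elastic energy and spaces of symmetric matrices\<close>

definition elastic_energy :: "(real^'n) set \<Rightarrow> 'n tensor4 \<Rightarrow> (real^'n \<Rightarrow> real^'n^'n) \<Rightarrow> real" where
  "elastic_energy \<Omega> C e = (1/2) * (LINT x|lebesgue_on \<Omega>. tapp C (e x) \<bullet> e x)"

lemma elastic_energy_midpoint:
  assumes "e0 \<in> L2 \<Omega>" "e1 \<in> L2 \<Omega>"
  shows "elastic_energy \<Omega> C (\<lambda>x. (1/2) *\<^sub>R e0 x + (1/2) *\<^sub>R e1 x) + (1/4) * elastic_energy \<Omega> C (\<lambda>x. e0 x - e1 x)
    = (1/2) * elastic_energy \<Omega> C e0 + (1/2) * elastic_energy \<Omega> C e1"
proof -
  let ?m = "\<lambda>x. (1/2) *\<^sub>R e0 x + (1/2) *\<^sub>R e1 x" and ?I = "\<lambda>e. LINT x|lebesgue_on \<Omega>. tapp C (e x) \<bullet> e x"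
  note int = integrable_tapp
  have m: "?m \<in> L2 \<Omega>" "(\<lambda>x. e0 x - e1 x) \<in> L2 \<Omega>" by (intro L2_add L2_scaleR L2_diff assms)+
  have "?I ?m + (1/4) * ?I (\<lambda>x. e0 x - e1 x) = (LINT x|lebesgue_on \<Omega>. tapp C (?m x) \<bullet> ?m x + (1/4) * (tapp C (e0 x - e1 x) \<bullet> (e0 x - e1 x)))"
    using int[OF m(1) m(1), of C] int[OF m(2) m(2), of C] by simp
  also have "\<dots> = (LINT x|lebesgue_on \<Omega>. (1/2) * (tapp C (e0 x) \<bullet> e0 x) + (1/2) * (tapp C (e1 x) \<bullet> e1 x))"
    by (simp only: tapp_parallelogram)
  also have "\<dots> = (1/2) * ?I e0 + (1/2) * ?I e1"
    using int[OF assms(1) assms(1), of C] int[OF assms(2) assms(2), of C] by simp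
  finally have *: "?I ?m + (1/4) * ?I (\<lambda>x. e0 x - e1 x) = (1/2) * ?I e0 + (1/2) * ?I e1" .
  show ?thesis unfolding elastic_energy_def using * by argo
qed

lemma elastic_energy_coercive:
  assumes e: "e \<in> L2_sym \<Omega>" and C: "\<And>\<xi>. \<xi> \<in> sym_mat \<Longrightarrow> \<gamma> * (norm \<xi>)\<^sup>2 \<le> tapp C \<xi> \<bullet> \<xi>"
  shows "\<gamma> / 2 * (L2_norm \<Omega> e)\<^sup>2 \<le> elastic_energy \<Omega> C e"
proof -
  have L: "e \<in> L2 \<Omega>" and ae: "AE x in lebesgue_on \<Omega>. e x \<in> sym_mat" using e by (auto simp: L2_sym_def)
  have "\<gamma> * (LINT x|lebesgue_on \<Omega>. (norm (e x))\<^sup>2) = (LINT x|lebesgue_on \<Omega>. \<gamma> * (norm (e x))\<^sup>2)" by simp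
  also have "\<dots> \<le> (LINT x|lebesgue_on \<Omega>. tapp C (e x) \<bullet> e x)"
    using ae by (intro integral_mono_AE integrable_mult_right L2_integrable_square integrable_tapp L) (auto elim!: eventually_mono intro: C)
  finally show ?thesis by (simp add: elastic_energy_def L2_norm_power2)
qed

text \<open>The price of shifting the strain is of first order in the shift, with a factor that
  stays bounded along the evolution.\<close>

lemma elastic_energy_diff_le:
  assumes "e \<in> L2 \<Omega>" "\<delta> \<in> L2 \<Omega>"
  shows "elastic_energy \<Omega> C (\<lambda>x. e x - \<delta> x) - elastic_energy \<Omega> C e
    \<le> norm C * tapp_const TYPE('n::finite) * L2_norm \<Omega> \<delta> * (L2_norm \<Omega> (e :: _ \<Rightarrow> real^'n^'n) + L2_norm \<Omega> \<delta>)"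
proof -
  let ?c = "norm C * tapp_const TYPE('n)" and ?I = "\<lambda>f g. LINT x|lebesgue_on \<Omega>. tapp C (f x) \<bullet> g x"
  note int = integrable_tapp
  have "?I (\<lambda>x. e x - \<delta> x) (\<lambda>x. e x - \<delta> x) = (LINT x|lebesgue_on \<Omega>. tapp C (e x) \<bullet> e x - tapp C (e x) \<bullet> \<delta> x - tapp C (\<delta> x) \<bullet> e x + tapp C (\<delta> x) \<bullet> \<delta> x)"
    by (simp add: tapp.diff_right inner_diff_left inner_diff_right algebra_simps)
  also have "\<dots> = ?I e e - ?I e \<delta> - ?I \<delta> e + ?I \<delta> \<delta>"
    using int[OF assms(1,1), of C] int[OF assms(1,2), of C] int[OF assms(2,1), of C] int[OF assms(2,2), of C] by simp
  finally have "?I (\<lambda>x. e x - \<delta> x) (\<lambda>x. e x - \<delta> x) - ?I e e = - ?I e \<delta> - ?I \<delta> e + ?I \<delta> \<delta>" by simp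
  also have "\<dots> \<le> ?c * (L2_norm \<Omega> e * L2_norm \<Omega> \<delta>) + ?c * (L2_norm \<Omega> \<delta> * L2_norm \<Omega> e) + ?c * (L2_norm \<Omega> \<delta> * L2_norm \<Omega> \<delta>)"
    using tapp_integral_bound[OF assms(1,2), of C] tapp_integral_bound[OF assms(2,1), of C] tapp_integral_bound[OF assms(2,2), of C] by linarith
  finally have "elastic_energy \<Omega> C (\<lambda>x. e x - \<delta> x) - elastic_energy \<Omega> C e \<le> ?c * (L2_norm \<Omega> \<delta> * L2_norm \<Omega> e) + (1/2) * (?c * (L2_norm \<Omega> \<delta> * L2_norm \<Omega> \<delta>))"
    unfolding elastic_energy_def by (simp add: mult.commute[of "L2_norm \<Omega> e"])
  also have "\<dots> \<le> ?c * (L2_norm \<Omega> \<delta> * L2_norm \<Omega> e) + ?c * (L2_norm \<Omega> \<delta> * L2_norm \<Omega> \<delta>)"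
    using tapp_const(1)[where 'n='n] by simp
  finally show ?thesis by (simp add: algebra_simps)
qed

lemma sym_mat_lincomb: "A \<in> sym_mat \<Longrightarrow> B \<in> sym_mat \<Longrightarrow> a *\<^sub>R A + b *\<^sub>R B \<in> sym_mat"
  by (simp add: sym_mat_def transpose_lincomb)

lemma sym_mat_diff: "A \<in> sym_mat \<Longrightarrow> B \<in> sym_mat \<Longrightarrow> A - B \<in> sym_mat"
  using sym_mat_lincomb[of A B 1 "-1"] by simp

lemma sym_grad_sym_mat: "sym_grad \<Omega> v x \<in> sym_mat"
  using transpose_lincomb[of 1 "wgrad \<Omega> v x" 1 "transpose (wgrad \<Omega> v x)"]
    transpose_lincomb[of "1/2" "wgrad \<Omega> v x + transpose (wgrad \<Omega> v x)" 0 0]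
  by (simp add: sym_grad_def sym_mat_def add.commute)

lemma L2_sym_lincomb:
  assumes "f \<in> L2_sym \<Omega>" "g \<in> L2_sym \<Omega>"
  shows "(\<lambda>x. a *\<^sub>R f x + b *\<^sub>R g x) \<in> L2_sym \<Omega>"
proof -
  have "AE x in lebesgue_on \<Omega>. f x \<in> sym_mat" "AE x in lebesgue_on \<Omega>. g x \<in> sym_mat" using assms by (auto simp: L2_sym_def)
  then have "AE x in lebesgue_on \<Omega>. a *\<^sub>R f x + b *\<^sub>R g x \<in> sym_mat" by eventually_elim (rule sym_mat_lincomb)
  then show ?thesis using assms by (auto simp: L2_sym_def intro!: L2_add L2_scaleR)
qed

lemma L2_sym_diff:
  assumes "f \<in> L2_sym \<Omega>" "g \<in> L2_sym \<Omega>"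
  shows "(\<lambda>x. f x - g x) \<in> L2_sym \<Omega>"
  using L2_sym_lincomb[OF assms, of 1 "-1"] by simp

lemma sym_grad_L2_sym: "v \<in> H1 \<Omega> \<Longrightarrow> sym_grad \<Omega> v \<in> L2_sym \<Omega>"
  by (simp add: L2_sym_def sym_grad_L2 sym_grad_sym_mat)

lemma H1_sym_L2_sym: "p \<in> H1_sym \<Omega> \<Longrightarrow> p \<in> L2_sym \<Omega>"
  by (auto simp: H1_sym_def L2_sym_def H1_L2)

lemma H1_sym_lincomb:
  assumes "open \<Omega>" "bounded \<Omega>" "f \<in> H1_sym \<Omega>" "g \<in> H1_sym \<Omega>"
  shows "(\<lambda>x. a *\<^sub>R f x + b *\<^sub>R g x) \<in> H1_sym \<Omega>"
  using L2_sym_lincomb[OF assms(3,4)[THEN H1_sym_L2_sym], of a b] H1_lincomb(1)[OF assms(1,2), of f g a b] assms(3,4)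
  by (auto simp: H1_sym_def L2_sym_def)

lemma C11_unit_continuous_on: "C11_unit f \<Longrightarrow> continuous_on {0..1} f"
  unfolding C11_unit_def continuous_on_eq_continuous_within by (blast intro: has_vector_derivative_continuous)

section \<open>Convexity of the energy up to a damage error\<close>

lemma integrable_damage:
  assumes \<Omega>: "open \<Omega>" "bounded \<Omega>" and \<alpha>: "\<alpha> \<in> H1_unit \<Omega>" and d: "continuous_on {0..1} d"
  shows "integrable (lebesgue_on \<Omega>) (\<lambda>x. d (\<alpha> x) :: real)"
proof -
  have ae: "AE x in lebesgue_on \<Omega>. 0 \<le> \<alpha> x \<and> \<alpha> x \<le> 1" and "\<alpha> \<in> borel_measurable (lebesgue_on \<Omega>)"
    using \<alpha> by (auto simp: H1_unit_def intro: L2_measurable H1_L2)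
  then have m: "(\<lambda>x. d (\<alpha> x)) \<in> borel_measurable (lebesgue_on \<Omega>)" using measurable_unit_compose[OF borel_open[OF \<Omega>(1)] d] by blast
  obtain M where M: "\<forall>a\<in>{0..1}. norm (d a) \<le> M"
    using compact_imp_bounded[OF compact_continuous_image[OF d]] by (auto simp: bounded_iff)
  interpret finite_measure "lebesgue_on \<Omega>" by (rule finite_measure_lebesgue_on_bounded[OF borel_open[OF \<Omega>(1)] \<Omega>(2)])
  from ae have "AE x in lebesgue_on \<Omega>. norm (d (\<alpha> x)) \<le> M" by eventually_elim (use M in simp)
  then show ?thesis by (rule integrable_const_bound[OF _ m])
qed

lemma integrable_hardening:
  assumes \<Omega>: "open \<Omega>" "bounded \<Omega>" and \<alpha>: "\<alpha> \<in> H1_unit \<Omega>" and B: "continuous_on {0..1} B" and p: "p \<in> L2 \<Omega>"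
  shows "integrable (lebesgue_on \<Omega>) (\<lambda>x. tapp (B (\<alpha> x)) (p x) \<bullet> (p x :: real^'n::finite^'n))"
proof -
  have ae: "AE x in lebesgue_on \<Omega>. 0 \<le> \<alpha> x \<and> \<alpha> x \<le> 1" and "\<alpha> \<in> borel_measurable (lebesgue_on \<Omega>)"
    using \<alpha> by (auto simp: H1_unit_def intro: L2_measurable H1_L2)
  then have [measurable]: "(\<lambda>x. B (\<alpha> x)) \<in> borel_measurable (lebesgue_on \<Omega>)" using measurable_unit_compose[OF borel_open[OF \<Omega>(1)] B] by blast
  note [measurable] = L2_measurable[OF p]
  obtain M where M: "\<forall>a\<in>{0..1}. norm (B a) \<le> M"
    using compact_imp_bounded[OF compact_continuous_image[OF B]] by (auto simp: bounded_iff)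
  show ?thesis
  proof (rule Bochner_Integration.integrable_bound)
    show "(\<lambda>x. tapp (B (\<alpha> x)) (p x) \<bullet> p x) \<in> borel_measurable (lebesgue_on \<Omega>)" by measurable
    show "integrable (lebesgue_on \<Omega>) (\<lambda>x. M * tapp_const TYPE('n) * (norm (p x))\<^sup>2)"
      by (intro integrable_mult_right L2_integrable_square p)
    from ae show "AE x in lebesgue_on \<Omega>. norm (tapp (B (\<alpha> x)) (p x) \<bullet> p x) \<le> norm (M * tapp_const TYPE('n) * (norm (p x))\<^sup>2)"
    proof eventually_elim
      fix x assume "0 \<le> \<alpha> x \<and> \<alpha> x \<le> 1"
      then have "norm (B (\<alpha> x)) \<le> M" using M by simp
      have "\<bar>tapp (B (\<alpha> x)) (p x) \<bullet> p x\<bar> \<le> norm (B (\<alpha> x)) * tapp_const TYPE('n) * norm (p x) * norm (p x)" by (rule tapp_inner_bound)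
      also have "\<dots> \<le> M * tapp_const TYPE('n) * norm (p x) * norm (p x)"
        using tapp_const(1)[where 'n='n] \<open>norm (B (\<alpha> x)) \<le> M\<close> by (intro mult_right_mono) auto
      also have "\<dots> \<le> \<bar>M * tapp_const TYPE('n) * (norm (p x))\<^sup>2\<bar>" by (simp add: power2_eq_square mult.assoc)
      finally show "norm (tapp (B (\<alpha> x)) (p x) \<bullet> p x) \<le> norm (M * tapp_const TYPE('n) * (norm (p x))\<^sup>2)" by simp
    qed
  qed
qed

lemma integrable_bounded_weight:
  fixes \<delta> :: "'a \<Rightarrow> real"
  assumes [measurable]: "\<delta> \<in> borel_measurable M" and ae: "AE x in M. \<bar>\<delta> x\<bar> \<le> 1" and g: "integrable M g"
  shows "integrable M (\<lambda>x. \<bar>\<delta> x\<bar> * g x :: real)"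
proof (rule Bochner_Integration.integrable_bound[OF g])
  note [measurable] = borel_measurable_integrable[OF g]
  show "(\<lambda>x. \<bar>\<delta> x\<bar> * g x) \<in> borel_measurable M" by measurable
  from ae show "AE x in M. norm (\<bar>\<delta> x\<bar> * g x) \<le> norm (g x)"
    by eventually_elim (simp add: abs_mult mult_left_le_one_le)
qed

text \<open>The quadratic form of \<open>B \<alpha>\<close> is convex for frozen \<open>\<alpha>\<close>, and freezing \<open>\<alpha>\<close> at the midpoint costs an
  error controlled by the Lipschitz constants of \<open>d\<close> and \<open>B\<close>.\<close>

lemma hardening_midpoint_le:
  fixes B :: "real \<Rightarrow> 'n::finite tensor4"
  assumes ab: "a \<in> {0..1}" "b \<in> {0..1}" and \<xi>: "\<xi> \<in> sym_mat" "\<zeta> \<in> sym_mat"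
    and B: "\<And>a \<xi>. \<xi> \<in> sym_mat \<Longrightarrow> a \<in> {0..1} \<Longrightarrow> 0 \<le> tapp (B a) \<xi> \<bullet> \<xi>"
    and L: "0 \<le> L" "\<And>a b. a \<in> {0..1} \<Longrightarrow> b \<in> {0..1} \<Longrightarrow> norm (B a - B b) \<le> L * \<bar>a - b\<bar>"
  defines "q \<equiv> (1/2) *\<^sub>R \<xi> + (1/2) *\<^sub>R \<zeta>"
  shows "tapp (B ((1/2) *\<^sub>R a + (1/2) *\<^sub>R b)) q \<bullet> q
    \<le> (1/2) * (tapp (B a) \<xi> \<bullet> \<xi>) + (1/2) * (tapp (B b) \<zeta> \<bullet> \<zeta>) + L * tapp_const TYPE('n) * (\<bar>a - b\<bar> * ((norm \<xi>)\<^sup>2 + (norm \<zeta>)\<^sup>2))"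
proof -
  define m where "m = (1/2) *\<^sub>R a + (1/2) *\<^sub>R b"
  have m: "m \<in> {0..1}" "\<bar>m - a\<bar> \<le> \<bar>a - b\<bar>" "\<bar>m - b\<bar> \<le> \<bar>a - b\<bar>" using ab by (auto simp: m_def)
  have *: "tapp (B m) z \<bullet> z \<le> tapp (B c) z \<bullet> z + L * tapp_const TYPE('n) * (\<bar>a - b\<bar> * (norm z)\<^sup>2)" if c: "c \<in> {0..1}" "\<bar>m - c\<bar> \<le> \<bar>a - b\<bar>" for c z
  proof -
    have "tapp (B m) z \<bullet> z - tapp (B c) z \<bullet> z = tapp (B m - B c) z \<bullet> z" by (simp add: tapp.diff_left inner_diff_left)
    also have "\<dots> \<le> norm (B m - B c) * tapp_const TYPE('n) * norm z * norm z" using tapp_inner_bound[of "B m - B c" z z] by linarith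
    also have "\<dots> \<le> (L * \<bar>a - b\<bar>) * tapp_const TYPE('n) * norm z * norm z"
    proof (intro mult_right_mono)
      have "norm (B m - B c) \<le> L * \<bar>m - c\<bar>" by (rule L(2)[OF m(1) c(1)])
      also have "\<dots> \<le> L * \<bar>a - b\<bar>" using L(1) c(2) by (rule mult_left_mono[rotated])
      finally show "norm (B m - B c) \<le> L * \<bar>a - b\<bar>" .
    qed (use tapp_const(1)[where 'n='n] in auto)
    finally show ?thesis by (simp add: power2_eq_square mult_ac)
  qed
  have "0 \<le> tapp (B m) (\<xi> - \<zeta>) \<bullet> (\<xi> - \<zeta>)" by (intro B sym_mat_diff \<xi> m)
  then have "tapp (B m) q \<bullet> q \<le> (1/2) * (tapp (B m) \<xi> \<bullet> \<xi>) + (1/2) * (tapp (B m) \<zeta> \<bullet> \<zeta>)"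
    using tapp_parallelogram[of "B m" \<xi> \<zeta>] unfolding q_def by linarith
  moreover have "0 \<le> L * tapp_const TYPE('n) * (\<bar>a - b\<bar> * (norm \<xi>)\<^sup>2)" "0 \<le> L * tapp_const TYPE('n) * (\<bar>a - b\<bar> * (norm \<zeta>)\<^sup>2)"
    using L(1) tapp_const(1)[where 'n='n] by simp_all
  ultimately have "tapp (B m) q \<bullet> q \<le> (1/2) * (tapp (B a) \<xi> \<bullet> \<xi>) + (1/2) * (tapp (B b) \<zeta> \<bullet> \<zeta>)
      + (L * tapp_const TYPE('n) * (\<bar>a - b\<bar> * (norm \<xi>)\<^sup>2) + L * tapp_const TYPE('n) * (\<bar>a - b\<bar> * (norm \<zeta>)\<^sup>2))"
    using *[OF ab(1) m(2), of \<xi>] *[OF ab(2) m(3), of \<zeta>] by linarith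
  then show ?thesis unfolding m_def[symmetric] by (simp only: distrib_left)
qed

text \<open>The elastic and gradient terms obey the parallelogram identity exactly, which produces
  the gain of one quarter. The damage and hardening potentials contribute only errors weighted by
  the distance of the damage variables.\<close>

lemma energy_midpoint_le:
  fixes \<Omega> :: "(real^'n) set"
  assumes \<Omega>: "open \<Omega>" "bounded \<Omega>" and \<alpha>: "\<alpha>0 \<in> H1_unit \<Omega>" "\<alpha>1 \<in> H1_unit \<Omega>"
    and e: "e0 \<in> L2 \<Omega>" "e1 \<in> L2 \<Omega>" and p: "p0 \<in> H1_sym \<Omega>" "p1 \<in> H1_sym \<Omega>"
    and d: "continuous_on {0..1} d" "0 \<le> Ld" "\<And>a b. a \<in> {0..1} \<Longrightarrow> b \<in> {0..1} \<Longrightarrow> norm (d a - d b) \<le> Ld * \<bar>a - b\<bar>"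
    and B: "continuous_on {0..1} B" "\<And>a \<xi>. \<xi> \<in> sym_mat \<Longrightarrow> a \<in> {0..1} \<Longrightarrow> 0 \<le> tapp (B a) \<xi> \<bullet> \<xi>"
    and LB: "0 \<le> LB" "\<And>a b. a \<in> {0..1} \<Longrightarrow> b \<in> {0..1} \<Longrightarrow> norm (B a - B b) \<le> LB * \<bar>a - b\<bar>"
  defines "\<alpha> \<equiv> \<lambda>x. (1/2) *\<^sub>R \<alpha>0 x + (1/2) *\<^sub>R \<alpha>1 x" and "\<eta> \<equiv> \<lambda>x. (1/2) *\<^sub>R e0 x + (1/2) *\<^sub>R e1 x"
    and "q \<equiv> \<lambda>x. (1/2) *\<^sub>R p0 x + (1/2) *\<^sub>R p1 x"
  shows "energy \<Omega> C B d \<alpha> \<eta> q + (1/4) * (elastic_energy \<Omega> C (\<lambda>x. e0 x - e1 x)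
      + (L2_norm \<Omega> (wgrad \<Omega> (\<lambda>x. \<alpha>0 x - \<alpha>1 x)))\<^sup>2 + (L2_norm \<Omega> (wgrad \<Omega> (\<lambda>x. p0 x - p1 x)))\<^sup>2)
    \<le> (1/2) * energy \<Omega> C B d \<alpha>0 e0 p0 + (1/2) * energy \<Omega> C B d \<alpha>1 e1 p1
      + Ld * (LINT x|lebesgue_on \<Omega>. \<bar>\<alpha>0 x - \<alpha>1 x\<bar>)
      + LB * tapp_const TYPE('n) * (LINT x|lebesgue_on \<Omega>. \<bar>\<alpha>0 x - \<alpha>1 x\<bar> * ((norm (p0 x))\<^sup>2 + (norm (p1 x))\<^sup>2))"
proof -
  have \<alpha>H: "\<alpha>0 \<in> H1 \<Omega>" "\<alpha>1 \<in> H1 \<Omega>" and ae\<alpha>: "AE x in lebesgue_on \<Omega>. 0 \<le> \<alpha>0 x \<and> \<alpha>0 x \<le> 1" "AE x in lebesgue_on \<Omega>. 0 \<le> \<alpha>1 x \<and> \<alpha>1 x \<le> 1"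
    using \<alpha> by (auto simp: H1_unit_def)
  have pH: "p0 \<in> H1 \<Omega>" "p1 \<in> H1 \<Omega>" and aep: "AE x in lebesgue_on \<Omega>. p0 x \<in> sym_mat" "AE x in lebesgue_on \<Omega>. p1 x \<in> sym_mat"
    using p by (auto simp: H1_sym_def)
  have ae: "AE x in lebesgue_on \<Omega>. \<alpha>0 x \<in> {0..1} \<and> \<alpha>1 x \<in> {0..1} \<and> p0 x \<in> sym_mat \<and> p1 x \<in> sym_mat"
    using ae\<alpha> aep by eventually_elim simp
  have \<alpha>m: "\<alpha> \<in> H1_unit \<Omega>"
  proof -
    have "AE x in lebesgue_on \<Omega>. 0 \<le> \<alpha> x \<and> \<alpha> x \<le> 1" using ae\<alpha> by eventually_elim (simp add: \<alpha>_def)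
    moreover have "\<alpha> \<in> H1 \<Omega>" unfolding \<alpha>_def by (rule H1_lincomb(1)[OF \<Omega> \<alpha>H])
    ultimately show ?thesis by (simp add: H1_unit_def)
  qed
  have qL: "q \<in> L2 \<Omega>" unfolding q_def by (intro L2_add L2_scaleR H1_L2 pH)
  note pL = H1_L2[OF pH(1)] H1_L2[OF pH(2)]
  have \<delta>L: "(\<lambda>x. \<alpha>0 x - \<alpha>1 x) \<in> L2 \<Omega>" by (intro L2_diff H1_L2 \<alpha>H)
  have w1: "integrable (lebesgue_on \<Omega>) (\<lambda>x. \<bar>\<alpha>0 x - \<alpha>1 x\<bar>)"
    using L2_integrable[OF borel_open[OF \<Omega>(1)] \<Omega>(2) \<delta>L] by (rule integrable_abs)
  have w2: "integrable (lebesgue_on \<Omega>) (\<lambda>x. \<bar>\<alpha>0 x - \<alpha>1 x\<bar> * ((norm (p0 x))\<^sup>2 + (norm (p1 x))\<^sup>2))"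
  proof (rule integrable_bounded_weight[OF L2_measurable[OF \<delta>L]])
    show "AE x in lebesgue_on \<Omega>. \<bar>\<alpha>0 x - \<alpha>1 x\<bar> \<le> 1" using ae by eventually_elim auto
  qed (intro Bochner_Integration.integrable_add L2_integrable_square pL)
  note intd = integrable_damage[OF \<Omega> \<alpha>(1) d(1)] integrable_damage[OF \<Omega> \<alpha>(2) d(1)]
  note intB = integrable_hardening[OF \<Omega> \<alpha>(1) B(1) pL(1)] integrable_hardening[OF \<Omega> \<alpha>(2) B(1) pL(2)]
  have "(LINT x|lebesgue_on \<Omega>. d (\<alpha> x)) \<le> (LINT x|lebesgue_on \<Omega>. (1/2) * d (\<alpha>0 x) + (1/2) * d (\<alpha>1 x) + Ld * \<bar>\<alpha>0 x - \<alpha>1 x\<bar>)"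
  proof (rule integral_mono_AE[OF integrable_damage[OF \<Omega> \<alpha>m d(1)]])
    from ae show "AE x in lebesgue_on \<Omega>. d (\<alpha> x) \<le> (1/2) * d (\<alpha>0 x) + (1/2) * d (\<alpha>1 x) + Ld * \<bar>\<alpha>0 x - \<alpha>1 x\<bar>"
    proof eventually_elim
      fix x assume x: "\<alpha>0 x \<in> {0..1} \<and> \<alpha>1 x \<in> {0..1} \<and> p0 x \<in> sym_mat \<and> p1 x \<in> sym_mat"
      then have m: "\<alpha> x \<in> {0..1}" "\<bar>\<alpha> x - \<alpha>0 x\<bar> \<le> \<bar>\<alpha>0 x - \<alpha>1 x\<bar>" "\<bar>\<alpha> x - \<alpha>1 x\<bar> \<le> \<bar>\<alpha>0 x - \<alpha>1 x\<bar>" by (auto simp: \<alpha>_def)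
      have "d (\<alpha> x) \<le> d c + Ld * \<bar>\<alpha>0 x - \<alpha>1 x\<bar>" if "c \<in> {0..1}" "\<bar>\<alpha> x - c\<bar> \<le> \<bar>\<alpha>0 x - \<alpha>1 x\<bar>" for c
        using d(3)[OF m(1) that(1)] mult_left_mono[OF that(2) d(2)] by (simp add: abs_le_iff)
      from this[of "\<alpha>0 x"] this[of "\<alpha>1 x"] show "d (\<alpha> x) \<le> (1/2) * d (\<alpha>0 x) + (1/2) * d (\<alpha>1 x) + Ld * \<bar>\<alpha>0 x - \<alpha>1 x\<bar>"
        using x m by simp
    qed
  qed (intro Bochner_Integration.integrable_add integrable_mult_right intd w1)
  also have "\<dots> = (1/2) * (LINT x|lebesgue_on \<Omega>. d (\<alpha>0 x)) + (1/2) * (LINT x|lebesgue_on \<Omega>. d (\<alpha>1 x)) + Ld * (LINT x|lebesgue_on \<Omega>. \<bar>\<alpha>0 x - \<alpha>1 x\<bar>)"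
    using intd w1 by simp
  finally have dd: "(LINT x|lebesgue_on \<Omega>. d (\<alpha> x)) \<le> \<dots>" .
  have "(LINT x|lebesgue_on \<Omega>. tapp (B (\<alpha> x)) (q x) \<bullet> q x) \<le> (LINT x|lebesgue_on \<Omega>. (1/2) * (tapp (B (\<alpha>0 x)) (p0 x) \<bullet> p0 x)
      + (1/2) * (tapp (B (\<alpha>1 x)) (p1 x) \<bullet> p1 x) + LB * tapp_const TYPE('n) * (\<bar>\<alpha>0 x - \<alpha>1 x\<bar> * ((norm (p0 x))\<^sup>2 + (norm (p1 x))\<^sup>2)))"
  proof (rule integral_mono_AE[OF integrable_hardening[OF \<Omega> \<alpha>m B(1) qL]])
    from ae show "AE x in lebesgue_on \<Omega>. tapp (B (\<alpha> x)) (q x) \<bullet> q x \<le> (1/2) * (tapp (B (\<alpha>0 x)) (p0 x) \<bullet> p0 x)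
      + (1/2) * (tapp (B (\<alpha>1 x)) (p1 x) \<bullet> p1 x) + LB * tapp_const TYPE('n) * (\<bar>\<alpha>0 x - \<alpha>1 x\<bar> * ((norm (p0 x))\<^sup>2 + (norm (p1 x))\<^sup>2))"
      unfolding \<alpha>_def q_def by eventually_elim (intro hardening_midpoint_le B LB, auto)
  qed (intro Bochner_Integration.integrable_add integrable_mult_right intB w2)
  also have "\<dots> = (1/2) * (LINT x|lebesgue_on \<Omega>. tapp (B (\<alpha>0 x)) (p0 x) \<bullet> p0 x) + (1/2) * (LINT x|lebesgue_on \<Omega>. tapp (B (\<alpha>1 x)) (p1 x) \<bullet> p1 x)
      + LB * tapp_const TYPE('n) * (LINT x|lebesgue_on \<Omega>. \<bar>\<alpha>0 x - \<alpha>1 x\<bar> * ((norm (p0 x))\<^sup>2 + (norm (p1 x))\<^sup>2))"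
    using intB w2 by simp
  finally have BB: "(LINT x|lebesgue_on \<Omega>. tapp (B (\<alpha> x)) (q x) \<bullet> q x) \<le> \<dots>" .
  show ?thesis
    using dd BB wgrad_midpoint[OF \<Omega> \<alpha>H, folded \<alpha>_def] wgrad_midpoint[OF \<Omega> pH, folded q_def] elastic_energy_midpoint[OF e, of C, folded \<eta>_def]
    unfolding energy_def elastic_energy_def by argo
qed

section \<open>The dissipation and its control of the L1 distance\<close>

text \<open>The midpoint covers half of the plastic increment; its dissipation is estimated by that
  of the whole increment, which is already small.\<close>

lemma support_fun_half: "support_fun K ((1/2) *\<^sub>R \<xi>) \<le> support_fun K \<xi>"
  unfolding support_fun_def
proof (rule SUP_mono, rule bexI)
  show "ennreal (\<sigma> \<bullet> (1/2) *\<^sub>R \<xi>) \<le> ennreal (\<sigma> \<bullet> \<xi>)" for \<sigma>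
    by (cases "0 \<le> \<sigma> \<bullet> \<xi>") (auto intro!: ennreal_leI simp: ennreal_neg)
qed

text \<open>The supremum is tested with the matrix of norm r in the direction of \<xi>, which is
  symmetric because \<xi> is.\<close>

lemma support_fun_ge:
  assumes "{\<sigma> \<in> sym_mat. norm \<sigma> \<le> r} \<subseteq> K" "0 \<le> r" "\<xi> \<in> sym_mat"
  shows "ennreal (r * norm \<xi>) \<le> support_fun K \<xi>"
proof (cases "\<xi> = 0")
  case False
  have "(r / norm \<xi>) *\<^sub>R \<xi> \<in> K"
    using assms False sym_mat_lincomb[OF assms(3,3), of "r / norm \<xi>" 0] by (intro subsetD[OF assms(1)]) simp
  moreover have "(r / norm \<xi>) *\<^sub>R \<xi> \<bullet> \<xi> = r * norm \<xi>"
    using False by (simp add: power2_norm_eq_inner[symmetric] power2_eq_square)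
  ultimately show ?thesis unfolding support_fun_def by (metis SUP_upper)
qed simp

lemma dissipation_ge:
  assumes \<Omega>: "open \<Omega>" "bounded \<Omega>" and K: "{\<sigma> \<in> sym_mat. norm \<sigma> \<le> r} \<subseteq> K" "0 \<le> r" and p: "p \<in> L2_sym \<Omega>"
  shows "ennreal (r * (LINT x|lebesgue_on \<Omega>. norm (p x))) \<le> dissipation \<Omega> K p"
proof -
  have L: "p \<in> L2 \<Omega>" and ae: "AE x in lebesgue_on \<Omega>. p x \<in> sym_mat" using p by (auto simp: L2_sym_def)
  have int: "integrable (lebesgue_on \<Omega>) (\<lambda>x. r * norm (p x))"
    by (intro integrable_mult_right integrable_norm L2_integrable[OF borel_open[OF \<Omega>(1)] \<Omega>(2) L])
  have "ennreal (r * (LINT x|lebesgue_on \<Omega>. norm (p x))) = ennreal (LINT x|lebesgue_on \<Omega>. r * norm (p x))" by simp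
  also have "\<dots> = (\<integral>\<^sup>+x. ennreal (r * norm (p x)) \<partial>lebesgue_on \<Omega>)"
    using K(2) by (intro nn_integral_eq_integral[OF int, symmetric]) simp
  also have "\<dots> \<le> dissipation \<Omega> K p"
    unfolding dissipation_def using ae by (intro nn_integral_mono_AE) (auto elim!: eventually_mono intro: support_fun_ge[OF K])
  finally show ?thesis .
qed

text \<open>Every partition ending at a extends to b by one more point. This gives both the
  monotonicity of the total dissipation and the bound of a single increment by its growth.\<close>

lemma total_dissipation_append:
  assumes "t \<le> a" "a < b"
  shows "total_dissipation \<Omega> K p t a + dissipation \<Omega> K (\<lambda>x. p b x - p a x) \<le> total_dissipation \<Omega> K p t b"
proof -
  define I where "I c = {(m::nat, s::nat \<Rightarrow> real). s 0 = t \<and> s m = c \<and> (\<forall>j<m. s j < s (Suc j))}" for c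
  define F where "F = (\<lambda>(m::nat, s::nat \<Rightarrow> real). \<Sum>j<m. dissipation \<Omega> K (\<lambda>x. p (s (Suc j)) x - p (s j) x))"
  have V: "total_dissipation \<Omega> K p t c = (SUP i\<in>I c. F i)" for c by (simp add: total_dissipation_def I_def F_def)
  \<comment> \<open>A constant may be moved inside the supremum only over a nonempty index set; for
    t = a the partition with no subinterval supplies a member.\<close>
  have "I a \<noteq> {}"
  proof (cases "t = a")
    case True then have "(0, \<lambda>_. t) \<in> I a" by (simp add: I_def) then show ?thesis by blast
  next
    case False then have "(1, \<lambda>j. if j = 0 then t else a) \<in> I a" using assms by (simp add: I_def) then show ?thesis by blast
  qed
  then have "total_dissipation \<Omega> K p t a + dissipation \<Omega> K (\<lambda>x. p b x - p a x) = (SUP i\<in>I a. F i + dissipation \<Omega> K (\<lambda>x. p b x - p a x))"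
    unfolding V by (rule ennreal_SUP_add_left[symmetric])
  also have "\<dots> \<le> (SUP i\<in>I b. F i)"
  proof (rule SUP_mono)
    fix i assume "i \<in> I a"
    then obtain m s where i: "i = (m, s)" "s 0 = t" "s m = a" "\<And>j. j < m \<Longrightarrow> s j < s (Suc j)" by (auto simp: I_def)
    let ?s = "s(Suc m := b)"
    have "(Suc m, ?s) \<in> I b" using i assms(2) by (auto simp: I_def less_Suc_eq)
    moreover have "F i + dissipation \<Omega> K (\<lambda>x. p b x - p a x) = F (Suc m, ?s)"
      using i(3) by (simp add: F_def i(1))
    ultimately show "\<exists>j\<in>I b. F i + dissipation \<Omega> K (\<lambda>x. p b x - p a x) \<le> F j" by (metis order_refl)
  qed
  finally show ?thesis by (simp add: V)
qed

section \<open>Limits in time\<close>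

lemma continuous_on_integral_upper_limit:
  fixes f :: "real \<Rightarrow> real"
  assumes "integrable (lebesgue_on {a<..<b}) f"
  shows "continuous_on {a..b} (\<lambda>t. LINT s|lebesgue_on {a<..<t}. f s)"
proof -
  have "f integrable_on {a..b}"
    using integrable_on_lebesgue_on[OF assms] by (simp add: integrable_on_Icc_iff_Ioo)
  moreover have "(LINT s|lebesgue_on {a<..<t}. f s) = integral {a..t} f" if "t \<in> {a..b}" for t
  proof -
    have "set_integrable lebesgue {a<..<b} f" using assms by (simp add: set_integrable_def integrable_restrict_space)
    then have "set_integrable lebesgue {a<..<t} f" by (rule set_integrable_subset) (use that in auto)
    then have "integrable (lebesgue_on {a<..<t}) f" by (simp add: set_integrable_def integrable_restrict_space)
    then show ?thesis by (simp add: lebesgue_integral_eq_integral integral_open_interval_real)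
  qed
  ultimately show ?thesis
    using indefinite_integral_continuous_1[of f a b] by (subst continuous_on_cong[OF refl]) auto
qed

text \<open>For ordered functions the L1 distance is the difference of the integrals; continuity of
  the mean damage is therefore L1 continuity of the damage.\<close>

lemma integral_abs_diff_AE_le:
  fixes f g :: "'a \<Rightarrow> real"
  assumes "integrable M f" "integrable M g" "AE x in M. f x \<le> g x"
  shows "(LINT x|M. \<bar>f x - g x\<bar>) = \<bar>(LINT x|M. f x) - (LINT x|M. g x)\<bar>"
proof -
  have "(LINT x|M. \<bar>f x - g x\<bar>) = (LINT x|M. g x - f x)"
    using assms by (intro integral_cong_AE) (auto elim!: eventually_mono)
  moreover have "(LINT x|M. f x) \<le> (LINT x|M. g x)" by (rule integral_mono_AE[OF assms])
  ultimately show ?thesis using assms by simp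
qed

text \<open>Where g is at most k the integral is at most k times the L1 norm of the weight; where g
  is larger the weight is at most 1 and the tail of g is small. The level k is fixed before s tends
  to its limit.\<close>

lemma tendsto_integral_bounded_weight:
  fixes \<delta> :: "'b \<Rightarrow> 'a \<Rightarrow> real"
  assumes m: "\<forall>\<^sub>F s in F. \<delta> s \<in> borel_measurable M \<and> (AE x in M. \<bar>\<delta> s x\<bar> \<le> 1) \<and> integrable M (\<delta> s)"
    and lim: "((\<lambda>s. LINT x|M. \<bar>\<delta> s x\<bar>) \<longlongrightarrow> 0) F" and g: "integrable M g" "\<And>x. 0 \<le> g x"
  shows "((\<lambda>s. LINT x|M. \<bar>\<delta> s x\<bar> * g x) \<longlongrightarrow> 0) F"
proof (rule tendstoI)
  fix \<epsilon> :: real assume \<epsilon>: "0 < \<epsilon>"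
  note [measurable] = borel_measurable_integrable[OF g(1)]
  define h where "h k x = g x * indicator {y. real k < g y} x" for k x
  have hb: "norm (h k x) \<le> g x" for k x using g(2)[of x] by (simp add: h_def split: split_indicator)
  have hm[measurable]: "h k \<in> borel_measurable M" for k unfolding h_def[abs_def] by measurable
  have hint: "integrable M (h k)" for k
    by (rule Bochner_Integration.integrable_bound[OF g(1) hm]) (use hb g(2) in auto)
  have "(\<lambda>k. LINT x|M. h k x) \<longlonglongrightarrow> (LINT x|M. 0)"
  proof (rule integral_dominated_convergence[OF _ hm g(1)])
    show "AE x in M. (\<lambda>k. h k x) \<longlonglongrightarrow> 0"
    proof (rule AE_I2)
      fix x
      obtain k0 where "g x \<le> real k0" using real_arch_simple by blast
      then have "h k x = 0" if "k \<ge> k0" for k using that by (simp add: h_def)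
      then show "(\<lambda>k. h k x) \<longlonglongrightarrow> 0" by (intro tendsto_eventually eventually_sequentiallyI)
    qed
  qed (use hb in auto)
  then have "\<forall>\<^sub>F k in sequentially. (LINT x|M. h k x) < \<epsilon> / 2" using \<epsilon> by (intro order_tendstoD) auto
  then obtain k where k: "(LINT x|M. h k x) < \<epsilon> / 2" by (auto simp: eventually_sequentially)
  have "\<forall>\<^sub>F s in F. (LINT x|M. \<bar>\<delta> s x\<bar>) < \<epsilon> / (2 * (real k + 1))" using lim \<epsilon> by (intro order_tendstoD) auto
  with m show "\<forall>\<^sub>F s in F. dist (LINT x|M. \<bar>\<delta> s x\<bar> * g x) 0 < \<epsilon>"
  proof eventually_elim
    fix s assume \<delta>: "\<delta> s \<in> borel_measurable M \<and> (AE x in M. \<bar>\<delta> s x\<bar> \<le> 1) \<and> integrable M (\<delta> s)"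
      and small: "(LINT x|M. \<bar>\<delta> s x\<bar>) < \<epsilon> / (2 * (real k + 1))"
    have "(LINT x|M. \<bar>\<delta> s x\<bar> * g x) \<le> (LINT x|M. real k * \<bar>\<delta> s x\<bar> + h k x)"
    proof (rule integral_mono_AE)
      show "integrable M (\<lambda>x. \<bar>\<delta> s x\<bar> * g x)" using \<delta> g(1) by (intro integrable_bounded_weight) auto
      show "integrable M (\<lambda>x. real k * \<bar>\<delta> s x\<bar> + h k x)" using \<delta> hint by (intro Bochner_Integration.integrable_add integrable_mult_right integrable_abs) auto
      have "AE x in M. \<bar>\<delta> s x\<bar> \<le> 1" using \<delta> by simp
      then show "AE x in M. \<bar>\<delta> s x\<bar> * g x \<le> real k * \<bar>\<delta> s x\<bar> + h k x"
      proof eventually_elim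
        fix x assume x: "\<bar>\<delta> s x\<bar> \<le> 1"
        show "\<bar>\<delta> s x\<bar> * g x \<le> real k * \<bar>\<delta> s x\<bar> + h k x"
        proof (cases "real k < g x")
          case True
          have "\<bar>\<delta> s x\<bar> * g x \<le> 1 * g x" using x g(2)[of x] by (intro mult_right_mono)
          moreover have "0 \<le> real k * \<bar>\<delta> s x\<bar>" "h k x = g x" using True by (simp_all add: h_def)
          ultimately show ?thesis by linarith
        next
          case False
          then have "\<bar>\<delta> s x\<bar> * g x \<le> \<bar>\<delta> s x\<bar> * real k" by (intro mult_left_mono) auto
          then show ?thesis using False by (simp add: h_def mult.commute)
        qed
      qed
    qed
    also have "\<dots> = real k * (LINT x|M. \<bar>\<delta> s x\<bar>) + (LINT x|M. h k x)" using \<delta> hint by simp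
    also have "\<dots> < \<epsilon>"
    proof -
      have "(real k + 1) * (LINT x|M. \<bar>\<delta> s x\<bar>) < \<epsilon> / 2" using small by (simp add: field_simps)
      moreover have "0 \<le> (LINT x|M. \<bar>\<delta> s x\<bar>)" by simp
      ultimately show ?thesis using k unfolding distrib_right by linarith
    qed
    finally have "(LINT x|M. \<bar>\<delta> s x\<bar> * g x) < \<epsilon>" .
    moreover have "0 \<le> (LINT x|M. \<bar>\<delta> s x\<bar> * g x)" using g(2) by simp
    ultimately show "dist (LINT x|M. \<bar>\<delta> s x\<bar> * g x) 0 < \<epsilon>" by simp
  qed
qed

section \<open>Stability and continuity\<close>

lemma L2_norm_wgrad_diff:
  assumes "open \<Omega>" "bounded \<Omega>" "f \<in> H1 \<Omega>" "g \<in> H1 \<Omega>"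
  shows "L2_norm \<Omega> (wgrad \<Omega> (\<lambda>x. f x - g x)) = L2_norm \<Omega> (\<lambda>x. wgrad \<Omega> f x - wgrad \<Omega> g x)"
  by (intro L2_AE_cong wgrad_L2 H1_diff wgrad_diff L2_diff assms)

lemma L2_norm_wgrad_minus_commute:
  assumes "open \<Omega>" "bounded \<Omega>" "f \<in> H1 \<Omega>" "g \<in> H1 \<Omega>"
  shows "L2_norm \<Omega> (wgrad \<Omega> (\<lambda>x. f x - g x)) = L2_norm \<Omega> (wgrad \<Omega> (\<lambda>x. g x - f x))"
  unfolding L2_norm_wgrad_diff[OF assms] L2_norm_wgrad_diff[OF assms(1,2,4,3)] by (rule L2_norm_minus_commute)

lemma tendsto_0_within_le:
  fixes f g :: "real \<Rightarrow> real"
  assumes "(g \<longlongrightarrow> 0) (at t within S)" "\<And>s. s \<in> S \<Longrightarrow> s \<noteq> t \<Longrightarrow> 0 \<le> f s" "\<And>s. s \<in> S \<Longrightarrow> s \<noteq> t \<Longrightarrow> f s \<le> g s"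
  shows "(f \<longlongrightarrow> 0) (at t within S)"
  by (rule tendsto_sandwich[OF _ _ tendsto_const assms(1)]) (auto simp: eventually_at_filter assms(2,3))

text \<open>The time-independent data in the form in which two states are compared. \<gamma> is the
  lower ellipticity constant, r the radius of the ball inside K, and \<kappa> the weight of the
  error made by freezing the damage in the hardening term.\<close>

locale material =
  fixes \<Omega> :: "(real^'n) set" and C :: "'n tensor4" and B :: "real \<Rightarrow> 'n tensor4" and d :: "real \<Rightarrow> real"
    and K :: "(real^'n^'n) set" and \<gamma> r Ld LB \<kappa> :: real
  assumes \<Omega>: "open \<Omega>" "bounded \<Omega>"
    and coercive: "\<And>\<xi>. \<xi> \<in> sym_mat \<Longrightarrow> \<gamma> * (norm \<xi>)\<^sup>2 \<le> tapp C \<xi> \<bullet> \<xi>" "0 < \<gamma>"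
    and d: "continuous_on {0..1} d" "\<And>a. a \<in> {0..1} \<Longrightarrow> 0 \<le> d a"
    and Ld: "0 \<le> Ld" "\<And>a b. a \<in> {0..1} \<Longrightarrow> b \<in> {0..1} \<Longrightarrow> norm (d a - d b) \<le> Ld * \<bar>a - b\<bar>"
    and B: "continuous_on {0..1} B" "\<And>a \<xi>. \<xi> \<in> sym_mat \<Longrightarrow> a \<in> {0..1} \<Longrightarrow> 0 \<le> tapp (B a) \<xi> \<bullet> \<xi>"
    and LB: "0 \<le> LB" "\<And>a b. a \<in> {0..1} \<Longrightarrow> b \<in> {0..1} \<Longrightarrow> norm (B a - B b) \<le> LB * \<bar>a - b\<bar>"
    and \<kappa>: "\<kappa> = LB * tapp_const TYPE('n)"
    and K: "{\<sigma> \<in> sym_mat. norm \<sigma> \<le> r} \<subseteq> K" "0 < r"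
begin

abbreviation "E \<equiv> energy \<Omega> C B d"

lemma \<kappa>_nonneg: "0 \<le> \<kappa>" using LB(1) tapp_const(1)[where 'n='n] by (simp add: \<kappa>)

lemma energy_coercive:
  assumes \<alpha>: "\<alpha> \<in> H1_unit \<Omega>" and e: "e \<in> L2_sym \<Omega>" and p: "p \<in> H1_sym \<Omega>"
  shows "\<gamma> / 2 * (L2_norm \<Omega> e)\<^sup>2 \<le> E \<alpha> e p"
proof -
  have ae: "AE x in lebesgue_on \<Omega>. 0 \<le> \<alpha> x \<and> \<alpha> x \<le> 1" "AE x in lebesgue_on \<Omega>. p x \<in> sym_mat"
    using \<alpha> p by (auto simp: H1_unit_def H1_sym_def)
  have "AE x in lebesgue_on \<Omega>. 0 \<le> d (\<alpha> x)" using ae(1) by eventually_elim (simp add: d)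
  then have "0 \<le> (LINT x|lebesgue_on \<Omega>. d (\<alpha> x))" by (rule integral_nonneg_AE)
  moreover have "AE x in lebesgue_on \<Omega>. 0 \<le> tapp (B (\<alpha> x)) (p x) \<bullet> p x" using ae by eventually_elim (simp add: B)
  then have "0 \<le> (LINT x|lebesgue_on \<Omega>. tapp (B (\<alpha> x)) (p x) \<bullet> p x)" by (rule integral_nonneg_AE)
  moreover have "\<gamma> / 2 * (L2_norm \<Omega> e)\<^sup>2 \<le> elastic_energy \<Omega> C e" by (rule elastic_energy_coercive[OF e coercive(1)])
  ultimately show ?thesis unfolding energy_def elastic_energy_def by (simp add: add_increasing2)
qed

text \<open>The competitor is the midpoint of the state \<open>0\<close> and of the state \<open>1\<close> corrected by \<open>w0 - w1\<close>: it is admissible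
  for \<open>w0\<close>, and monotonicity of the damage puts it below \<open>\<alpha>0\<close>.\<close>

lemma stability_increment:
  assumes \<alpha>: "\<alpha>0 \<in> H1_unit \<Omega>" "\<alpha>1 \<in> H1_unit \<Omega>" "AE x in lebesgue_on \<Omega>. \<alpha>1 x \<le> \<alpha>0 x"
    and adm: "(u0, e0, p0) \<in> admissible \<Omega> w0" "(u1, e1, p1) \<in> admissible \<Omega> w1"
    and stable: "\<forall>\<beta>\<in>damage_below \<Omega> \<alpha>0. \<forall>(v, \<eta>, q)\<in>admissible \<Omega> w0.
      ereal (E \<alpha>0 e0 p0) \<le> ereal (E \<beta> \<eta> q) + enn2ereal (dissipation \<Omega> K (\<lambda>x. q x - p0 x))"
    and D: "dissipation \<Omega> K (\<lambda>x. p1 x - p0 x) \<le> ennreal D" "0 \<le> D"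
  defines "\<Delta> \<equiv> sym_grad \<Omega> (\<lambda>x. w1 x - w0 x)"
  shows "(1/4) * (elastic_energy \<Omega> C (\<lambda>x. e0 x - (e1 x - \<Delta> x))
      + (L2_norm \<Omega> (wgrad \<Omega> (\<lambda>x. \<alpha>0 x - \<alpha>1 x)))\<^sup>2 + (L2_norm \<Omega> (wgrad \<Omega> (\<lambda>x. p0 x - p1 x)))\<^sup>2)
    \<le> (1/2) * (E \<alpha>1 e1 p1 - E \<alpha>0 e0 p0) + (1/2) * (elastic_energy \<Omega> C (\<lambda>x. e1 x - \<Delta> x) - elastic_energy \<Omega> C e1)
      + Ld * (LINT x|lebesgue_on \<Omega>. \<bar>\<alpha>0 x - \<alpha>1 x\<bar>)
      + \<kappa> * (LINT x|lebesgue_on \<Omega>. \<bar>\<alpha>0 x - \<alpha>1 x\<bar> * ((norm (p0 x))\<^sup>2 + (norm (p1 x))\<^sup>2)) + D"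
proof -
  have H: "u0 \<in> H1 \<Omega>" "u1 \<in> H1 \<Omega>" "e0 \<in> L2_sym \<Omega>" "e1 \<in> L2_sym \<Omega>" "p0 \<in> H1_sym \<Omega>" "p1 \<in> H1_sym \<Omega>"
    and tr: "same_trace \<Omega> u0 w0" "same_trace \<Omega> u1 w1"
    and dec: "AE x in lebesgue_on \<Omega>. sym_grad \<Omega> u0 x = e0 x + p0 x" "AE x in lebesgue_on \<Omega>. sym_grad \<Omega> u1 x = e1 x + p1 x"
    using adm by (auto simp: admissible_def)
  have w: "w0 \<in> H1 \<Omega>" "w1 \<in> H1 \<Omega>" using same_trace_H1[OF tr(1)] same_trace_H1[OF tr(2)] by auto
  have dw: "(\<lambda>x. w1 x - w0 x) \<in> H1 \<Omega>" by (rule H1_diff[OF \<Omega> w(2,1)])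
  have \<Delta>: "\<Delta> \<in> L2_sym \<Omega>" unfolding \<Delta>_def by (rule sym_grad_L2_sym[OF dw])
  let ?\<beta> = "\<lambda>x. (1/2) *\<^sub>R \<alpha>0 x + (1/2) *\<^sub>R \<alpha>1 x" and ?v = "\<lambda>x. (1/2) *\<^sub>R u0 x + (1/2) *\<^sub>R (u1 x - (w1 x - w0 x))"
    and ?\<eta> = "\<lambda>x. (1/2) *\<^sub>R e0 x + (1/2) *\<^sub>R (e1 x - \<Delta> x)" and ?q = "\<lambda>x. (1/2) *\<^sub>R p0 x + (1/2) *\<^sub>R p1 x"
  have \<beta>: "?\<beta> \<in> damage_below \<Omega> \<alpha>0"
  proof -
    have ae: "AE x in lebesgue_on \<Omega>. 0 \<le> \<alpha>0 x \<and> \<alpha>0 x \<le> 1" "AE x in lebesgue_on \<Omega>. 0 \<le> \<alpha>1 x \<and> \<alpha>1 x \<le> 1"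
      using \<alpha> by (auto simp: H1_unit_def)
    have "AE x in lebesgue_on \<Omega>. (0 \<le> ?\<beta> x \<and> ?\<beta> x \<le> 1) \<and> ?\<beta> x \<le> \<alpha>0 x" using ae \<alpha>(3) by eventually_elim simp
    moreover have "?\<beta> \<in> H1 \<Omega>" by (rule H1_lincomb(1)[OF \<Omega>]) (use \<alpha> in \<open>auto simp: H1_unit_def\<close>)
    ultimately show ?thesis unfolding damage_below_def H1_unit_def by simp
  qed
  have u1': "(\<lambda>x. u1 x - (w1 x - w0 x)) \<in> H1 \<Omega>" by (rule H1_diff[OF \<Omega> H(2) dw])
  have v: "(?v, ?\<eta>, ?q) \<in> admissible \<Omega> w0"
    unfolding admissible_def mem_Collect_eq prod.case
  proof (intro conjI)
    show "?v \<in> H1 \<Omega>" by (rule H1_lincomb(1)[OF \<Omega> H(1) u1'])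
    show "?\<eta> \<in> L2_sym \<Omega>" by (intro L2_sym_lincomb L2_sym_diff H \<Delta>)
    show "?q \<in> H1_sym \<Omega>" by (intro H1_sym_lincomb \<Omega> H)
    show "same_trace \<Omega> ?v w0" by (rule same_trace_midpoint[OF \<Omega> tr])
    show "AE x in lebesgue_on \<Omega>. sym_grad \<Omega> ?v x = ?\<eta> x + ?q x"
      using sym_grad_lincomb[OF \<Omega> H(1) u1', of "1/2" "1/2"] sym_grad_diff[OF \<Omega> H(2) dw] dec
    proof eventually_elim
      fix x assume *: "sym_grad \<Omega> ?v x = (1/2) *\<^sub>R sym_grad \<Omega> u0 x + (1/2) *\<^sub>R sym_grad \<Omega> (\<lambda>x. u1 x - (w1 x - w0 x)) x"
        "sym_grad \<Omega> (\<lambda>x. u1 x - (w1 x - w0 x)) x = sym_grad \<Omega> u1 x - sym_grad \<Omega> (\<lambda>x. w1 x - w0 x) x"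
        "sym_grad \<Omega> u0 x = e0 x + p0 x" "sym_grad \<Omega> u1 x = e1 x + p1 x"
      show "sym_grad \<Omega> ?v x = ?\<eta> x + ?q x" unfolding * \<Delta>_def by (simp add: algebra_simps)
    qed
  qed
  \<comment> \<open>The competitor moves the plastic strain by half the increment from
    \<open>p0\<close> to \<open>p1\<close>, so its dissipation is at most D.\<close>
  have "dissipation \<Omega> K (\<lambda>x. ?q x - p0 x) \<le> ennreal D"
  proof (rule order_trans[OF _ D(1)])
    have "?q x - p0 x = (1/2) *\<^sub>R (p1 x - p0 x)" for x
    proof -
      have "p0 x = (1/2) *\<^sub>R p0 x + (1/2) *\<^sub>R p0 x" by (simp add: scaleR_add_left[symmetric])
      then show ?thesis by (simp add: algebra_simps)
    qed
    then show "dissipation \<Omega> K (\<lambda>x. ?q x - p0 x) \<le> dissipation \<Omega> K (\<lambda>x. p1 x - p0 x)"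
      unfolding dissipation_def by (intro nn_integral_mono) (simp only: support_fun_half)
  qed
  then have "enn2ereal (dissipation \<Omega> K (\<lambda>x. ?q x - p0 x)) \<le> ereal D"
    using D(2) by (simp add: less_eq_ennreal.rep_eq enn2ereal_ennreal)
  moreover have "ereal (E \<alpha>0 e0 p0) \<le> ereal (E ?\<beta> ?\<eta> ?q) + enn2ereal (dissipation \<Omega> K (\<lambda>x. ?q x - p0 x))"
    using stable \<beta> v by fast
  ultimately have "ereal (E \<alpha>0 e0 p0) \<le> ereal (E ?\<beta> ?\<eta> ?q) + ereal D"
    by (meson add_left_mono order_trans)
  then have "E \<alpha>0 e0 p0 \<le> E ?\<beta> ?\<eta> ?q + D" by simp
  \<comment> \<open>The shift \<Delta>, which compensates the change of the boundary datum, alters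
    only the elastic part of the later energy.\<close>
  moreover have "E \<alpha>1 (\<lambda>x. e1 x - \<Delta> x) p1 = E \<alpha>1 e1 p1 + (elastic_energy \<Omega> C (\<lambda>x. e1 x - \<Delta> x) - elastic_energy \<Omega> C e1)"
    by (simp add: energy_def elastic_energy_def)
  moreover have "E ?\<beta> ?\<eta> ?q + (1/4) * (elastic_energy \<Omega> C (\<lambda>x. e0 x - (e1 x - \<Delta> x))
      + (L2_norm \<Omega> (wgrad \<Omega> (\<lambda>x. \<alpha>0 x - \<alpha>1 x)))\<^sup>2 + (L2_norm \<Omega> (wgrad \<Omega> (\<lambda>x. p0 x - p1 x)))\<^sup>2)
    \<le> (1/2) * E \<alpha>0 e0 p0 + (1/2) * E \<alpha>1 (\<lambda>x. e1 x - \<Delta> x) p1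
      + Ld * (LINT x|lebesgue_on \<Omega>. \<bar>\<alpha>0 x - \<alpha>1 x\<bar>)
      + \<kappa> * (LINT x|lebesgue_on \<Omega>. \<bar>\<alpha>0 x - \<alpha>1 x\<bar> * ((norm (p0 x))\<^sup>2 + (norm (p1 x))\<^sup>2))"
    unfolding \<kappa> using H \<Delta> by (intro energy_midpoint_le \<Omega> \<alpha> d Ld B LB) (auto simp: L2_sym_def intro: L2_diff)
  ultimately show ?thesis by argo
qed

text \<open>The strain p stands for whichever endpoint is kept fixed in the limit. The condition 16
  \<kappa> \<epsilon> \<le> 1 makes the absorbed gradient term at most 1/8 of the squared norm, half
  of the 1/4 gained by convexity; this leaves the factor 8 for the strain gradient against 4 for the
  other terms.\<close>

lemma increment_estimate:
  assumes \<alpha>: "\<alpha>0 \<in> H1_unit \<Omega>" "\<alpha>1 \<in> H1_unit \<Omega>" "AE x in lebesgue_on \<Omega>. \<alpha>1 x \<le> \<alpha>0 x"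
    and adm: "(u0, e0, p0) \<in> admissible \<Omega> w0" "(u1, e1, p1) \<in> admissible \<Omega> w1"
    and stable: "\<forall>\<beta>\<in>damage_below \<Omega> \<alpha>0. \<forall>(v, \<eta>, q)\<in>admissible \<Omega> w0.
      ereal (E \<alpha>0 e0 p0) \<le> ereal (E \<beta> \<eta> q) + enn2ereal (dissipation \<Omega> K (\<lambda>x. q x - p0 x))"
    and D: "dissipation \<Omega> K (\<lambda>x. p1 x - p0 x) \<le> ennreal D" "0 \<le> D"
    and interpolation: "0 \<le> Ce" "16 * \<kappa> * \<epsilon> \<le> 1" "\<And>f :: real^'n \<Rightarrow> real^'n^'n. f \<in> H1 \<Omega> \<Longrightarrow>
      (L2_norm \<Omega> f)\<^sup>2 \<le> \<epsilon> * (L2_norm \<Omega> (wgrad \<Omega> f))\<^sup>2 + Ce * (LINT x|lebesgue_on \<Omega>. norm (f x))\<^sup>2"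
    and p: "p = p0 \<or> p = p1"
  defines "\<Delta> \<equiv> sym_grad \<Omega> (\<lambda>x. w1 x - w0 x)"
  defines "\<rho> \<equiv> (1/2) * \<bar>E \<alpha>1 e1 p1 - E \<alpha>0 e0 p0\<bar>
      + (1/2) * (norm C * tapp_const TYPE('n) * L2_norm \<Omega> \<Delta> * (L2_norm \<Omega> e1 + L2_norm \<Omega> \<Delta>))
      + Ld * (LINT x|lebesgue_on \<Omega>. \<bar>\<alpha>0 x - \<alpha>1 x\<bar>)
      + 3 * \<kappa> * (LINT x|lebesgue_on \<Omega>. \<bar>\<alpha>0 x - \<alpha>1 x\<bar> * (norm (p x))\<^sup>2) + 2 * \<kappa> * (Ce * (D / r)\<^sup>2) + D"
  shows "\<gamma> / 2 * (L2_norm \<Omega> (\<lambda>x. e0 x - (e1 x - \<Delta> x)))\<^sup>2 \<le> 4 * \<rho>"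
    and "(L2_norm \<Omega> (wgrad \<Omega> (\<lambda>x. \<alpha>0 x - \<alpha>1 x)))\<^sup>2 \<le> 4 * \<rho>"
    and "(L2_norm \<Omega> (wgrad \<Omega> (\<lambda>x. p0 x - p1 x)))\<^sup>2 \<le> 8 * \<rho>"
    and "(L2_norm \<Omega> (\<lambda>x. p0 x - p1 x))\<^sup>2 \<le> \<epsilon> * (L2_norm \<Omega> (wgrad \<Omega> (\<lambda>x. p0 x - p1 x)))\<^sup>2 + Ce * (D / r)\<^sup>2"
proof -
  have H: "e0 \<in> L2_sym \<Omega>" "e1 \<in> L2_sym \<Omega>" "p0 \<in> H1_sym \<Omega>" "p1 \<in> H1_sym \<Omega>"
    and tr: "same_trace \<Omega> u0 w0" "same_trace \<Omega> u1 w1" using adm by (auto simp: admissible_def)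
  have w: "w0 \<in> H1 \<Omega>" "w1 \<in> H1 \<Omega>" using same_trace_H1[OF tr(1)] same_trace_H1[OF tr(2)] by auto
  have \<Delta>: "\<Delta> \<in> L2_sym \<Omega>" unfolding \<Delta>_def by (intro sym_grad_L2_sym H1_diff \<Omega> w)
  have pH: "p0 \<in> H1 \<Omega>" "p1 \<in> H1 \<Omega>" "p \<in> L2 \<Omega>" using H p by (auto simp: H1_sym_def H1_L2)
  have dp: "(\<lambda>x. p0 x - p1 x) \<in> H1 \<Omega>" by (rule H1_diff[OF \<Omega> pH(1,2)])
  let ?P = "(L2_norm \<Omega> (\<lambda>x. p0 x - p1 x))\<^sup>2" and ?G = "(L2_norm \<Omega> (wgrad \<Omega> (\<lambda>x. p0 x - p1 x)))\<^sup>2"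
  let ?W = "\<lambda>g. LINT x|lebesgue_on \<Omega>. \<bar>\<alpha>0 x - \<alpha>1 x\<bar> * g x"
  \<comment> \<open>Since K contains the symmetric matrices of norm at most r, the dissipation D
    bounds the L1 distance of the strains by D/r.\<close>
  have "ennreal (r * (LINT x|lebesgue_on \<Omega>. norm (p1 x - p0 x))) \<le> ennreal D"
    by (rule order_trans[OF dissipation_ge[OF \<Omega> K(1) less_imp_le[OF K(2)] L2_sym_diff[OF H(4,3)[THEN H1_sym_L2_sym]]] D(1)])
  then have "(LINT x|lebesgue_on \<Omega>. norm (p0 x - p1 x)) \<le> D / r"
    using K(2) D(2) by (simp add: pos_le_divide_eq mult.commute norm_minus_commute)
  then have "(LINT x|lebesgue_on \<Omega>. norm (p0 x - p1 x))\<^sup>2 \<le> (D / r)\<^sup>2" by (intro power_mono) auto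
  then have "Ce * (LINT x|lebesgue_on \<Omega>. norm (p0 x - p1 x))\<^sup>2 \<le> Ce * (D / r)\<^sup>2" by (rule mult_left_mono[OF _ interpolation(1)])
  with interpolation(3)[OF dp] show P: "?P \<le> \<epsilon> * ?G + Ce * (D / r)\<^sup>2" by linarith
  have ae: "AE x in lebesgue_on \<Omega>. 0 \<le> \<alpha>0 x \<and> \<alpha>0 x \<le> 1" "AE x in lebesgue_on \<Omega>. 0 \<le> \<alpha>1 x \<and> \<alpha>1 x \<le> 1"
    using \<alpha> by (auto simp: H1_unit_def)
  have a1: "AE x in lebesgue_on \<Omega>. \<bar>\<alpha>0 x - \<alpha>1 x\<bar> \<le> 1" using ae by eventually_elim auto
  have am: "(\<lambda>x. \<alpha>0 x - \<alpha>1 x) \<in> borel_measurable (lebesgue_on \<Omega>)"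
    using \<alpha> by (intro L2_measurable L2_diff) (auto simp: H1_unit_def H1_L2)
  note wint = integrable_bounded_weight[OF am a1]
  note sq = L2_integrable_square[OF H1_L2[OF pH(1)]] L2_integrable_square[OF H1_L2[OF pH(2)]]
    L2_integrable_square[OF pH(3)] L2_integrable_square[OF H1_L2[OF dp]]
  have "?W (\<lambda>x. (norm (p0 x))\<^sup>2 + (norm (p1 x))\<^sup>2) \<le> (LINT x|lebesgue_on \<Omega>. 3 * (\<bar>\<alpha>0 x - \<alpha>1 x\<bar> * (norm (p x))\<^sup>2) + 2 * (norm (p0 x - p1 x))\<^sup>2)"
  proof (rule integral_mono_AE)
    from a1 show "AE x in lebesgue_on \<Omega>. \<bar>\<alpha>0 x - \<alpha>1 x\<bar> * ((norm (p0 x))\<^sup>2 + (norm (p1 x))\<^sup>2)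
        \<le> 3 * (\<bar>\<alpha>0 x - \<alpha>1 x\<bar> * (norm (p x))\<^sup>2) + 2 * (norm (p0 x - p1 x))\<^sup>2"
    proof eventually_elim
      fix x assume x: "\<bar>\<alpha>0 x - \<alpha>1 x\<bar> \<le> 1"
      \<comment> \<open>One of the two strains is p; the other is at most |p| plus the increment,
        whose square costs 2|p|^2 and 2|p0 - p1|^2.\<close>
      have "(norm (p0 x))\<^sup>2 + (norm (p1 x))\<^sup>2 \<le> 3 * (norm (p x))\<^sup>2 + 2 * (norm (p0 x - p1 x))\<^sup>2"
        using p power2_norm_add_le[of "p1 x" "p0 x - p1 x"] power2_norm_add_le[of "p0 x" "p1 x - p0 x"] by (auto simp: norm_minus_commute)
      then have "\<bar>\<alpha>0 x - \<alpha>1 x\<bar> * ((norm (p0 x))\<^sup>2 + (norm (p1 x))\<^sup>2) \<le> \<bar>\<alpha>0 x - \<alpha>1 x\<bar> * (3 * (norm (p x))\<^sup>2 + 2 * (norm (p0 x - p1 x))\<^sup>2)"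
        by (rule mult_left_mono) simp
      moreover have "\<bar>\<alpha>0 x - \<alpha>1 x\<bar> * (norm (p0 x - p1 x))\<^sup>2 \<le> (norm (p0 x - p1 x))\<^sup>2"
        by (rule mult_left_le_one_le) (use x in auto)
      ultimately show "\<bar>\<alpha>0 x - \<alpha>1 x\<bar> * ((norm (p0 x))\<^sup>2 + (norm (p1 x))\<^sup>2)
        \<le> 3 * (\<bar>\<alpha>0 x - \<alpha>1 x\<bar> * (norm (p x))\<^sup>2) + 2 * (norm (p0 x - p1 x))\<^sup>2" by (simp add: distrib_left)
    qed
  qed (intro wint Bochner_Integration.integrable_add integrable_mult_right sq)+
  also have "\<dots> = 3 * ?W (\<lambda>x. (norm (p x))\<^sup>2) + 2 * ?P"
    using wint[OF sq(3)] sq(4) by (simp add: L2_norm_power2)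
  also have "\<dots> \<le> 3 * ?W (\<lambda>x. (norm (p x))\<^sup>2) + 2 * (\<epsilon> * ?G + Ce * (D / r)\<^sup>2)" using P by simp
  finally have "\<kappa> * ?W (\<lambda>x. (norm (p0 x))\<^sup>2 + (norm (p1 x))\<^sup>2) \<le> \<kappa> * \<dots>" using \<kappa>_nonneg by (rule mult_left_mono)
  \<comment> \<open>Interpolation has replaced the squared L2 distance; the gradient part 2 \<kappa>
    \<epsilon> is written as 1/8 of 16 \<kappa> \<epsilon> to use the smallness of
    \<epsilon>.\<close>
  also have "\<dots> = 3 * \<kappa> * ?W (\<lambda>x. (norm (p x))\<^sup>2) + (1/8) * ((16 * \<kappa> * \<epsilon>) * ?G) + 2 * \<kappa> * (Ce * (D / r)\<^sup>2)"
    by (simp add: algebra_simps)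
  also have "(16 * \<kappa> * \<epsilon>) * ?G \<le> 1 * ?G" by (rule mult_right_mono[OF interpolation(2)]) simp
  finally have W: "\<kappa> * ?W (\<lambda>x. (norm (p0 x))\<^sup>2 + (norm (p1 x))\<^sup>2) \<le> 3 * \<kappa> * ?W (\<lambda>x. (norm (p x))\<^sup>2) + (1/8) * ?G + 2 * \<kappa> * (Ce * (D / r)\<^sup>2)"
    by simp
  have el: "\<gamma> / 2 * (L2_norm \<Omega> (\<lambda>x. e0 x - (e1 x - \<Delta> x)))\<^sup>2 \<le> elastic_energy \<Omega> C (\<lambda>x. e0 x - (e1 x - \<Delta> x))"
    by (intro elastic_energy_coercive coercive L2_sym_diff H \<Delta>)
  have el2: "elastic_energy \<Omega> C (\<lambda>x. e1 x - \<Delta> x) - elastic_energy \<Omega> C e1 \<le> norm C * tapp_const TYPE('n) * L2_norm \<Omega> \<Delta> * (L2_norm \<Omega> e1 + L2_norm \<Omega> \<Delta>)"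
    using H \<Delta> by (intro elastic_energy_diff_le) (auto simp: L2_sym_def)
  define A where "A = \<gamma> / 2 * (L2_norm \<Omega> (\<lambda>x. e0 x - (e1 x - \<Delta> x)))\<^sup>2"
  have nn: "0 \<le> A" "0 \<le> (L2_norm \<Omega> (wgrad \<Omega> (\<lambda>x. \<alpha>0 x - \<alpha>1 x)))\<^sup>2" "0 \<le> ?G" using coercive(2) by (auto simp: A_def)
  have "(1/4) * (A + (L2_norm \<Omega> (wgrad \<Omega> (\<lambda>x. \<alpha>0 x - \<alpha>1 x)))\<^sup>2 + ?G) \<le> \<rho> + (1/8) * ?G"
    using stability_increment[OF \<alpha> adm stable D, folded \<Delta>_def] W el[folded A_def] el2
      abs_ge_self[of "E \<alpha>1 e1 p1 - E \<alpha>0 e0 p0"]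
    unfolding \<rho>_def by argo
  then have "A \<le> 4 * \<rho>" "(L2_norm \<Omega> (wgrad \<Omega> (\<lambda>x. \<alpha>0 x - \<alpha>1 x)))\<^sup>2 \<le> 4 * \<rho>" "?G \<le> 8 * \<rho>"
    using nn by - argo+
  then show "\<gamma> / 2 * (L2_norm \<Omega> (\<lambda>x. e0 x - (e1 x - \<Delta> x)))\<^sup>2 \<le> 4 * \<rho>"
    and "(L2_norm \<Omega> (wgrad \<Omega> (\<lambda>x. \<alpha>0 x - \<alpha>1 x)))\<^sup>2 \<le> 4 * \<rho>" and "?G \<le> 8 * \<rho>"
    by (simp_all add: A_def)
qed

end

lemma H1_norm_minus_commute:
  assumes "open \<Omega>" "bounded \<Omega>" "f \<in> H1 \<Omega>" "g \<in> H1 \<Omega>"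
  shows "H1_norm \<Omega> (\<lambda>x. f x - g x) = H1_norm \<Omega> (\<lambda>x. g x - f x)"
  unfolding H1_norm_def using L2_norm_wgrad_minus_commute[OF assms] L2_norm_minus_commute[of \<Omega> f g] by simp

section \<open>Strong continuity off a countable set of times\<close>

theorem lemma3p9:
  fixes \<Omega> :: "(real^'n::finite) set"
    and T \<gamma>1 \<gamma>2 rH :: real
    and w :: "real \<Rightarrow> real^'n \<Rightarrow> real^'n"
    and d :: "real \<Rightarrow> real"
    and C :: "'n tensor4"
    and B :: "real \<Rightarrow> 'n tensor4"
    and K :: "(real^'n^'n) set"
    and \<alpha> :: "real \<Rightarrow> real^'n \<Rightarrow> real"
    and u :: "real \<Rightarrow> real^'n \<Rightarrow> real^'n"
    and e p :: "real \<Rightarrow> real^'n \<Rightarrow> real^'n^'n"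
  assumes dim: "CARD('n) \<in> {2, 3}"
    and domain: "open \<Omega>" "connected \<Omega>" "\<Omega> \<noteq> {}" "bounded \<Omega>" "lipschitz_boundary \<Omega>"
    and T: "0 < T"
    and w: "w \<in> Bochner_H1 (H1 \<Omega>) (H1_norm \<Omega>) {0<..<T}"
      "\<forall>t\<in>{0..T}. w t \<in> H1 \<Omega>" "seminorm_continuous_on {0..T} (H1_norm \<Omega>) w"
    and d: "C11_unit d" "\<forall>a\<in>{0..1}. 0 \<le> d a" "vector_derivative d (at 0 within {0..1}) \<le> 0"
    and C: "tensor_symmetric C" "0 < \<gamma>1" "0 < \<gamma>2"
      "\<forall>\<xi>\<in>sym_mat. \<gamma>1 * (norm \<xi>)\<^sup>2 \<le> tapp C \<xi> \<bullet> \<xi> \<and> tapp C \<xi> \<bullet> \<xi> \<le> \<gamma>2 * (norm \<xi>)\<^sup>2"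
    and B: "C11_unit B" "\<forall>a\<in>{0..1}. tensor_symmetric (B a)"
      "\<forall>\<xi>\<in>sym_mat. tapp (vector_derivative B (at 0 within {0..1})) \<xi> \<bullet> \<xi> \<le> 0"
      "\<forall>\<xi>\<in>sym_mat. \<forall>a\<in>{0..1}. 0 \<le> tapp (B a) \<xi> \<bullet> \<xi>"
    and K: "K \<subseteq> sym_mat" "closed K" "convex K" "0 < rH" "{\<sigma> \<in> sym_mat. norm \<sigma> \<le> rH} \<subseteq> K"
    and evolution: "global_quasistatic_evolution \<Omega> T C B d K w \<alpha> u e p"
  shows "\<exists>N. N \<subseteq> {0..T} \<and> countable N \<and>
           seminorm_continuous_on ({0..T} - N) (H1_norm \<Omega>) \<alpha> \<and>
           seminorm_continuous_on ({0..T} - N) (H1_norm \<Omega>) u \<and>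
           seminorm_continuous_on ({0..T} - N) (L2_norm \<Omega>) e \<and>
           seminorm_continuous_on ({0..T} - N) (H1_norm \<Omega>) p"
proof -
  note \<Omega> = domain(1,4)
  have card: "2 \<le> CARD('n)" using dim by auto
  obtain Ld where Ld: "0 \<le> Ld" "\<And>a b. a \<in> {0..1} \<Longrightarrow> b \<in> {0..1} \<Longrightarrow> norm (d a - d b) \<le> Ld * \<bar>a - b\<bar>"
    using C11_unit_lipschitz[OF d(1)] by blast
  obtain LB where LB: "0 \<le> LB" "\<And>a b. a \<in> {0..1} \<Longrightarrow> b \<in> {0..1} \<Longrightarrow> norm (B a - B b) \<le> LB * \<bar>a - b\<bar>"
    using C11_unit_lipschitz[OF B(1)] by blast
  define \<kappa> where "\<kappa> = LB * tapp_const TYPE('n)"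
  interpret material \<Omega> C B d K \<gamma>1 rH Ld LB \<kappa>
    by unfold_locales (use \<Omega> C d(2) B(4) Ld LB K \<kappa>_def C11_unit_continuous_on[OF d(1)] C11_unit_continuous_on[OF B(1)] in auto)
  \<comment> \<open>Adding 1 to \<kappa> keeps \<epsilon> finite and positive when the hardening
    does not depend on the damage.\<close>
  define \<epsilon> where "\<epsilon> = 1 / (16 * (\<kappa> + 1))"
  have \<epsilon>: "0 < \<epsilon>" "16 * \<kappa> * \<epsilon> \<le> 1" using \<kappa>_nonneg by (auto simp: \<epsilon>_def field_simps)
  obtain Ce where Ce: "0 \<le> Ce" "\<And>f :: real^'n \<Rightarrow> real^'n^'n. f \<in> H1 \<Omega> \<Longrightarrow>
      (L2_norm \<Omega> f)\<^sup>2 \<le> \<epsilon> * (L2_norm \<Omega> (wgrad \<Omega> f))\<^sup>2 + Ce * (LINT x|lebesgue_on \<Omega>. norm (f x))\<^sup>2"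
    by (rule lipschitz_domain_interpolation[OF \<Omega> domain(5) \<epsilon>(1)]) (rule that)
  obtain Cu where Cu: "0 \<le> Cu" "\<And>u1 u2 w1 w2 :: real^'n \<Rightarrow> real^'n. same_trace \<Omega> u1 w1 \<Longrightarrow> same_trace \<Omega> u2 w2 \<Longrightarrow>
    H1_norm \<Omega> (\<lambda>x. u1 x - u2 x) \<le> Cu * (L2_norm \<Omega> (sym_grad \<Omega> (\<lambda>x. u1 x - u2 x)) + H1_norm \<Omega> (\<lambda>x. w1 x - w2 x))"
    by (rule displacement_bound[OF \<Omega> domain(5) card]) (rule that)
  define En where "En t = energy \<Omega> C B d (\<alpha> t) (e t) (p t)" for t
  define V where "V t = enn2real (total_dissipation \<Omega> K p 0 t)" for t
  \<comment> \<open>The integral of the damage variable with a minus sign, so that irreversibility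
    makes it nondecreasing like the total dissipation.\<close>
  define m where "m t = - (LINT x|lebesgue_on \<Omega>. \<alpha> t x)" for t
  note ev = evolution[unfolded global_quasistatic_evolution_def]
  have \<alpha>: "\<alpha> t \<in> H1_unit \<Omega>" if "t \<in> {0..T}" for t using ev that by blast
  have \<alpha>_mono: "AE x in lebesgue_on \<Omega>. \<alpha> b x \<le> \<alpha> a x" if "a \<in> {0..T}" "b \<in> {0..T}" "a \<le> b" for a b using ev that by blast
  have adm: "(u t, e t, p t) \<in> admissible \<Omega> (w t)" if "t \<in> {0..T}" for t using ev that by blast
  have stable: "\<forall>\<beta>\<in>damage_below \<Omega> (\<alpha> t). \<forall>(v, \<eta>, q)\<in>admissible \<Omega> (w t).
      ereal (energy \<Omega> C B d (\<alpha> t) (e t) (p t)) \<le> ereal (energy \<Omega> C B d \<beta> \<eta> q) + enn2ereal (dissipation \<Omega> K (\<lambda>x. q x - p t x))"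
    if "t \<in> {0..T}" for t using ev that by blast
  have fin: "total_dissipation \<Omega> K p 0 T < \<infinity>" using ev by blast
  have power: "integrable (lebesgue_on {0<..<T}) (power_loading \<Omega> T C w e)" using ev by blast
  have balance: "ereal (En t) + enn2ereal (total_dissipation \<Omega> K p 0 t) = ereal (En 0 + (LINT s|lebesgue_on {0<..<t}. power_loading \<Omega> T C w e s))"
    if "t \<in> {0..T}" for t unfolding En_def using ev that by blast
  have \<alpha>L: "\<alpha> t \<in> H1 \<Omega>" "integrable (lebesgue_on \<Omega>) (\<alpha> t)" if "t \<in> {0..T}" for t
    using \<alpha>[OF that] by (auto simp: H1_unit_def intro: L2_integrable[OF borel_open[OF \<Omega>(1)] \<Omega>(2)] H1_L2)
  have uep: "u t \<in> H1 \<Omega>" "e t \<in> L2_sym \<Omega>" "p t \<in> H1_sym \<Omega>" "same_trace \<Omega> (u t) (w t)" "AE x in lebesgue_on \<Omega>. sym_grad \<Omega> (u t) x = e t x + p t x"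
    if "t \<in> {0..T}" for t using adm[OF that] by (auto simp: admissible_def)
  have eL: "e t \<in> L2 \<Omega>" and pH: "p t \<in> H1 \<Omega>" if "t \<in> {0..T}" for t
    using uep[OF that] by (auto simp: L2_sym_def H1_sym_def)
  have wH: "w t \<in> H1 \<Omega>" if "t \<in> {0..T}" for t using w(2) that by blast

  have tot: "total_dissipation \<Omega> K p 0 t = ennreal (V t)" if "t \<in> {0..T}" for t
  proof -
    have "total_dissipation \<Omega> K p 0 t \<le> total_dissipation \<Omega> K p 0 T"
    proof (cases "t = T")
      case False
      then have "total_dissipation \<Omega> K p 0 t + dissipation \<Omega> K (\<lambda>x. p T x - p t x) \<le> total_dissipation \<Omega> K p 0 T"
        using that by (intro total_dissipation_append) auto
      then show ?thesis by (rule order_trans[rotated]) simp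
    qed simp
    with fin show ?thesis by (simp add: V_def)
  qed
  have V_nonneg: "0 \<le> V t" for t by (simp add: V_def)
  have diss: "V a \<le> V b \<and> dissipation \<Omega> K (\<lambda>x. p b x - p a x) \<le> ennreal (V b - V a)" if "a \<in> {0..T}" "b \<in> {0..T}" "a < b" for a b
  proof -
    have *: "ennreal (V a) + dissipation \<Omega> K (\<lambda>x. p b x - p a x) \<le> ennreal (V b)"
      using total_dissipation_append[of 0 a b \<Omega> K p] that by (simp add: tot)
    show ?thesis
    proof (cases "dissipation \<Omega> K (\<lambda>x. p b x - p a x)")
      case (real D)
      with * have "V a + D \<le> V b" using V_nonneg by (simp add: ennreal_plus[symmetric] del: ennreal_plus)
      then show ?thesis using real by (auto intro: ennreal_leI)
    qed (use * in \<open>simp add: top_unique\<close>)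
  qed
  have V_mono: "mono_on {0..T} V" by (rule mono_onI) (metis diss order_le_less order_refl)
  have m_mono: "mono_on {0..T} m"
    unfolding m_def by (rule mono_onI) (simp add: integral_mono_AE \<alpha>L \<alpha>_mono)
  \<comment> \<open>Monotone functions have at most countably many discontinuities, taken relative
    to the closed interval so that the endpoints are covered too.\<close>
  define N where "N = {t \<in> {0..T}. \<not> continuous (at t within {0..T}) V} \<union> {t \<in> {0..T}. \<not> continuous (at t within {0..T}) m}"
  have "countable N" unfolding N_def using mono_on_ctble_discont[OF V_mono] mono_on_ctble_discont[OF m_mono] by simp
  \<comment> \<open>The balance is solved for the energy: the work of the loading is continuous in
    its upper limit, so the energy is continuous wherever the dissipation is.\<close>
  have energy: "En t = En 0 + (LINT s|lebesgue_on {0<..<t}. power_loading \<Omega> T C w e s) - V t" if "t \<in> {0..T}" for t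
    using balance[OF that] V_nonneg[of t] by (simp add: tot[OF that] enn2ereal_ennreal)

  have main: "((\<lambda>s. H1_norm \<Omega> (\<lambda>x. \<alpha> s x - \<alpha> t x)) \<longlongrightarrow> 0) (at t within {0..T}) \<and>
      ((\<lambda>s. H1_norm \<Omega> (\<lambda>x. u s x - u t x)) \<longlongrightarrow> 0) (at t within {0..T}) \<and>
      ((\<lambda>s. L2_norm \<Omega> (\<lambda>x. e s x - e t x)) \<longlongrightarrow> 0) (at t within {0..T}) \<and>
      ((\<lambda>s. H1_norm \<Omega> (\<lambda>x. p s x - p t x)) \<longlongrightarrow> 0) (at t within {0..T})"
    if t: "t \<in> {0..T}" "t \<notin> N" for t
  proof -
    let ?F = "at t within {0..T}"
    have Vt: "((\<lambda>s. \<bar>V s - V t\<bar>) \<longlongrightarrow> 0) ?F" and mt: "(m \<longlongrightarrow> m t) ?F" and Vl: "(V \<longlongrightarrow> V t) ?F"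
      using t by (auto simp: N_def continuous_within intro: tendsto_rabs_zero LIM_zero)
    \<comment> \<open>The L1 distance of the damage; for either order of s and t it equals the
      increment of the mean.\<close>
    define A where "A s = (LINT x|lebesgue_on \<Omega>. \<bar>\<alpha> s x - \<alpha> t x\<bar>)" for s
    have At: "(A \<longlongrightarrow> 0) ?F"
    proof (rule tendsto_0_within_le)
      show "((\<lambda>s. \<bar>m s - m t\<bar>) \<longlongrightarrow> 0) ?F" by (intro tendsto_rabs_zero LIM_zero mt)
      fix s assume s: "s \<in> {0..T}" "s \<noteq> t"
      have "A s = \<bar>m s - m t\<bar>"
      proof (cases "s \<le> t")
        case True
        show ?thesis
          using integral_abs_diff_AE_le[OF \<alpha>L(2)[OF t(1)] \<alpha>L(2)[OF s(1)] \<alpha>_mono[OF s(1) t(1) True]]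
          by (simp add: A_def m_def abs_minus_commute)
      next
        case False
        then show ?thesis
          using integral_abs_diff_AE_le[OF \<alpha>L(2)[OF s(1)] \<alpha>L(2)[OF t(1)] \<alpha>_mono[OF t(1) s(1)]]
          by (simp add: A_def m_def abs_minus_commute)
      qed
      then show "A s \<le> \<bar>m s - m t\<bar>" by simp
    qed (simp add: A_def)
    have \<delta>\<alpha>: "(\<lambda>x. \<alpha> s x - \<alpha> t x) \<in> L2 \<Omega>" "AE x in lebesgue_on \<Omega>. \<bar>\<alpha> s x - \<alpha> t x\<bar> \<le> 1" if "s \<in> {0..T}" for s
    proof -
      show "(\<lambda>x. \<alpha> s x - \<alpha> t x) \<in> L2 \<Omega>" by (intro L2_diff H1_L2 \<alpha>L that t)
      have "AE x in lebesgue_on \<Omega>. 0 \<le> \<alpha> s x \<and> \<alpha> s x \<le> 1" "AE x in lebesgue_on \<Omega>. 0 \<le> \<alpha> t x \<and> \<alpha> t x \<le> 1"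
        using \<alpha>[OF that] \<alpha>[OF t(1)] by (auto simp: H1_unit_def)
      then show "AE x in lebesgue_on \<Omega>. \<bar>\<alpha> s x - \<alpha> t x\<bar> \<le> 1" by eventually_elim auto
    qed
    \<comment> \<open>The weight carries the strain at the fixed time t, a single integrable
      function, so L1 convergence of the bounded damage increments is enough.\<close>
    define P where "P s = (LINT x|lebesgue_on \<Omega>. \<bar>\<alpha> s x - \<alpha> t x\<bar> * (norm (p t x))\<^sup>2)" for s
    have Pt: "(P \<longlongrightarrow> 0) ?F"
      unfolding P_def[abs_def]
    proof (rule tendsto_integral_bounded_weight[OF _ At[unfolded A_def[abs_def]]])
      show "integrable (lebesgue_on \<Omega>) (\<lambda>x. (norm (p t x))\<^sup>2)" by (intro L2_integrable_square H1_L2 pH t)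
      show "\<forall>\<^sub>F s in ?F. (\<lambda>x. \<alpha> s x - \<alpha> t x) \<in> borel_measurable (lebesgue_on \<Omega>) \<and> (AE x in lebesgue_on \<Omega>. \<bar>\<alpha> s x - \<alpha> t x\<bar> \<le> 1)
          \<and> integrable (lebesgue_on \<Omega>) (\<lambda>x. \<alpha> s x - \<alpha> t x)"
        unfolding eventually_at_filter
        by (rule always_eventually) (use \<delta>\<alpha> in \<open>auto intro: L2_measurable L2_integrable[OF borel_open[OF \<Omega>(1)] \<Omega>(2)]\<close>)
    qed simp
    define W where "W s = H1_norm \<Omega> (\<lambda>x. w s x - w t x)" for s
    have Wt: "(W \<longlongrightarrow> 0) ?F" unfolding W_def[abs_def] using w(3) t(1) by (simp add: seminorm_continuous_on_def)
    have Et: "((\<lambda>s. \<bar>En s - En t\<bar>) \<longlongrightarrow> 0) ?F"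
    proof (intro tendsto_rabs_zero LIM_zero)
      have "((\<lambda>s. En 0 + (LINT s|lebesgue_on {0<..<s}. power_loading \<Omega> T C w e s) - V s) \<longlongrightarrow> En t) ?F"
        unfolding energy[OF t(1)]
        by (intro tendsto_intros Vl) (use continuous_on_integral_upper_limit[OF power] t(1) in \<open>auto simp: continuous_on_def\<close>)
      then show "(En \<longlongrightarrow> En t) ?F"
        by (rule Lim_transform_eventually) (simp add: eventually_at_filter energy[symmetric])
    qed
    define c where "c = norm C * tapp_const TYPE('n)"
    have c: "0 \<le> c" using tapp_const(1)[where 'n='n] by (simp add: c_def)
    \<comment> \<open>The later time may be s, so the elastic strain there is bounded through the
      energy at t plus the increment of the energy; the bound converges as s tends to t.\<close>
    define M where "M s = sqrt (2 / \<gamma>1 * (En t + \<bar>En s - En t\<bar>))" for s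
    \<comment> \<open>The right-hand side of the increment estimate in terms of quantities at s and
      t, independent of their order; every summand tends to zero.\<close>
    define R where "R s = (1/2) * \<bar>En s - En t\<bar> + (1/2) * (c * W s * (M s + W s)) + Ld * A s + 3 * \<kappa> * P s
      + 2 * \<kappa> * (Ce * (\<bar>V s - V t\<bar> / rH)\<^sup>2) + \<bar>V s - V t\<bar>" for s
    have Rt: "(R \<longlongrightarrow> 0) ?F"
    proof -
      have "(M \<longlongrightarrow> sqrt (2 / \<gamma>1 * (En t + 0))) ?F" unfolding M_def[abs_def] by (intro tendsto_intros Et)
      then have "(R \<longlongrightarrow> (1/2) * 0 + (1/2) * (c * 0 * (sqrt (2 / \<gamma>1 * (En t + 0)) + 0)) + Ld * 0 + 3 * \<kappa> * 0
        + 2 * \<kappa> * (Ce * (0 / rH)\<^sup>2) + 0) ?F"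
        unfolding R_def[abs_def] using K(2) by (intro tendsto_intros Et Wt At Pt Vt) auto
      then show ?thesis by simp
    qed
    have est: "\<gamma>1 / 2 * (L2_norm \<Omega> (\<lambda>x. e s x - e t x - sym_grad \<Omega> (\<lambda>x. w s x - w t x) x))\<^sup>2 \<le> 4 * R s"
      "(L2_norm \<Omega> (wgrad \<Omega> (\<lambda>x. \<alpha> s x - \<alpha> t x)))\<^sup>2 \<le> 4 * R s"
      "(L2_norm \<Omega> (wgrad \<Omega> (\<lambda>x. p s x - p t x)))\<^sup>2 \<le> 8 * R s"
      "(L2_norm \<Omega> (\<lambda>x. p s x - p t x))\<^sup>2 \<le> \<epsilon> * (8 * R s) + Ce * (\<bar>V s - V t\<bar> / rH)\<^sup>2" if s: "s \<in> {0..T}" "s \<noteq> t" for s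
    proof -
      \<comment> \<open>Stability is used at the earlier time in both cases, whereas limits are
        taken at t.\<close>
      define a where "a = min s t"
      define b where "b = max s t"
      have ab: "a \<in> {0..T}" "b \<in> {0..T}" "a < b" using s t by (auto simp: a_def b_def)
      have cases: "(a = s \<and> b = t) \<or> (a = t \<and> b = s)" using s by (auto simp: a_def b_def)
      define \<Delta> where "\<Delta> = sym_grad \<Omega> (\<lambda>x. w b x - w a x)"
      define D where "D = V b - V a"
      have D: "0 \<le> D" "dissipation \<Omega> K (\<lambda>x. p b x - p a x) \<le> ennreal D" "D = \<bar>V s - V t\<bar>"
        using diss[OF ab] cases by (auto simp: D_def)
      have pt: "p t = p a \<or> p t = p b" using cases by auto
      note inc = increment_estimate[OF \<alpha>[OF ab(1)] \<alpha>[OF ab(2)] \<alpha>_mono[OF ab(1,2) less_imp_le[OF ab(3)]] adm[OF ab(1)] adm[OF ab(2)]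
        stable[OF ab(1)] D(2,1) Ce(1) \<epsilon>(2) Ce(2) pt, folded En_def c_def \<Delta>_def]
      define \<rho> where "\<rho> = (1/2) * \<bar>En b - En a\<bar> + (1/2) * (c * L2_norm \<Omega> \<Delta> * (L2_norm \<Omega> (e b) + L2_norm \<Omega> \<Delta>))
        + Ld * (LINT x|lebesgue_on \<Omega>. \<bar>\<alpha> a x - \<alpha> b x\<bar>) + 3 * \<kappa> * (LINT x|lebesgue_on \<Omega>. \<bar>\<alpha> a x - \<alpha> b x\<bar> * (norm (p t x))\<^sup>2)
        + 2 * \<kappa> * (Ce * (D / rH)\<^sup>2) + D"
      note inc = inc[folded \<rho>_def]
      have "\<rho> \<le> R s"
      proof -
        have "L2_norm \<Omega> \<Delta> \<le> H1_norm \<Omega> (\<lambda>x. w b x - w a x)"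
          unfolding \<Delta>_def by (intro sym_grad_norm_le H1_diff \<Omega> wH ab)
        also have "\<dots> = W s"
          using cases H1_norm_minus_commute[OF \<Omega> wH[OF ab(1)] wH[OF ab(2)]] by (auto simp: W_def)
        finally have \<Delta>W: "L2_norm \<Omega> \<Delta> \<le> W s" .
        have "\<gamma>1 / 2 * (L2_norm \<Omega> (e b))\<^sup>2 \<le> En b" unfolding En_def by (intro energy_coercive \<alpha> uep ab)
        also have "\<dots> \<le> En t + \<bar>En s - En t\<bar>" using cases by auto
        finally have "(L2_norm \<Omega> (e b))\<^sup>2 \<le> 2 / \<gamma>1 * (En t + \<bar>En s - En t\<bar>)" using C(2) by (simp add: field_simps)
        then have "L2_norm \<Omega> (e b) \<le> M s" unfolding M_def by (rule real_le_rsqrt)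
        then have "c * L2_norm \<Omega> \<Delta> * (L2_norm \<Omega> (e b) + L2_norm \<Omega> \<Delta>) \<le> c * W s * (M s + W s)"
          using \<Delta>W c order_trans[OF L2_norm_nonneg \<Delta>W] by (intro mult_mono add_mono mult_left_mono) (auto intro: add_nonneg_nonneg)
        moreover have "\<bar>En b - En a\<bar> = \<bar>En s - En t\<bar>" using cases by auto
        moreover have "(LINT x|lebesgue_on \<Omega>. \<bar>\<alpha> a x - \<alpha> b x\<bar>) = A s" "(LINT x|lebesgue_on \<Omega>. \<bar>\<alpha> a x - \<alpha> b x\<bar> * (norm (p t x))\<^sup>2) = P s"
          using cases by (auto simp: A_def P_def abs_minus_commute)
        ultimately show ?thesis unfolding \<rho>_def R_def D(3) by simp
      qed
      have eq: "L2_norm \<Omega> (\<lambda>x. e a x - (e b x - \<Delta> x)) = L2_norm \<Omega> (\<lambda>x. e s x - e t x - sym_grad \<Omega> (\<lambda>x. w s x - w t x) x)"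
        using cases
      proof
        assume st: "a = s \<and> b = t"
        \<comment> \<open>The datum increment now has the opposite sign. Gradients of a function and
          of its negative are chosen separately, so they are opposite only almost
          everywhere.\<close>
        have "AE x in lebesgue_on \<Omega>. \<Delta> x = - sym_grad \<Omega> (\<lambda>x. w s x - w t x) x"
          using sym_grad_diff[OF \<Omega> wH[OF s(1)] wH[OF t(1)]] sym_grad_diff[OF \<Omega> wH[OF t(1)] wH[OF s(1)]]
          by eventually_elim (simp add: \<Delta>_def st)
        then have "AE x in lebesgue_on \<Omega>. e a x - (e b x - \<Delta> x) = e s x - e t x - sym_grad \<Omega> (\<lambda>x. w s x - w t x) x"
          by eventually_elim (simp add: st)
        note ae = this
        have S: "\<Delta> \<in> L2 \<Omega>" "sym_grad \<Omega> (\<lambda>x. w s x - w t x) \<in> L2 \<Omega>"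
          unfolding \<Delta>_def by (rule sym_grad_L2[OF H1_diff[OF \<Omega> wH[OF ab(2)] wH[OF ab(1)]]], rule sym_grad_L2[OF H1_diff[OF \<Omega> wH[OF s(1)] wH[OF t(1)]]])
        show ?thesis
          by (rule L2_AE_cong[OF L2_diff[OF eL[OF ab(1)] L2_diff[OF eL[OF ab(2)] S(1)]] L2_diff[OF L2_diff[OF eL[OF s(1)] eL[OF t(1)]] S(2)] ae])
      next
        assume st: "a = t \<and> b = s"
        have "e a x - (e b x - \<Delta> x) = - (e s x - e t x - sym_grad \<Omega> (\<lambda>x. w s x - w t x) x)" for x
          unfolding \<Delta>_def st[THEN conjunct1] st[THEN conjunct2] by (simp add: algebra_simps)
        then show ?thesis by (simp only: L2_norm_uminus)
      qed
      show "\<gamma>1 / 2 * (L2_norm \<Omega> (\<lambda>x. e s x - e t x - sym_grad \<Omega> (\<lambda>x. w s x - w t x) x))\<^sup>2 \<le> 4 * R s"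
        using inc(1) \<open>\<rho> \<le> R s\<close> unfolding eq by linarith
      have "L2_norm \<Omega> (wgrad \<Omega> (\<lambda>x. \<alpha> a x - \<alpha> b x)) = L2_norm \<Omega> (wgrad \<Omega> (\<lambda>x. \<alpha> s x - \<alpha> t x))"
        using cases L2_norm_wgrad_minus_commute[OF \<Omega> \<alpha>L(1)[OF s(1)] \<alpha>L(1)[OF t(1)]] by auto
      with inc(2) \<open>\<rho> \<le> R s\<close> show "(L2_norm \<Omega> (wgrad \<Omega> (\<lambda>x. \<alpha> s x - \<alpha> t x)))\<^sup>2 \<le> 4 * R s" by simp
      have eqp: "L2_norm \<Omega> (wgrad \<Omega> (\<lambda>x. p a x - p b x)) = L2_norm \<Omega> (wgrad \<Omega> (\<lambda>x. p s x - p t x))"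
        using cases L2_norm_wgrad_minus_commute[OF \<Omega> pH[OF s(1)] pH[OF t(1)]] by auto
      with inc(3) \<open>\<rho> \<le> R s\<close> show *: "(L2_norm \<Omega> (wgrad \<Omega> (\<lambda>x. p s x - p t x)))\<^sup>2 \<le> 8 * R s" by simp
      have "L2_norm \<Omega> (\<lambda>x. p a x - p b x) = L2_norm \<Omega> (\<lambda>x. p s x - p t x)"
        using cases L2_norm_minus_commute[of \<Omega> "p s" "p t"] by auto
      with inc(4) have "(L2_norm \<Omega> (\<lambda>x. p s x - p t x))\<^sup>2 \<le> \<epsilon> * (L2_norm \<Omega> (wgrad \<Omega> (\<lambda>x. p s x - p t x)))\<^sup>2 + Ce * (\<bar>V s - V t\<bar> / rH)\<^sup>2"
        by (simp only: eqp D(3))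
      also have "\<dots> \<le> \<epsilon> * (8 * R s) + Ce * (\<bar>V s - V t\<bar> / rH)\<^sup>2"
        using mult_left_mono[OF *, of \<epsilon>] \<epsilon>(1) by simp
      finally show "(L2_norm \<Omega> (\<lambda>x. p s x - p t x))\<^sup>2 \<le> \<epsilon> * (8 * R s) + Ce * (\<bar>V s - V t\<bar> / rH)\<^sup>2" .
    qed
    show ?thesis
    proof -
      have root: "((\<lambda>s. sqrt (g s)) \<longlongrightarrow> 0) ?F" if "(g \<longlongrightarrow> 0) ?F" for g using tendsto_real_sqrt[OF that] by simp
      have R': "((\<lambda>s. k * R s) \<longlongrightarrow> 0) ?F" for k using tendsto_mult_left[OF Rt, of k] by simp
      have e: "((\<lambda>s. L2_norm \<Omega> (\<lambda>x. e s x - e t x)) \<longlongrightarrow> 0) ?F"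
      proof (rule tendsto_0_within_le)
        show "((\<lambda>s. sqrt (8 / \<gamma>1 * R s) + W s) \<longlongrightarrow> 0) ?F" using tendsto_add[OF root[OF R'[of "8 / \<gamma>1"]] Wt] by simp
        fix s assume s: "s \<in> {0..T}" "s \<noteq> t"
        let ?S = "sym_grad \<Omega> (\<lambda>x. w s x - w t x)"
        have wst: "(\<lambda>x. w s x - w t x) \<in> H1 \<Omega>" by (intro H1_diff \<Omega> wH s t)
        have "L2_norm \<Omega> (\<lambda>x. e s x - e t x) = L2_norm \<Omega> (\<lambda>x. (e s x - e t x - ?S x) + ?S x)" by simp
        also have "\<dots> \<le> L2_norm \<Omega> (\<lambda>x. e s x - e t x - ?S x) + L2_norm \<Omega> ?S"
          by (intro L2_norm_triangle L2_diff eL s t sym_grad_L2 wst)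
        also have "L2_norm \<Omega> (\<lambda>x. e s x - e t x - ?S x) \<le> sqrt (8 / \<gamma>1 * R s)"
          using est(1)[OF s] C(2) by (intro real_le_rsqrt) (simp add: field_simps)
        also have "L2_norm \<Omega> ?S \<le> W s" unfolding W_def by (rule sym_grad_norm_le[OF wst])
        finally show "L2_norm \<Omega> (\<lambda>x. e s x - e t x) \<le> sqrt (8 / \<gamma>1 * R s) + W s" by simp
      qed simp
      have p: "((\<lambda>s. H1_norm \<Omega> (\<lambda>x. p s x - p t x)) \<longlongrightarrow> 0) ?F"
      proof (rule tendsto_0_within_le)
        have "((\<lambda>s. \<epsilon> * (8 * R s) + Ce * (\<bar>V s - V t\<bar> / rH)\<^sup>2) \<longlongrightarrow> \<epsilon> * 0 + Ce * (0 / rH)\<^sup>2) ?F"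
          using K(2) by (intro tendsto_intros R' Vt) simp
        then show "((\<lambda>s. sqrt (\<epsilon> * (8 * R s) + Ce * (\<bar>V s - V t\<bar> / rH)\<^sup>2) + sqrt (8 * R s)) \<longlongrightarrow> 0) ?F"
          using tendsto_add[OF root root[OF R'[of 8]]] by simp
        fix s assume s: "s \<in> {0..T}" "s \<noteq> t"
        show "H1_norm \<Omega> (\<lambda>x. p s x - p t x) \<le> sqrt (\<epsilon> * (8 * R s) + Ce * (\<bar>V s - V t\<bar> / rH)\<^sup>2) + sqrt (8 * R s)"
          by (rule order_trans[OF H1_norm_le]) (intro add_mono real_le_rsqrt est s)
      qed simp
      have \<alpha>: "((\<lambda>s. H1_norm \<Omega> (\<lambda>x. \<alpha> s x - \<alpha> t x)) \<longlongrightarrow> 0) ?F"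
      proof (rule tendsto_0_within_le)
        show "((\<lambda>s. sqrt (A s) + sqrt (4 * R s)) \<longlongrightarrow> 0) ?F" using tendsto_add[OF root[OF At] root[OF R'[of 4]]] by simp
        fix s assume s: "s \<in> {0..T}" "s \<noteq> t"
        have "(L2_norm \<Omega> (\<lambda>x. \<alpha> s x - \<alpha> t x))\<^sup>2 \<le> A s"
          unfolding L2_norm_power2 A_def
        proof (rule integral_mono_AE[OF L2_integrable_square[OF \<delta>\<alpha>(1)[OF s(1)]]])
          show "integrable (lebesgue_on \<Omega>) (\<lambda>x. \<bar>\<alpha> s x - \<alpha> t x\<bar>)"
            by (rule integrable_abs[OF L2_integrable[OF borel_open[OF \<Omega>(1)] \<Omega>(2) \<delta>\<alpha>(1)[OF s(1)]]])
          \<comment> \<open>Values of the increment are bounded by 1, so the squared L2 norm of the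
            damage increment is at most its L1 norm.\<close>
          have "(norm y)\<^sup>2 \<le> \<bar>y\<bar>" if "\<bar>y\<bar> \<le> 1" for y :: real
            using mult_left_le_one_le[of "\<bar>y\<bar>" "\<bar>y\<bar>"] that by (simp add: power2_eq_square)
          from \<delta>\<alpha>(2)[OF s(1)] show "AE x in lebesgue_on \<Omega>. (norm (\<alpha> s x - \<alpha> t x))\<^sup>2 \<le> \<bar>\<alpha> s x - \<alpha> t x\<bar>"
            by eventually_elim fact
        qed
        then show "H1_norm \<Omega> (\<lambda>x. \<alpha> s x - \<alpha> t x) \<le> sqrt (A s) + sqrt (4 * R s)"
          by (intro order_trans[OF H1_norm_le] add_mono real_le_rsqrt[OF est(2)[OF s]]) (rule real_le_rsqrt)
      qed simp
      have "((\<lambda>s. H1_norm \<Omega> (\<lambda>x. u s x - u t x)) \<longlongrightarrow> 0) ?F"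
      proof (rule tendsto_0_within_le)
        \<comment> \<open>The symmetric gradient of the displacement increment is the sum of the
          strain increments; adding the datum increment bounds its full H1 norm.\<close>
        have "((\<lambda>s. Cu * (L2_norm \<Omega> (\<lambda>x. e s x - e t x) + H1_norm \<Omega> (\<lambda>x. p s x - p t x) + W s)) \<longlongrightarrow> Cu * (0 + 0 + 0)) ?F"
          by (intro tendsto_intros e p Wt)
        then show "((\<lambda>s. Cu * (L2_norm \<Omega> (\<lambda>x. e s x - e t x) + H1_norm \<Omega> (\<lambda>x. p s x - p t x) + W s)) \<longlongrightarrow> 0) ?F" by simp
        fix s assume s: "s \<in> {0..T}" "s \<noteq> t"
        have "AE x in lebesgue_on \<Omega>. sym_grad \<Omega> (\<lambda>x. u s x - u t x) x = (e s x - e t x) + (p s x - p t x)"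
          using sym_grad_diff[OF \<Omega> uep(1)[OF s(1)] uep(1)[OF t(1)]] uep(5)[OF s(1)] uep(5)[OF t(1)] by eventually_elim simp
        then have "L2_norm \<Omega> (sym_grad \<Omega> (\<lambda>x. u s x - u t x)) = L2_norm \<Omega> (\<lambda>x. (e s x - e t x) + (p s x - p t x))"
          by (rule L2_AE_cong[rotated 2]) (intro sym_grad_L2 H1_diff L2_add L2_diff H1_L2 \<Omega> uep eL pH s t)+
        also have "\<dots> \<le> L2_norm \<Omega> (\<lambda>x. e s x - e t x) + L2_norm \<Omega> (\<lambda>x. p s x - p t x)"
          by (intro L2_norm_triangle L2_diff H1_L2 eL pH s t)
        also have "L2_norm \<Omega> (\<lambda>x. p s x - p t x) \<le> H1_norm \<Omega> (\<lambda>x. p s x - p t x)" by (rule L2_norm_le_H1_norm)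
        finally have "L2_norm \<Omega> (sym_grad \<Omega> (\<lambda>x. u s x - u t x)) + W s \<le> L2_norm \<Omega> (\<lambda>x. e s x - e t x) + H1_norm \<Omega> (\<lambda>x. p s x - p t x) + W s" by simp
        from mult_left_mono[OF this Cu(1)] Cu(2)[OF uep(4)[OF s(1)] uep(4)[OF t(1)]]
        show "H1_norm \<Omega> (\<lambda>x. u s x - u t x) \<le> Cu * (L2_norm \<Omega> (\<lambda>x. e s x - e t x) + H1_norm \<Omega> (\<lambda>x. p s x - p t x) + W s)"
          by (simp add: W_def)
      qed simp
      with \<alpha> e p show ?thesis by blast
    qed
  qed
  show ?thesis
  proof (intro exI[of _ N] conjI)
    show "N \<subseteq> {0..T}" by (auto simp: N_def)
    show "countable N" by fact
    have within: "at t within ({0..T} - N) \<le> at t within {0..T}" for t by (rule at_le) auto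
    show "seminorm_continuous_on ({0..T} - N) (H1_norm \<Omega>) \<alpha>" "seminorm_continuous_on ({0..T} - N) (H1_norm \<Omega>) u"
      "seminorm_continuous_on ({0..T} - N) (L2_norm \<Omega>) e" "seminorm_continuous_on ({0..T} - N) (H1_norm \<Omega>) p"
      unfolding seminorm_continuous_on_def using main by (auto intro: tendsto_mono[OF within])
  qed
qed

end
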